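(* Let $L$ be a lattice of signature $(2,n)$ with $n\ge3$, let $\Gamma$ be a finite-index subgroup of $\mathrm O^+(L)$, let $J\subset L$ be a primitive isotropic sublattice of rank $2$, let $\lambda=(\lambda_1\ge\cdots\ge\lambda_n\ge0)$ be a partition with ${}^t\lambda_1+{}^t\lambda_2\le n$ and $k\in\mathbb Z$. For $m>0$ the $m$-th Fourier-Jacobi coefficient (at the $J$-cusp) of a modular form $f\in M_{\lambda,k}(\Gamma)$, as a section of $\mathcal E_{\lambda,k}\otimes\Theta_J^{\otimes m}$ over $\Delta_J$, is a Jacobi form of weight $(\lambda,k)$ and index $m$ for $\Gamma(J)_{\mathbb Z}$. When $f$ is a cusp form, the Fourier-Jacobi coefficient is a Jacobi cusp form.
   Context: Basic setting. A lattice is a free $\mathbb Z$-module of finite rank with a nondegenerate symmetric bilinear form with values in $\mathbb Z$; $L_F=L\otimes_{\mathbb Z}F$. $\mathcal D$ is a fixed connected component of $\{[\omega]\in\mathbb P(L_{\mathbb C}) : (\omega,\omega)=0,\ (\omega,\bar\omega)>0\}$; $\mathrm O^+(L)$ is the subgroup of $\mathrm O(L)$ preserving $\mathcal D$. Over $\mathcal D$: $\mathcal L\subset L_{\mathbb C}\otimes\mathcal O_{\mathcal D}$ is the tautological line bundle (fiber $\mathbb C\omega$) and $\mathcal E=\mathcal L^\perp/\mathcal L$ with its induced quadratic form. For a partition $\lambda$ as in the claim, $d=|\lambda|$ and an $n$-dimensional complex quadratic space $V$, $V^{[d]}\subset V^{\otimes d}$ is the intersection of the kernels of all contractions and $V_\lambda=c_\lambda\cdot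 V^{[d]}$ with $c_\lambda=b_\lambda a_\lambda$ the Young symmetrizer of the column canonical tableau ($a_\lambda$ the sum over the row subgroup, $b_\lambda$ the signed sum over the column subgroup). Applied fiberwise to $\mathcal E$ this gives $\mathcal E_\lambda$; $\mathcal E_{\lambda,k}=\mathcal E_\lambda\otimes\mathcal L^{\otimes k}$; $M_{\lambda,k}(\Gamma)$ is the space of $\Gamma$-invariant holomorphic sections of $\mathcal E_{\lambda,k}$ over $\mathcal D$. Fourier expansion. For a primitive isotropic $I\subset L$ of rank $1$, put $V(I)=(I^\perp/I)_{\mathbb C}$. The pairing with $I_{\mathbb C}$ gives $\mathcal L\simeq I_{\mathbb C}^\vee\otimes\mathcal O_{\mathcal D}$, and $I_{\mathbb C}^\perp/I_{\mathbb C}\leftarrow I_{\mathbb C}^\perp\cap\omega^\perp\to\omega^\perp/\mathbb C\omega$ give $\mathcal E\simeq V(I)\otimes\mathcal O_{\mathcal D}$; hence the $I$-trivialization $\mathcal E_{\lambda,k}\simeq V(I)_{\lambda,k}\otimes\mathcal O_{\mathcal D}$, $V(I)_{\lambda,k}=V(I)_\lambda\otimes(I_{\mathbb C}^\vee)^{\otimes k}$. Let $U(I)_F=(I^\perp/I)_F\otimes I_F$ (generators of $I$ given norm $1$), a subgroup of $\mathrm O(L_F)$ by the Eichler transvections $E_{m\otimes l}(v)=v-(\tilde m,v)l+(l,v)\tilde m-\frac12(m,m)(l,v)l$; $U(I)_{\mathbb Z}=U(I)_{\mathbb Q}\cap\Gamma$, with dual lattice $U(I)_{\mathbb Z}^\vee$.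 Choose a rank $1$ isotropic $I'\subset L$ with $(I,I')\ne0$; with $e$ a generator of $I$, $e'\in I'_{\mathbb Q}$, $(e,e')=1$ and $V(I)=(I\oplus I')_{\mathbb C}^\perp$, the map $z\otimes e\mapsto[e'+z-\frac12(z,z)e]$ identifies $\mathcal D_I=\{Z\in U(I)_{\mathbb C}:\mathrm{Im}(Z)\in\mathcal C_I\}$ with $\mathcal D$, for one component $\mathcal C_I$ of $\{v\in U(I)_{\mathbb R}:(v,v)>0\}$. Then $f=\sum_{l\in U(I)_{\mathbb Z}^\vee}a(l)q^l$, $q^l=\exp(2\pi i(l,Z))$, $a(l)\in V(I)_{\lambda,k}$; $f$ is a cusp form if for every $I$, $a(l)\ne0$ implies $l\in\mathcal C_I$. The $J$-cusp. For $F=\mathbb Q,\mathbb R$, $\Gamma(J)_F$ is the group of isometries of $L_F$ preserving $J_F$ and acting trivially on $\wedge^2J_F$ and $(J^\perp/J)_F$; $U(J)_F\subset\Gamma(J)_F$ is the subgroup acting trivially on $J_F^\perp$ ($\simeq\wedge^2J_F$, central). $\Gamma(J)_{\mathbb Z}=\Gamma(J)_{\mathbb Q}\cap\Gamma$, $U(J)_{\mathbb Z}=U(J)_{\mathbb Q}\cap\Gamma\simeq\mathbb Z$, $\overline{\Gamma(J)}_{\mathbb Z}=\Gamma(J)_{\mathbb Z}/U(J)_{\mathbb Z}$. The projections $\mathbb PL_{\mathbb C}\dashrightarrow\mathbb P(L/J)_{\mathbb C}\dashrightarrow\mathbb P(L/J^\perp)_{\mathbb C}$ restrict to $\mathcal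 D\to\mathcal V_J\to\mathbb H_J$ (onto the images), where $\mathbb H_J$ is an upper half plane and $\mathcal D\to\mathcal V_J$ is a bundle of upper half planes on whose fibers $U(J)_{\mathbb R}$ acts by real translations. $\mathcal X(J)=\mathcal D/U(J)_{\mathbb Z}$ is a punctured disc bundle over $\mathcal V_J$; $\overline{\mathcal X(J)}$ is the disc bundle obtained by filling in the origins, $\Delta_J\simeq\mathcal V_J$ its boundary divisor and $\Theta_J$ the conormal bundle of $\Delta_J$. For $I\subset J$ the $I$-trivialization descends to $\mathcal X(J)$ and $\mathcal E_{\lambda,k}$ is extended over $\overline{\mathcal X(J)}$ so that it becomes $V(I)_{\lambda,k}\otimes\mathcal O_{\overline{\mathcal X(J)}}$ (independent of $I\subset J$); $\overline{\Gamma(J)}_{\mathbb Z}$ acts on the extension and on $\Theta_J$. $\mathcal E_{\lambda,k}\otimes\Theta_J^{\otimes m}$ denotes $\mathcal E_{\lambda,k}|_{\Delta_J}\otimes\Theta_J^{\otimes m}$. $(I,\omega_J)$-trivialization. Let $I\subset J$ be primitive of rank $1$. Then $U(J)_F=(J/I)_F\otimes I_F$ is an isotropic line in $U(I)_F$, and $\mathcal D\to\mathcal V_J$ is the restriction of $U(I)_{\mathbb C}\to U(I)_{\mathbb C}/U(J)_{\mathbb C}$, so $\Delta_J\subset U(I)_{\mathbb C}/U(J)_{\mathbb C}$. Let $v_{J,\Gamma}$ be the generator of $U(J)_{\mathbb Z}$ lying in $\overline{\mathcal C_I}$ and choose an isotropic $l_{J,\Gamma}\in U(I)_{\mathbb Q}$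 with $(v_{J,\Gamma},l_{J,\Gamma})=1$. The function $\omega_J=\exp(2\pi i(l_{J,\Gamma},Z))$ descends to $\mathcal X(J)$ and extends to $\overline{\mathcal X(J)}$ as a generator of the ideal sheaf of $\Delta_J$; together with the $I$-trivialization it gives $\mathcal E_{\lambda,k}\otimes\Theta_J^{\otimes m}\simeq V(I)_{\lambda,k}\otimes\mathcal O_{\Delta_J}$. Fourier-Jacobi coefficient. The $m$-th Fourier-Jacobi coefficient of $f=\sum a(l)q^l$ is the section of $\mathcal E_{\lambda,k}\otimes\Theta_J^{\otimes m}$ over $\Delta_J$ corresponding under the $(I,\omega_J)$-trivialization to $\phi_m=\sum_{l\in U(J)_{\mathbb Q}^\perp}a(l+ml_{J,\Gamma})q^l$ (with $a(l+ml_{J,\Gamma})=0$ if $l+ml_{J,\Gamma}\notin U(I)_{\mathbb Z}^\vee$), so that $f=\sum_{m\ge0}\phi_m\omega_J^m$; the section is independent of the choices $I,I',l_{J,\Gamma}$. Jacobi forms. A $\overline{\Gamma(J)}_{\mathbb Z}$-invariant holomorphic section $\phi$ of $\mathcal E_{\lambda,k}\otimes\Theta_J^{\otimes m}$ over $\Delta_J$ has, in the $(I,\omega_J)$-trivialization, a Fourier expansion $\sum_l a(l)q^l$ with $l$ in a full lattice of $U(J)_{\mathbb Q}^\perp$. It is holomorphic (resp. vanishes) at the $I$-cusp if $a(l)\neq0$ only when $(ml_{J,\Gamma}+l,ml_{J,\Gamma}+l)\ge0$ (resp. $>0$); this is independent of $I',l_{J,\Gamma}$. A Jacobi form (resp.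 Jacobi cusp form) of weight $(\lambda,k)$ and index $m$ for $\Gamma(J)_{\mathbb Z}$ is such a $\phi$ that is holomorphic (resp. vanishes) at every cusp $I\subset J$. *)

theory Defs
  imports "HOL-Analysis.Analysis" "HOL-Combinatorics.Permutations" "HOL-Algebra.Coset"
begin

section \<open>Lattices and their isometries\<close>

text \<open>
  After the choice of a \<open>\<int>\<close>-basis, a lattice is \<open>\<int>\<^sup>N\<close> with a symmetric nondegenerate integral Gram
  matrix \<open>Q\<close>.  All the modules \<open>L\<^sub>F\<close> live inside the single space \<open>L\<^sub>\<complex> = complex ^ 'N\<close>, with
  \<open>F\<close> one of the subsets \<open>\<int>\<close>, \<open>\<rat>\<close>, \<open>\<real>\<close>, \<open>UNIV\<close> of the complex numbers.
\<close>

definition bil :: "int^'N^'N \<Rightarrow> complex^'N \<Rightarrow> complex^'N \<Rightarrow> complex" where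
  "bil Q x y = (\<Sum>i\<in>UNIV. \<Sum>j\<in>UNIV. of_int (Q $ i $ j) * x $ i * y $ j)"

definition has_signature :: "int^'N^'N \<Rightarrow> nat \<Rightarrow> nat \<Rightarrow> bool" where
  "has_signature Q p q \<longleftrightarrow>
     (\<exists>(A :: real^'N^'N) (s :: 'N \<Rightarrow> real).
        invertible A \<and> (\<forall>i. s i = 1 \<or> s i = -1) \<and>
        transpose A ** map_matrix of_int Q ** A = (\<chi> i j. if i = j then s i else 0) \<and>
        card {i. s i = 1} = p \<and> card {i. s i = -1} = q)"

definition vecs :: "complex set \<Rightarrow> (complex^'N) set" where
  "vecs F = {v. \<forall>i. v $ i \<in> F}"

definition fspan :: "complex set \<Rightarrow> (complex^'N) set \<Rightarrow> (complex^'N) set" where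
  "fspan F S = {\<Sum>x\<in>A. c x *s x |A c. finite A \<and> A \<subseteq> S \<and> (\<forall>x\<in>A. c x \<in> F)}"

definition perp :: "int^'N^'N \<Rightarrow> (complex^'N) set \<Rightarrow> (complex^'N) set" where
  "perp Q S = {x. \<forall>y\<in>S. bil Q x y = 0}"

text \<open>
  The rank of a sublattice \<open>M\<close> of \<open>\<int>\<^sup>N\<close> is the complex dimension of \<open>M \<otimes> \<complex>\<close>, its complex span.
\<close>

definition primitive_isotropic :: "int^'N^'N \<Rightarrow> nat \<Rightarrow> (complex^'N) set \<Rightarrow> bool" where
  "primitive_isotropic Q r M \<longleftrightarrow>
     M \<subseteq> vecs \<int> \<and> fspan \<int> M = M \<and> vec.dim M = r \<and>
     (\<forall>x\<in>M. \<forall>y\<in>M. bil Q x y = 0) \<and>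
     (\<forall>x\<in>vecs \<int>. \<forall>c\<in>\<int>. c \<noteq> 0 \<and> c *s x \<in> M \<longrightarrow> x \<in> M)"

text \<open>\<open>O(L\<^sub>F)\<close>, as matrices.\<close>

definition isometries :: "int^'N^'N \<Rightarrow> complex set \<Rightarrow> (complex^'N^'N) set" where
  "isometries Q F =
     {g. (*v) g ` vecs F = vecs F \<and> (\<forall>x y. bil Q (g *v x) (g *v y) = bil Q x y)}"


section \<open>The period domain\<close>

definition line :: "complex^'N \<Rightarrow> (complex^'N) set" where
  "line \<omega> = vec.span {\<omega>}"

text \<open>The projective space of lines in \<open>L\<^sub>\<complex>\<close> with the quotient topology.\<close>

definition proj_space :: "(complex^'N) set topology" where
  "proj_space = topology (\<lambda>U. U \<subseteq> line ` (- {0}) \<and> open {\<omega>. \<omega> \<noteq> 0 \<and> line \<omega> \<in> U})"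

lemma openin_proj_space:
  fixes U :: "(complex^'N) set set"
  shows
  "openin proj_space U \<longleftrightarrow> U \<subseteq> line ` (- {0}) \<and> open {\<omega>. \<omega> \<noteq> 0 \<and> line \<omega> \<in> U}"
proof -
  have "istopology (\<lambda>U. U \<subseteq> line ` (- {0 :: complex^'N}) \<and> open {\<omega>. \<omega> \<noteq> 0 \<and> line \<omega> \<in> U})"
    unfolding istopology_def
  proof (intro conjI allI impI)
    fix S T :: "(complex^'N) set set"
    assume S: "S \<subseteq> line ` (- {0}) \<and> open {\<omega>. \<omega> \<noteq> 0 \<and> line \<omega> \<in> S}"
      and T: "T \<subseteq> line ` (- {0}) \<and> open {\<omega>. \<omega> \<noteq> 0 \<and> line \<omega> \<in> T}"
    show "S \<inter> T \<subseteq> line ` (- {0})" using S by blast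
    have "{\<omega>. \<omega> \<noteq> 0 \<and> line \<omega> \<in> S \<inter> T} =
        {\<omega>. \<omega> \<noteq> 0 \<and> line \<omega> \<in> S} \<inter> {\<omega>. \<omega> \<noteq> 0 \<and> line \<omega> \<in> T}" by blast
    then show "open {\<omega>. \<omega> \<noteq> 0 \<and> line \<omega> \<in> S \<inter> T}" using S T by (simp add: open_Int)
  next
    fix K :: "(complex^'N) set set set"
    assume K: "\<forall>S\<in>K. S \<subseteq> line ` (- {0}) \<and> open {\<omega>. \<omega> \<noteq> 0 \<and> line \<omega> \<in> S}"
    show "\<Union>K \<subseteq> line ` (- {0})" using K by blast
    have "{\<omega>. \<omega> \<noteq> 0 \<and> line \<omega> \<in> \<Union>K} = (\<Union>S\<in>K. {\<omega>. \<omega> \<noteq> 0 \<and> line \<omega> \<in> S})" by blast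
    then show "open {\<omega>. \<omega> \<noteq> 0 \<and> line \<omega> \<in> \<Union>K}" using K by (simp add: open_UN)
  qed
  then show ?thesis by (simp add: proj_space_def topology_inverse')
qed

definition vec_cnj :: "complex^'N \<Rightarrow> complex^'N" where
  "vec_cnj v = (\<chi> i. cnj (v $ i))"

definition vec_Im :: "complex^'N \<Rightarrow> complex^'N" where
  "vec_Im v = (\<chi> i. of_real (Im (v $ i)))"

text \<open>
  \<open>bil Q \<omega> (vec_cnj \<omega>)\<close> is automatically real, so positivity is positivity of its real part; the
  same remark applies to \<open>Re\<close> of norms of real vectors below.
\<close>

definition period_space :: "int^'N^'N \<Rightarrow> (complex^'N) set set" where
  "period_space Q = {line \<omega> |\<omega>. bil Q \<omega> \<omega> = 0 \<and> 0 < Re (bil Q \<omega> (vec_cnj \<omega>))}"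

definition period_domain :: "int^'N^'N \<Rightarrow> (complex^'N) set set \<Rightarrow> bool" where
  "period_domain Q D \<longleftrightarrow> D \<in> connected_components_of (subtopology proj_space (period_space Q))"

definition cone :: "(complex^'N) set set \<Rightarrow> (complex^'N) set" where
  "cone D = {\<omega>. \<omega> \<noteq> 0 \<and> line \<omega> \<in> D}"

definition Oplus :: "int^'N^'N \<Rightarrow> (complex^'N) set set \<Rightarrow> (complex^'N^'N) monoid" where
  "Oplus Q D = \<lparr> carrier = {g \<in> isometries Q \<int>. (\<lambda>p. (*v) g ` p) ` D = D},
                 monoid.mult = (**), one = mat 1 \<rparr>"


section \<open>Tensors and orthogonal Schur functors\<close>

text \<open>
  A tensor of degree \<open>d\<close> over \<open>complex ^ 'N\<close> is its coordinate function on the multi-indices, the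
  lists of length \<open>d\<close>, extended by 0 to all lists.
\<close>

type_synonym 'N tensor = "'N list \<Rightarrow> complex"

definition pure_tensor :: "(complex^'N) list \<Rightarrow> 'N tensor" where
  "pure_tensor vs = (\<lambda>xs. if length xs = length vs
     then (\<Prod>i<length vs. (vs ! i) $ (xs ! i)) else 0)"

definition tspan :: "'N tensor set \<Rightarrow> 'N tensor set" where
  "tspan S = {(\<lambda>xs. \<Sum>T\<in>A. c T * T xs) |A c. finite A \<and> A \<subseteq> S}"

definition tpower :: "nat \<Rightarrow> (complex^'N) set \<Rightarrow> 'N tensor set" where
  "tpower d W = tspan {pure_tensor vs |vs. length vs = d \<and> set vs \<subseteq> W}"

text \<open>The kernel of \<open>W\<^sup>\<otimes>\<^sup>d \<rightarrow> (W/K)\<^sup>\<otimes>\<^sup>d\<close>, and the image in \<open>(W/K)\<^sup>\<otimes>\<^sup>d\<close> of a tensor over \<open>W\<close>.\<close>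

definition tkernel :: "nat \<Rightarrow> (complex^'N) set \<Rightarrow> (complex^'N) set \<Rightarrow> 'N tensor set" where
  "tkernel d W K = tspan {pure_tensor vs |vs. length vs = d \<and> set vs \<subseteq> W \<and> set vs \<inter> K \<noteq> {}}"

definition tcoset :: "nat \<Rightarrow> (complex^'N) set \<Rightarrow> (complex^'N) set \<Rightarrow> 'N tensor \<Rightarrow> 'N tensor set" where
  "tcoset d W K T = {(\<lambda>xs. T xs + R xs) |R. R \<in> tkernel d W K}"

text \<open>\<open>g\<^sup>\<otimes>\<^sup>d\<close>, for all \<open>d\<close> at once.\<close>

definition tmap :: "complex^'N^'N \<Rightarrow> 'N tensor \<Rightarrow> 'N tensor" where
  "tmap g T = (\<lambda>xs. \<Sum>ys | length ys = length xs.
     (\<Prod>i<length xs. g $ (xs ! i) $ (ys ! i)) * T ys)"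

text \<open>Contraction of the \<open>i\<close>-th and \<open>j\<close>-th factors (\<open>i < j\<close>, counted from 0).\<close>

definition contraction :: "int^'N^'N \<Rightarrow> nat \<Rightarrow> nat \<Rightarrow> 'N tensor \<Rightarrow> 'N tensor" where
  "contraction Q i j T = (\<lambda>xs. \<Sum>a\<in>UNIV. \<Sum>b\<in>UNIV. of_int (Q $ a $ b) *
     T (take i xs @ a # take (j - i - 1) (drop i xs) @ b # drop (j - 1) xs))"

text \<open>
  A partition is the list of its parts; \<open>conj_part lam j\<close> is the length of the \<open>j\<close>-th column of its
  Young diagram, \<open>j \<ge> 1\<close>.  Rows, columns and the entries of the column canonical tableau (which
  fills the columns downwards, from left to right) are counted from 0.
\<close>

definition conj_part :: "nat list \<Rightarrow> nat \<Rightarrow> nat" where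
  "conj_part lam j = card {i. i < length lam \<and> j \<le> lam ! i}"

definition boxes :: "nat list \<Rightarrow> (nat \<times> nat) set" where
  "boxes lam = {(i, j). i < length lam \<and> j < lam ! i}"

definition tableau :: "nat list \<Rightarrow> nat \<times> nat \<Rightarrow> nat" where
  "tableau lam = (\<lambda>(i, j). (\<Sum>j'<j. conj_part lam (Suc j')) + i)"

definition row_group :: "nat list \<Rightarrow> (nat \<Rightarrow> nat) set" where
  "row_group lam = {\<sigma>. \<sigma> permutes {..<sum_list lam} \<and>
     (\<forall>(i, j)\<in>boxes lam. \<exists>j'. (i, j') \<in> boxes lam \<and> \<sigma> (tableau lam (i, j)) = tableau lam (i, j'))}"

definition col_group :: "nat list \<Rightarrow> (nat \<Rightarrow> nat) set" where
  "col_group lam = {\<sigma>. \<sigma> permutes {..<sum_list lam} \<and>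
     (\<forall>(i, j)\<in>boxes lam. \<exists>i'. (i', j) \<in> boxes lam \<and> \<sigma> (tableau lam (i, j)) = tableau lam (i', j))}"

text \<open>
  \<open>\<lambda>xs. T (permute_list \<sigma> xs)\<close> is the left action
  \<open>\<sigma>(v\<^sub>1 \<otimes> \<dots> \<otimes> v\<^sub>d) = v\<^bsub>\<sigma>\<inverse>(1)\<^esub> \<otimes> \<dots> \<otimes> v\<^bsub>\<sigma>\<inverse>(d)\<^esub>\<close>.
\<close>

definition row_symmetrizer :: "nat list \<Rightarrow> 'N tensor \<Rightarrow> 'N tensor" where
  "row_symmetrizer lam T = (\<lambda>xs. \<Sum>\<sigma>\<in>row_group lam. T (permute_list \<sigma> xs))"

definition col_antisymmetrizer :: "nat list \<Rightarrow> 'N tensor \<Rightarrow> 'N tensor" where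
  "col_antisymmetrizer lam T = (\<lambda>xs. \<Sum>\<sigma>\<in>col_group lam. of_int (sign \<sigma>) * T (permute_list \<sigma> xs))"

definition young_symmetrizer :: "nat list \<Rightarrow> 'N tensor \<Rightarrow> 'N tensor" where
  "young_symmetrizer lam T = col_antisymmetrizer lam (row_symmetrizer lam T)"

text \<open>
  For \<open>K\<close> in the radical of the quadratic space \<open>W\<close>: the tensors over \<open>W\<close> that represent the
  elements of \<open>V\<^sub>\<lambda>\<close> for \<open>V = W/K\<close>.  For \<open>K = {0}\<close> this is \<open>V\<^sub>\<lambda>\<close> itself.
\<close>

definition schur :: "int^'N^'N \<Rightarrow> nat list \<Rightarrow> (complex^'N) set \<Rightarrow> (complex^'N) set \<Rightarrow> 'N tensor set" where
  "schur Q lam W K = {young_symmetrizer lam T |T. T \<in> tpower (sum_list lam) W \<and>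
     (\<forall>j<sum_list lam. \<forall>i<j. contraction Q i j T \<in> tkernel (sum_list lam - 2) W K)}"


section \<open>Modular forms\<close>

text \<open>The fibre of \<open>\<E>\<^sub>\<lambda>\<close> at \<open>[\<omega>]\<close>, for \<open>\<E> = \<omega>\<^sup>\<bottom>/\<complex>\<omega>\<close>.\<close>

definition E_fibre :: "int^'N^'N \<Rightarrow> nat list \<Rightarrow> complex^'N \<Rightarrow> 'N tensor set set" where
  "E_fibre Q lam \<omega> = tcoset (sum_list lam) (perp Q {\<omega>}) (line \<omega>) ` schur Q lam (perp Q {\<omega>}) (line \<omega>)"

definition tscale :: "complex \<Rightarrow> 'N tensor \<Rightarrow> 'N tensor" where
  "tscale c T = (\<lambda>xs. c * T xs)"

definition holomorphic_vec :: "(complex^'N \<Rightarrow> complex) \<Rightarrow> (complex^'N) set \<Rightarrow> bool" where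
  "holomorphic_vec F S \<longleftrightarrow>
     (\<forall>x\<in>S. \<exists>c. (F has_derivative (\<lambda>h. \<Sum>i\<in>UNIV. c $ i * h $ i)) (at x within S))"

text \<open>
  A section \<open>s\<close> of \<open>\<E>\<^sub>\<lambda> \<otimes> \<L>\<^sup>\<otimes>\<^sup>k\<close> over \<open>\<D>\<close> is given by the function \<open>f\<close> on the cone over \<open>\<D>\<close> with
  \<open>s([\<omega>]) = f(\<omega>) \<otimes> \<omega>\<^sup>\<otimes>\<^sup>k\<close>, whence the homogeneity condition; the vector \<open>g\<omega>\<^sup>\<otimes>\<^sup>k\<close> being the image of
  \<open>\<omega>\<^sup>\<otimes>\<^sup>k\<close> under \<open>g\<close>, invariance is \<open>f(g\<omega>) = g f(\<omega>)\<close>.  As \<open>\<E>\<close> is a quotient of the subbundle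
  \<open>\<L>\<^sup>\<bottom>\<close> of the trivial bundle \<open>L\<^sub>\<complex>\<close>, holomorphy means the local existence of holomorphic
  \<open>L\<^sub>\<complex>\<^sup>\<otimes>\<^sup>d\<close>-valued representatives.
\<close>

definition modular_forms ::
  "int^'N^'N \<Rightarrow> (complex^'N) set set \<Rightarrow> (complex^'N^'N) set \<Rightarrow> nat list \<Rightarrow> int \<Rightarrow>
   (complex^'N \<Rightarrow> 'N tensor set) set" where
  "modular_forms Q D \<Gamma> lam k = {f.
     (\<forall>\<omega>\<in>cone D. f \<omega> \<in> E_fibre Q lam \<omega>) \<and>
     (\<forall>\<omega>\<in>cone D. \<forall>t. t \<noteq> 0 \<longrightarrow> f (t *s \<omega>) = tscale (t powi (- k)) ` f \<omega>) \<and>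
     (\<forall>\<omega>\<^sub>0\<in>cone D. \<exists>U S. open U \<and> \<omega>\<^sub>0 \<in> U \<and> (\<forall>xs. holomorphic_vec (\<lambda>\<omega>. S \<omega> xs) U) \<and>
        (\<forall>\<omega>\<in>U \<inter> cone D. S \<omega> \<in> f \<omega>)) \<and>
     (\<forall>g\<in>\<Gamma>. \<forall>\<omega>\<in>cone D. f (g *v \<omega>) = tmap g ` f \<omega>)}"


section \<open>Fourier expansion at 0-dimensional cusps\<close>

text \<open>
  A pair \<open>(e, e')\<close> encodes a primitive isotropic \<open>I = \<int>e\<close> of rank 1 with a chosen generator, and
  \<open>I' = L \<inter> \<rat>e'\<close>.  \<open>V(I)\<close> is identified with \<open>{e, e'}\<^sup>\<bottom>\<close>, and so is \<open>U(I)\<^sub>\<complex>\<close> by \<open>z \<otimes> e \<mapsto> z\<close>.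
\<close>

definition cusp_data :: "int^'N^'N \<Rightarrow> ((complex^'N) \<times> (complex^'N)) set" where
  "cusp_data Q = {(e, e'). primitive_isotropic Q 1 (fspan \<int> {e}) \<and>
     e' \<in> vecs \<rat> \<and> bil Q e' e' = 0 \<and> bil Q e e' = 1}"

definition UI :: "int^'N^'N \<Rightarrow> complex set \<Rightarrow> complex^'N \<Rightarrow> complex^'N \<Rightarrow> (complex^'N) set" where
  "UI Q F e e' = vecs F \<inter> perp Q {e, e'}"

text \<open>The Eichler transvection \<open>E\<^bsub>z \<otimes> e\<^esub>\<close>.\<close>

definition eichler :: "int^'N^'N \<Rightarrow> complex^'N \<Rightarrow> complex^'N \<Rightarrow> complex^'N^'N" where
  "eichler Q z e = matrix (\<lambda>v. v - bil Q z v *s e + bil Q e v *s z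
                               - (1 / 2 * bil Q z z * bil Q e v) *s e)"

definition UI_int ::
  "int^'N^'N \<Rightarrow> (complex^'N^'N) set \<Rightarrow> complex^'N \<Rightarrow> complex^'N \<Rightarrow> (complex^'N) set" where
  "UI_int Q \<Gamma> e e' = {z \<in> UI Q \<rat> e e'. eichler Q z e \<in> \<Gamma>}"

definition UI_dual ::
  "int^'N^'N \<Rightarrow> (complex^'N^'N) set \<Rightarrow> complex^'N \<Rightarrow> complex^'N \<Rightarrow> (complex^'N) set" where
  "UI_dual Q \<Gamma> e e' = {l \<in> UI Q \<rat> e e'. \<forall>z\<in>UI_int Q \<Gamma> e e'. bil Q l z \<in> \<int>}"

definition tube_pt :: "int^'N^'N \<Rightarrow> complex^'N \<Rightarrow> complex^'N \<Rightarrow> complex^'N \<Rightarrow> complex^'N" where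
  "tube_pt Q e e' Z = e' + Z - (1 / 2 * bil Q Z Z) *s e"

text \<open>The inverse of \<open>Z \<mapsto> [tube_pt Z]\<close>, as a function of \<open>\<omega>\<close> in the cone.\<close>

definition tube_coord :: "int^'N^'N \<Rightarrow> complex^'N \<Rightarrow> complex^'N \<Rightarrow> complex^'N \<Rightarrow> complex^'N" where
  "tube_coord Q e e' \<omega> = (1 / bil Q \<omega> e) *s \<omega> - e' - (bil Q \<omega> e' / bil Q \<omega> e) *s e"

definition pos_cone ::
  "int^'N^'N \<Rightarrow> (complex^'N) set set \<Rightarrow> complex^'N \<Rightarrow> complex^'N \<Rightarrow> (complex^'N) set" where
  "pos_cone Q D e e' = (THE C. C \<in> components {v \<in> UI Q \<real> e e'. 0 < Re (bil Q v v)} \<and>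
     {line (tube_pt Q e e' Z) |Z. Z \<in> UI Q UNIV e e' \<and> vec_Im Z \<in> C} = D)"

definition tube_domain ::
  "int^'N^'N \<Rightarrow> (complex^'N) set set \<Rightarrow> complex^'N \<Rightarrow> complex^'N \<Rightarrow> (complex^'N) set" where
  "tube_domain Q D e e' = {Z \<in> UI Q UNIV e e'. vec_Im Z \<in> pos_cone Q D e e'}"

definition V_lam :: "int^'N^'N \<Rightarrow> nat list \<Rightarrow> complex^'N \<Rightarrow> complex^'N \<Rightarrow> 'N tensor set" where
  "V_lam Q lam e e' = schur Q lam (perp Q {e, e'}) {0}"

text \<open>
  The isomorphism \<open>\<omega>\<^sup>\<bottom>/\<complex>\<omega> \<rightarrow> e\<^sup>\<bottom>/\<complex>e = {e, e'}\<^sup>\<bottom>\<close> induced by \<open>e\<^sup>\<bottom> \<inter> \<omega>\<^sup>\<bottom>\<close>: \<open>u - ((u,e)/(\<omega>,e))\<omega>\<close>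
  represents \<open>u\<close> modulo \<open>\<omega>\<close> in \<open>e\<^sup>\<bottom> \<inter> \<omega>\<^sup>\<bottom>\<close>, and \<open>y - (y,e')e\<close> represents \<open>y\<close> modulo \<open>e\<close> in
  \<open>{e, e'}\<^sup>\<bottom>\<close>.  Likewise for the inverse.
\<close>

definition to_VI :: "int^'N^'N \<Rightarrow> complex^'N \<Rightarrow> complex^'N \<Rightarrow> complex^'N \<Rightarrow> complex^'N^'N" where
  "to_VI Q e e' \<omega> = matrix (\<lambda>u. let y = u - (bil Q u e / bil Q \<omega> e) *s \<omega> in y - bil Q y e' *s e)"

definition from_VI :: "int^'N^'N \<Rightarrow> complex^'N \<Rightarrow> complex^'N \<Rightarrow> complex^'N^'N" where
  "from_VI Q e \<omega> = matrix (\<lambda>z. z - (bil Q z \<omega> / bil Q \<omega> e) *s e)"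

text \<open>
  The \<open>I\<close>-trivialization of \<open>A \<otimes> \<omega>\<^sup>\<otimes>\<^sup>k\<close>, with \<open>I\<^sub>\<complex>\<^sup>\<or>\<close> identified with \<open>\<complex>\<close> by the basis dual to \<open>e\<close>
  (\<open>\<omega>\<close> corresponds to \<open>(\<omega>,e)\<close>).  As \<open>to_VI\<close> annihilates \<open>\<omega>\<close>, its tensor power is constant on the
  coset \<open>A\<close>.
\<close>

definition I_triv ::
  "int^'N^'N \<Rightarrow> int \<Rightarrow> complex^'N \<Rightarrow> complex^'N \<Rightarrow> complex^'N \<Rightarrow> 'N tensor set \<Rightarrow> 'N tensor" where
  "I_triv Q k e e' \<omega> A = tscale (bil Q \<omega> e powi k) (the_elem (tmap (to_VI Q e e' \<omega>) ` A))"

definition qexp :: "int^'N^'N \<Rightarrow> complex^'N \<Rightarrow> complex^'N \<Rightarrow> complex" where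
  "qexp Q l Z = exp (2 * of_real pi * \<i> * bil Q l Z)"

definition fourier_coeff ::
  "int^'N^'N \<Rightarrow> (complex^'N) set set \<Rightarrow> (complex^'N^'N) set \<Rightarrow> nat list \<Rightarrow> int \<Rightarrow>
   (complex^'N \<Rightarrow> 'N tensor set) \<Rightarrow> complex^'N \<Rightarrow> complex^'N \<Rightarrow> (complex^'N \<Rightarrow> 'N tensor)" where
  "fourier_coeff Q D \<Gamma> lam k f e e' = (THE a.
     (\<forall>l. a l \<in> V_lam Q lam e e') \<and>
     (\<forall>l. l \<notin> UI_dual Q \<Gamma> e e' \<longrightarrow> a l = (\<lambda>xs. 0)) \<and>
     (\<forall>Z\<in>tube_domain Q D e e'. \<forall>xs.
        ((\<lambda>l. a l xs * qexp Q l Z) has_sum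
          I_triv Q k e e' (tube_pt Q e e' Z) (f (tube_pt Q e e' Z)) xs) (UI_dual Q \<Gamma> e e')))"

definition cusp_form ::
  "int^'N^'N \<Rightarrow> (complex^'N) set set \<Rightarrow> (complex^'N^'N) set \<Rightarrow> nat list \<Rightarrow> int \<Rightarrow>
   (complex^'N \<Rightarrow> 'N tensor set) \<Rightarrow> bool" where
  "cusp_form Q D \<Gamma> lam k f \<longleftrightarrow> f \<in> modular_forms Q D \<Gamma> lam k \<and>
     (\<forall>(e, e')\<in>cusp_data Q. \<forall>l.
        fourier_coeff Q D \<Gamma> lam k f e e' l \<noteq> (\<lambda>xs. 0) \<longrightarrow> l \<in> pos_cone Q D e e')"


section \<open>The 1-dimensional cusp \<open>J\<close>\<close>

definition wedge :: "complex^'N \<Rightarrow> complex^'N \<Rightarrow> complex^'N^'N" where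
  "wedge x y = (\<chi> i j. x $ i * y $ j - x $ j * y $ i)"

definition GammaJ :: "int^'N^'N \<Rightarrow> complex set \<Rightarrow> (complex^'N) set \<Rightarrow> (complex^'N^'N) set" where
  "GammaJ Q F J = {g \<in> isometries Q F. (*v) g ` fspan F J = fspan F J \<and>
     (\<forall>x\<in>fspan F J. \<forall>y\<in>fspan F J. wedge (g *v x) (g *v y) = wedge x y) \<and>
     (\<forall>x\<in>vecs F \<inter> perp Q J. g *v x - x \<in> fspan F J)}"

definition UJ :: "int^'N^'N \<Rightarrow> complex set \<Rightarrow> (complex^'N) set \<Rightarrow> (complex^'N^'N) set" where
  "UJ Q F J = {g \<in> GammaJ Q F J. \<forall>x\<in>vecs F \<inter> perp Q J. g *v x = x}"

text \<open>\<open>U(J)\<^sub>\<rat>\<close> and \<open>U(J)\<^sub>\<int>\<close> as subgroups of \<open>U(I)\<^sub>\<rat>\<close>, for \<open>I \<subseteq> J\<close>.\<close>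

definition UJ_rat ::
  "int^'N^'N \<Rightarrow> (complex^'N) set \<Rightarrow> complex^'N \<Rightarrow> complex^'N \<Rightarrow> (complex^'N) set" where
  "UJ_rat Q J e e' = {z \<in> UI Q \<rat> e e'. eichler Q z e \<in> UJ Q \<rat> J}"

definition UJ_int ::
  "int^'N^'N \<Rightarrow> (complex^'N^'N) set \<Rightarrow> (complex^'N) set \<Rightarrow> complex^'N \<Rightarrow> complex^'N \<Rightarrow> (complex^'N) set" where
  "UJ_int Q \<Gamma> J e e' = {z \<in> UI Q \<rat> e e'. eichler Q z e \<in> UJ Q \<rat> J \<inter> \<Gamma>}"

definition vJ ::
  "int^'N^'N \<Rightarrow> (complex^'N) set set \<Rightarrow> (complex^'N^'N) set \<Rightarrow> (complex^'N) set \<Rightarrow>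
   complex^'N \<Rightarrow> complex^'N \<Rightarrow> complex^'N" where
  "vJ Q D \<Gamma> J e e' = (THE v. v \<in> closure (pos_cone Q D e e') \<and> UJ_int Q \<Gamma> J e e' = fspan \<int> {v})"

text \<open>
  The data \<open>(e, e', l)\<close> on which an \<open>(I, \<omega>\<^sub>J)\<close>-trivialization depends: \<open>(e, e')\<close> as above with
  \<open>I \<subseteq> J\<close>, and \<open>l = l\<^bsub>J,\<Gamma>\<^esub>\<close>.
\<close>

type_synonym 'N triv = "(complex^'N) \<times> (complex^'N) \<times> (complex^'N)"

definition triv_data ::
  "int^'N^'N \<Rightarrow> (complex^'N) set set \<Rightarrow> (complex^'N^'N) set \<Rightarrow> (complex^'N) set \<Rightarrow> 'N triv set" where
  "triv_data Q D \<Gamma> J = {(e, e', l). (e, e') \<in> cusp_data Q \<and> e \<in> J \<and>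
     l \<in> UI Q \<rat> e e' \<and> bil Q l l = 0 \<and> bil Q (vJ Q D \<Gamma> J e e') l = 1}"

text \<open>
  The point of \<open>\<Delta>\<^sub>J \<simeq> \<V>\<^sub>J\<close> below \<open>[\<omega>]\<close>: the line in \<open>(L/J)\<^sub>\<complex>\<close> spanned by \<open>\<omega>\<close>, given by its
  preimage in \<open>L\<^sub>\<complex>\<close>.
\<close>

definition VJ_pt :: "(complex^'N) set \<Rightarrow> complex^'N \<Rightarrow> (complex^'N) set" where
  "VJ_pt J \<omega> = vec.span (insert \<omega> J)"

definition Delta :: "(complex^'N) set set \<Rightarrow> (complex^'N) set \<Rightarrow> (complex^'N) set set" where
  "Delta D J = VJ_pt J ` cone D"

text \<open>The function \<open>\<omega>\<^sub>J\<close> on the cone.\<close>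

definition omegaJ :: "int^'N^'N \<Rightarrow> 'N triv \<Rightarrow> complex^'N \<Rightarrow> complex" where
  "omegaJ Q = (\<lambda>(e, e', l) \<omega>. qexp Q l (tube_coord Q e e' \<omega>))"

text \<open>
  The class of \<open>Z\<close> in \<open>U(I)\<^sub>\<complex>/U(J)\<^sub>\<complex>\<close>, represented by the element of \<open>Z + \<complex>v\<^bsub>J,\<Gamma>\<^esub>\<close> orthogonal to
  \<open>l\<^bsub>J,\<Gamma>\<^esub>\<close>: as a function of \<open>\<omega>\<close>, and of the point of \<open>\<Delta>\<^sub>J\<close> below.
\<close>

definition base_coord ::
  "int^'N^'N \<Rightarrow> (complex^'N) set set \<Rightarrow> (complex^'N^'N) set \<Rightarrow> (complex^'N) set \<Rightarrow> 'N triv \<Rightarrow>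
   complex^'N \<Rightarrow> complex^'N" where
  "base_coord Q D \<Gamma> J = (\<lambda>(e, e', l) \<omega>.
     let Z = tube_coord Q e e' \<omega> in Z - bil Q l Z *s vJ Q D \<Gamma> J e e')"

definition Delta_coord ::
  "int^'N^'N \<Rightarrow> (complex^'N) set set \<Rightarrow> (complex^'N^'N) set \<Rightarrow> (complex^'N) set \<Rightarrow> 'N triv \<Rightarrow>
   (complex^'N) set \<Rightarrow> complex^'N" where
  "Delta_coord Q D \<Gamma> J \<tau> p = (THE u. \<exists>\<omega>\<in>cone D. p = VJ_pt J \<omega> \<and> u = base_coord Q D \<Gamma> J \<tau> \<omega>)"

text \<open>
  \<open>(base_coord, \<omega>\<^sub>J)\<close> is a coordinate system on \<open>\<X>(J)\<close> in which the filled-in disc bundle is obtained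
  by adding the points with \<open>\<omega>\<^sub>J = 0\<close>.  The following filter on the cone thus expresses that the
  image of \<open>\<omega>\<close> in \<open>\<X>(J)\<close> converges to the boundary point \<open>p \<in> \<Delta>\<^sub>J\<close>.
\<close>

definition to_boundary ::
  "int^'N^'N \<Rightarrow> (complex^'N) set set \<Rightarrow> (complex^'N^'N) set \<Rightarrow> (complex^'N) set \<Rightarrow> 'N triv \<Rightarrow>
   (complex^'N) set \<Rightarrow> (complex^'N) filter" where
  "to_boundary Q D \<Gamma> J \<tau> p = inf (principal (cone D))
     (filtercomap (\<lambda>\<omega>. (base_coord Q D \<Gamma> J \<tau> \<omega>, omegaJ Q \<tau> \<omega>)) (nhds (Delta_coord Q D \<Gamma> J \<tau> p, 0)))"

text \<open>
  The transition function at \<open>[\<omega>]\<close>, for the bundle of sections of \<open>\<E>\<^sub>\<lambda>\<^sub>,\<^sub>k\<close> vanishing to order \<open>m\<close>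
  along \<open>\<Delta>\<^sub>J\<close>, from the frame given by the \<open>I\<^sub>1\<close>-trivialization and \<open>\<omega>\<^sub>1\<^sup>m\<close> to the one given by the
  \<open>I\<^sub>2\<close>-trivialization and \<open>\<omega>\<^sub>2\<^sup>m\<close>.
\<close>

definition transition ::
  "int^'N^'N \<Rightarrow> int \<Rightarrow> nat \<Rightarrow> 'N triv \<Rightarrow> 'N triv \<Rightarrow> complex^'N \<Rightarrow> 'N tensor \<Rightarrow> 'N tensor" where
  "transition Q k m = (\<lambda>(e\<^sub>1, e\<^sub>1', l\<^sub>1) (e\<^sub>2, e\<^sub>2', l\<^sub>2) \<omega> T.
     tscale ((omegaJ Q (e\<^sub>1, e\<^sub>1', l\<^sub>1) \<omega> / omegaJ Q (e\<^sub>2, e\<^sub>2', l\<^sub>2) \<omega>) ^ m *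
             (bil Q \<omega> e\<^sub>2 / bil Q \<omega> e\<^sub>1) powi k)
       (tmap (to_VI Q e\<^sub>2 e\<^sub>2' \<omega>) (tmap (from_VI Q e\<^sub>1 \<omega>) T)))"

text \<open>
  The extension of \<open>\<E>\<^sub>\<lambda>\<^sub>,\<^sub>k\<close> over \<open>\<Delta>\<^sub>J\<close> is the one in which every \<open>I\<close>-trivialization extends, and the
  conormal bundle \<open>\<Theta>\<^sub>J\<close> has the frames \<open>\<omega>\<^sub>J\<close> mod squares of the ideal.  So \<open>\<E>\<^sub>\<lambda>\<^sub>,\<^sub>k \<otimes> \<Theta>\<^sub>J\<^sup>\<otimes>\<^sup>m\<close> is glued from
  trivial bundles, one for each choice of trivialization data \<open>\<tau>\<close>, along the boundary values of the
  transition functions.  A point of its fibre at \<open>p \<in> \<Delta>\<^sub>J\<close> is given by the family \<open>x\<close> of its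
  coordinates \<open>x \<tau>\<close> in the \<open>(I, \<omega>\<^sub>J)\<close>-trivializations.
\<close>

definition J_fibre ::
  "int^'N^'N \<Rightarrow> (complex^'N) set set \<Rightarrow> (complex^'N^'N) set \<Rightarrow> (complex^'N) set \<Rightarrow> nat list \<Rightarrow> int \<Rightarrow>
   nat \<Rightarrow> (complex^'N) set \<Rightarrow> ('N triv \<Rightarrow> 'N tensor) set" where
  "J_fibre Q D \<Gamma> J lam k m p = {x.
     (\<forall>(e, e', l)\<in>triv_data Q D \<Gamma> J. x (e, e', l) \<in> V_lam Q lam e e') \<and>
     (\<forall>\<tau>\<^sub>1\<in>triv_data Q D \<Gamma> J. \<forall>\<tau>\<^sub>2\<in>triv_data Q D \<Gamma> J. \<forall>xs.
        ((\<lambda>\<omega>. transition Q k m \<tau>\<^sub>1 \<tau>\<^sub>2 \<omega> (x \<tau>\<^sub>1) xs) \<longlongrightarrow> x \<tau>\<^sub>2 xs) (to_boundary Q D \<Gamma> J \<tau>\<^sub>1 p))}"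

text \<open>The point with coordinate \<open>T\<close> in the trivialization \<open>\<tau>\<^sub>0\<close>.\<close>

definition J_fibre_point ::
  "int^'N^'N \<Rightarrow> (complex^'N) set set \<Rightarrow> (complex^'N^'N) set \<Rightarrow> (complex^'N) set \<Rightarrow> int \<Rightarrow>
   nat \<Rightarrow> (complex^'N) set \<Rightarrow> 'N triv \<Rightarrow> 'N tensor \<Rightarrow> ('N triv \<Rightarrow> 'N tensor)" where
  "J_fibre_point Q D \<Gamma> J k m p \<tau>\<^sub>0 T = (\<lambda>\<tau> xs.
     Lim (to_boundary Q D \<Gamma> J \<tau>\<^sub>0 p) (\<lambda>\<omega>. transition Q k m \<tau>\<^sub>0 \<tau> \<omega> T xs))"

text \<open>
  Holomorphy of a section is tested on the preimage of \<open>\<Delta>\<^sub>J \<subseteq> U(I)\<^sub>\<complex>/U(J)\<^sub>\<complex>\<close> in \<open>U(I)\<^sub>\<complex>\<close>.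
  The action of \<open>g \<in> \<Gamma>(J)\<^sub>\<int>\<close> carries the \<open>(I, \<omega>\<^sub>J)\<close>-trivialization with data \<open>(e, e', l)\<close> to the one
  with data \<open>(ge, ge', gl)\<close>.
\<close>

definition invariant_sections ::
  "int^'N^'N \<Rightarrow> (complex^'N) set set \<Rightarrow> (complex^'N^'N) set \<Rightarrow> (complex^'N) set \<Rightarrow> nat list \<Rightarrow> int \<Rightarrow>
   nat \<Rightarrow> ((complex^'N) set \<Rightarrow> 'N triv \<Rightarrow> 'N tensor) set" where
  "invariant_sections Q D \<Gamma> J lam k m = {\<phi>.
     (\<forall>p\<in>Delta D J. \<phi> p \<in> J_fibre Q D \<Gamma> J lam k m p) \<and>
     (\<forall>(e, e', l)\<in>triv_data Q D \<Gamma> J. \<forall>xs.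
        holomorphic_vec (\<lambda>Z. \<phi> (VJ_pt J (tube_pt Q e e' Z)) (e, e', l) xs)
          {Z \<in> UI Q UNIV e e'. VJ_pt J (tube_pt Q e e' Z) \<in> Delta D J}) \<and>
     (\<forall>g\<in>GammaJ Q \<rat> J \<inter> \<Gamma>. \<forall>p\<in>Delta D J. \<forall>(e, e', l)\<in>triv_data Q D \<Gamma> J.
        \<phi> ((*v) g ` p) (g *v e, g *v e', g *v l) = tmap g (\<phi> p (e, e', l)))}"

definition UJ_perp ::
  "int^'N^'N \<Rightarrow> (complex^'N) set \<Rightarrow> complex^'N \<Rightarrow> complex^'N \<Rightarrow> (complex^'N) set" where
  "UJ_perp Q J e e' = UI Q \<rat> e e' \<inter> perp Q (UJ_rat Q J e e')"

text \<open>
  Every exponent \<open>l\<close> occurring in the Fourier expansion of \<open>\<phi>\<close> in the given trivialization, which is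
  a series over some full lattice \<open>\<Lambda>\<close> in \<open>U(J)\<^sub>\<rat>\<^sup>\<bottom>\<close>, has \<open>P (ml\<^bsub>J,\<Gamma>\<^esub> + l, ml\<^bsub>J,\<Gamma>\<^esub> + l)\<close>.
\<close>

definition fourier_condition ::
  "int^'N^'N \<Rightarrow> (complex^'N) set set \<Rightarrow> (complex^'N^'N) set \<Rightarrow> (complex^'N) set \<Rightarrow>
   nat \<Rightarrow> (real \<Rightarrow> bool) \<Rightarrow> 'N triv \<Rightarrow> ((complex^'N) set \<Rightarrow> 'N triv \<Rightarrow> 'N tensor) \<Rightarrow> bool" where
  "fourier_condition Q D \<Gamma> J m P = (\<lambda>(e, e', lJ) \<phi>. \<exists>\<Lambda> a.
     (\<exists>B. finite B \<and> \<Lambda> = fspan \<int> B \<and> fspan \<rat> B = UJ_perp Q J e e') \<and>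
     (\<forall>p\<in>Delta D J. \<forall>xs.
        ((\<lambda>l. a l xs * qexp Q l (Delta_coord Q D \<Gamma> J (e, e', lJ) p)) has_sum \<phi> p (e, e', lJ) xs) \<Lambda>) \<and>
     (\<forall>l\<in>\<Lambda>. a l \<noteq> (\<lambda>xs. 0) \<longrightarrow>
        P (Re (bil Q (of_nat m *s lJ + l) (of_nat m *s lJ + l)))))"

definition jacobi_form ::
  "int^'N^'N \<Rightarrow> (complex^'N) set set \<Rightarrow> (complex^'N^'N) set \<Rightarrow> (complex^'N) set \<Rightarrow> nat list \<Rightarrow> int \<Rightarrow>
   nat \<Rightarrow> ((complex^'N) set \<Rightarrow> 'N triv \<Rightarrow> 'N tensor) \<Rightarrow> bool" where
  "jacobi_form Q D \<Gamma> J lam k m \<phi> \<longleftrightarrow> \<phi> \<in> invariant_sections Q D \<Gamma> J lam k m \<and>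
     (\<forall>\<tau>\<in>triv_data Q D \<Gamma> J. fourier_condition Q D \<Gamma> J m (\<lambda>r. 0 \<le> r) \<tau> \<phi>)"

definition jacobi_cusp_form ::
  "int^'N^'N \<Rightarrow> (complex^'N) set set \<Rightarrow> (complex^'N^'N) set \<Rightarrow> (complex^'N) set \<Rightarrow> nat list \<Rightarrow> int \<Rightarrow>
   nat \<Rightarrow> ((complex^'N) set \<Rightarrow> 'N triv \<Rightarrow> 'N tensor) \<Rightarrow> bool" where
  "jacobi_cusp_form Q D \<Gamma> J lam k m \<phi> \<longleftrightarrow> \<phi> \<in> invariant_sections Q D \<Gamma> J lam k m \<and>
     (\<forall>\<tau>\<in>triv_data Q D \<Gamma> J. fourier_condition Q D \<Gamma> J m (\<lambda>r. 0 < r) \<tau> \<phi>)"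

text \<open>
  The \<open>m\<close>-th Fourier-Jacobi coefficient of \<open>f\<close>, as the section of \<open>\<E>\<^sub>\<lambda>\<^sub>,\<^sub>k \<otimes> \<Theta>\<^sub>J\<^sup>\<otimes>\<^sup>m\<close> that corresponds
  to \<open>fj_series\<close> in the trivialization with data \<open>\<tau>\<close>.
\<close>

definition fj_series ::
  "int^'N^'N \<Rightarrow> (complex^'N) set set \<Rightarrow> (complex^'N^'N) set \<Rightarrow> (complex^'N) set \<Rightarrow> nat list \<Rightarrow> int \<Rightarrow>
   (complex^'N \<Rightarrow> 'N tensor set) \<Rightarrow> nat \<Rightarrow> 'N triv \<Rightarrow> (complex^'N) set \<Rightarrow> 'N tensor" where
  "fj_series Q D \<Gamma> J lam k f m = (\<lambda>(e, e', lJ) p xs.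
     \<Sum>\<^sub>\<infinity>l\<in>UJ_perp Q J e e'. fourier_coeff Q D \<Gamma> lam k f e e' (l + of_nat m *s lJ) xs *
       qexp Q l (Delta_coord Q D \<Gamma> J (e, e', lJ) p))"

definition fj_coeff ::
  "int^'N^'N \<Rightarrow> (complex^'N) set set \<Rightarrow> (complex^'N^'N) set \<Rightarrow> (complex^'N) set \<Rightarrow> nat list \<Rightarrow> int \<Rightarrow>
   (complex^'N \<Rightarrow> 'N tensor set) \<Rightarrow> nat \<Rightarrow> 'N triv \<Rightarrow> ((complex^'N) set \<Rightarrow> 'N triv \<Rightarrow> 'N tensor)" where
  "fj_coeff Q D \<Gamma> J lam k f m \<tau> = (\<lambda>p.
     J_fibre_point Q D \<Gamma> J k m p \<tau> (fj_series Q D \<Gamma> J lam k f m \<tau> p))"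

end

theory Submission
  imports Defs "HOL-Complex_Analysis.Complex_Analysis" "HOL-Real_Asymp.Real_Asymp"
begin

text \<open>
  Fix a cusp \<open>I = \<int>e\<close> inside \<open>J\<close>, and let \<open>v\<close> be the positive generator of \<open>U(J)\<^sub>\<int>\<close>.  In the tube domain of
  \<open>I\<close> a modular form is a holomorphic function that is periodic under the lattice \<open>U(I)\<^sub>\<int>\<close>; iterating
  one-dimensional Fourier expansions along linearly independent periods gives its absolutely convergent Fourier
  series (\<open>modes_has_sum\<close>, \<open>fourier_exists\<close>).  The terms with \<open>(l, v) = m\<close> are selected by integrating along
  the translations by \<open>v\<close>, so that the \<open>m\<close>-th Fourier-Jacobi series times \<open>\<omega>\<^sub>J\<^sup>m\<close> is the integral
  of \<open>f(E\<^bsub>tv\<^esub> \<omega>) exp(-2\<pi>imt)\<close> over \<open>0 \<le> t \<le> 1\<close> (\<open>fjs_has_integral\<close>).  Everything about the change of cusp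
  follows from this formula.

  The translation \<open>E\<^bsub>tv\<^esub>\<close> is an element of the center \<open>U(J)\<close> and, with its orientation, does not depend on \<open>I\<close>
  (\<open>unipotent_same\<close>).  The change from the \<open>I\<^sub>1\<close>- to the \<open>I\<^sub>2\<close>-trivialization is
  invariant under it (\<open>change_eichler\<close>), hence can be pulled out of the integral: the transition functions carry the
  series at one cusp to the series at the other, already at every point of \<open>\<D>\<close> (\<open>transition_fjs\<close>).
  For the same reason they are constant on the fibres of \<open>\<D> \<rightarrow> \<V>\<^sub>J\<close>, including their analytic continuation to complex
  \<open>t\<close>, so that they are continuous functions of the base coordinate and extend to the boundary
  (\<open>transition_tendsto\<close>).  Thus the series at the various cusps are the coordinates of one section, which is
  the Fourier-Jacobi coefficient (\<open>fj_coeff_eq\<close>).  Its coordinates are holomorphic because an exponential series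
  that converges absolutely on a neighbourhood can be differentiated term by term (\<open>fjs_holomorphic\<close>).  An element
  of \<open>\<Gamma>(J)\<^sub>\<int>\<close> fixes \<open>\<wedge>\<^sup>2J\<close>, hence maps the generator \<open>v\<close> of one cusp to that of the other, and the invariance is
  transport of structure (\<open>GammaJ_image\<close>, \<open>fjs_image\<close>).

  It remains to see that \<open>a(l) \<noteq> 0\<close> and \<open>(l, v) = m > 0\<close> imply \<open>(l, l) \<ge> 0\<close>, which is the Koecher principle
  (\<open>koecher\<close>).  If \<open>(l, l) < 0\<close>, there is a rational isotropic vector \<open>v'\<close> in the closure of the
  positive cone with \<open>(l, v') < 0\<close>.  Since \<open>n \<ge> 3\<close>, there is a rational vector \<open>w\<close> of negative norm orthogonal to
  \<open>e\<close>, \<open>e'\<close>, \<open>v\<close> and \<open>v'\<close>.  The transvections along \<open>w\<close> that fix \<open>v'\<close> have powers in \<open>\<Gamma>\<close>, by finite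
  index.  They fix the cusp and move \<open>l\<close> along a parabola on which the pairing with any point of the positive cone tends to
  \<open>-\<infinity>\<close>, while the coefficients change by matrices of polynomial growth only.  As the coefficients are
  bounded by an exponential of this pairing, \<open>a(l) = 0\<close> (\<open>coeff_unipotent_vanishing\<close>).  For cusp forms, \<open>a(l) \<noteq> 0\<close>
  implies \<open>(l, l) > 0\<close> by definition.
\<close>

unbundle no Formal_Power_Series.fps_syntax

section \<open>The exponential function of period one\<close>

definition ee :: "complex \<Rightarrow> complex" where "ee s = exp (2 * of_real pi * \<i> * s)"

lemma ee_add: "ee (s + t) = ee s * ee t"
  by (simp add: ee_def exp_add distrib_left)

lemma ee_0 [simp]: "ee 0 = 1"
  by (simp add: ee_def)

lemma ee_nz [simp]: "ee s \<noteq> 0"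
  by (simp add: ee_def)

lemma ee_minus: "ee (- s) = inverse (ee s)"
  by (simp add: ee_def exp_minus)

lemma ee_of_int [simp]: "ee (of_int n) = 1"
  unfolding ee_def using exp_integer_2pi[of "of_int n"] by (simp add: mult_ac)

lemma ee_eq_1_iff: "ee s = 1 \<longleftrightarrow> s \<in> \<int>"
proof
  assume "ee s = 1"
  then obtain n :: int where n: "Im (2 * of_real pi * \<i> * s) = of_int (2 * n) * pi" and "Re (2 * of_real pi * \<i> * s) = 0"
    unfolding ee_def exp_eq_1 by auto
  then have "Im s = 0" "Re s = of_int n" by (auto simp: field_simps)
  then have "s = of_int n" by (simp add: complex_eq_iff)
  then show "s \<in> \<int>" by simp
qed (auto elim!: Ints_cases)

lemma norm_ee: "norm (ee s) = exp (- 2 * pi * Im s)"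
  by (simp add: ee_def norm_exp_eq_Re)

lemma ee_has_field_derivative [derivative_intros]:
  "(f has_field_derivative f') (at x within S) \<Longrightarrow>
   ((\<lambda>x. ee (f x)) has_field_derivative (2 * of_real pi * \<i> * f' * ee (f x))) (at x within S)"
  unfolding ee_def by (auto intro!: derivative_eq_intros)

lemma ee_holomorphic [holomorphic_intros]: "f holomorphic_on S \<Longrightarrow> (\<lambda>x. ee (f x)) holomorphic_on S"
  unfolding ee_def by (auto intro!: holomorphic_intros)

lemma ee_continuous [continuous_intros]: "continuous_on S f \<Longrightarrow> continuous_on S (\<lambda>x. ee (f x))"
  unfolding ee_def by (auto intro!: continuous_intros)

lemma ee_power: "ee s ^ n = ee (of_nat n * s)"
  by (simp add: ee_def exp_of_nat_mult[symmetric] mult_ac)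

section \<open>Fourier series of a periodic holomorphic function on a strip\<close>

definition circle_coeff :: "int \<Rightarrow> (complex \<Rightarrow> complex) \<Rightarrow> complex" where
  "circle_coeff n h = integral {0..1} (\<lambda>t. h (of_real t) * ee (- (of_int n * of_real t)))"

lemma integral_period_const:
  assumes S: "open S" "convex S" "\<And>s t. s \<in> S \<Longrightarrow> s + of_real t \<in> S"
    and h: "h holomorphic_on S" "\<And>s. s \<in> S \<Longrightarrow> h (s + 1) = h s"
    and "s \<in> S" "s' \<in> S"
  shows "integral {0..1} (\<lambda>t. h (s + of_real t)) = integral {0..1} (\<lambda>t. h (s' + of_real t))"
proof -
  have "\<exists>P. \<forall>x\<in>S. (P has_field_derivative h x) (at x within S)"
    using holomorphic_convex_primitive'[OF S(2,1) h(1), of "\<exists>P. \<forall>x\<in>S. (P has_field_derivative h x) (at x within S)"]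
    by blast
  then obtain P where P: "\<And>x. x \<in> S \<Longrightarrow> (P has_field_derivative h x) (at x within S)" by auto
  then have P': "(P has_field_derivative h x) (at x)" if "x \<in> S" for x
    using P[OF that] at_within_open[OF that S(1)] by simp
  have K: "integral {0..1} (\<lambda>t. h (s + of_real t)) = P (s + 1) - P s" if s: "s \<in> S" for s
  proof -
    have "((\<lambda>t. h (s + of_real t)) has_integral P (s + of_real 1) - P (s + of_real 0)) {0..1}"
    proof (rule fundamental_theorem_of_calculus)
      fix t :: real
      have "((\<lambda>x. P (s + x)) has_field_derivative h (s + of_real t)) (at (of_real t))"
        by (rule DERIV_chain'[where f = "\<lambda>x. s + x" and D = 1, simplified])
           (use P'[OF S(3)[OF s, of t]] in \<open>auto intro!: derivative_eq_intros\<close>)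
      then show "((\<lambda>t. P (s + of_real t)) has_vector_derivative h (s + of_real t)) (at t within {0..1})"
        by (rule has_vector_derivative_real_field)
    qed simp
    then show ?thesis by (simp add: integral_unique)
  qed
  have s1: "s + 1 \<in> S" if "s \<in> S" for s using S(3)[OF that, of 1] by simp
  obtain c where c: "\<forall>x\<in>S. P (x + 1) - P x = c"
  proof -
  have "\<exists>c. \<forall>x\<in>S. P (x + 1) - P x = c"
  proof (rule has_field_derivative_zero_constant[OF S(2)])
    fix x assume x: "x \<in> S"
    have "((\<lambda>x. P (x + 1)) has_field_derivative h (x + 1)) (at x)"
      using DERIV_shift P'[OF s1[OF x]] by blast
    from DERIV_diff[OF this P'[OF x]]
    show "((\<lambda>x. P (x + 1) - P x) has_field_derivative 0) (at x within S)"
      using h(2)[OF x] by (auto intro: has_field_derivative_at_within)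
  qed
  then show thesis using that by auto
  qed
  show ?thesis using K[OF assms(6)] K[OF assms(7)] c assms(6,7) by simp
qed

text \<open>
  The integral of a function of period 1 over a horizontal segment of length 1 is independent of the segment,
  so the path in the Fourier integral may be moved to any height of the strip.
\<close>

lemma circle_coeff_shift:
  assumes S: "open S" "convex S" "\<And>s t. s \<in> S \<Longrightarrow> s + of_real t \<in> S"
    and h: "h holomorphic_on S" "\<And>s. s \<in> S \<Longrightarrow> h (s + 1) = h s"
    and "s \<in> S" "0 \<in> S"
  shows "integral {0..1} (\<lambda>t. h (s + of_real t) * ee (- (of_int n * of_real t))) = ee (of_int n * s) * circle_coeff n h"
proof -
  let ?k = "\<lambda>s. h s * ee (- (of_int n * s))"
  have "integral {0..1} (\<lambda>t. ?k (s + of_real t)) = integral {0..1} (\<lambda>t. ?k (0 + of_real t))"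
  proof (rule integral_period_const[OF S _ _ assms(6,7)])
    show "?k holomorphic_on S" by (intro holomorphic_intros h)
    show "?k (s + 1) = ?k s" if "s \<in> S" for s
    proof -
      have "ee (- (of_int n * (s + 1))) = ee (- (of_int n * s)) * ee (of_int (- n))"
        unfolding ee_add[symmetric] by (simp add: algebra_simps)
      then show ?thesis using h(2)[OF that] by (metis ee_of_int mult.right_neutral)
    qed
  qed
  moreover have "?k (s + of_real t) = ee (- (of_int n * s)) * (h (s + of_real t) * ee (- (of_int n * of_real t)))" for t
  proof -
    have "- (of_int n * (s + of_real t)) = - (of_int n * s) + - (of_int n * of_real t)"
      by (simp add: algebra_simps)
    then show ?thesis by (simp only: ee_add mult_ac)
  qed
  ultimately have "ee (- (of_int n * s)) * integral {0..1} (\<lambda>t. h (s + of_real t) * ee (- (of_int n * of_real t))) = circle_coeff n h"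
    by (simp only: integral_mult_right circle_coeff_def add_0)
  then have "ee (of_int n * s) * (ee (- (of_int n * s)) * integral {0..1} (\<lambda>t. h (s + of_real t) * ee (- (of_int n * of_real t)))) = ee (of_int n * s) * circle_coeff n h"
    by (simp only:)
  then show ?thesis
    unfolding mult.assoc[symmetric] ee_add[symmetric] by simp
qed

lemma integral_cnorm_bound:
  fixes f :: "real \<Rightarrow> complex"
  assumes "continuous_on {0..1} f" "\<And>t. t \<in> {0..1} \<Longrightarrow> norm (f t) \<le> B"
  shows "norm (integral {0..1} f) \<le> B"
  using integral_bound[of 0 1 f B] assms by simp

text \<open>
  Move the path up or down, according to the sign of the frequency, to the height where the exponential
  factor is small.
\<close>

lemma circle_coeff_bound:
  assumes S: "open S" "convex S" "\<And>s t. s \<in> S \<Longrightarrow> s + of_real t \<in> S"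
    and h: "h holomorphic_on S" "\<And>s. s \<in> S \<Longrightarrow> h (s + 1) = h s"
    and "0 \<in> S" "\<i> * of_real \<epsilon> \<in> S" "- \<i> * of_real \<epsilon> \<in> S"
    and B: "\<And>t. t \<in> {0..1} \<Longrightarrow> norm (h (\<i> * of_real \<epsilon> + of_real t)) \<le> B"
           "\<And>t. t \<in> {0..1} \<Longrightarrow> norm (h (- \<i> * of_real \<epsilon> + of_real t)) \<le> B"
  shows "norm (circle_coeff n h) \<le> B * exp (- (2 * pi * \<epsilon> * \<bar>of_int n\<bar>))"
proof -
  define s where "s = (if n \<ge> 0 then - \<i> * of_real \<epsilon> else \<i> * of_real \<epsilon>)"
  have s: "s \<in> S" using assms by (auto simp: s_def)
  have B': "norm (h (s + of_real t)) \<le> B" if "t \<in> {0..1}" for t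
    using B that by (auto simp: s_def)
  have "circle_coeff n h = ee (- (of_int n * s)) * integral {0..1} (\<lambda>t. h (s + of_real t) * ee (- (of_int n * of_real t)))"
    using circle_coeff_shift[OF S h s \<open>0 \<in> S\<close>, of n] by (simp add: ee_minus)
  also have "norm \<dots> \<le> norm (ee (- (of_int n * s))) * B"
    unfolding norm_mult
  proof (intro mult_left_mono integral_cnorm_bound)
    have "continuous_on {0..1} (\<lambda>t. h (s + complex_of_real t))"
      using holomorphic_on_imp_continuous_on[OF h(1)]
      by (rule continuous_on_compose2) (auto intro!: continuous_intros S(3) s)
    then show "continuous_on {0..1} (\<lambda>t. h (s + of_real t) * ee (- (of_int n * of_real t)))"
      by (intro continuous_intros)
  qed (use B' in \<open>auto simp: norm_mult norm_ee\<close>)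
  also have "norm (ee (- (of_int n * s))) = exp (- (2 * pi * \<epsilon> * \<bar>of_int n\<bar>))"
    by (auto simp: norm_ee s_def)
  finally show ?thesis by (simp add: mult.commute)
qed

lemma summable_exp_int:
  assumes "c > 0"
  shows "(\<lambda>n::int. exp (- (c * \<bar>of_int n\<bar>)) :: real) summable_on UNIV"
proof -
  have nat: "(\<lambda>n::nat. exp (- (c * of_nat n)) :: real) summable_on UNIV"
  proof -
    have "summable (\<lambda>n. exp (- c) ^ n)" using assms by (intro summable_geometric) simp
    then have "summable (\<lambda>n. norm (exp (- (c * of_nat n)) :: real))"
      by (simp add: exp_of_nat_mult[symmetric] mult.commute)
    then show ?thesis by (rule norm_summable_imp_summable_on)
  qed
  have 1: "(\<lambda>n::int. exp (- (c * \<bar>of_int n\<bar>)) :: real) summable_on range int"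
    by (subst summable_on_reindex) (use nat in \<open>auto simp: o_def inj_on_def\<close>)
  have 2: "(\<lambda>n::int. exp (- (c * \<bar>of_int n\<bar>)) :: real) summable_on range (\<lambda>n. - int n)"
    by (subst summable_on_reindex) (use nat in \<open>auto simp: o_def inj_on_def\<close>)
  have "(UNIV :: int set) = range int \<union> range (\<lambda>n. - int n)"
    by (auto simp: image_iff) (metis int_cases2)
  then show ?thesis using summable_on_union[OF 1 2] by simp
qed

text \<open>
  The quotient of the increment of a periodic function by \<open>ee s - 1\<close> has removable singularities at the
  integers.  With it the Fourier series telescopes, which is Chernoff's proof of pointwise convergence.
\<close>

lemma chernoff_quotient:
  assumes S: "open S" "\<And>s t. s \<in> S \<Longrightarrow> s + of_real t \<in> S"
    and h: "h holomorphic_on S" "\<And>s. s \<in> S \<Longrightarrow> h (s + 1) = h s" and "0 \<in> S"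
  obtains k where "k holomorphic_on S" "\<And>s. s \<in> S \<Longrightarrow> k (s + 1) = k s"
    "\<And>s. s \<in> S \<Longrightarrow> h s - h 0 = (ee s - 1) * k s"
proof -
  define k where "k = (\<lambda>s. if s \<in> \<int> then deriv h s / (2 * of_real pi * \<i>) else (h s - h 0) / (ee s - 1))"
  have s1: "s + 1 \<in> S" if "s \<in> S" for s using S(2)[OF that, of 1] by simp
  have intS: "of_int n \<in> S" for n using S(2)[OF \<open>0 \<in> S\<close>, of "of_int n"] by simp
  have hint: "h (of_int n) = h 0" for n
  proof (induction n rule: int_induct[where k=0])
    case (step1 i) then show ?case using h(2)[OF intS[of i]] by simp
  next
    case (step2 i) then show ?case using h(2)[OF intS[of "i - 1"]] by simp
  qed simp
  have dper: "deriv h (s + 1) = deriv h s" if s: "s \<in> S" for s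
  proof -
    have "(h has_field_derivative deriv h (s + 1)) (at (s + 1))"
      using holomorphic_derivI[OF h(1) S(1) s1[OF s]] by simp
    then have "((\<lambda>x. h (x + 1)) has_field_derivative deriv h (s + 1)) (at s)"
      using DERIV_shift by blast
    then have "(h has_field_derivative deriv h (s + 1)) (at s)"
      by (rule has_field_derivative_transform_within_open[OF _ S(1) s]) (simp add: h(2))
    then show ?thesis by (simp add: DERIV_imp_deriv)
  qed
  have cl: "closed (\<int> :: complex set)" by (rule closed_Ints)
  have hol1: "k holomorphic_on (S - \<int>)"
  proof -
    have "(\<lambda>s. (h s - h 0) / (ee s - 1)) holomorphic_on (S - \<int>)"
      by (intro holomorphic_intros holomorphic_on_subset[OF h(1)]) (auto simp: ee_eq_1_iff)
    then show ?thesis by (rule holomorphic_transform) (auto simp: k_def)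
  qed
  have "k holomorphic_on S"
  proof -
    have "k field_differentiable (at z within S)" if z: "z \<in> S" for z
    proof (cases "z \<in> \<int>")
      case False
      then have "k field_differentiable (at z)"
        using hol1 z S(1) cl by (meson DiffI holomorphic_on_imp_differentiable_at open_Diff)
      then show ?thesis using field_differentiable_at_within by blast
    next
      case True
      then obtain n where n: "z = of_int n" by (auto elim: Ints_cases)
      define U where "U = S \<inter> ball z 1"
      have U: "open U" "z \<in> U" using S(1) z by (auto simp: U_def)
      have Uint: "s \<notin> \<int>" if "s \<in> U - {z}" for s
      proof
        assume "s \<in> \<int>"
        then obtain m where m: "s = of_int m" by (auto elim: Ints_cases)
        have "norm (of_int (n - m) :: complex) < 1"
          using that m n by (simp add: U_def dist_norm)
        then have "n = m" unfolding norm_of_int by linarith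
        then show False using that m n by simp
      qed
      have "k holomorphic_on U"
      proof (rule no_isolated_singularity'[OF _ _ U(1), of "{z}"])
        show "k holomorphic_on U - {z}"
          by (rule holomorphic_on_subset[OF hol1]) (use Uint in \<open>auto simp: U_def\<close>)
        fix w assume "w \<in> {z}" then have w: "w = z" by simp
        have d1: "((\<lambda>s. (h s - h z) / (s - z)) \<longlongrightarrow> deriv h z) (at z)"
          using holomorphic_derivI[OF h(1) S(1) z] by (simp add: has_field_derivative_iff)
        have "(ee has_field_derivative (2 * of_real pi * \<i> * 1 * ee z)) (at z)"
          by (rule ee_has_field_derivative) simp
        then have d2: "((\<lambda>s. (ee s - 1) / (s - z)) \<longlongrightarrow> 2 * of_real pi * \<i>) (at z)"
          using n by (simp add: has_field_derivative_iff)
        have "((\<lambda>s. ((h s - h z) / (s - z)) / ((ee s - 1) / (s - z))) \<longlongrightarrow> deriv h z / (2 * of_real pi * \<i>)) (at z)"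
          by (rule tendsto_divide[OF d1 d2]) simp
        moreover have "\<forall>\<^sub>F s in at z. ((h s - h z) / (s - z)) / ((ee s - 1) / (s - z)) = k s"
          unfolding eventually_at_topological
          by (rule exI[of _ U]) (use U Uint hint[of n] n in \<open>auto simp: k_def\<close>)
        ultimately have "(k \<longlongrightarrow> deriv h z / (2 * of_real pi * \<i>)) (at z)"
          by (rule Lim_transform_eventually)
        then have "(k \<longlongrightarrow> k z) (at z)" using True by (simp add: k_def)
        then show "(k \<longlongrightarrow> k w) (at w within U)" using w tendsto_within_subset by blast
      qed simp
      then have "k field_differentiable (at z)" using U holomorphic_on_imp_differentiable_at by blast
      then show ?thesis using field_differentiable_at_within by blast
    qed
    then show ?thesis by (simp add: holomorphic_on_def)
  qed
  moreover have "k (s + 1) = k s" if s: "s \<in> S" for s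
  proof -
    have "s + 1 \<in> \<int> \<longleftrightarrow> s \<in> \<int>" by (metis Ints_1 Ints_add Ints_diff add_diff_cancel_right')
    moreover have "ee (s + 1) = ee s" using ee_of_int[of 1] by (simp add: ee_add del: ee_of_int)
    ultimately show ?thesis using dper[OF s] h(2)[OF s] by (simp add: k_def)
  qed
  moreover have "h s - h 0 = (ee s - 1) * k s" if s: "s \<in> S" for s
    using hint by (cases "s \<in> \<int>") (auto simp: k_def ee_eq_1_iff elim!: Ints_cases)
  ultimately show ?thesis using that by blast
qed

lemma ee_has_integral:
  "((\<lambda>t. ee (of_int n * of_real t)) has_integral (if n = 0 then 1 else 0)) {0..1}"
proof (cases "n = 0")
  case True then show ?thesis using has_integral_const_real[of "1::complex" 0 1] by simp
next
  case False
  let ?F = "\<lambda>t. ee (of_int n * t) / (2 * of_real pi * \<i> * of_int n)"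
  have "((\<lambda>t. ee (of_int n * of_real t)) has_integral ?F (of_real 1) - ?F (of_real 0)) {0..1}"
  proof (rule fundamental_theorem_of_calculus)
    fix t :: real
    have "(?F has_field_derivative ee (of_int n * of_real t)) (at (of_real t))"
      using False by (auto intro!: derivative_eq_intros simp: field_simps)
    then show "((\<lambda>t. ?F (of_real t)) has_vector_derivative ee (of_int n * of_real t)) (at t within {0..1})"
      by (rule has_vector_derivative_real_field)
  qed simp
  then show ?thesis using False ee_of_int[of n] by simp
qed

text \<open>
  Comparing coefficients in \<open>h s - h 0 = (ee s - 1) * k s\<close> shows that, away from frequency 0, the
  coefficients of \<open>h\<close> are the differences of consecutive coefficients of \<open>k\<close>, and the latter tend to 0.
\<close>

lemma circle_coeff_has_sum:
  assumes S: "open S" "convex S" "\<And>s t. s \<in> S \<Longrightarrow> s + of_real t \<in> S"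
    and h: "h holomorphic_on S" "\<And>s. s \<in> S \<Longrightarrow> h (s + 1) = h s" and "0 \<in> S"
  shows "((\<lambda>n. circle_coeff n h) has_sum h 0) UNIV"
proof -
  obtain d where d: "d > 0" "cball 0 d \<subseteq> S" using S(1) \<open>0 \<in> S\<close> open_contains_cball by blast
  have dS: "\<i> * of_real d \<in> S" "- \<i> * of_real d \<in> S"
    using d by (auto intro!: subsetD[OF d(2)] simp: norm_mult)
  have bd: "\<exists>B. \<forall>n. norm (circle_coeff n g) \<le> B * exp (- (2 * pi * d * \<bar>of_int n\<bar>))"
    if g: "g holomorphic_on S" "\<And>s. s \<in> S \<Longrightarrow> g (s + 1) = g s" for g
  proof -
    have c: "continuous_on {0..1} (\<lambda>t. g (s + complex_of_real t))" if "s \<in> S" for s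
      using holomorphic_on_imp_continuous_on[OF g(1)]
      by (rule continuous_on_compose2) (auto intro!: continuous_intros S(3) that)
    have b: "\<exists>B. \<forall>t\<in>{0..1}. norm (g (s + complex_of_real t)) \<le> B" if "s \<in> S" for s
      using compact_imp_bounded[OF compact_continuous_image[OF c[OF that] compact_Icc]]
      by (auto simp: bounded_iff)
    obtain B1 B2 where B: "\<forall>t\<in>{0..1}. norm (g (\<i> * of_real d + of_real t)) \<le> B1"
        "\<forall>t\<in>{0..1}. norm (g (- \<i> * of_real d + of_real t)) \<le> B2"
      using b[OF dS(1)] b[OF dS(2)] by blast
    have "norm (circle_coeff n g) \<le> max B1 B2 * exp (- (2 * pi * d * \<bar>of_int n\<bar>))" for n
      by (rule circle_coeff_bound[OF S g \<open>0 \<in> S\<close> dS]) (use B in \<open>auto simp: le_max_iff_disj\<close>)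
    then show ?thesis by blast
  qed
  obtain B where B: "\<And>n. norm (circle_coeff n h) \<le> B * exp (- (2 * pi * d * \<bar>of_int n\<bar>))"
    using bd[OF h] by blast
  have "(\<lambda>n. B * exp (- (2 * pi * d * \<bar>of_int n\<bar>))) summable_on (UNIV :: int set)"
    using d(1) by (intro summable_on_cmult_right summable_exp_int) simp
  then have "(\<lambda>n. norm (circle_coeff n h)) summable_on UNIV"
    by (rule summable_on_comparison_test) (use B in auto)
  then have sm: "(\<lambda>n. circle_coeff n h) summable_on UNIV" by (rule abs_summable_summable)
  obtain k where k: "k holomorphic_on S" "\<And>s. s \<in> S \<Longrightarrow> k (s + 1) = k s"
    "\<And>s. s \<in> S \<Longrightarrow> h s - h 0 = (ee s - 1) * k s"
    using chernoff_quotient[OF S(1,3) h \<open>0 \<in> S\<close>] by blast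
  obtain B' where B': "\<And>n. norm (circle_coeff n k) \<le> B' * exp (- (2 * pi * d * \<bar>of_int n\<bar>))"
    using bd[OF k(1,2)] by blast
  have realS: "of_real t \<in> S" for t using S(3)[OF \<open>0 \<in> S\<close>, of t] by simp
  have ic: "(\<lambda>t. k (of_real t) * ee (- (of_int n * of_real t))) integrable_on {0..1}" for n
  proof -
    have "continuous_on {0..1} (\<lambda>t. k (complex_of_real t))"
      using holomorphic_on_imp_continuous_on[OF k(1)]
      by (rule continuous_on_compose2) (auto intro!: continuous_intros realS)
    then show ?thesis by (intro integrable_continuous_real continuous_intros)
  qed
  have ch: "((\<lambda>t. ee (- (of_int n * of_real t))) has_integral (if n = 0 then 1 else 0)) {0..1}" for n
    using ee_has_integral[of "- n"] by simp
  \<comment> \<open>Multiplication by \<open>ee s\<close> shifts the frequency by one.\<close>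
  have tel: "circle_coeff n h - (if n = 0 then h 0 else 0) = circle_coeff (n - 1) k - circle_coeff n k" for n
  proof -
    have "circle_coeff (n - 1) k - circle_coeff n k = integral {0..1} (\<lambda>t. k (of_real t) * ee (- (of_int (n - 1) * of_real t))
        - k (of_real t) * ee (- (of_int n * of_real t)))"
      unfolding circle_coeff_def by (rule integral_diff[symmetric]) (rule ic)+
    also have "\<dots> = integral {0..1} (\<lambda>t. h (of_real t) * ee (- (of_int n * of_real t)) - h 0 * ee (- (of_int n * of_real t)))"
    proof (rule integral_cong)
      fix t :: real
      have "ee (- (of_int (n - 1) * of_real t)) = ee (of_real t) * ee (- (of_int n * of_real t))"
        by (simp add: ee_add[symmetric] left_diff_distrib)
      then show "k (of_real t) * ee (- (of_int (n - 1) * of_real t)) - k (of_real t) * ee (- (of_int n * of_real t))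
        = h (of_real t) * ee (- (of_int n * of_real t)) - h 0 * ee (- (of_int n * of_real t))"
        using arg_cong[OF k(3)[OF realS[of t]], of "\<lambda>x. x * ee (- (of_int n * of_real t))"]
        by (simp only: left_diff_distrib right_diff_distrib mult_ac mult_1)
    qed
    also have "\<dots> = circle_coeff n h - integral {0..1} (\<lambda>t. h 0 * ee (- (of_int n * of_real t)))"
    proof -
      have "continuous_on {0..1} (\<lambda>t. h (complex_of_real t))"
        using holomorphic_on_imp_continuous_on[OF h(1)]
        by (rule continuous_on_compose2) (auto intro!: continuous_intros realS)
      then show ?thesis unfolding circle_coeff_def
        by (intro integral_diff integrable_continuous_real continuous_intros) auto
    qed
    also have "integral {0..1} (\<lambda>t. h 0 * ee (- (of_int n * of_real t))) = (if n = 0 then h 0 else 0)"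
      using integral_unique[OF has_integral_mult_right[OF ch[of n], of "h 0"]] by (cases "n = 0") auto
    finally show ?thesis by simp
  qed
  have part: "(\<Sum>n\<in>{- int N..int N}. circle_coeff n h) = h 0 + circle_coeff (- int N - 1) k - circle_coeff (int N) k" for N
  proof -
    have "(\<Sum>n\<in>{- int N..int N}. circle_coeff n h - (if n = 0 then h 0 else 0)) = circle_coeff (- int N - 1) k - circle_coeff (int N) k"
    proof (induction N)
      case 0 then show ?case using tel[of 0] by simp
    next
      case (Suc N)
      have "{- int (Suc N)..int (Suc N)} = insert (int (Suc N)) (insert (- int (Suc N)) {- int N..int N})" by auto
      then have "(\<Sum>n\<in>{- int (Suc N)..int (Suc N)}. circle_coeff n h - (if n = 0 then h 0 else 0))
        = (circle_coeff (int (Suc N)) h - 0) + ((circle_coeff (- int (Suc N)) h - 0) + (circle_coeff (- int N - 1) k - circle_coeff (int N) k))"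
        unfolding Suc[symmetric] by (simp del: of_nat_Suc)
      moreover have "circle_coeff (int (Suc N)) h - 0 = circle_coeff (int N) k - circle_coeff (int (Suc N)) k"
        using tel[of "int (Suc N)"] by simp
      moreover have "circle_coeff (- int (Suc N)) h - 0 = circle_coeff (- int (Suc N) - 1) k - circle_coeff (- int N - 1) k"
      proof -
        have e: "- int N - 1 = - int (Suc N)" by simp
        show ?thesis unfolding e using tel[of "- int (Suc N)"] by (simp del: of_nat_Suc)
      qed
      ultimately show ?case by simp
    qed
    then show ?thesis by (simp add: sum_subtractf algebra_simps)
  qed
  have fclim: "(\<lambda>N. circle_coeff (j N) k) \<longlonglongrightarrow> 0" if "\<And>N. real N \<le> \<bar>of_int (j N)\<bar>" for j
  proof (rule Lim_null_comparison)
    have "B' \<ge> 0" using order_trans[OF norm_ge_zero B'[of 0]] by simp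
    show "\<forall>\<^sub>F N in sequentially. norm (circle_coeff (j N) k) \<le> B' * exp (- (2 * pi * d)) ^ N"
    proof (rule always_eventually, rule allI)
      fix N
      have "exp (- (2 * pi * d * \<bar>of_int (j N)\<bar>)) \<le> exp (- (2 * pi * d)) ^ N"
        using that[of N] d(1) by (simp add: exp_of_nat_mult[symmetric] mult.commute)
      then show "norm (circle_coeff (j N) k) \<le> B' * exp (- (2 * pi * d)) ^ N"
        using B'[of "j N"] \<open>B' \<ge> 0\<close> by (meson mult_left_mono order_trans)
    qed
    have "(\<lambda>N. exp (- (2 * pi * d)) ^ N) \<longlonglongrightarrow> 0" using d(1) by (intro LIMSEQ_power_zero) simp
    then show "(\<lambda>N. B' * exp (- (2 * pi * d)) ^ N) \<longlonglongrightarrow> 0" using tendsto_mult_right_zero by blast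
  qed
  have l1: "(\<lambda>N. \<Sum>n\<in>{- int N..int N}. circle_coeff n h) \<longlonglongrightarrow> h 0 + 0 - 0"
    unfolding part by (intro tendsto_intros fclim) auto
  have fl: "filterlim (\<lambda>N. {- int N..int N}) (finite_subsets_at_top UNIV) sequentially"
    unfolding filterlim_def le_filter_def eventually_finite_subsets_at_top eventually_filtermap
  proof (intro allI impI, elim exE conjE)
    fix P X assume X: "finite X" "X \<subseteq> (UNIV :: int set)" "\<forall>Y. finite Y \<and> X \<subseteq> Y \<and> Y \<subseteq> UNIV \<longrightarrow> P Y"
    define M where "M = Max (abs ` X)"
    have M: "\<forall>x\<in>X. \<bar>x\<bar> \<le> M" using X(1) by (auto simp: M_def)
    have "P {- int N..int N}" if "N \<ge> nat M" for N
    proof -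
      have "X \<subseteq> {- int N..int N}"
      proof
        fix x assume "x \<in> X"
        then have "\<bar>x\<bar> \<le> M" using M by blast
        then show "x \<in> {- int N..int N}" using that by auto
      qed
      then show ?thesis using X(3) by auto
    qed
    then show "\<forall>\<^sub>F N in sequentially. P {- int N..int N}" by (rule eventually_sequentiallyI)
  qed
  have l2: "(\<lambda>N. \<Sum>n\<in>{- int N..int N}. circle_coeff n h) \<longlonglongrightarrow> infsum (\<lambda>n. circle_coeff n h) UNIV"
    using filterlim_compose[OF has_sum_infsum[OF sm, unfolded has_sum_def] fl] .
  have "infsum (\<lambda>n. circle_coeff n h) UNIV = h 0" using LIMSEQ_unique[OF l1 l2] by simp
  then show ?thesis using has_sum_infsum[OF sm] by simp
qed

section \<open>Fourier series on tube domains\<close>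

text \<open>
  Cauchy's formula for the integrand, integrated over the parameter, represents the integral as a Cauchy
  integral of a continuous function on a circle.
\<close>

lemma holomorphic_integral_param:
  fixes f :: "complex \<Rightarrow> real \<Rightarrow> complex"
  assumes U: "open U" and cont: "continuous_on (U \<times> {0..1}) (\<lambda>(s, t). f s t)"
    and hol: "\<And>t. t \<in> {0..1} \<Longrightarrow> (\<lambda>s. f s t) holomorphic_on U"
  shows "(\<lambda>s. integral {0..1} (f s)) holomorphic_on U"
proof -
  define G where "G s = integral {0..1} (f s)" for s
  have contG: "continuous_on U G"
    unfolding G_def using integral_continuous_on_param[of U 0 1 f] cont by simp
  have "G field_differentiable (at z)" if z: "z \<in> U" for z
  proof -
    obtain r where r: "r > 0" "cball z r \<subseteq> U" using U z open_contains_cball by blast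
    have pimg: "path_image (circlepath z r) \<subseteq> U" using r by (auto simp: sphere_def)
    have key: "((\<lambda>u. G u / (u - w) ^ 1) has_contour_integral (2 * of_real pi * \<i> * G w)) (circlepath z r)"
      if w: "w \<in> ball z r" for w
    proof -
      define F where "F = (\<lambda>u v. f u (Re v) / (u - w))"
      have nw: "u \<noteq> w" if "u \<in> path_image (circlepath z r)" for u
        using that w r(1) by (auto simp: dist_norm)
      have cF: "continuous_on (path_image (circlepath z r) \<times> path_image (linepath 0 1)) (\<lambda>(u, v). F u v)"
      proof -
        have "continuous_on (path_image (circlepath z r) \<times> path_image (linepath 0 1)) (\<lambda>p. (fst p, Re (snd p)))"
          by (intro continuous_intros)
        moreover have "(\<lambda>p. (fst p, Re (snd p))) ` (path_image (circlepath z r) \<times> path_image (linepath 0 1)) \<subseteq> U \<times> {0..1}"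
          using pimg by (auto simp: linepath_def path_image_def)
        ultimately have "continuous_on (path_image (circlepath z r) \<times> path_image (linepath 0 1)) (\<lambda>p. (\<lambda>(s, t). f s t) (fst p, Re (snd p)))"
          by (rule continuous_on_compose2[OF cont])
        then have "continuous_on (path_image (circlepath z r) \<times> path_image (linepath 0 1)) (\<lambda>p. f (fst p) (Re (snd p)))"
          by simp
        then show ?thesis unfolding F_def split_beta
          by (intro continuous_intros) (use nw in auto)
      qed
      have sw: "contour_integral (circlepath z r) (\<lambda>u. contour_integral (linepath 0 1) (F u)) =
          contour_integral (linepath 0 1) (\<lambda>v. contour_integral (circlepath z r) (\<lambda>u. F u v))"
        by (rule contour_integral_swap[OF cF])
           (auto simp: vector_derivative_circlepath vector_derivative_linepath_at intro!: continuous_intros)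
      have lp: "contour_integral (linepath 0 1) g = integral {0..1} (\<lambda>t. g (of_real t))" for g
        by (simp add: contour_integral_integral vector_derivative_linepath_at linepath_def scaleR_conv_of_real)
      have "contour_integral (linepath 0 1) (F u) = G u / (u - w)" for u
        by (simp add: lp F_def G_def)
      moreover have "contour_integral (linepath 0 1) (\<lambda>v. contour_integral (circlepath z r) (\<lambda>u. F u v))
         = 2 * of_real pi * \<i> * G w"
      proof -
        have "contour_integral (circlepath z r) (\<lambda>u. F u (of_real t)) = 2 * of_real pi * \<i> * f w t"
          if t: "t \<in> {0..1}" for t
        proof -
          have "((\<lambda>u. f u t / (u - w)) has_contour_integral (2 * of_real pi * \<i> * f w t)) (circlepath z r)"
            using Cauchy_integral_circlepath_simple[of "\<lambda>s. f s t" z r w]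
              holomorphic_on_subset[OF hol[OF t] r(2)] w by (simp add: dist_norm norm_minus_commute)
          then show ?thesis by (simp add: F_def contour_integral_unique)
        qed
        then have "integral {0..1} (\<lambda>t. contour_integral (circlepath z r) (\<lambda>u. F u (of_real t)))
          = integral {0..1} (\<lambda>t. 2 * of_real pi * \<i> * f w t)"
          by (intro integral_cong) auto
        then show ?thesis by (simp add: lp G_def)
      qed
      moreover have "(\<lambda>u. G u / (u - w)) contour_integrable_on (circlepath z r)"
        by (rule contour_integrable_continuous_circlepath)
           (intro continuous_intros continuous_on_subset[OF contG pimg], use nw in auto)
      ultimately show ?thesis
        using has_contour_integral_integral[of "\<lambda>u. G u / (u - w)" "circlepath z r"] sw by simp
    qed
    have "(((\<lambda>w. 2 * of_real pi * \<i> * G w)) has_field_derivative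
        (of_nat 1 * contour_integral (circlepath z r) (\<lambda>u. G u / (u - z) ^ Suc 1))) (at z)"
      by (rule Cauchy_next_derivative_circlepath(2)[OF continuous_on_subset[OF contG pimg] key])
         (use r in auto)
    then have "((\<lambda>w. (1 / (2 * of_real pi * \<i>)) * (2 * of_real pi * \<i> * G w)) has_field_derivative
       (1 / (2 * of_real pi * \<i>)) * (of_nat 1 * contour_integral (circlepath z r) (\<lambda>u. G u / (u - z) ^ Suc 1))) (at z)"
      by (rule DERIV_cmult)
    then show ?thesis unfolding field_differentiable_def by auto
  qed
  then show ?thesis unfolding G_def[symmetric]
    by (simp add: holomorphic_on_def field_differentiable_at_within)
qed

definition mode :: "complex^'N \<Rightarrow> int \<Rightarrow> (complex^'N \<Rightarrow> complex) \<Rightarrow> complex^'N \<Rightarrow> complex" where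
  "mode b n g Z = integral {0..1} (\<lambda>t. g (Z + of_real t *s b) * ee (- (of_int n * of_real t)))"

text \<open>
  The repeated mode is the coefficient for the lattice spanned by \<open>bs\<close>.  It takes one mode at a time,
  so that the several-variable theory reduces to a strip.
\<close>

fun modes :: "(complex^'N) list \<Rightarrow> int list \<Rightarrow> (complex^'N \<Rightarrow> complex) \<Rightarrow> complex^'N \<Rightarrow> complex" where
  "modes (b # bs) (n # ns) g = modes bs ns (mode b n g)"
| "modes _ _ g = g"

lemma mode_eq_circle_coeff: "mode b n g Z = circle_coeff n (\<lambda>s. g (Z + s *s b))"
  by (simp add: mode_def circle_coeff_def)

lemma continuous_on_vec_scale:
  fixes f :: "'a::topological_space \<Rightarrow> complex" and v :: "'a \<Rightarrow> complex^'N"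
  assumes "continuous_on S f" "continuous_on S v"
  shows "continuous_on S (\<lambda>x. f x *s v x)"
  unfolding vector_scalar_mult_def
  by (intro continuous_on_vec_lambda continuous_intros assms)

text \<open>
  An absolutely convergent exponential series may be integrated term by term, and only the terms of
  frequency \<open>n\<close> along \<open>b\<close> survive.  Thus the mode is the sum of these terms.
\<close>

lemma mode_has_sum:
  fixes c :: "'l \<Rightarrow> complex" and k :: "'l \<Rightarrow> int"
  assumes "\<And>t. t \<in> {0..1} \<Longrightarrow> ((\<lambda>l. c l * ee (of_int (k l) * of_real t)) has_sum g (Z + of_real t *s b)) A"
  shows "(c has_sum mode b n g Z) {l \<in> A. k l = n}"
proof -
  have "(c has_sum g Z) A" using assms[of 0] by simp
  then have "c summable_on A" by (rule has_sum_imp_summable)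
  then have sm: "(\<lambda>l. norm (c l)) summable_on A" using summable_on_iff_abs_summable_on_complex by blast
  let ?f = "\<lambda>l t. c l * ee (of_int (k l) * of_real t) * ee (- (of_int n * of_real t))"
  have ul: "uniform_limit {0..1} (\<lambda>X t. \<Sum>l\<in>X. ?f l t)
     (\<lambda>t. g (Z + of_real t *s b) * ee (- (of_int n * of_real t))) (finite_subsets_at_top A)"
  proof (rule Weierstrass_m_test_general'[OF _ _ sm])
    show "norm (?f l t) \<le> norm (c l)" for l t by (simp add: norm_mult norm_ee)
    show "((\<lambda>l. ?f l t) has_sum g (Z + of_real t *s b) * ee (- (of_int n * of_real t))) A" if "t \<in> {0..1}" for t
      using assms[OF that] by (rule has_sum_cmult_left)
  qed
  obtain I J where IJ: "\<And>X. ((\<lambda>t. \<Sum>l\<in>X. ?f l t) has_integral I X) {0..1}"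
      "((\<lambda>t. g (Z + of_real t *s b) * ee (- (of_int n * of_real t))) has_integral J) {0..1}"
      "(I \<longlongrightarrow> J) (finite_subsets_at_top A)"
    by (rule uniform_limit_integral[OF ul]) (auto intro!: continuous_intros)
  have J: "J = mode b n g Z" using integral_unique[OF IJ(2)] by (simp add: mode_def)
  have ch: "((\<lambda>t. c l * (ee (of_int (k l - n) * of_real t))) has_integral c l * (if k l = n then 1 else 0)) {0..1}" for l
    using ee_has_integral[of "k l - n"] by (intro has_integral_mult_right) simp
  have I: "I X = (\<Sum>l\<in>X. if k l = n then c l else 0)" if "finite X" for X
  proof -
    have "((\<lambda>t. \<Sum>l\<in>X. c l * ee (of_int (k l - n) * of_real t)) has_integral (\<Sum>l\<in>X. c l * (if k l = n then 1 else 0))) {0..1}"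
      by (intro has_integral_sum that ch)
    moreover have "?f l t = c l * ee (of_int (k l - n) * of_real t)" for l t
      by (simp add: ee_add[symmetric] left_diff_distrib mult.assoc)
    ultimately have "((\<lambda>t. \<Sum>l\<in>X. ?f l t) has_integral (\<Sum>l\<in>X. c l * (if k l = n then 1 else 0))) {0..1}"
      by (simp only:)
    from has_integral_unique[OF IJ(1) this] show ?thesis by (simp add: if_distrib cong: if_cong)
  qed
  have "((\<lambda>X. \<Sum>l\<in>X. if k l = n then c l else 0) \<longlongrightarrow> J) (finite_subsets_at_top A)"
    by (rule Lim_transform_eventually[OF IJ(3)])
       (use I in \<open>auto simp: eventually_finite_subsets_at_top\<close>)
  then have "((\<lambda>l. if k l = n then c l else 0) has_sum mode b n g Z) A" by (simp add: has_sum_def J)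
  then show ?thesis
    by (rule has_sum_cong_neutral[THEN iffD1, rotated 3]) auto
qed

lemma modes_has_sum_extract:
  fixes c :: "'l \<Rightarrow> complex" and k :: "complex^'N \<Rightarrow> 'l \<Rightarrow> int"
  assumes "\<And>ts. length ts = length bs \<Longrightarrow>
      ((\<lambda>l. c l * ee (\<Sum>(t, b)\<leftarrow>zip ts bs. of_int (k b l) * of_real t)) has_sum
         g (Z + (\<Sum>(t, b)\<leftarrow>zip ts bs. of_real t *s b))) A"
    and "length ns = length bs"
  shows "(c has_sum modes bs ns g Z) {l \<in> A. map (\<lambda>b. k b l) bs = ns}"
  using assms
proof (induction bs arbitrary: g A ns)
  case Nil then show ?case using Nil.prems(1)[of "[]"] by simp
next
  case (Cons b bs)
  obtain n ns' where ns: "ns = n # ns'" "length ns' = length bs"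
    using Cons.prems(2) by (cases ns) auto
  have "(c has_sum modes bs ns' (mode b n g) Z) {l \<in> {l\<in>A. k b l = n}. map (\<lambda>b. k b l) bs = ns'}"
  proof (rule Cons.IH)
    fix ts :: "real list" assume ts: "length ts = length bs"
    let ?S = "\<Sum>(t, b)\<leftarrow>zip ts bs. of_real t *s b" and ?E = "\<lambda>l. \<Sum>(t, b)\<leftarrow>zip ts bs. of_int (k b l) * of_real t"
    show "((\<lambda>l. c l * ee (?E l)) has_sum mode b n g (Z + ?S)) {l \<in> A. k b l = n}"
    proof (rule mode_has_sum)
      fix t :: real
      have "((\<lambda>l. c l * ee (of_int (k b l) * of_real t + ?E l)) has_sum g (Z + (of_real t *s b + ?S))) A"
        using Cons.prems(1)[of "t # ts"] ts by simp
      then show "((\<lambda>l. c l * ee (?E l) * ee (of_int (k b l) * of_real t)) has_sum g (Z + ?S + of_real t *s b)) A"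
        by (simp add: ee_add mult_ac add_ac)
    qed
  qed (use ns in simp)
  moreover have "{l \<in> {l\<in>A. k b l = n}. map (\<lambda>b. k b l) bs = ns'} = {l \<in> A. map (\<lambda>b. k b l) (b # bs) = ns}"
    using ns by auto
  ultimately show ?case using ns by simp
qed

text \<open>
  A tube \<open>T\<close> over a convex open cone in the real space \<open>W\<close>, seen through its complex lines in real directions:
  these meet \<open>T\<close> in horizontal strips.
\<close>

locale tube =
  fixes T W :: "(complex^'N) set"
  assumes W0: "0 \<in> W"
    and W_add: "\<And>x y. x \<in> W \<Longrightarrow> y \<in> W \<Longrightarrow> x + y \<in> W"
    and W_scale: "\<And>r x. x \<in> W \<Longrightarrow> of_real r *s x \<in> W"
    and T_real: "\<And>Z x. Z \<in> T \<Longrightarrow> x \<in> W \<Longrightarrow> Z + x \<in> T"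
    and T_open: "\<And>Z. Z \<in> T \<Longrightarrow> \<exists>\<delta>>0. \<forall>y\<in>W. norm y < \<delta> \<longrightarrow> Z + \<i> *s y \<in> T"
    and T_convex: "\<And>Z b. Z \<in> T \<Longrightarrow> b \<in> W \<Longrightarrow> convex {s. Z + s *s b \<in> T}"
    and T_diff: "\<And>Z Z'. Z \<in> T \<Longrightarrow> Z' \<in> T \<Longrightarrow> \<exists>x\<in>W. \<exists>y\<in>W. Z' = Z + x + \<i> *s y"
begin

text \<open>
  Holomorphy along the lines in real directions, together with continuity, is what Fourier
  expansion in one variable at a time needs, and it passes to modes.
\<close>

definition hol :: "(complex^'N \<Rightarrow> complex) \<Rightarrow> bool" where
  "hol g \<longleftrightarrow> continuous_on T g \<and>
     (\<forall>Z\<in>T. \<forall>b\<in>W. (\<lambda>s. g (Z + s *s b)) holomorphic_on {s. Z + s *s b \<in> T})"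

lemma norm_of_real_vector_scale: "norm (of_real r *s (x :: complex^'N)) = \<bar>r\<bar> * norm x"
proof -
  have "of_real r *s x = r *\<^sub>R x" by (simp add: vec_eq_iff) (simp add: scaleR_conv_of_real)
  then show ?thesis by simp
qed

lemma strip_real: "Z + s *s b \<in> T \<Longrightarrow> b \<in> W \<Longrightarrow> Z + (s + of_real t) *s b \<in> T"
  using T_real[of "Z + s *s b" "of_real t *s b"] W_scale by (simp add: vec.scale_left_distrib add.assoc)

lemma strip_real': "Z + s *s b \<in> T \<Longrightarrow> b \<in> W \<Longrightarrow> Z + (s *s b + of_real t *s b) \<in> T"
  using strip_real[of Z s b t] by (simp add: vec.scale_left_distrib)

lemma T_real_scale: "Z \<in> T \<Longrightarrow> b \<in> W \<Longrightarrow> Z + of_real t *s b \<in> T"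
  using T_real W_scale by blast

lemma strip_open:
  assumes "b \<in> W" shows "open {s. Z + s *s b \<in> T}"
  unfolding open_dist
proof (intro ballI)
  fix s assume "s \<in> {s. Z + s *s b \<in> T}"
  then obtain d where d: "d > 0" "\<And>y. y \<in> W \<Longrightarrow> norm y < d \<Longrightarrow> Z + s *s b + \<i> *s y \<in> T"
    using T_open[of "Z + s *s b"] by auto
  have "Z + s' *s b \<in> T" if "dist s' s < d / (norm b + 1)" for s'
  proof -
    have "\<bar>Im (s' - s)\<bar> * norm b \<le> norm (s' - s) * (norm b + 1)"
      by (intro mult_mono abs_Im_le_cmod) auto
    also have "\<dots> < d" using that by (simp add: dist_norm pos_less_divide_eq add_nonneg_pos)
    finally have "Z + s *s b + \<i> *s (of_real (Im (s' - s)) *s b) \<in> T"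
      by (intro d(2) W_scale assms) (simp only: norm_of_real_vector_scale)
    then have "Z + s *s b + \<i> *s (of_real (Im (s' - s)) *s b) + of_real (Re (s' - s)) *s b \<in> T"
      by (rule T_real[OF _ W_scale[OF assms]])
    moreover have "Z + s *s b + \<i> *s (of_real (Im (s' - s)) *s b) + of_real (Re (s' - s)) *s b = Z + s' *s b"
      by (simp add: vec_eq_iff complex_eq_iff algebra_simps)
    ultimately show ?thesis by (simp only:)
  qed
  moreover have "d / (norm b + 1) > 0" using d(1) by (intro divide_pos_pos add_nonneg_pos) auto
  ultimately show "\<exists>e>0. \<forall>s'. dist s' s < e \<longrightarrow> s' \<in> {s. Z + s *s b \<in> T}" by blast
qed

lemma hol_line: "hol g \<Longrightarrow> Z \<in> T \<Longrightarrow> b \<in> W \<Longrightarrow> (\<lambda>s. g (Z + s *s b)) holomorphic_on {s. Z + s *s b \<in> T}"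
  by (simp add: hol_def)

lemma hol_cont: "hol g \<Longrightarrow> continuous_on T g"
  by (simp add: hol_def)

lemma mode_hol:
  assumes g: "hol g" and b: "b \<in> W" shows "hol (mode b n g)"
  unfolding hol_def
proof (intro conjI ballI)
  have c: "continuous_on (T \<times> {0..1}) (\<lambda>(Z, t). g (Z + of_real t *s b) * ee (- (of_int n * of_real t)))"
    unfolding split_beta
    by (intro continuous_intros continuous_on_compose2[OF hol_cont[OF g]] continuous_on_vec_scale)
       (auto intro!: T_real W_scale b)
  show "continuous_on T (mode b n g)"
    unfolding mode_def using integral_continuous_on_param[of T 0 1 "\<lambda>Z t. g (Z + of_real t *s b) * ee (- (of_int n * of_real t))"] c by simp
next
  fix Z c assume Z: "Z \<in> T" and c: "c \<in> W"
  show "(\<lambda>s. mode b n g (Z + s *s c)) holomorphic_on {s. Z + s *s c \<in> T}"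
    unfolding mode_def
  proof (rule holomorphic_integral_param[OF strip_open[OF c]])
    show "continuous_on ({s. Z + s *s c \<in> T} \<times> {0..1}) (\<lambda>(s, t). g (Z + s *s c + of_real t *s b) * ee (- (of_int n * of_real t)))"
      unfolding split_beta
      by (intro continuous_intros continuous_on_compose2[OF hol_cont[OF g]] continuous_on_vec_scale)
         (auto intro!: T_real_scale b)
    fix t :: real
    have "Z + of_real t *s b + s *s c = Z + s *s c + of_real t *s b" for s by simp
    moreover have "{s. Z + s *s c \<in> T} \<subseteq> {s. Z + of_real t *s b + s *s c \<in> T}"
      using T_real W_scale[OF b, of t] by (auto simp: calculation)
    ultimately show "(\<lambda>s. g (Z + s *s c + of_real t *s b) * ee (- (of_int n * of_real t))) holomorphic_on {s. Z + s *s c \<in> T}"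
      using holomorphic_on_subset[OF hol_line[OF g T_real[OF Z W_scale[OF b, of t]] c]]
      by (intro holomorphic_intros) (auto simp: add.commute add.left_commute)
  qed
qed

lemma mode_translate:
  assumes "\<And>Z. Z \<in> T \<Longrightarrow> g (Z + b') = g Z" "b' \<in> W" "b \<in> W" "Z \<in> T"
  shows "mode b n g (Z + b') = mode b n g Z"
proof -
  have "g (Z + b' + of_real t *s b) = g (Z + of_real t *s b)" for t
    using assms(1)[OF T_real[OF assms(4) W_scale[OF assms(3), of t]]] by (simp add: ac_simps)
  then show ?thesis by (simp add: mode_def)
qed

lemma mode_shift:
  assumes g: "hol g" "\<And>Z. Z \<in> T \<Longrightarrow> g (Z + b) = g Z" and b: "b \<in> W" and Z: "Z \<in> T" "Z + s *s b \<in> T"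
  shows "mode b n g (Z + s *s b) = ee (of_int n * s) * mode b n g Z"
proof -
  let ?S = "{s. Z + s *s b \<in> T}"
  have "integral {0..1} (\<lambda>t. g (Z + (s + of_real t) *s b) * ee (- (of_int n * of_real t)))
      = ee (of_int n * s) * circle_coeff n (\<lambda>s. g (Z + s *s b))"
  proof (rule circle_coeff_shift[where S = ?S])
    show "g (Z + (s + 1) *s b) = g (Z + s *s b)" if "s \<in> ?S" for s
      using g(2)[of "Z + s *s b"] that by (simp add: vec.scale_left_distrib add.assoc)
  qed (use Z b g(1) in \<open>auto intro: strip_open T_convex strip_real' hol_line\<close>)
  then show ?thesis by (simp add: mode_eq_circle_coeff[symmetric] mode_def vec.scale_left_distrib add.assoc)
qed

lemma mode_quasi_periodic:
  assumes "\<And>Z s. Z \<in> T \<Longrightarrow> Z + s *s b' \<in> T \<Longrightarrow> g (Z + s *s b') = ee (c * s) * g Z"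
    and "b' \<in> W" "b \<in> W" "Z \<in> T" "Z + s *s b' \<in> T"
  shows "mode b n g (Z + s *s b') = ee (c * s) * mode b n g Z"
proof -
  have "g (Z + s *s b' + of_real t *s b) = ee (c * s) * g (Z + of_real t *s b)" for t
    using assms(1)[OF T_real[OF assms(4) W_scale[OF assms(3), of t]], of s]
      T_real[OF assms(5) W_scale[OF assms(3), of t]] by (simp add: ac_simps)
  then show ?thesis by (simp add: mode_def mult.assoc)
qed

lemma mode_has_sum_int:
  assumes g: "hol g" "\<And>Z. Z \<in> T \<Longrightarrow> g (Z + b) = g Z" and b: "b \<in> W" and Z: "Z \<in> T"
  shows "((\<lambda>n. mode b n g Z) has_sum g Z) UNIV"
proof -
  let ?S = "{s. Z + s *s b \<in> T}"
  have "((\<lambda>n. circle_coeff n (\<lambda>s. g (Z + s *s b))) has_sum g (Z + 0 *s b)) UNIV"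
  proof (rule circle_coeff_has_sum[where S = ?S])
    show "g (Z + (s + 1) *s b) = g (Z + s *s b)" if "s \<in> ?S" for s
      using g(2)[of "Z + s *s b"] that by (simp add: vec.scale_left_distrib add.assoc)
  qed (use Z b g(1) in \<open>auto intro: strip_open T_convex strip_real' hol_line\<close>)
  then show ?thesis by (simp add: mode_eq_circle_coeff)
qed

lemma mode_bound:
  assumes g: "hol g" "\<And>Z. Z \<in> T \<Longrightarrow> g (Z + b) = g Z" and b: "b \<in> W" and Z: "Z \<in> T"
    and T: "Z + (\<i> * of_real \<epsilon>) *s b \<in> T" "Z + (- \<i> * of_real \<epsilon>) *s b \<in> T"
    and B: "\<And>s. Re s \<in> {0..1} \<Longrightarrow> \<bar>Im s\<bar> \<le> \<bar>\<epsilon>\<bar> \<Longrightarrow> norm (g (Z + s *s b)) \<le> B"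
  shows "norm (mode b n g Z) \<le> B * exp (- (2 * pi * \<epsilon> * \<bar>of_int n\<bar>))"
proof -
  let ?S = "{s. Z + s *s b \<in> T}"
  show ?thesis unfolding mode_eq_circle_coeff
  proof (rule circle_coeff_bound[where S = ?S])
    show "g (Z + (s + 1) *s b) = g (Z + s *s b)" if "s \<in> ?S" for s
      using g(2)[of "Z + s *s b"] that by (simp add: vec.scale_left_distrib add.assoc)
    show "norm (g (Z + (\<i> * of_real \<epsilon> + of_real t) *s b)) \<le> B" if "t \<in> {0..1}" for t
      by (rule B) (use that in auto)
    show "norm (g (Z + (- \<i> * of_real \<epsilon> + of_real t) *s b)) \<le> B" if "t \<in> {0..1}" for t
      by (rule B) (use that in auto)
    show "convex ?S" by (rule T_convex[OF Z b])
    show "open ?S" by (rule strip_open[OF b])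
    show "(\<lambda>s. g (Z + s *s b)) holomorphic_on ?S" by (rule hol_line[OF g(1) Z b])
    show "s + of_real t \<in> ?S" if "s \<in> ?S" for s t using strip_real b that by blast
  qed (use Z T in auto)
qed

text \<open>
  A compact set that contains all the paths to which the successive Fourier integrals are moved.
\<close>

fun polystrip :: "real \<Rightarrow> complex^'N \<Rightarrow> (complex^'N) list \<Rightarrow> (complex^'N) set" where
  "polystrip \<epsilon> Z [] = {Z}"
| "polystrip \<epsilon> Z (b # bs) = (\<lambda>(s, x). x + s *s b) ` (cbox (Complex 0 (- \<epsilon>)) (Complex 1 \<epsilon>) \<times> polystrip \<epsilon> Z bs)"

lemma compact_polystrip: "compact (polystrip \<epsilon> Z bs)"
proof (induction bs)
  case (Cons b bs)
  have "continuous_on (cbox (Complex 0 (- \<epsilon>)) (Complex 1 \<epsilon>) \<times> polystrip \<epsilon> Z bs) (\<lambda>(s, x). x + s *s b)"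
    unfolding split_beta by (intro continuous_intros continuous_on_vec_scale)
  then show ?case using Cons by (simp only: polystrip.simps) (intro compact_continuous_image compact_Times compact_cbox)
qed simp

lemma in_cbox_Complex: "s \<in> cbox (Complex a c) (Complex b d) \<longleftrightarrow> Re s \<in> {a..b} \<and> Im s \<in> {c..d}"
  by (auto simp: in_cbox_complex_iff)

lemma polystrip_rep:
  assumes "set bs \<subseteq> W" "z \<in> polystrip \<epsilon> Z bs" "\<epsilon> \<ge> 0"
  shows "\<exists>x\<in>W. \<exists>y\<in>W. z = Z + x + \<i> *s y \<and> norm y \<le> \<epsilon> * (\<Sum>b\<leftarrow>bs. norm b)"
  using assms(1,2)
proof (induction bs arbitrary: z)
  case Nil
  then show ?case using W0 by (auto intro!: bexI[of _ 0])
next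
  case (Cons b bs)
  then obtain s z' where z: "z = z' + s *s b" "z' \<in> polystrip \<epsilon> Z bs" "Im s \<in> {-\<epsilon>..\<epsilon>}"
    by (auto simp: in_cbox_Complex)
  obtain x y where xy: "x \<in> W" "y \<in> W" "z' = Z + x + \<i> *s y" "norm y \<le> \<epsilon> * (\<Sum>b\<leftarrow>bs. norm b)"
    using Cons.IH[OF _ z(2)] Cons.prems(1) by auto
  have b: "b \<in> W" using Cons.prems by auto
  have "norm (y + of_real (Im s) *s b) \<le> norm y + \<bar>Im s\<bar> * norm b"
    using norm_triangle_ineq[of y "of_real (Im s) *s b"] by (simp only: norm_of_real_vector_scale)
  also have "\<dots> \<le> \<epsilon> * (\<Sum>b\<leftarrow>bs. norm b) + \<epsilon> * norm b"
    using xy(4) z(3) by (intro add_mono mult_right_mono) auto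
  finally have "norm (y + of_real (Im s) *s b) \<le> \<epsilon> * (\<Sum>b\<leftarrow>b # bs. norm b)" by (simp add: algebra_simps)
  moreover have "z = Z + (x + of_real (Re s) *s b) + \<i> *s (y + of_real (Im s) *s b)"
    unfolding z(1) xy(3) by (simp add: vec_eq_iff complex_eq_iff algebra_simps)
  ultimately show ?case using W_add[OF xy(1) W_scale[OF b]] W_add[OF xy(2) W_scale[OF b]] by blast
qed

lemma polystrip_subset:
  assumes "Z \<in> T" "set bs \<subseteq> W"
  obtains \<epsilon> where "\<epsilon> > 0" "polystrip \<epsilon> Z bs \<subseteq> T"
proof -
  obtain d where d: "d > 0" "\<And>y. y \<in> W \<Longrightarrow> norm y < d \<Longrightarrow> Z + \<i> *s y \<in> T"
    using T_open[OF assms(1)] by auto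
  define N where "N = (\<Sum>b\<leftarrow>bs. norm b)"
  have N: "N \<ge> 0" unfolding N_def by (induction bs) auto
  define \<epsilon> where "\<epsilon> = d / (N + 1)"
  have e: "\<epsilon> > 0" using d(1) N by (simp add: \<epsilon>_def add_nonneg_pos)
  have "\<epsilon> * N < d" using d(1) N by (simp add: \<epsilon>_def pos_divide_less_eq add_nonneg_pos)
  have "z \<in> T" if "z \<in> polystrip \<epsilon> Z bs" for z
  proof -
    have "\<exists>x\<in>W. \<exists>y\<in>W. z = Z + x + \<i> *s y \<and> norm y \<le> \<epsilon> * N"
      using polystrip_rep[OF assms(2) that] e unfolding N_def[symmetric] by simp
    then obtain x y where xy: "x \<in> W" "y \<in> W" "z = Z + x + \<i> *s y" "norm y \<le> \<epsilon> * N" by blast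
    then have "Z + \<i> *s y + x \<in> T" using \<open>\<epsilon> * N < d\<close> T_real[OF d(2)[OF xy(2)] xy(1)] by simp
    then show ?thesis using xy(3) by (simp add: ac_simps)
  qed
  then show ?thesis using that e by blast
qed

text \<open>
  Every mode in turn contributes its factor of exponential decay, by moving the path within the polystrip.
\<close>

lemma modes_bound:
  assumes "hol g" "\<And>Z b. Z \<in> T \<Longrightarrow> b \<in> set bs \<Longrightarrow> g (Z + b) = g Z" "set bs \<subseteq> W"
    and "polystrip \<epsilon> Z bs \<subseteq> T" "\<epsilon> \<ge> 0" "\<And>z. z \<in> polystrip \<epsilon> Z bs \<Longrightarrow> norm (g z) \<le> B"
    and "length ns = length bs"
  shows "norm (modes bs ns g Z) \<le> B * exp (- (2 * pi * \<epsilon> * (\<Sum>n\<leftarrow>ns. \<bar>of_int n\<bar>)))"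
  using assms
proof (induction bs arbitrary: g B ns)
  case Nil then show ?case by simp
next
  case (Cons b bs)
  obtain n ns' where ns: "ns = n # ns'" "length ns' = length bs" using Cons.prems(7) by (cases ns) auto
  have b: "b \<in> W" using Cons.prems by auto
  have mem: "z + s *s b \<in> polystrip \<epsilon> Z (b # bs)" if "z \<in> polystrip \<epsilon> Z bs" "Re s \<in> {0..1}" "\<bar>Im s\<bar> \<le> \<epsilon>" for z s
    unfolding polystrip.simps
    by (rule image_eqI[where x = "(s, z)"]) (use that in \<open>auto simp: in_cbox_Complex\<close>)
  have sub: "polystrip \<epsilon> Z bs \<subseteq> T"
  proof
    fix z assume "z \<in> polystrip \<epsilon> Z bs"
    then have "z + 0 *s b \<in> polystrip \<epsilon> Z (b # bs)" using Cons.prems(5) by (intro mem) auto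
    then show "z \<in> T" using Cons.prems(4) by auto
  qed
  have "norm (modes bs ns' (mode b n g) Z) \<le>
    (B * exp (- (2 * pi * \<epsilon> * \<bar>of_int n\<bar>))) * exp (- (2 * pi * \<epsilon> * (\<Sum>n\<leftarrow>ns'. \<bar>of_int n\<bar>)))"
  proof (rule Cons.IH)
    show "hol (mode b n g)" by (rule mode_hol[OF Cons.prems(1) b])
    show "mode b n g (Z + b') = mode b n g Z" if "Z \<in> T" "b' \<in> set bs" for Z b'
      by (rule mode_translate) (use Cons.prems that b in auto)
    show "norm (mode b n g z) \<le> B * exp (- (2 * pi * \<epsilon> * \<bar>of_int n\<bar>))" if z: "z \<in> polystrip \<epsilon> Z bs" for z
    proof (rule mode_bound)
      show "norm (g (z + s *s b)) \<le> B" if "Re s \<in> {0..1}" "\<bar>Im s\<bar> \<le> \<bar>\<epsilon>\<bar>" for s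
        using Cons.prems(5,6) mem[OF z] that by simp
      show "z + (\<i> * of_real \<epsilon>) *s b \<in> T" "z + (- \<i> * of_real \<epsilon>) *s b \<in> T"
        using Cons.prems(5) by (auto intro!: subsetD[OF Cons.prems(4)] mem[OF z] simp del: polystrip.simps vec.scale_minus_left mult_minus_left)
    qed (use Cons.prems b sub z in auto)
  qed (use Cons.prems ns sub in auto)
  then show ?case using ns by (simp add: exp_add[symmetric] algebra_simps)
qed

lemma summable_exp_int_list:
  fixes c :: real
  assumes "c > 0"
  shows "(\<lambda>ns::int list. exp (- (c * (\<Sum>n\<leftarrow>ns. \<bar>of_int n\<bar>)))) summable_on {ns. length ns = k}"
proof (induction k)
  case 0
  have "{ns :: int list. length ns = 0} = {[]}" by auto
  then show ?case by simp
next
  case (Suc k)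
  let ?f = "\<lambda>ns::int list. exp (- (c * (\<Sum>n\<leftarrow>ns. \<bar>of_int n\<bar>))) :: real"
  have eq: "{ns :: int list. length ns = Suc k} = (\<lambda>(n, ns). n # ns) ` (UNIV \<times> {ns. length ns = k})"
    by (auto simp: length_Suc_conv)
  have "(\<lambda>p. ?f (case p of (n, ns) \<Rightarrow> n # ns)) summable_on (SIGMA n:UNIV. {ns. length ns = k})"
  proof (rule summable_on_SigmaI)
    fix n :: int
    have "((\<lambda>ns. exp (- (c * \<bar>of_int n\<bar>)) * ?f ns) has_sum exp (- (c * \<bar>of_int n\<bar>)) * infsum ?f {ns. length ns = k}) {ns. length ns = k}"
      by (intro has_sum_cmult_right has_sum_infsum Suc)
    then show "((\<lambda>ns. ?f (case (n, ns) of (n, ns) \<Rightarrow> n # ns)) has_sum exp (- (c * \<bar>of_int n\<bar>)) * infsum ?f {ns. length ns = k}) {ns. length ns = k}"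
      by (simp add: exp_add[symmetric] algebra_simps)
  next
    show "(\<lambda>n::int. exp (- (c * \<bar>of_int n\<bar>)) * infsum ?f {ns. length ns = k}) summable_on UNIV"
      by (intro summable_on_cmult_left summable_exp_int assms)
  qed auto
  then show ?case unfolding eq
    by (subst summable_on_reindex) (auto simp: inj_on_def o_def)
qed

text \<open>
  The one-variable expansions combine to a series over \<open>\<int>\<^sup>r\<close> because the bound on the modes makes it
  absolutely summable.
\<close>

lemma modes_has_sum:
  assumes "hol g" "\<And>Z b. Z \<in> T \<Longrightarrow> b \<in> set bs \<Longrightarrow> g (Z + b) = g Z" "set bs \<subseteq> W" "Z \<in> T"
  shows "((\<lambda>ns. modes bs ns g Z) has_sum g Z) {ns. length ns = length bs}"
  using assms(1-3)
proof (induction bs arbitrary: g)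
  case Nil
  have "{ns :: int list. length ns = 0} = {[]}" by auto
  then show ?case using has_sum_finite[of "{[]}" "\<lambda>ns :: int list. g Z"] by simp
next
  case (Cons b bs)
  have b: "b \<in> W" using Cons.prems by auto
  obtain \<epsilon> where e: "\<epsilon> > 0" "polystrip \<epsilon> Z (b # bs) \<subseteq> T"
    using polystrip_subset[OF assms(4) Cons.prems(3)] by blast
  have "compact (g ` polystrip \<epsilon> Z (b # bs))"
    by (intro compact_continuous_image compact_polystrip continuous_on_subset[OF hol_cont[OF Cons.prems(1)] e(2)])
  then obtain B where B: "\<And>z. z \<in> polystrip \<epsilon> Z (b # bs) \<Longrightarrow> norm (g z) \<le> B"
    using compact_imp_bounded by (metis bounded_iff image_eqI)
  let ?L = "\<lambda>k. {ns :: int list. length ns = k}"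
  have "(\<lambda>ns. modes (b # bs) ns g Z) summable_on ?L (length (b # bs))"
  proof (rule abs_summable_summable, rule summable_on_comparison_test)
    show "(\<lambda>ns. B * exp (- (2 * pi * \<epsilon> * (\<Sum>n\<leftarrow>ns. \<bar>of_int n\<bar>)))) summable_on ?L (length (b # bs))"
      using e(1) by (intro summable_on_cmult_right summable_exp_int_list) simp
    show "norm (modes (b # bs) ns g Z) \<le> B * exp (- (2 * pi * \<epsilon> * (\<Sum>n\<leftarrow>ns. \<bar>of_int n\<bar>)))"
      if "ns \<in> ?L (length (b # bs))" for ns
      by (rule modes_bound[OF Cons.prems e(2) _ B]) (use e that in auto)
  qed auto
  moreover have eq: "?L (length (b # bs)) = (\<lambda>(n, ns). n # ns) ` (UNIV \<times> ?L (length bs))"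
    by (auto simp: length_Suc_conv)
  ultimately have sm: "(\<lambda>p. modes (b # bs) (case p of (n, ns) \<Rightarrow> n # ns) g Z) summable_on (UNIV \<times> ?L (length bs))"
    unfolding eq by (subst (asm) summable_on_reindex) (auto simp: inj_on_def o_def)
  have "((\<lambda>p. modes (b # bs) (case p of (n, ns) \<Rightarrow> n # ns) g Z) has_sum g Z) (SIGMA n:UNIV. ?L (length bs))"
  proof (rule has_sum_SigmaI[OF _ _ sm])
    fix n :: int
    have "((\<lambda>ns. modes bs ns (mode b n g) Z) has_sum mode b n g Z) (?L (length bs))"
    proof (rule Cons.IH)
      show "mode b n g (Z + b') = mode b n g Z" if "Z \<in> T" "b' \<in> set bs" for Z b'
        by (rule mode_translate) (use Cons.prems that b in auto)
    qed (use Cons.prems mode_hol[OF Cons.prems(1) b] in auto)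
    then show "((\<lambda>ns. modes (b # bs) (case (n, ns) of (n, ns) \<Rightarrow> n # ns) g Z) has_sum mode b n g Z) (?L (length bs))"
      by simp
  next
    show "((\<lambda>n. mode b n g Z) has_sum g Z) UNIV"
      by (rule mode_has_sum_int) (use Cons.prems b assms(4) in auto)
  qed
  then show ?case unfolding eq
    by (subst has_sum_reindex) (auto simp: inj_on_def o_def)
qed

lemma modes_hol:
  assumes "hol g" "set bs \<subseteq> W" "length ns = length bs"
  shows "hol (modes bs ns g)"
  using assms
proof (induction bs arbitrary: g ns)
  case (Cons b bs)
  then show ?case by (cases ns) (auto intro: mode_hol)
qed simp

text \<open>
  A function that transforms by a character along \<open>b'\<close> keeps doing so after modes along other directions
  have been taken.
\<close>

lemma modes_quasi_periodic:
  assumes "\<And>Z s. Z \<in> T \<Longrightarrow> Z + s *s b' \<in> T \<Longrightarrow> g (Z + s *s b') = ee (c * s) * g Z"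
    and "b' \<in> W" "set bs \<subseteq> W" "length ns = length bs" "Z \<in> T" "Z + s *s b' \<in> T"
  shows "modes bs ns g (Z + s *s b') = ee (c * s) * modes bs ns g Z"
  using assms
proof (induction bs arbitrary: g ns)
  case (Cons b bs)
  obtain n ns' where ns: "ns = n # ns'" "length ns' = length bs" using Cons.prems(4) by (cases ns) auto
  have "modes bs ns' (mode b n g) (Z + s *s b') = ee (c * s) * modes bs ns' (mode b n g) Z"
  proof (rule Cons.IH)
    show "mode b n g (Z + s *s b') = ee (c * s) * mode b n g Z" if "Z \<in> T" "Z + s *s b' \<in> T" for Z s
      by (rule mode_quasi_periodic) (use Cons.prems that in auto)
  qed (use Cons.prems ns in auto)
  then show ?case using ns by simp
qed simp

lemma modes_shift:
  assumes "hol g" "\<And>Z b. Z \<in> T \<Longrightarrow> b \<in> set bs \<Longrightarrow> g (Z + b) = g Z" "set bs \<subseteq> W"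
    and "length ns = length bs" "i < length bs" "Z \<in> T" "Z + s *s (bs ! i) \<in> T"
  shows "modes bs ns g (Z + s *s (bs ! i)) = ee (of_int (ns ! i) * s) * modes bs ns g Z"
  using assms
proof (induction bs arbitrary: g ns i)
  case (Cons b bs)
  obtain n ns' where ns: "ns = n # ns'" "length ns' = length bs" using Cons.prems(4) by (cases ns) auto
  have b: "b \<in> W" using Cons.prems by auto
  show ?case
  proof (cases i)
    case 0
    have "modes bs ns' (mode b n g) (Z + s *s b) = ee (of_int n * s) * modes bs ns' (mode b n g) Z"
    proof (rule modes_quasi_periodic)
      show "mode b n g (Z + s *s b) = ee (of_int n * s) * mode b n g Z" if "Z \<in> T" "Z + s *s b \<in> T" for Z s
        by (rule mode_shift) (use Cons.prems that in auto)
    qed (use Cons.prems 0 ns in auto)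
    then show ?thesis using 0 ns by simp
  next
    case (Suc j)
    have "modes bs ns' (mode b n g) (Z + s *s (bs ! j)) = ee (of_int (ns' ! j) * s) * modes bs ns' (mode b n g) Z"
    proof (rule Cons.IH)
      show "mode b n g (Z + b') = mode b n g Z" if "Z \<in> T" "b' \<in> set bs" for Z b'
        by (rule mode_translate) (use Cons.prems that b in auto)
    qed (use Cons.prems Suc ns mode_hol[OF Cons.prems(1) b] in auto)
    then show ?thesis using Suc ns by simp
  qed
qed simp

text \<open>
  On every line in a real direction the function is constant along the real points, hence constant, and any
  two points of the tube differ by a real vector and \<open>\<i>\<close> times a real vector.
\<close>

lemma hol_invariant_const:
  assumes g: "hol g" and inv: "\<And>Z x. Z \<in> T \<Longrightarrow> x \<in> W \<Longrightarrow> g (Z + x) = g Z" and "Z \<in> T" "Z' \<in> T"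
  shows "g Z' = g Z"
proof -
  obtain x y where xy: "x \<in> W" "y \<in> W" "Z' = Z + x + \<i> *s y" using T_diff[OF assms(3,4)] by blast
  have Zx: "Z + x \<in> T" using T_real assms xy by blast
  let ?S = "{s. Z + x + s *s y \<in> T}"
  have "g (Z + x + \<i> *s y) - g (Z + x) = 0"
  proof (rule analytic_continuation[where f = "\<lambda>s. g (Z + x + s *s y) - g (Z + x)" and S = ?S and U = "range of_real" and \<xi> = 0])
    show "(\<lambda>s. g (Z + x + s *s y) - g (Z + x)) holomorphic_on ?S"
      by (intro holomorphic_intros hol_line g Zx xy)
    show "open ?S" by (rule strip_open[OF xy(2)])
    show "connected ?S" by (intro convex_connected T_convex Zx xy)
    show "range of_real \<subseteq> ?S" using T_real[OF Zx W_scale[OF xy(2)]] by auto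
    show "0 islimpt range (of_real :: real \<Rightarrow> complex)"
      unfolding islimpt_approachable
    proof (intro allI impI)
      fix e :: real assume "e > 0"
      then show "\<exists>x'\<in>range of_real. x' \<noteq> (0 :: complex) \<and> dist x' 0 < e"
        by (intro bexI[OF _ rangeI[of of_real "e / 2"]]) auto
    qed
    show "g (Z + x + s *s y) - g (Z + x) = 0" if "s \<in> range of_real" for s
      using that inv[OF Zx W_scale[OF xy(2)]] by auto
  qed (use Zx assms(4) xy in auto)
  then show ?thesis using xy inv[OF assms(3) xy(1)] by simp
qed

end

section \<open>Tensors\<close>

lemma lists_length_Suc: "{ys :: 'a list. length ys = Suc n} = (\<lambda>(y, ys). y # ys) ` (UNIV \<times> {ys. length ys = n})"
  by (auto simp: length_Suc_conv)

lemma tmap_Nil [simp]: "tmap g T [] = T []"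
proof -
  have "{ys :: 'a list. length ys = 0} = {[]}" by auto
  then show ?thesis by (simp add: tmap_def)
qed

lemma tmap_Cons: "tmap g T (x # xs) = (\<Sum>y\<in>UNIV. g $ x $ y * tmap g (\<lambda>ys. T (y # ys)) xs)"
proof -
  have "tmap g T (x # xs) = (\<Sum>(y, ys)\<in>UNIV \<times> {ys. length ys = length xs}.
      (\<Prod>i<Suc (length xs). g $ ((x # xs) ! i) $ ((y # ys) ! i)) * T (y # ys))"
    unfolding tmap_def list.size(4) add_Suc_right add_0_right lists_length_Suc
    by (subst sum.reindex) (auto simp: inj_on_def split_beta intro!: sum.cong)
  also have "\<dots> = (\<Sum>y\<in>UNIV. \<Sum>ys | length ys = length xs.
      g $ x $ y * ((\<Prod>i<length xs. g $ (xs ! i) $ (ys ! i)) * T (y # ys)))"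
    unfolding sum.cartesian_product prod.lessThan_Suc_shift by (simp add: mult.assoc)
  finally show ?thesis by (simp add: tmap_def sum_distrib_left)
qed

lemma tmap_zero [simp]: "tmap g (\<lambda>xs. 0) = (\<lambda>xs. 0)"
  by (simp add: tmap_def)

lemma tmap_add: "tmap g (\<lambda>xs. S xs + T xs) = (\<lambda>xs. tmap g S xs + tmap g T xs)"
  by (simp add: tmap_def distrib_left sum.distrib)

lemma tmap_cmult: "tmap g (\<lambda>xs. c * T xs) = (\<lambda>xs. c * tmap g T xs)"
  by (simp add: tmap_def sum_distrib_left mult_ac)

lemma tmap_tscale: "tmap g (tscale c T) = tscale c (tmap g T)"
  by (simp add: tscale_def tmap_cmult)

lemma tmap_sum: "tmap g (\<lambda>xs. \<Sum>a\<in>A. F a xs) xs = (\<Sum>a\<in>A. tmap g (F a) xs)"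
proof (cases "finite A")
  case True then show ?thesis by (induction A rule: finite_induct) (simp_all add: tmap_add)
qed simp

lemma tmap_compose: "tmap A (tmap B T) = tmap (A ** B) T"
proof
  fix xs show "tmap A (tmap B T) xs = tmap (A ** B) T xs"
  proof (induction xs arbitrary: T)
    case (Cons x xs)
    have "tmap A (tmap B T) (x # xs) = (\<Sum>y\<in>UNIV. A $ x $ y * tmap A (\<lambda>ys. \<Sum>z\<in>UNIV. B $ y $ z * tmap B (\<lambda>zs. T (z # zs)) ys) xs)"
      by (simp add: tmap_Cons)
    also have "\<dots> = (\<Sum>y\<in>UNIV. \<Sum>z\<in>UNIV. A $ x $ y * (B $ y $ z * tmap (A ** B) (\<lambda>zs. T (z # zs)) xs))"
      by (simp add: tmap_sum tmap_cmult Cons.IH sum_distrib_left)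
    also have "\<dots> = (\<Sum>z\<in>UNIV. \<Sum>y\<in>UNIV. A $ x $ y * (B $ y $ z * tmap (A ** B) (\<lambda>zs. T (z # zs)) xs))"
      by (rule sum.swap)
    also have "\<dots> = tmap (A ** B) T (x # xs)"
      by (simp add: tmap_Cons matrix_matrix_mult_def sum_distrib_right mult.assoc)
    finally show ?case .
  qed simp
qed

lemma tmap_id: "tmap (mat 1) T = T"
proof
  fix xs show "tmap (mat 1) T xs = T xs"
  proof (induction xs arbitrary: T)
    case (Cons x xs)
    have "tmap (mat 1) T (x # xs) = (\<Sum>y\<in>UNIV. if x = y then T (y # xs) else 0)"
    proof -
      have "mat 1 $ x $ y = (if x = y then 1 else 0 :: complex)" for y by (simp add: mat_def)
      then show ?thesis unfolding tmap_Cons Cons.IH by (intro sum.cong refl) simp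
    qed
    then show ?case by simp
  qed simp
qed

lemma pure_tensor_Cons: "pure_tensor (v # vs) (x # xs) = v $ x * pure_tensor vs xs"
  by (simp add: pure_tensor_def prod.lessThan_Suc_shift del: prod.lessThan_Suc)

lemma pure_tensor_length: "length xs \<noteq> length vs \<Longrightarrow> pure_tensor vs xs = 0"
  by (simp add: pure_tensor_def)

lemma pure_tensor_Nil: "pure_tensor [] [] = 1"
  by (simp add: pure_tensor_def)

lemma pure_tensor_append:
  "length xs = length us \<Longrightarrow> pure_tensor (us @ vs) (xs @ ys) = pure_tensor us xs * pure_tensor vs ys"
  by (induction xs us rule: list_induct2) (auto simp: pure_tensor_Cons pure_tensor_Nil)

lemma tmap_length: "(\<And>ys. length ys \<noteq> d \<Longrightarrow> T ys = 0) \<Longrightarrow> length xs \<noteq> d \<Longrightarrow> tmap g T xs = 0"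
  by (simp add: tmap_def)

lemma tmap_pure: "tmap g (pure_tensor vs) = pure_tensor (map ((*v) g) vs)"
proof
  fix xs show "tmap g (pure_tensor vs) xs = pure_tensor (map ((*v) g) vs) xs"
  proof (cases "length xs = length vs")
    case True
    then show ?thesis
    proof (induction xs vs rule: list_induct2)
      case (Cons x xs v vs)
      then show ?case
        by (simp add: tmap_Cons pure_tensor_Cons tmap_cmult matrix_vector_mult_def sum_distrib_right mult.assoc)
    qed simp
  next
    case False
    then show ?thesis using tmap_length[of "length vs" "pure_tensor vs" xs] by (simp add: pure_tensor_length)
  qed
qed

definition tsubspace :: "'N tensor set \<Rightarrow> bool" where
  "tsubspace V \<longleftrightarrow> (\<lambda>xs. 0) \<in> V \<and> (\<forall>S\<in>V. \<forall>T\<in>V. (\<lambda>xs. S xs + T xs) \<in> V) \<and> (\<forall>c. \<forall>T\<in>V. (\<lambda>xs. c * T xs) \<in> V)"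

lemma tspan_zero: "(\<lambda>xs. 0) \<in> tspan S"
  unfolding tspan_def by (rule CollectI, rule exI[of _ "{}"]) auto

lemma tspan_insert:
  assumes "T \<in> S" "R \<in> tspan S" shows "(\<lambda>xs. c * T xs + R xs) \<in> tspan S"
proof -
  obtain A k where A: "R = (\<lambda>xs. \<Sum>T\<in>A. k T * T xs)" "finite A" "A \<subseteq> S"
    using assms(2) by (auto simp: tspan_def)
  define k' where "k' = (\<lambda>U. (if U \<in> A then k U else 0) + (if U = T then c else 0))"
  have "(\<Sum>U\<in>insert T A. k' U * U xs) = (\<Sum>U\<in>insert T A. (if U \<in> A then k U * U xs else 0)) + (\<Sum>U\<in>insert T A. if U = T then c * U xs else 0)" for xs
    unfolding sum.distrib[symmetric] by (intro sum.cong) (auto simp: k'_def algebra_simps)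
  moreover have "(\<Sum>U\<in>insert T A. (if U \<in> A then k U * U xs else 0)) = R xs" for xs
    unfolding A(1) using A(2) by (subst sum.mono_neutral_right[of "insert T A" A]) auto
  moreover have "(\<Sum>U\<in>insert T A. if U = T then c * U xs else 0) = c * T xs" for xs
    using A(2) by (subst sum.delta) auto
  ultimately have "(\<lambda>xs. c * T xs + R xs) = (\<lambda>xs. \<Sum>U\<in>insert T A. k' U * U xs)" by (simp add: add.commute)
  then show ?thesis unfolding tspan_def using A assms(1)
    by (intro CollectI exI[of _ "insert T A"] exI[of _ k']) auto
qed

lemma tspan_induct [consumes 1, case_names zero step]:
  assumes "T \<in> tspan S" "P (\<lambda>xs. 0)" "\<And>c T R. T \<in> S \<Longrightarrow> R \<in> tspan S \<Longrightarrow> P R \<Longrightarrow> P (\<lambda>xs. c * T xs + R xs)"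
  shows "P T"
proof -
  obtain A k where A: "T = (\<lambda>xs. \<Sum>T\<in>A. k T * T xs)" "finite A" "A \<subseteq> S"
    using assms(1) by (auto simp: tspan_def)
  have "(\<lambda>xs. \<Sum>T\<in>A. k T * T xs) \<in> tspan S \<and> P (\<lambda>xs. \<Sum>T\<in>A. k T * T xs)"
    using A(2,3)
  proof (induction A rule: finite_induct)
    case empty then show ?case using assms(2) tspan_zero by simp
  next
    case (insert x F)
    then have "(\<lambda>xs. k x * x xs + (\<Sum>T\<in>F. k T * T xs)) \<in> tspan S \<and> P (\<lambda>xs. k x * x xs + (\<Sum>T\<in>F. k T * T xs))"
      using assms(3) tspan_insert by blast
    then show ?case using insert.hyps by simp
  qed
  then show ?thesis using A(1) by simp
qed

lemma tspan_subset:
  assumes "tsubspace V" "S \<subseteq> V" shows "tspan S \<subseteq> V"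
proof
  fix T assume "T \<in> tspan S" then show "T \<in> V"
    by (induction rule: tspan_induct) (use assms in \<open>auto simp: tsubspace_def\<close>)
qed

lemma tsubspace_tspan: "tsubspace (tspan S)"
proof -
  have add: "(\<lambda>xs. T xs + R xs) \<in> tspan S" if "T \<in> tspan S" "R \<in> tspan S" for T R
    using that(1)
  proof (induction rule: tspan_induct)
    case (step c T R') then show ?case using tspan_insert[of T S _ c] by (simp add: add.assoc)
  qed (use that in simp)
  have scale: "(\<lambda>xs. c * T xs) \<in> tspan S" if "T \<in> tspan S" for c T
    using that
  proof (induction rule: tspan_induct)
    case (step d T R) then show ?case using tspan_insert[of T S _ "c * d"] by (simp add: distrib_left mult.assoc)
  qed (simp add: tspan_zero)
  show ?thesis using add scale tspan_zero by (auto simp: tsubspace_def)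
qed

lemma tspan_superset: "T \<in> S \<Longrightarrow> T \<in> tspan S"
  using tspan_insert[OF _ tspan_zero, of T S 1] by simp

lemma tspan_mono: "S \<subseteq> S' \<Longrightarrow> tspan S \<subseteq> tspan S'"
  by (rule tspan_subset[OF tsubspace_tspan]) (auto intro: tspan_superset)

lemma tmap_tspan:
  assumes "T \<in> tspan S" "\<And>T. T \<in> S \<Longrightarrow> tmap g T \<in> tspan S'" shows "tmap g T \<in> tspan S'"
  using assms(1)
proof (induction rule: tspan_induct)
  case (step c T R)
  then show ?case using tsubspace_tspan[of S'] assms(2) by (simp add: tmap_add tmap_cmult tsubspace_def)
qed (simp add: tspan_zero)

lemma tpower_length: "T \<in> tpower d W \<Longrightarrow> length xs \<noteq> d \<Longrightarrow> T xs = 0"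
  unfolding tpower_def
  by (induction rule: tspan_induct) (auto simp: pure_tensor_length)

lemma tkernel_subset_tpower: "tkernel d W K \<subseteq> tpower d W"
  unfolding tkernel_def tpower_def by (rule tspan_mono) auto

lemma tmap_tpower: "T \<in> tpower d W \<Longrightarrow> (\<And>w. w \<in> W \<Longrightarrow> M *v w \<in> W') \<Longrightarrow> tmap M T \<in> tpower d W'"
  unfolding tpower_def
  by (erule tmap_tspan) (fastforce simp: tmap_pure intro: tspan_superset)

lemma tmap_tkernel:
  assumes "T \<in> tkernel d W K" "\<And>w. w \<in> W \<Longrightarrow> M *v w \<in> W'" "\<And>w. w \<in> K \<Longrightarrow> M *v w \<in> K'"
  shows "tmap M T \<in> tkernel d W' K'"
  using assms(1) unfolding tkernel_def
proof (rule tmap_tspan)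
  fix T assume "T \<in> {pure_tensor vs |vs. length vs = d \<and> set vs \<subseteq> W \<and> set vs \<inter> K \<noteq> {}}"
  then obtain vs where "T = pure_tensor vs" "length vs = d" "set vs \<subseteq> W" "set vs \<inter> K \<noteq> {}" by auto
  then show "tmap M T \<in> tspan {pure_tensor vs |vs. length vs = d \<and> set vs \<subseteq> W' \<and> set vs \<inter> K' \<noteq> {}}"
    using assms(2,3) unfolding \<open>T = pure_tensor vs\<close> tmap_pure
    by (intro tspan_superset CollectI exI[of _ "map ((*v) M) vs"]) auto
qed

lemma pure_tensor_0: "0 \<in> set vs \<Longrightarrow> pure_tensor vs = (\<lambda>xs. 0)"
proof
  fix xs assume "0 \<in> set vs"
  then obtain i where "i < length vs" "vs ! i = 0" by (auto simp: in_set_conv_nth)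
  then have "(\<Prod>i<length vs. (vs ! i) $ (xs ! i)) = 0" by (intro prod_zero) (auto intro!: bexI[of _ i])
  then show "pure_tensor vs xs = 0" by (simp add: pure_tensor_def)
qed

lemma tkernel_0: "tkernel d W {0} = {\<lambda>xs. 0}"
proof
  have "tsubspace {\<lambda>xs. 0 :: complex}" by (auto simp: tsubspace_def)
  then show "tkernel d W {0} \<subseteq> {\<lambda>xs. 0}"
    unfolding tkernel_def by (rule tspan_subset) (auto simp: pure_tensor_0)
  show "{\<lambda>xs. 0} \<subseteq> tkernel d W {0}" using tspan_zero by (auto simp: tkernel_def)
qed

lemma contraction_add: "contraction Q i j (\<lambda>xs. c * S xs + T xs) = (\<lambda>xs. c * contraction Q i j S xs + contraction Q i j T xs)"
  by (simp add: contraction_def distrib_left sum.distrib sum_distrib_left mult_ac)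

lemma contraction_zero: "contraction Q i j (\<lambda>xs. 0) = (\<lambda>xs. 0)"
  by (simp add: contraction_def)

lemma contraction_pure:
  "contraction Q (length A) (Suc (length A + length B)) (pure_tensor (A @ v # B @ w # C)) =
     (\<lambda>xs. bil Q v w * pure_tensor (A @ B @ C) xs)"
proof
  fix xs :: "'a list"
  let ?i = "length A" and ?j = "Suc (length A + length B)"
  show "contraction Q ?i ?j (pure_tensor (A @ v # B @ w # C)) xs = bil Q v w * pure_tensor (A @ B @ C) xs"
  proof (cases "length xs = length (A @ B @ C)")
    case True
    define X Y Z where "X = take ?i xs" "Y = take (length B) (drop ?i xs)" "Z = drop (?i + length B) xs"
    have len: "length X = length A" "length Y = length B" "length Z = length C"
      using True by (auto simp: X_Y_Z_def)
    have xs: "xs = X @ Y @ Z" unfolding X_Y_Z_def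
      by (metis append.assoc append_take_drop_id take_add)
    have "pure_tensor (A @ v # B @ w # C) (take ?i xs @ a # take (?j - ?i - 1) (drop ?i xs) @ b # drop (?j - 1) xs)
       = v $ a * w $ b * pure_tensor (A @ B @ C) xs" for a b
    proof -
      have "pure_tensor (A @ v # B @ w # C) (X @ a # Y @ b # Z) = v $ a * w $ b * pure_tensor (A @ B @ C) (X @ Y @ Z)"
        using len by (simp add: pure_tensor_append pure_tensor_Cons mult_ac)
      moreover have "take ?i xs = X" "take (?j - ?i - 1) (drop ?i xs) = Y" "drop (?j - 1) xs = Z"
        by (simp_all add: X_Y_Z_def)
      ultimately show ?thesis unfolding xs[symmetric] by (simp only:)
    qed
    then show ?thesis by (simp add: contraction_def bil_def sum_distrib_right mult.assoc)
  next
    case False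
    have "length (take ?i xs @ a # take (?j - ?i - 1) (drop ?i xs) @ b # drop (?j - 1) xs) = length xs + 2" for a b
      by auto
    then have "pure_tensor (A @ v # B @ w # C) (take ?i xs @ a # take (?j - ?i - 1) (drop ?i xs) @ b # drop (?j - 1) xs) = 0" for a b
      using False by (intro pure_tensor_length) auto
    then show ?thesis using False by (simp add: contraction_def pure_tensor_length)
  qed
qed

lemma split_two:
  assumes "i < j" "j < length vs"
  obtains A v B w C where "vs = A @ v # B @ w # C" "length A = i" "j = Suc (length A + length B)"
proof
  have "vs = take i vs @ vs ! i # drop (Suc i) vs" using assms by (simp add: id_take_nth_drop)
  also have "drop (Suc i) vs = take (j - Suc i) (drop (Suc i) vs) @ drop (Suc i) vs ! (j - Suc i) # drop (Suc (j - Suc i)) (drop (Suc i) vs)"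
    using assms by (intro id_take_nth_drop) simp
  finally show "vs = take i vs @ vs ! i # take (j - Suc i) (drop (Suc i) vs) @ drop (Suc i) vs ! (j - Suc i) # drop (Suc (j - Suc i)) (drop (Suc i) vs)" .
qed (use assms in auto)

lemma contraction_tmap:
  assumes "T \<in> tpower d W" "i < j" "j < d"
    and iso: "\<And>x y. x \<in> W \<Longrightarrow> y \<in> W \<Longrightarrow> bil Q (M *v x) (M *v y) = bil Q x y"
  shows "contraction Q i j (tmap M T) = tmap M (contraction Q i j T)"
  using assms(1) unfolding tpower_def
proof (induction rule: tspan_induct)
  case zero then show ?case by (simp add: contraction_zero)
next
  case (step c T R)
  obtain vs where vs: "T = pure_tensor vs" "length vs = d" "set vs \<subseteq> W" using step.hyps by auto
  obtain A v B w C where d: "vs = A @ v # B @ w # C" "length A = i" "j = Suc (length A + length B)"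
    using split_two[OF assms(2)] assms(3) vs(2) by blast
  have "contraction Q i j (tmap M T) = tmap M (contraction Q i j T)"
    using contraction_pure[of Q A B v w C] contraction_pure[of Q "map ((*v) M) A" "map ((*v) M) B" "M *v v" "M *v w" "map ((*v) M) C"]
      d vs iso[of v w] by (simp add: tmap_pure tmap_cmult)
  then show ?case using step by (simp add: contraction_add tmap_add tmap_cmult)
qed

lemma permute_list_bij:
  assumes "\<sigma> permutes {..<n}"
  shows "bij_betw (permute_list \<sigma>) {ys. length ys = n} {ys. length ys = n}"
proof (rule bij_betwI[where g = "permute_list (inv_into UNIV \<sigma>)"])
  show "permute_list (inv_into UNIV \<sigma>) (permute_list \<sigma> ys) = ys" if "ys \<in> {ys. length ys = n}" for ys
    using that assms permute_list_compose[of "inv_into UNIV \<sigma>" ys \<sigma>] permutes_inv_o[OF assms] permutes_inv[OF assms] by simp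
  show "permute_list \<sigma> (permute_list (inv_into UNIV \<sigma>) ys) = ys" if "ys \<in> {ys. length ys = n}" for ys
    using that assms permute_list_compose[of \<sigma> ys "inv_into UNIV \<sigma>"] permutes_inv_o[OF assms] by simp
qed auto

lemma tmap_permute:
  assumes "\<sigma> permutes {..<length xs}"
  shows "tmap g T (permute_list \<sigma> xs) = tmap g (\<lambda>ys. T (permute_list \<sigma> ys)) xs"
proof -
  let ?n = "length xs"
  have "tmap g T (permute_list \<sigma> xs) = (\<Sum>ys | length ys = ?n. (\<Prod>i<?n. g $ (permute_list \<sigma> xs ! i) $ (ys ! i)) * T ys)"
    by (simp add: tmap_def)
  also have "\<dots> = (\<Sum>ys | length ys = ?n. (\<Prod>i<?n. g $ (permute_list \<sigma> xs ! i) $ (permute_list \<sigma> ys ! i)) * T (permute_list \<sigma> ys))"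
    by (rule sum.reindex_bij_betw[OF permute_list_bij[OF assms], symmetric])
  also have "\<dots> = (\<Sum>ys | length ys = ?n. (\<Prod>i<?n. g $ (xs ! i) $ (ys ! i)) * T (permute_list \<sigma> ys))"
  proof (intro sum.cong refl)
    fix ys assume "ys \<in> {ys :: 'a list. length ys = ?n}"
    then have l: "length ys = ?n" by simp
    have "(\<Prod>i<?n. g $ (permute_list \<sigma> xs ! i) $ (permute_list \<sigma> ys ! i)) = (\<Prod>i<?n. g $ (xs ! \<sigma> i) $ (ys ! \<sigma> i))"
      using assms l by (intro prod.cong) (auto simp: permute_list_nth)
    also have "\<dots> = (\<Prod>i<?n. g $ (xs ! i) $ (ys ! i))"
      using prod.permute[OF assms, of "\<lambda>i. g $ (xs ! i) $ (ys ! i)"] by (simp add: o_def)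
    finally show "(\<Prod>i<?n. g $ (permute_list \<sigma> xs ! i) $ (permute_list \<sigma> ys ! i)) * T (permute_list \<sigma> ys)
       = (\<Prod>i<?n. g $ (xs ! i) $ (ys ! i)) * T (permute_list \<sigma> ys)" by simp
  qed
  finally show ?thesis by (simp add: tmap_def)
qed

lemma row_symmetrizer_length: "(\<And>ys. length ys \<noteq> d \<Longrightarrow> T ys = 0) \<Longrightarrow> length xs \<noteq> d \<Longrightarrow> row_symmetrizer lam T xs = 0"
  by (simp add: row_symmetrizer_def)

lemma young_symmetrizer_length: "(\<And>ys. length ys \<noteq> d \<Longrightarrow> T ys = 0) \<Longrightarrow> length xs \<noteq> d \<Longrightarrow> young_symmetrizer lam T xs = 0"
  by (simp add: young_symmetrizer_def col_antisymmetrizer_def row_symmetrizer_def)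

lemma young_symmetrizer_add: "young_symmetrizer lam (\<lambda>xs. S xs + T xs) = (\<lambda>xs. young_symmetrizer lam S xs + young_symmetrizer lam T xs)"
  by (simp add: young_symmetrizer_def row_symmetrizer_def col_antisymmetrizer_def sum.distrib distrib_left)

lemma young_symmetrizer_cmult: "young_symmetrizer lam (\<lambda>xs. c * T xs) = (\<lambda>xs. c * young_symmetrizer lam T xs)"
  by (simp add: young_symmetrizer_def row_symmetrizer_def col_antisymmetrizer_def sum_distrib_left mult_ac)

lemma tmap_row_symmetrizer:
  assumes "\<And>ys. length ys \<noteq> sum_list lam \<Longrightarrow> T ys = 0"
  shows "row_symmetrizer lam (tmap g T) = tmap g (row_symmetrizer lam T)"
proof
  fix xs show "row_symmetrizer lam (tmap g T) xs = tmap g (row_symmetrizer lam T) xs"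
  proof (cases "length xs = sum_list lam")
    case True
    then have "tmap g T (permute_list \<sigma> xs) = tmap g (\<lambda>ys. T (permute_list \<sigma> ys)) xs" if "\<sigma> \<in> row_group lam" for \<sigma>
      using that by (intro tmap_permute) (auto simp: row_group_def)
    then show ?thesis unfolding row_symmetrizer_def tmap_sum by (intro sum.cong) auto
  next
    case False
    then show ?thesis using assms
      by (simp add: tmap_length[where d = "sum_list lam"] row_symmetrizer_length[where d = "sum_list lam"])
  qed
qed

lemma tmap_col_antisymmetrizer:
  assumes "\<And>ys. length ys \<noteq> sum_list lam \<Longrightarrow> T ys = 0"
  shows "col_antisymmetrizer lam (tmap g T) = tmap g (col_antisymmetrizer lam T)"
proof
  fix xs show "col_antisymmetrizer lam (tmap g T) xs = tmap g (col_antisymmetrizer lam T) xs"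
  proof (cases "length xs = sum_list lam")
    case True
    then have "tmap g T (permute_list \<sigma> xs) = tmap g (\<lambda>ys. T (permute_list \<sigma> ys)) xs" if "\<sigma> \<in> col_group lam" for \<sigma>
      using that by (intro tmap_permute) (auto simp: col_group_def)
    then show ?thesis unfolding col_antisymmetrizer_def tmap_sum tmap_cmult by (intro sum.cong) auto
  next
    case False
    then show ?thesis using assms
      by (simp add: tmap_length[where d = "sum_list lam"] col_antisymmetrizer_def)
  qed
qed

lemma tmap_young_symmetrizer:
  assumes "\<And>ys. length ys \<noteq> sum_list lam \<Longrightarrow> T ys = 0"
  shows "young_symmetrizer lam (tmap g T) = tmap g (young_symmetrizer lam T)"
  unfolding young_symmetrizer_def
  using assms by (simp add: tmap_row_symmetrizer tmap_col_antisymmetrizer row_symmetrizer_length[where d = "sum_list lam"])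

lemma schur_length: "T \<in> schur Q lam W K \<Longrightarrow> length xs \<noteq> sum_list lam \<Longrightarrow> T xs = 0"
  unfolding schur_def using tpower_length by (auto intro!: young_symmetrizer_length)

text \<open>
  Contractions and permutations of the factors commute with a linear map that preserves the form, so
  that the orthogonal Schur functor is a functor for such maps.
\<close>

lemma tmap_schur:
  assumes "T \<in> schur Q lam W K"
    and W: "\<And>w. w \<in> W \<Longrightarrow> M *v w \<in> W'" and K: "\<And>w. w \<in> K \<Longrightarrow> M *v w \<in> K'"
    and iso: "\<And>x y. x \<in> W \<Longrightarrow> y \<in> W \<Longrightarrow> bil Q (M *v x) (M *v y) = bil Q x y"
  shows "tmap M T \<in> schur Q lam W' K'"
proof -
  obtain S where S: "T = young_symmetrizer lam S" "S \<in> tpower (sum_list lam) W"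
    "\<forall>j<sum_list lam. \<forall>i<j. contraction Q i j S \<in> tkernel (sum_list lam - 2) W K"
    using assms(1) by (auto simp: schur_def)
  have "tmap M T = young_symmetrizer lam (tmap M S)"
    unfolding S(1) using tpower_length[OF S(2)] by (intro tmap_young_symmetrizer[symmetric])
  moreover have "contraction Q i j (tmap M S) \<in> tkernel (sum_list lam - 2) W' K'"
    if "j < sum_list lam" "i < j" for i j
  proof -
    have "contraction Q i j S \<in> tkernel (sum_list lam - 2) W K" using S(3) that by blast
    then have "tmap M (contraction Q i j S) \<in> tkernel (sum_list lam - 2) W' K'"
      by (rule tmap_tkernel) (use W K in auto)
    then show ?thesis using contraction_tmap[OF S(2) that(2,1) iso] by simp
  qed
  ultimately show ?thesis using tmap_tpower[OF S(2) W] unfolding schur_def by blast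
qed

lemma tsubspace_schur:
  fixes W K :: "(complex^'N) set"
  shows "tsubspace (schur Q lam W K)"
proof -
  let ?d = "sum_list lam"
  define X where "X = {T. T \<in> tpower ?d W \<and> (\<forall>j<?d. \<forall>i<j. contraction Q i j T \<in> tkernel (?d - 2) W K)}"
  have sp: "tsubspace (tpower ?d W)" "tsubspace (tkernel (?d - 2) W K)"
    unfolding tpower_def tkernel_def by (rule tsubspace_tspan)+
  have lin: "contraction Q i j (\<lambda>xs. S xs + T xs) = (\<lambda>xs. contraction Q i j S xs + contraction Q i j T xs)"
     "contraction Q i j (\<lambda>xs. c * T xs) = (\<lambda>xs. c * contraction Q i j T xs)" for i j S T c
    using contraction_add[of Q i j 1 S T] contraction_add[of Q i j c T "\<lambda>xs. 0"] by (simp_all add: contraction_zero)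
  have X: "tsubspace X" using sp unfolding X_def tsubspace_def by (simp add: lin contraction_zero)
  have "schur Q lam W K = young_symmetrizer lam ` X" by (auto simp: schur_def X_def)
  have y0: "young_symmetrizer lam (\<lambda>xs. 0 :: complex) = (\<lambda>xs :: 'N list. 0 :: complex)"
    using young_symmetrizer_cmult[of lam 0 "\<lambda>xs :: 'N list. 0"] by simp
  have "(\<lambda>xs. 0) \<in> X" using X by (simp add: tsubspace_def)
  from imageI[OF this, of "young_symmetrizer lam"] have "(\<lambda>xs. 0) \<in> schur Q lam W K"
    unfolding y0 \<open>schur Q lam W K = young_symmetrizer lam ` X\<close> .
  then show ?thesis using X \<open>schur Q lam W K = young_symmetrizer lam ` X\<close> unfolding tsubspace_def
    by (auto simp: young_symmetrizer_add[symmetric] young_symmetrizer_cmult[symmetric])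
qed

text \<open>
  A linear map that annihilates \<open>K\<close> annihilates the kernel of \<open>W\<^sup>\<otimes>\<^sup>d \<rightarrow> (W/K)\<^sup>\<otimes>\<^sup>d\<close>, hence takes a single value on
  every class.
\<close>

lemma tmap_tcoset:
  assumes W: "\<And>w. w \<in> W \<Longrightarrow> M *v w \<in> W'" and K: "\<And>w. w \<in> K \<Longrightarrow> M *v w = 0"
  shows "tmap M ` tcoset d W K T = {tmap M T}"
proof -
  have "tmap M R = (\<lambda>xs. 0)" if "R \<in> tkernel d W K" for R
    using tmap_tkernel[OF that W, of "{0}"] K by (auto simp: tkernel_0)
  then have 1: "tmap M U = tmap M T" if "U \<in> tcoset d W K T" for U
    using that by (auto simp: tcoset_def tmap_add)
  have "(\<lambda>xs. 0) \<in> tkernel d W K" unfolding tkernel_def by (rule tspan_zero)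
  then have "(\<lambda>xs. T xs + (\<lambda>xs. 0) xs) \<in> tcoset d W K T"
    unfolding tcoset_def by (intro CollectI exI[of _ "\<lambda>xs. 0"] conjI) simp_all
  then have "T \<in> tcoset d W K T" by simp
  show ?thesis
  proof (rule equalityI)
    show "tmap M ` tcoset d W K T \<subseteq> {tmap M T}" by (rule image_subsetI) (simp add: 1)
    show "{tmap M T} \<subseteq> tmap M ` tcoset d W K T" using imageI[OF \<open>T \<in> tcoset d W K T\<close>, of "tmap M"] by simp
  qed
qed

section \<open>Echelon bases\<close>

text \<open>
  A space of functions on a finite set has a basis that is dual to some of the evaluations, by Gaussian
  elimination one point at a time.  The scalars \<open>F\<close> are the rational numbers for spaces of exponents and
  the complex numbers for spaces of tensors.
\<close>

lemma echelon_basis: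
  fixes V :: "('a \<Rightarrow> complex) set"
  assumes fin: "finite A" and F: "\<And>a b. a \<in> F \<Longrightarrow> b \<in> F \<Longrightarrow> a * b \<in> F" "\<And>a. a \<in> F \<Longrightarrow> inverse a \<in> F"
    and add: "\<And>f g c. f \<in> V \<Longrightarrow> g \<in> V \<Longrightarrow> c \<in> F \<Longrightarrow> (\<lambda>x. f x + c * g x) \<in> V"
    and coord: "\<And>f x. f \<in> V \<Longrightarrow> f x \<in> F" "-1 \<in> F" "1 \<in> F"
    and supp: "\<And>f x. f \<in> V \<Longrightarrow> x \<notin> A \<Longrightarrow> f x = 0"
  shows "\<exists>S B. S \<subseteq> A \<and> (\<forall>s\<in>S. B s \<in> V) \<and> (\<forall>f\<in>V. f = (\<lambda>x. \<Sum>s\<in>S. f s * B s x)) \<and> (\<forall>s\<in>S. \<forall>t\<in>S. B s t = (if s = t then 1 else 0))"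
  using fin add coord(1) supp
proof (induction A arbitrary: V rule: finite_induct)
  case empty
  then show ?case by (intro exI[of _ "{}"]) auto
next
  case (insert a A)
  show ?case
  proof (cases "\<exists>f\<in>V. f a \<noteq> 0")
    case False
    then have "\<And>f x. f \<in> V \<Longrightarrow> x \<notin> A \<Longrightarrow> f x = 0" using insert.prems(3) by (metis insertE)
    then have "\<exists>S B. S \<subseteq> A \<and> (\<forall>s\<in>S. B s \<in> V) \<and> (\<forall>f\<in>V. f = (\<lambda>x. \<Sum>s\<in>S. f s * B s x)) \<and> (\<forall>s\<in>S. \<forall>t\<in>S. B s t = (if s = t then 1 else 0))"
      by (intro insert.IH) (use insert.prems in auto)
    then obtain S B where SB: "S \<subseteq> A" "\<forall>s\<in>S. B s \<in> V" "\<forall>f\<in>V. f = (\<lambda>x. \<Sum>s\<in>S. f s * B s x)"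
      "\<forall>s\<in>S. \<forall>t\<in>S. B s t = (if s = t then 1 else 0)" by (elim exE conjE) (rule that; assumption)
    show ?thesis
      by (rule exI[of _ S], rule exI[of _ B], intro conjI SB(2,3,4)) (use SB(1) in blast)
  next
    case True
    then obtain f0 where f0: "f0 \<in> V" "f0 a \<noteq> 0" by blast
    note add' = insert.prems(1) and coord' = insert.prems(2)
    have zero: "(\<lambda>x. 0) \<in> V" using insert.prems(1)[OF f0(1) f0(1) coord(2)] by simp
    define b where "b = (\<lambda>x. f0 x * inverse (f0 a))"
    have b: "b \<in> V" "b a = 1"
      using insert.prems(1)[OF zero f0(1), of "inverse (f0 a)"] F(2)[OF insert.prems(2)[OF f0(1), of a]] f0(2)
      by (simp_all add: b_def mult.commute)
    have red: "(\<lambda>x. f x - f a * b x) \<in> V" if "f \<in> V" for f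
      using insert.prems(1)[OF that b(1), of "-1 * f a"] F(1)[OF coord(2) insert.prems(2)[OF that, of a]] by simp
    define V' where "V' = {f \<in> V. f a = 0}"
    have "\<exists>S B. S \<subseteq> A \<and> (\<forall>s\<in>S. B s \<in> V') \<and> (\<forall>f\<in>V'. f = (\<lambda>x. \<Sum>s\<in>S. f s * B s x)) \<and> (\<forall>s\<in>S. \<forall>t\<in>S. B s t = (if s = t then 1 else 0))"
    proof (rule insert.IH)
      show "(\<lambda>x. f x + c * g x) \<in> V'" if "f \<in> V'" "g \<in> V'" "c \<in> F" for f g c
        using that insert.prems(1) by (auto simp: V'_def)
      show "f x = 0" if "f \<in> V'" "x \<notin> A" for f x
        using that insert.prems(3)[of f x] by (cases "x = a") (auto simp: V'_def)
    qed (use insert.prems in \<open>auto simp: V'_def\<close>)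
    then obtain S B where SB: "S \<subseteq> A" "\<forall>s\<in>S. B s \<in> V'" "\<forall>f\<in>V'. f = (\<lambda>x. \<Sum>s\<in>S. f s * B s x)"
      "\<forall>s\<in>S. \<forall>t\<in>S. B s t = (if s = t then 1 else 0)" by (elim exE conjE) (rule that; assumption)
    have finS: "finite S" using SB(1) insert.hyps(1) finite_subset by blast
    have aS: "a \<notin> S" using SB(1) insert.hyps(2) by blast
    define b' where "b' = (\<lambda>x. b x - (\<Sum>s\<in>S. b s * B s x))"
    have "(\<lambda>x. f x - (\<Sum>s\<in>T. f s * B s x)) \<in> V" if "f \<in> V" "T \<subseteq> S" for f T
      using finite_subset[OF that(2) finS] that
    proof (induction T rule: finite_induct)
      case (insert t T)
      have "(\<lambda>x. (f x - (\<Sum>s\<in>T. f s * B s x)) + (-1 * f t) * B t x) \<in> V"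
      proof (rule add')
        show "(\<lambda>x. f x - (\<Sum>s\<in>T. f s * B s x)) \<in> V" using insert by blast
        show "B t \<in> V" using SB(2) insert.prems by (auto simp: V'_def)
        show "-1 * f t \<in> F" using F(1)[OF coord(2) coord'[OF \<open>f \<in> V\<close>]] .
      qed
      then show ?case using insert.hyps by (simp add: algebra_simps)
    qed simp
    then have b': "b' \<in> V" using b(1) by (simp add: b'_def)
    show ?thesis
    proof (intro exI[of _ "insert a S"] exI[of _ "\<lambda>s. if s = a then b' else B s"] conjI ballI)
      fix f assume f: "f \<in> V"
      have "(\<lambda>x. f x - f a * b x) \<in> V'" using red[OF f] b(2) by (simp add: V'_def)
      then have e: "(\<lambda>x. f x - f a * b x) = (\<lambda>x. \<Sum>s\<in>S. (f s - f a * b s) * B s x)"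
        by (rule SB(3)[rule_format])
      show "f = (\<lambda>x. \<Sum>s\<in>insert a S. f s * (if s = a then b' else B s) x)"
      proof
        fix x
        have "f x = f a * b x + (\<Sum>s\<in>S. (f s - f a * b s) * B s x)" using fun_cong[OF e, of x] by (simp add: algebra_simps)
        also have "\<dots> = f a * b' x + (\<Sum>s\<in>S. f s * B s x)"
          by (simp add: b'_def left_diff_distrib right_diff_distrib sum_subtractf sum_distrib_left mult.assoc)
        also have "(\<Sum>s\<in>S. f s * B s x) = (\<Sum>s\<in>S. f s * (if s = a then b' else B s) x)"
          using aS by (intro sum.cong) auto
        finally show "f x = (\<Sum>s\<in>insert a S. f s * (if s = a then b' else B s) x)" using aS finS by simp
      qed
    next
      have Ba: "B s a = 0" if "s \<in> S" for s using SB(2) that by (auto simp: V'_def)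
      then have b'a: "b' a = 1" using b(2) by (simp add: b'_def)
      have b't: "b' t = 0" if "t \<in> S" for t
      proof -
        have "(\<Sum>s\<in>S. b s * B s t) = (\<Sum>s\<in>S. if s = t then b s else 0)"
          using SB(4) that by (intro sum.cong) auto
        then show ?thesis using finS that by (simp add: b'_def)
      qed
      fix s t assume "s \<in> insert a S" "t \<in> insert a S"
      then show "(if s = a then b' else B s) t = (if s = t then 1 else 0)"
        using Ba b'a b't SB(4) aS by (cases "s = a"; cases "t = a") auto
    qed (use SB b' V'_def in auto)
  qed
qed

section \<open>Lattices of signature (2,n)\<close>

lemma matrix_apply:
  fixes f :: "complex^'N \<Rightarrow> complex^'M"
  assumes "\<And>x y. f (x + y) = f x + f y" "\<And>c x. f (c *s x) = c *s f x"
  shows "matrix f *v x = f x"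
  by (rule matrix_works) (unfold_locales; simp add: assms vec.scale_right_distrib vec.scale_left_distrib)

lemma bil_add_left: "bil Q (x + y) z = bil Q x z + bil Q y z"
  by (simp add: bil_def distrib_left distrib_right sum.distrib)

lemma bil_add_right: "bil Q z (x + y) = bil Q z x + bil Q z y"
  by (simp add: bil_def distrib_left distrib_right sum.distrib)

lemma bil_scale_left: "bil Q (c *s x) y = c * bil Q x y"
  by (simp add: bil_def sum_distrib_left mult_ac)

lemma bil_scale_right: "bil Q x (c *s y) = c * bil Q x y"
  by (simp add: bil_def sum_distrib_left mult_ac)

lemma bil_diff_left: "bil Q (x - y) z = bil Q x z - bil Q y z"
  using bil_add_left[of Q "x - y" y z] by simp

lemma bil_diff_right: "bil Q z (x - y) = bil Q z x - bil Q z y"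
  using bil_add_right[of Q z "x - y" y] by simp

lemma bil_zero_left [simp]: "bil Q 0 y = 0"
  by (simp add: bil_def)

lemma bil_zero_right [simp]: "bil Q y 0 = 0"
  by (simp add: bil_def)

lemma bil_minus_left: "bil Q (- x) y = - bil Q x y"
  using bil_diff_left[of Q 0 x y] by simp

lemma bil_minus_right: "bil Q x (- y) = - bil Q x y"
  using bil_diff_right[of Q x 0 y] by simp

lemmas bil_simps = bil_add_left bil_add_right bil_scale_left bil_scale_right bil_diff_left
  bil_diff_right bil_minus_left bil_minus_right

lemma bil_cnj: "bil Q (vec_cnj x) (vec_cnj y) = cnj (bil Q x y)"
  by (simp add: bil_def vec_cnj_def)

lemma continuous_on_bil [continuous_intros]:
  fixes f :: "'a::topological_space \<Rightarrow> complex^'N"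
  assumes "continuous_on S f" "continuous_on S g"
  shows "continuous_on S (\<lambda>x. bil Q (f x) (g x))"
  unfolding bil_def by (intro continuous_intros assms)

lemma tendsto_bil [tendsto_intros]:
  assumes "(f \<longlongrightarrow> a) F" "(g \<longlongrightarrow> b) F" shows "((\<lambda>x. bil Q (f x) (g x)) \<longlongrightarrow> bil Q a b) F"
  unfolding bil_def by (intro tendsto_intros assms)

subsection \<open>Rational and real vectors\<close>

lemma Rats_subset_Reals_complex: "(\<rat> :: complex set) \<subseteq> \<real>"
proof
  fix x :: complex assume "x \<in> \<rat>"
  then obtain p q :: int where "x = of_int p / of_int q" by (auto elim: Rats_cases')
  then show "x \<in> \<real>" by simp
qed

lemma vecs_mono: "F \<subseteq> G \<Longrightarrow> vecs F \<subseteq> vecs G"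
  by (auto simp: vecs_def)

lemma vecs_Ints_Rats: "x \<in> vecs \<int> \<Longrightarrow> x \<in> vecs \<rat>"
  using vecs_mono[OF Ints_subset_Rats] by blast

lemma vecs_Rats_Reals: "x \<in> vecs \<rat> \<Longrightarrow> x \<in> vecs \<real>"
  using vecs_mono[OF Rats_subset_Reals_complex] by blast

lemma vecs_UNIV [simp]: "vecs UNIV = UNIV"
  by (simp add: vecs_def)

lemma vecs_Reals_arith:
  "x \<in> vecs \<real> \<Longrightarrow> y \<in> vecs \<real> \<Longrightarrow> x + y \<in> vecs \<real>" "x \<in> vecs \<real> \<Longrightarrow> y \<in> vecs \<real> \<Longrightarrow> x - y \<in> vecs \<real>"
  "c \<in> \<real> \<Longrightarrow> x \<in> vecs \<real> \<Longrightarrow> c *s x \<in> vecs \<real>" "x \<in> vecs \<real> \<Longrightarrow> - x \<in> vecs \<real>" "0 \<in> vecs \<real>"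
  by (auto simp: vecs_def)

lemma vecs_Rats_arith:
  "x \<in> vecs \<rat> \<Longrightarrow> y \<in> vecs \<rat> \<Longrightarrow> x + y \<in> vecs \<rat>" "x \<in> vecs \<rat> \<Longrightarrow> y \<in> vecs \<rat> \<Longrightarrow> x - y \<in> vecs \<rat>"
  "c \<in> \<rat> \<Longrightarrow> x \<in> vecs \<rat> \<Longrightarrow> c *s x \<in> vecs \<rat>" "x \<in> vecs \<rat> \<Longrightarrow> - x \<in> vecs \<rat>" "0 \<in> vecs \<rat>"
  by (auto simp: vecs_def)

lemma vecs_Ints_arith:
  "x \<in> vecs \<int> \<Longrightarrow> y \<in> vecs \<int> \<Longrightarrow> x + y \<in> vecs \<int>" "x \<in> vecs \<int> \<Longrightarrow> y \<in> vecs \<int> \<Longrightarrow> x - y \<in> vecs \<int>"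
  "c \<in> \<int> \<Longrightarrow> x \<in> vecs \<int> \<Longrightarrow> c *s x \<in> vecs \<int>" "x \<in> vecs \<int> \<Longrightarrow> - x \<in> vecs \<int>" "0 \<in> vecs \<int>"
  by (auto simp: vecs_def)

lemma bil_Reals: "x \<in> vecs \<real> \<Longrightarrow> y \<in> vecs \<real> \<Longrightarrow> bil Q x y \<in> \<real>"
  unfolding bil_def vecs_def by (intro sum_in_Reals Reals_mult) auto

lemma bil_Rats: "x \<in> vecs \<rat> \<Longrightarrow> y \<in> vecs \<rat> \<Longrightarrow> bil Q x y \<in> \<rat>"
  unfolding bil_def vecs_def by (intro Rats_sum Rats_mult) auto

lemma bil_Ints: "x \<in> vecs \<int> \<Longrightarrow> y \<in> vecs \<int> \<Longrightarrow> bil Q x y \<in> \<int>"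
  unfolding bil_def vecs_def by (intro Ints_sum Ints_mult) auto

lemma bil_of_Re: "x \<in> vecs \<real> \<Longrightarrow> y \<in> vecs \<real> \<Longrightarrow> bil Q x y = of_real (Re (bil Q x y))"
  using bil_Reals[of x y Q] by (simp add: of_real_Re)

definition vec_Re :: "complex^'N \<Rightarrow> complex^'N" where
  "vec_Re v = (\<chi> i. of_real (Re (v $ i)))"

lemma vec_Re_Im: "v = vec_Re v + \<i> *s vec_Im v"
  by (simp add: vec_eq_iff vec_Re_def vec_Im_def complex_eq_iff)

lemma vec_cnj_eq: "vec_cnj v = vec_Re v - \<i> *s vec_Im v"
  by (simp add: vec_eq_iff vec_Re_def vec_Im_def vec_cnj_def complex_eq_iff)

lemma vec_Re_real [simp]: "vec_Re v \<in> vecs \<real>" and vec_Im_real [simp]: "vec_Im v \<in> vecs \<real>"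
  by (simp_all add: vec_Re_def vec_Im_def vecs_def)

lemma vec_Im_add: "vec_Im (x + y) = vec_Im x + vec_Im y"
  by (simp add: vec_eq_iff vec_Im_def)

lemma vec_Im_of_real: "x \<in> vecs \<real> \<Longrightarrow> vec_Im x = 0"
  by (auto simp: vec_eq_iff vec_Im_def vecs_def complex_is_Real_iff)

lemma vec_Im_scale: "x \<in> vecs \<real> \<Longrightarrow> vec_Im (c *s x) = of_real (Im c) *s x"
  by (auto simp: vec_eq_iff vec_Im_def vecs_def complex_is_Real_iff complex_eq_iff)

lemma bil_real_Re: "y \<in> vecs \<real> \<Longrightarrow> bil Q (vec_Re x) y = of_real (Re (bil Q x y))"
  and bil_real_Im: "y \<in> vecs \<real> \<Longrightarrow> bil Q (vec_Im x) y = of_real (Im (bil Q x y))"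
proof -
  assume y: "y \<in> vecs \<real>"
  have "bil Q x y = bil Q (vec_Re x) y + \<i> * bil Q (vec_Im x) y"
    by (subst vec_Re_Im[of x]) (simp add: bil_simps)
  then show "bil Q (vec_Re x) y = of_real (Re (bil Q x y))" "bil Q (vec_Im x) y = of_real (Im (bil Q x y))"
    using bil_Reals[OF vec_Re_real y, of Q x] bil_Reals[OF vec_Im_real y, of Q x]
    by (auto simp: complex_eq_iff complex_is_Real_iff)
qed

lemma rational_scale_to_int:
  assumes "x \<in> vecs \<rat>" obtains M :: int where "M > 0" "of_int M *s x \<in> vecs \<int>"
proof -
  have "\<exists>M::int. M > 0 \<and> (\<forall>i\<in>A. of_int M * x $ i \<in> \<int>)" for A :: "'a set"
  proof (induction A rule: finite_induct[OF finite])
    case 1 then show ?case by (intro exI[of _ 1]) simp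
  next
    case (2 a A)
    then obtain M :: int where M: "M > 0" "\<forall>i\<in>A. of_int M * x $ i \<in> \<int>" by blast
    have "x $ a \<in> \<rat>" using assms by (simp add: vecs_def)
    then obtain p q :: int where pq: "q > 0" "x $ a = of_int p / of_int q" by (auto elim: Rats_cases')
    have "of_int (M * q) * x $ i \<in> \<int>" if "i \<in> insert a A" for i
    proof (cases "i = a")
      case True
      then have "of_int (M * q) * x $ i = of_int (M * p)" using pq by simp
      then show ?thesis by (simp only: Ints_of_int)
    next
      case False
      have "of_int q * (of_int M * x $ i) \<in> \<int>" by (rule Ints_mult[OF Ints_of_int M(2)[rule_format]]) (use that False in auto)
      moreover have "of_int (M * q) * x $ i = of_int q * (of_int M * x $ i)" by simp
      ultimately show ?thesis by (simp only:)
    qed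
    then show ?case using M(1) pq(1) by (intro exI[of _ "M * q"]) simp
  qed
  from this[of UNIV] show ?thesis using that by (auto simp: vecs_def)
qed

subsection \<open>Signature\<close>

locale lat =
  fixes Q :: "int^'N^'N" and n :: nat
  assumes Qsym: "transpose Q = Q" and sig: "has_signature Q 2 n"
begin

lemma bil_sym: "bil Q x y = bil Q y x"
proof -
  have "Q $ i $ j = Q $ j $ i" for i j
    using arg_cong[OF Qsym, of "\<lambda>M. M $ j $ i"] by (simp add: transpose_def)
  then have "bil Q x y = (\<Sum>i\<in>UNIV. \<Sum>j\<in>UNIV. of_int (Q $ j $ i) * x $ i * y $ j)" by (simp add: bil_def)
  also have "\<dots> = bil Q y x" unfolding bil_def by (subst sum.swap) (simp add: mult_ac)
  finally show ?thesis .
qed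

text \<open>
  Transfers the change of basis in the definition of the signature to the real vectors inside \<open>complex^'N\<close>.
\<close>

lemma diagonalization:
  "\<exists>(s :: 'N \<Rightarrow> real) (c :: complex^'N \<Rightarrow> 'N \<Rightarrow> real).
    (\<forall>x y. x \<in> vecs \<real> \<longrightarrow> y \<in> vecs \<real> \<longrightarrow> Re (bil Q x y) = (\<Sum>i\<in>UNIV. s i * c x i * c y i)) \<and>
    (\<forall>x y i. c (x + y) i = c x i + c y i) \<and> (\<forall>r x i. c (of_real r *s x) i = r * c x i) \<and>
    (\<forall>x. x \<in> vecs \<real> \<longrightarrow> (\<forall>i. c x i = 0) \<longrightarrow> x = 0) \<and> (\<forall>i. s i = 1 \<or> s i = -1) \<and> card {i. s i = 1} = 2"
proof -
  obtain A :: "real^'N^'N" and s where A: "invertible A" "\<forall>i. s i = 1 \<or> s i = -1"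
    "transpose A ** map_matrix of_int Q ** A = (\<chi> i j. if i = j then s i else 0)"
    "card {i. s i = 1} = 2" "card {i. s i = -1} = n"
    using sig unfolding has_signature_def by blast
  define r :: "complex^'N \<Rightarrow> real^'N" where "r x = (\<chi> i. Re (x $ i))" for x
  obtain A' where A': "A ** A' = mat 1" using A(1) by (auto simp: invertible_def)
  define c where "c x i = (A' *v r x) $ i" for x i
  have Ac: "A *v (\<chi> i. c x i) = r x" for x
  proof -
    have "(\<chi> i. c x i) = A' *v r x" by (simp add: c_def vec_eq_iff)
    then show ?thesis using A' by (simp add: matrix_vector_mul_assoc)
  qed
  show ?thesis
  proof (intro exI[of _ s] exI[of _ c] conjI allI impI)
    fix x y :: "complex^'N" assume xy: "x \<in> vecs \<real>" "y \<in> vecs \<real>"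
    let ?Q = "map_matrix of_int Q :: real^'N^'N"
    have xr: "x $ i = of_real (r x $ i)" "y $ i = of_real (r y $ i)" for i
      using xy by (auto simp: r_def vecs_def)
    have "bil Q x y = of_real (\<Sum>i\<in>UNIV. \<Sum>j\<in>UNIV. of_int (Q $ i $ j) * r x $ i * r y $ j)"
      by (simp add: bil_def xr)
    then have "Re (bil Q x y) = (\<Sum>i\<in>UNIV. \<Sum>j\<in>UNIV. of_int (Q $ i $ j) * r x $ i * r y $ j)" by simp
    also have "\<dots> = r x \<bullet> (?Q *v r y)"
      by (simp add: inner_vec_def matrix_vector_mult_def sum_distrib_left map_matrix_def mult_ac)
    also have "\<dots> = (\<chi> i. c x i) \<bullet> (transpose A *v (?Q *v (A *v (\<chi> i. c y i))))"
    proof -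
      have "(A *v a) \<bullet> b = a \<bullet> (transpose A *v b)" for a b
        using dot_lmul_matrix[of a "transpose A" b] by (simp add: vector_transpose_matrix)
      from this[of "\<chi> i. c x i" "?Q *v r y"] show ?thesis by (simp only: Ac)
    qed
    also have "\<dots> = (\<chi> i. c x i) \<bullet> ((\<chi> i j. if i = j then s i else 0) *v (\<chi> i. c y i))"
      unfolding A(3)[symmetric] by (simp add: matrix_vector_mul_assoc matrix_mul_assoc)
    also have "\<dots> = (\<Sum>i\<in>UNIV. s i * c x i * c y i)"
      by (simp add: inner_vec_def matrix_vector_mult_def if_distrib if_distribR mult_ac cong: if_cong)
    finally show "Re (bil Q x y) = (\<Sum>i\<in>UNIV. s i * c x i * c y i)" .
  next
    fix x y :: "complex^'N" and i
    have "r (x + y) = r x + r y" by (simp add: r_def vec_eq_iff)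
    then show "c (x + y) i = c x i + c y i" by (simp add: c_def matrix_vector_right_distrib)
  next
    fix x :: "complex^'N" and t i
    have "r (of_real t *s x) = t *s r x" by (simp add: r_def vec_eq_iff)
    then show "c (of_real t *s x) i = t * c x i" by (simp add: c_def matrix_vector_mult_scaleR scalar_mult_eq_scaleR)
  next
    fix x :: "complex^'N" assume x: "x \<in> vecs \<real>" "\<forall>i. c x i = 0"
    then have "(\<chi> i. c x i) = 0" by (simp add: vec_eq_iff)
    then have "r x = 0" using Ac[of x] by simp
    then show "x = 0" using x(1) by (auto simp: r_def vec_eq_iff vecs_def complex_is_Real_iff complex_eq_iff)
  qed (use A in auto)
qed

lemma card_N: "CARD('N) = n + 2"
proof -
  obtain A :: "real^'N^'N" and s where A: "invertible A" "\<forall>i. s i = 1 \<or> s i = -1"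
    "transpose A ** map_matrix of_int Q ** A = (\<chi> i j. if i = j then s i else 0)"
    "card {i. s i = 1} = 2" "card {i. s i = -1} = n"
    using sig unfolding has_signature_def by blast
  have "UNIV = {i. s i = 1} \<union> {i. s i = -1}" using A(2) by auto
  then have "CARD('N) = card ({i. s i = 1} \<union> {i. s i = -1})" by simp
  also have "\<dots> = card {i. s i = 1} + card {i. s i = -1}" by (rule card_Un_disjoint) auto
  finally show "CARD('N) = n + 2" using A by simp
qed

text \<open>
  Otherwise the form would be positive semidefinite, of rank at least two, on the span of \<open>w\<close>, \<open>x\<close> and
  \<open>y\<close>.  This space contains a nonzero vector on which the two positive coordinates vanish, and its norm would be
  negative.
\<close>

lemma orthogonal_to_positive_plane:
  assumes real: "x \<in> vecs \<real>" "y \<in> vecs \<real>" "w \<in> vecs \<real>"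
    and pos: "Re (bil Q x x) > 0" "Re (bil Q y y) > 0" and orth: "bil Q x y = 0" "bil Q w x = 0" "bil Q w y = 0"
    and w: "Re (bil Q w w) \<ge> 0"
  shows "w = 0"
proof -
  obtain s :: "'N \<Rightarrow> real" and c :: "complex^'N \<Rightarrow> 'N \<Rightarrow> real" where
    B': "\<forall>x y. x \<in> vecs \<real> \<longrightarrow> y \<in> vecs \<real> \<longrightarrow> Re (bil Q x y) = (\<Sum>i\<in>UNIV. s i * c x i * c y i)"
    and c': "\<forall>x y i. c (x + y) i = c x i + c y i" "\<forall>r x i. c (of_real r *s x) i = r * c x i"
    and inj': "\<forall>x. x \<in> vecs \<real> \<longrightarrow> (\<forall>i. c x i = 0) \<longrightarrow> x = 0" and s: "\<forall>i. s i = 1 \<or> s i = -1" "card {i. s i = 1} = 2"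
    using diagonalization by blast
  note B = B'[rule_format] and c = c'[rule_format] and inj = inj'[rule_format]
  obtain i j where ij: "{i. s i = 1} = {i, j}" using s(2) by (auto simp: card_2_iff)
  have neg: "v = 0" if v: "v \<in> vecs \<real>" "c v i = 0" "c v j = 0" "Re (bil Q v v) \<ge> 0" for v
  proof (rule inj[OF v(1)])
    have eq: "s k * c v k * c v k = - (c v k)\<^sup>2" for k
    proof (cases "s k = 1")
      case True then have "k = i \<or> k = j" using ij by blast
      then show ?thesis using v by auto
    next
      case False then have "s k = -1" using s(1) by blast
      then show ?thesis by (simp add: power2_eq_square)
    qed
    have "0 \<le> (\<Sum>k\<in>UNIV. - (c v k)\<^sup>2)" using v(4) B[OF v(1) v(1)] by (simp add: eq)
    then have "(\<Sum>k\<in>UNIV. (c v k)\<^sup>2) = 0" by (simp add: sum_negf sum_nonneg antisym)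
    then show "c v k = 0" for k by (simp add: sum_nonneg_eq_0_iff)
  qed
  have comb: "of_real a *s w + of_real b *s x + of_real d *s y \<in> vecs \<real>"
    "Re (bil Q (of_real a *s w + of_real b *s x + of_real d *s y) (of_real a *s w + of_real b *s x + of_real d *s y))
      = a\<^sup>2 * Re (bil Q w w) + b\<^sup>2 * Re (bil Q x x) + d\<^sup>2 * Re (bil Q y y)" for a b d
  proof -
    show "of_real a *s w + of_real b *s x + of_real d *s y \<in> vecs \<real>"
      by (intro vecs_Reals_arith real) auto
    have o': "bil Q y x = 0" "bil Q x w = 0" "bil Q y w = 0"
      using orth bil_sym[of y x] bil_sym[of x w] bil_sym[of y w] by simp_all
    show "Re (bil Q (of_real a *s w + of_real b *s x + of_real d *s y) (of_real a *s w + of_real b *s x + of_real d *s y))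
      = a\<^sup>2 * Re (bil Q w w) + b\<^sup>2 * Re (bil Q x x) + d\<^sup>2 * Re (bil Q y y)"
      by (simp add: bil_simps orth o' power2_eq_square)
  qed
  have key: "b = 0 \<and> d = 0 \<and> (a \<noteq> 0 \<longrightarrow> w = 0)"
    if "a * c w i + b * c x i + d * c y i = 0" "a * c w j + b * c x j + d * c y j = 0" for a b d
  proof -
    let ?v = "of_real a *s w + of_real b *s x + of_real d *s y"
    have nn: "a\<^sup>2 * Re (bil Q w w) \<ge> 0" "b\<^sup>2 * Re (bil Q x x) \<ge> 0" "d\<^sup>2 * Re (bil Q y y) \<ge> 0" using pos w by auto
    have v0: "?v = 0"
      by (rule neg[OF comb(1)]) (use that nn comb(2)[of a b d] in \<open>auto simp: c\<close>)
    then have z: "a\<^sup>2 * Re (bil Q w w) + b\<^sup>2 * Re (bil Q x x) + d\<^sup>2 * Re (bil Q y y) = 0"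
      using comb(2)[of a b d] by simp
    then have "b\<^sup>2 * Re (bil Q x x) = 0" "d\<^sup>2 * Re (bil Q y y) = 0" using nn by linarith+
    then have "b = 0" "d = 0" using pos by auto
    then show ?thesis using v0 by auto
  qed
  define al where "al = c x i * c y j - c x j * c y i"
  have "al \<noteq> 0"
  proof
    assume al: "al = 0"
    have 1: "c y i = 0 \<and> c x i = 0"
      using key[of 0 "c y i" "- c x i"] al by (auto simp: al_def algebra_simps)
    have 2: "c y j = 0 \<and> c x j = 0"
      using key[of 0 "c y j" "- c x j"] al by (auto simp: al_def algebra_simps)
    show False using key[of 0 1 0] 1 2 by simp
  qed
  \<comment> \<open>Cramer's rule: the two positive coordinates vanish on this combination of \<open>w\<close>, \<open>x\<close> and \<open>y\<close>.\<close>
  moreover have "al * c w i + (c y i * c w j - c y j * c w i) * c x i + (c w i * c x j - c w j * c x i) * c y i = 0"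
    "al * c w j + (c y i * c w j - c y j * c w i) * c x j + (c w i * c x j - c w j * c x i) * c y j = 0"
    by (simp_all add: al_def algebra_simps)
  ultimately show ?thesis using key by blast
qed

subsection \<open>Nondegeneracy over the rationals\<close>

text \<open>
  The determinant of the Gram matrix is nonzero, hence the coordinate functions are given by rational vectors.
\<close>

lemma dual_basis:
  "\<exists>k :: 'N \<Rightarrow> complex^'N. (\<forall>i. k i \<in> vecs \<rat>) \<and> (\<forall>i x. bil Q (k i) x = x $ i)"
proof -
  have det_hom: "det (map_matrix of_int Q :: 'a::field^'N^'N) = of_int (det Q)"
    by (simp add: det_def map_matrix_def)
  obtain A :: "real^'N^'N" and s where A: "invertible A" "\<forall>i. s i = 1 \<or> s i = -1"
    "transpose A ** map_matrix of_int Q ** A = (\<chi> i j. if i = j then s i else 0)"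
    using sig unfolding has_signature_def by blast
  have "det (transpose A ** map_matrix of_int Q ** A) = (\<Prod>i\<in>UNIV. s i)"
    unfolding A(3) by (subst det_diagonal) auto
  moreover have "(\<Prod>i\<in>UNIV. s i) \<noteq> 0" using A(2) by (auto simp: prod_zero_iff) (metis zero_neq_neg_one zero_neq_one)
  ultimately have "det (map_matrix of_int Q :: real^'N^'N) \<noteq> 0" by (auto simp: det_mul)
  then have "det Q \<noteq> 0" unfolding det_hom by simp
  then have "det (map_matrix of_int Q :: rat^'N^'N) \<noteq> 0" unfolding det_hom by simp
  then have "invertible (map_matrix of_int Q :: rat^'N^'N)" by (simp add: invertible_det_nz)
  then obtain R :: "rat^'N^'N" where R: "R ** map_matrix of_int Q = mat 1" by (auto simp: invertible_def)
  define k :: "'N \<Rightarrow> complex^'N" where "k i = (\<chi> j. of_rat (R $ i $ j))" for i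
  show ?thesis
  proof (intro exI[of _ k] conjI allI)
    show "k i \<in> vecs \<rat>" for i by (simp add: k_def vecs_def)
    show "bil Q (k i) x = x $ i" for i x
    proof -
      have "(\<Sum>j\<in>UNIV. of_int (Q $ j $ l) * of_rat (R $ i $ j)) = (if i = l then 1 else 0 :: complex)" for l
      proof -
        have "(\<Sum>j\<in>UNIV. R $ i $ j * of_int (Q $ j $ l)) = (if i = l then 1 else 0)"
          using arg_cong[OF R, of "\<lambda>M. M $ i $ l"] by (simp add: matrix_matrix_mult_def map_matrix_def mat_def)
        from arg_cong[OF this, of "of_rat :: rat \<Rightarrow> complex"] show ?thesis
          by (simp add: of_rat_sum of_rat_mult mult.commute split: if_splits)
      qed
      then have "(\<Sum>l\<in>UNIV. (\<Sum>j\<in>UNIV. of_int (Q $ j $ l) * of_rat (R $ i $ j)) * x $ l)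
          = (\<Sum>l\<in>UNIV. (if i = l then 1 else 0) * x $ l)"
        by (simp only:)
      also have "\<dots> = x $ i" by (simp add: if_distrib if_distribR cong: if_cong)
      finally show ?thesis unfolding bil_def k_def
        by (subst sum.swap) (simp add: sum_distrib_right)
    qed
  qed
qed

lemma nondegenerate: "(\<And>y. y \<in> vecs \<rat> \<Longrightarrow> bil Q x y = 0) \<Longrightarrow> x = 0"
proof -
  assume x: "\<And>y. y \<in> vecs \<rat> \<Longrightarrow> bil Q x y = 0"
  obtain k :: "'N \<Rightarrow> complex^'N" where k: "\<forall>i. k i \<in> vecs \<rat>" "\<forall>i x. bil Q (k i) x = x $ i"
    using dual_basis by blast
  have "x $ i = 0" for i using x[OF k(1)[rule_format, of i]] k(2)[rule_format, of i x] bil_sym[of x "k i"] by simp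
  then show "x = 0" by (simp add: vec_eq_iff)
qed

end

section \<open>The tube domain realization\<close>

lemma UI_iff: "z \<in> UI Q F e e' \<longleftrightarrow> z \<in> vecs F \<and> bil Q z e = 0 \<and> bil Q z e' = 0"
  by (auto simp: UI_def perp_def)

lemma line_eq: "line \<omega> = {c *s \<omega> |c. True}"
  by (auto simp: line_def vec.span_singleton)

lemma line_scale: "c \<noteq> 0 \<Longrightarrow> line (c *s \<omega>) = line \<omega>"
proof -
  assume c: "c \<noteq> 0"
  have "x \<in> line (c *s \<omega>)" if x: "x \<in> line \<omega>" for x
  proof -
    obtain d where "x = d *s \<omega>" using x by (auto simp: line_eq)
    then have "x = (d / c) *s (c *s \<omega>)" using c by (simp add: vector_smult_assoc)
    then show ?thesis unfolding line_eq by blast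
  qed
  moreover have "line (c *s \<omega>) \<subseteq> line \<omega>" by (auto simp: line_eq vector_smult_assoc)
  ultimately show ?thesis by blast
qed

lemma line_eqD:
  assumes "line \<omega> = line \<omega>'" "\<omega> \<noteq> 0" shows "\<exists>c. c \<noteq> 0 \<and> \<omega> = c *s \<omega>'"
proof -
  have "\<omega> \<in> line \<omega>" unfolding line_eq by (auto intro: exI[of _ 1])
  then obtain c where "\<omega> = c *s \<omega>'" using assms(1) by (auto simp: line_eq)
  then show ?thesis using assms(2) by (intro exI[of _ c]) auto
qed

lemma vecs_Re_UI:
  "e \<in> vecs \<real> \<Longrightarrow> e' \<in> vecs \<real> \<Longrightarrow> z \<in> UI Q UNIV e e' \<Longrightarrow> vec_Re z \<in> UI Q \<real> e e' \<and> vec_Im z \<in> UI Q \<real> e e'"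
  by (auto simp: UI_iff bil_real_Re bil_real_Im)

lemma topspace_proj_space: "topspace proj_space = line ` (- {0 :: complex^'N})"
proof
  show "topspace proj_space \<subseteq> line ` (- {0 :: complex^'N})"
    using openin_topspace[of proj_space] unfolding openin_proj_space by (rule conjunct1)
  have "{\<omega>. \<omega> \<noteq> 0 \<and> line \<omega> \<in> line ` (- {0 :: complex^'N})} = - {0 :: complex^'N}" by auto
  then have "openin proj_space (line ` (- {0 :: complex^'N}))"
    unfolding openin_proj_space by (simp add: open_Compl)
  then show "line ` (- {0 :: complex^'N}) \<subseteq> topspace proj_space" by (rule openin_subset)
qed

text \<open>
  Continuity into the quotient topology, for the projectivization of a nowhere vanishing map.
\<close>

lemma connectedin_line_image:
  fixes f :: "'a::topological_space \<Rightarrow> complex^'N"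
  assumes "continuous_on S f" "\<And>x. x \<in> S \<Longrightarrow> f x \<noteq> 0" "connected S"
  shows "connectedin proj_space ((\<lambda>x. line (f x)) ` S)"
proof (rule connectedin_continuous_map_image[of "top_of_set S"])
  show "continuous_map (top_of_set S) proj_space (\<lambda>x. line (f x))"
    unfolding continuous_map
  proof (intro conjI allI impI)
    show "(\<lambda>x. line (f x)) ` topspace (top_of_set S) \<subseteq> topspace proj_space"
      using assms(2) by (auto simp: topspace_proj_space)
    fix U :: "(complex^'N) set set" assume "openin proj_space U"
    then have "open {\<omega>. \<omega> \<noteq> 0 \<and> line \<omega> \<in> U}" by (simp add: openin_proj_space)
    then have "openin (top_of_set S) (S \<inter> f -` {\<omega>. \<omega> \<noteq> 0 \<and> line \<omega> \<in> U})"
      using assms(1) continuous_openin_preimage_gen by blast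
    moreover have "S \<inter> f -` {\<omega>. \<omega> \<noteq> 0 \<and> line \<omega> \<in> U} = {x \<in> topspace (top_of_set S). line (f x) \<in> U}"
      using assms(2) by auto
    ultimately show "openin (top_of_set S) {x \<in> topspace (top_of_set S). line (f x) \<in> U}" by simp
  qed
  show "connectedin (top_of_set S) S" using assms(3) by (simp add: connectedin_subtopology)
qed

lemma tube_coord_scale: "c \<noteq> 0 \<Longrightarrow> tube_coord Q e e' (c *s \<omega>) = tube_coord Q e e' \<omega>"
  by (simp add: tube_coord_def bil_simps vec_eq_iff)

context lat begin

lemma period_space_iff: "line \<omega> \<in> period_space Q \<longleftrightarrow> bil Q \<omega> \<omega> = 0 \<and> 0 < Re (bil Q \<omega> (vec_cnj \<omega>))"
proof
  assume "line \<omega> \<in> period_space Q"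
  then obtain w where w: "line \<omega> = line w" "bil Q w w = 0" "0 < Re (bil Q w (vec_cnj w))"
    by (auto simp: period_space_def)
  have "w \<noteq> 0" using w(3) by auto
  then obtain c where c: "c \<noteq> 0" "w = c *s \<omega>" using line_eqD[OF w(1)[symmetric]] by blast
  have "vec_cnj (c *s \<omega>) = cnj c *s vec_cnj \<omega>" by (simp add: vec_eq_iff vec_cnj_def)
  then have e: "bil Q w (vec_cnj w) = of_real ((norm c)\<^sup>2) * bil Q \<omega> (vec_cnj \<omega>)"
    unfolding c(2) complex_norm_square by (simp add: bil_simps mult_ac)
  have "0 < (norm c)\<^sup>2 * Re (bil Q \<omega> (vec_cnj \<omega>))" using w(3) unfolding e by simp
  then show "bil Q \<omega> \<omega> = 0 \<and> 0 < Re (bil Q \<omega> (vec_cnj \<omega>))"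
    using w(2) c by (simp add: bil_simps zero_less_mult_iff)
qed (auto simp: period_space_def)

text \<open>
  The domain is a connected component, so it is enough to connect points inside the period space.
\<close>

lemma cone_path:
  fixes \<gamma> :: "real \<Rightarrow> complex^'N"
  assumes D: "period_domain Q D" and "continuous_on {0..1} \<gamma>" "\<gamma> 0 \<in> cone D"
    and per: "\<And>t. t \<in> {0..1} \<Longrightarrow> bil Q (\<gamma> t) (\<gamma> t) = 0 \<and> 0 < Re (bil Q (\<gamma> t) (vec_cnj (\<gamma> t)))"
  shows "\<gamma> 1 \<in> cone D"
proof -
  have nz: "\<gamma> t \<noteq> 0" if "t \<in> {0..1}" for t using per[OF that] by auto
  let ?K = "(\<lambda>t. line (\<gamma> t)) ` {0..1}"
  have "connectedin (subtopology proj_space (period_space Q)) ?K"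
    unfolding connectedin_subtopology
    using connectedin_line_image[OF assms(2) nz] per by (auto simp: period_space_iff)
  moreover have "\<not> disjnt D ?K" using assms(3) by (auto simp: disjnt_def cone_def)
  ultimately have "?K \<subseteq> D" using connected_components_of_maximal D unfolding period_domain_def by blast
  then show ?thesis using nz[of 1] by (auto simp: cone_def)
qed

end

locale cusp = lat Q n for Q :: "int^'N^'N" and n +
  fixes e e' :: "complex^'N"
  assumes cusp: "(e, e') \<in> cusp_data Q"
begin

lemma e_int: "e \<in> vecs \<int>"
proof -
  have "e \<in> fspan \<int> {e}" unfolding fspan_def
    by (intro CollectI exI[of _ "{e}"] exI[of _ "\<lambda>_. 1"]) auto
  then show ?thesis using cusp by (auto simp: cusp_data_def primitive_isotropic_def)
qed

lemma ee: "bil Q e e = 0"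
proof -
  have "e \<in> fspan \<int> {e}" unfolding fspan_def
    by (intro CollectI exI[of _ "{e}"] exI[of _ "\<lambda>_. 1"]) auto
  then show ?thesis using cusp by (auto simp: cusp_data_def primitive_isotropic_def)
qed

lemma e'_rat: "e' \<in> vecs \<rat>" and e'e': "bil Q e' e' = 0" and ee': "bil Q e e' = 1" and e'e: "bil Q e' e = 1"
  using cusp bil_sym[of e' e] by (auto simp: cusp_data_def)

lemma e_rat: "e \<in> vecs \<rat>" and e_real: "e \<in> vecs \<real>" and e'_real: "e' \<in> vecs \<real>"
  using e_int e'_rat vecs_Ints_Rats vecs_Rats_Reals by blast+

lemmas cusp_bil = ee ee' e'e e'e'

definition proj_UI :: "complex^'N \<Rightarrow> complex^'N" where "proj_UI x = x - bil Q x e' *s e - bil Q x e *s e'"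

lemma proj_UI_in: "proj_UI x \<in> UI Q UNIV e e'"
  by (simp add: UI_iff proj_UI_def bil_simps cusp_bil)

lemma proj_UI_rat: "x \<in> vecs \<rat> \<Longrightarrow> proj_UI x \<in> UI Q \<rat> e e'"
  using proj_UI_in[of x] unfolding proj_UI_def UI_iff
  by (auto intro!: vecs_Rats_arith bil_Rats e_rat e'_rat)

lemma bil_proj_UI: "u \<in> UI Q UNIV e e' \<Longrightarrow> bil Q u (proj_UI x) = bil Q u x"
  by (simp add: UI_iff proj_UI_def bil_simps)

lemma UI_mono: "z \<in> UI Q F e e' \<Longrightarrow> z \<in> UI Q UNIV e e'"
  by (simp add: UI_iff)

lemma UI_Rats_Reals: "z \<in> UI Q \<rat> e e' \<Longrightarrow> z \<in> UI Q \<real> e e'"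
  by (auto simp: UI_iff vecs_Rats_Reals)

lemma UI_nondegenerate:
  assumes "u \<in> UI Q UNIV e e'" "\<And>y. y \<in> UI Q \<rat> e e' \<Longrightarrow> bil Q u y = 0" shows "u = 0"
  by (rule nondegenerate) (use assms proj_UI_rat bil_proj_UI in metis)

lemma UI_arith:
  "x \<in> UI Q UNIV e e' \<Longrightarrow> y \<in> UI Q UNIV e e' \<Longrightarrow> x + y \<in> UI Q UNIV e e'"
  "x \<in> UI Q UNIV e e' \<Longrightarrow> y \<in> UI Q UNIV e e' \<Longrightarrow> x - y \<in> UI Q UNIV e e'"
  "x \<in> UI Q UNIV e e' \<Longrightarrow> c *s x \<in> UI Q UNIV e e'" "0 \<in> UI Q UNIV e e'"
  by (auto simp: UI_iff bil_simps)

lemma UI_Reals_arith: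
  "x \<in> UI Q \<real> e e' \<Longrightarrow> y \<in> UI Q \<real> e e' \<Longrightarrow> x + y \<in> UI Q \<real> e e'"
  "x \<in> UI Q \<real> e e' \<Longrightarrow> y \<in> UI Q \<real> e e' \<Longrightarrow> x - y \<in> UI Q \<real> e e'"
  "c \<in> \<real> \<Longrightarrow> x \<in> UI Q \<real> e e' \<Longrightarrow> c *s x \<in> UI Q \<real> e e'" "0 \<in> UI Q \<real> e e'"
  "x \<in> UI Q \<real> e e' \<Longrightarrow> - x \<in> UI Q \<real> e e'"
  by (auto simp: UI_iff bil_simps vecs_Reals_arith)

lemma UI_Rats_arith:
  "x \<in> UI Q \<rat> e e' \<Longrightarrow> y \<in> UI Q \<rat> e e' \<Longrightarrow> x + y \<in> UI Q \<rat> e e'"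
  "x \<in> UI Q \<rat> e e' \<Longrightarrow> y \<in> UI Q \<rat> e e' \<Longrightarrow> x - y \<in> UI Q \<rat> e e'"
  "c \<in> \<rat> \<Longrightarrow> x \<in> UI Q \<rat> e e' \<Longrightarrow> c *s x \<in> UI Q \<rat> e e'" "0 \<in> UI Q \<rat> e e'"
  "x \<in> UI Q \<rat> e e' \<Longrightarrow> - x \<in> UI Q \<rat> e e'"
  by (auto simp: UI_iff bil_simps vecs_Rats_arith)

lemma bil_UI_real: "x \<in> UI Q \<real> e e' \<Longrightarrow> y \<in> UI Q \<real> e e' \<Longrightarrow> bil Q x y = of_real (Re (bil Q x y))"
  by (rule bil_of_Re) (auto simp: UI_iff)

text \<open>
  The form on \<open>{e, e'}\<^sup>\<bottom>\<close> has signature \<open>(1, n - 1)\<close>: the vector \<open>e + e'\<close> of norm 2 and \<open>y\<close> already span a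
  positive plane.
\<close>

lemma timelike_complement:
  assumes "y \<in> UI Q \<real> e e'" "0 < Re (bil Q y y)" "w \<in> UI Q \<real> e e'" "bil Q w y = 0" "0 \<le> Re (bil Q w w)"
  shows "w = 0"
proof (rule orthogonal_to_positive_plane[of "e + e'" y w])
  show "e + e' \<in> vecs \<real>" by (intro vecs_Reals_arith e_real e'_real)
  show "bil Q (e + e') y = 0" using assms(1) bil_sym[of e y] bil_sym[of e' y] by (simp add: UI_iff bil_simps)
qed (use assms in \<open>auto simp: UI_iff bil_simps cusp_bil\<close>)

lemma timelike_pairing:
  assumes "y \<in> UI Q \<real> e e'" "0 < Re (bil Q y y)" "u \<in> UI Q \<real> e e'" "0 \<le> Re (bil Q u u)" "u \<noteq> 0"
  shows "Re (bil Q u y) \<noteq> 0"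
  using timelike_complement[OF assms(1-3)] bil_UI_real[OF assms(3,1)] assms(4,5) by (metis of_real_0)

text \<open>
  The reversed Cauchy-Schwarz inequality of Lorentzian geometry: subtracting from \<open>v\<close> the multiple of \<open>u\<close> that
  makes it orthogonal to \<open>y\<close> leaves a vector of nonpositive norm.
\<close>

lemma same_side:
  assumes y: "y \<in> UI Q \<real> e e'" "0 < Re (bil Q y y)"
    and u: "u \<in> UI Q \<real> e e'" "0 \<le> Re (bil Q u u)" "0 < Re (bil Q u y)"
    and v: "v \<in> UI Q \<real> e e'" "0 \<le> Re (bil Q v v)" "0 < Re (bil Q v y)"
  shows "0 \<le> Re (bil Q u v)" "0 < Re (bil Q u u) \<or> 0 < Re (bil Q v v) \<Longrightarrow> 0 < Re (bil Q u v)"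
proof -
  define c where "c = Re (bil Q v y) / Re (bil Q u y)"
  have c: "c > 0" using u v by (simp add: c_def)
  define w where "w = v - of_real c *s u"
  have w: "w \<in> UI Q \<real> e e'" unfolding w_def by (intro UI_Reals_arith u v) simp
  have "bil Q w y = 0"
    using u(3) bil_UI_real[OF u(1) y(1)] bil_UI_real[OF v(1) y(1)]
    by (simp add: w_def bil_simps c_def complex_eq_iff)
  have ww: "Re (bil Q w w) = Re (bil Q v v) - 2 * c * Re (bil Q u v) + c\<^sup>2 * Re (bil Q u u)"
    by (simp add: w_def bil_simps bil_sym[of v u] power2_eq_square algebra_simps)
  have "0 \<le> Re (bil Q u v) \<and> (0 < Re (bil Q u u) \<or> 0 < Re (bil Q v v) \<longrightarrow> 0 < Re (bil Q u v))"
  proof (cases "0 \<le> Re (bil Q w w)")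
    case True
    then have "w = 0" using timelike_complement[OF y w \<open>bil Q w y = 0\<close>] by simp
    then have "v = of_real c *s u" by (simp add: w_def)
    then show ?thesis using c u(2) by (auto simp: bil_simps zero_less_mult_iff)
  next
    case False
    then have "2 * c * Re (bil Q u v) > Re (bil Q v v) + c\<^sup>2 * Re (bil Q u u)" using ww by linarith
    moreover have "Re (bil Q v v) + c\<^sup>2 * Re (bil Q u u) \<ge> 0" using u v by simp
    ultimately have "0 < 2 * c * Re (bil Q u v)" by linarith
    then show ?thesis using c by (simp add: zero_less_mult_iff)
  qed
  then show "0 \<le> Re (bil Q u v)" "0 < Re (bil Q u u) \<or> 0 < Re (bil Q v v) \<Longrightarrow> 0 < Re (bil Q u v)" by auto
qed

definition timelike :: "complex^'N \<Rightarrow> bool" where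
  "timelike u \<longleftrightarrow> u \<in> UI Q \<real> e e' \<and> 0 < Re (bil Q u u)"

text \<open>
  One of the two components of the cone of vectors of positive norm, the one that contains \<open>u\<close>.
\<close>

definition half_cone :: "complex^'N \<Rightarrow> (complex^'N) set" where
  "half_cone u = {v. timelike v \<and> 0 < Re (bil Q v u)}"

lemma half_cone_pairing: "timelike u \<Longrightarrow> v \<in> half_cone u \<Longrightarrow> w \<in> half_cone u \<Longrightarrow> 0 < Re (bil Q v w)"
  by (rule same_side(2)[of u]) (auto simp: half_cone_def timelike_def)

lemma half_cone_eq:
  assumes "timelike u" "u' \<in> half_cone u" shows "half_cone u' = half_cone u"
proof -
  have u': "timelike u'" using assms by (simp add: half_cone_def)
  have "u \<in> half_cone u'" using assms bil_sym[of u u'] by (simp add: half_cone_def)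
  then have "v \<in> half_cone u" if "v \<in> half_cone u'" for v
    using half_cone_pairing[OF u' that] that by (simp add: half_cone_def)
  moreover have "v \<in> half_cone u'" if "v \<in> half_cone u" for v
    using half_cone_pairing[OF assms(1) that assms(2)] that by (simp add: half_cone_def)
  ultimately show ?thesis by blast
qed

lemma half_cone_self: "timelike u \<Longrightarrow> u \<in> half_cone u"
  by (simp add: half_cone_def timelike_def)

lemma half_cone_add:
  assumes u: "timelike u" and v: "v \<in> half_cone u"
    and w: "w \<in> UI Q \<real> e e'" "0 \<le> Re (bil Q w w)" "0 < Re (bil Q w u)"
  shows "v + w \<in> half_cone u"
proof -
  have "0 < Re (bil Q v w)" by (rule same_side(2)[of u]) (use u v w in \<open>auto simp: half_cone_def timelike_def\<close>)
  then show ?thesis using v w bil_sym[of w v]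
    by (auto simp: half_cone_def timelike_def bil_simps intro!: UI_Reals_arith add_pos_nonneg)
qed

lemma half_cone_scale: "v \<in> half_cone u \<Longrightarrow> r > 0 \<Longrightarrow> of_real r *s v \<in> half_cone u"
  by (auto simp: half_cone_def timelike_def bil_simps intro!: UI_Reals_arith)

lemma half_cone_combination:
  assumes "timelike u" "v \<in> half_cone u" "w \<in> half_cone u" "0 \<le> a" "0 \<le> b" "a + b = 1"
  shows "of_real a *s v + of_real b *s w \<in> half_cone u"
proof (cases "a = 0 \<or> b = 0")
  case True then show ?thesis using assms by auto
next
  case False
  then have "of_real a *s v \<in> half_cone u" "of_real b *s w \<in> half_cone u"
    using assms by (auto intro: half_cone_scale)
  then show ?thesis using half_cone_add[OF assms(1)] by (simp add: half_cone_def timelike_def)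
qed

lemma scaleR_eq: "r *\<^sub>R x = of_real r *s (x :: complex^'N)"
  by (simp add: vec_eq_iff) (simp add: scaleR_conv_of_real)

lemma half_cone_convex: "timelike u \<Longrightarrow> convex (half_cone u)"
  by (rule convexI) (simp add: scaleR_eq half_cone_combination)

lemma half_cone_open:
  assumes "v \<in> half_cone u"
  shows "\<exists>\<delta>>0. \<forall>y\<in>UI Q \<real> e e'. norm y < \<delta> \<longrightarrow> v + y \<in> half_cone u"
proof -
  have "open {x. 0 < Re (bil Q x x) \<and> 0 < Re (bil Q x u)}"
    by (intro open_Collect_conj open_Collect_less continuous_intros)
  moreover have "v \<in> {x. 0 < Re (bil Q x x) \<and> 0 < Re (bil Q x u)}" using assms by (simp add: half_cone_def timelike_def)
  ultimately obtain d where d: "d > 0" "ball v d \<subseteq> {x. 0 < Re (bil Q x x) \<and> 0 < Re (bil Q x u)}"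
    using open_contains_ball by blast
  have "v + y \<in> half_cone u" if "y \<in> UI Q \<real> e e'" "norm y < d" for y
  proof -
    have "v + y \<in> ball v d" using that(2) by (simp add: dist_norm)
    then show ?thesis using d(2) that(1) assms
      by (auto simp: half_cone_def timelike_def intro!: UI_Reals_arith)
  qed
  then show ?thesis using d(1) by blast
qed

text \<open>
  Pairing with \<open>u\<close> cannot vanish on timelike vectors, so its sign is constant on components.
\<close>

lemma half_cone_component:
  assumes u: "timelike u"
  shows "connected_component_set {v. timelike v} u = half_cone u"
proof
  show "half_cone u \<subseteq> connected_component_set {v. timelike v} u"
    by (rule connected_component_maximal[OF half_cone_self[OF u] convex_connected[OF half_cone_convex[OF u]]])
       (auto simp: half_cone_def)
  show "connected_component_set {v. timelike v} u \<subseteq> half_cone u"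
  proof
    fix v assume v: "v \<in> connected_component_set {v. timelike v} u"
    let ?K = "connected_component_set {v. timelike v} u"
    have K: "?K \<subseteq> {v. timelike v}" by (rule connected_component_subset)
    have uK: "u \<in> ?K" using u by simp
    have "connected ((\<lambda>x. Re (bil Q x u)) ` ?K)"
      by (intro connected_continuous_image continuous_intros connected_connected_component)
    moreover have "0 < Re (bil Q u u)" using u by (simp add: timelike_def)
    moreover have "0 \<notin> (\<lambda>x. Re (bil Q x u)) ` ?K"
    proof
      assume "0 \<in> (\<lambda>x. Re (bil Q x u)) ` ?K"
      then obtain x where "x \<in> ?K" "Re (bil Q x u) = 0" by auto
      moreover have "x \<noteq> 0" using K \<open>x \<in> ?K\<close> by (auto simp: timelike_def)
      ultimately show False using timelike_pairing[of u x] K u by (auto simp: timelike_def)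
    qed
    ultimately have "0 < Re (bil Q v u)"
      using connectedD_interval[of "(\<lambda>x. Re (bil Q x u)) ` ?K" "Re (bil Q v u)" "Re (bil Q u u)" 0] uK v
      by (metis image_eqI less_le_not_le linorder_not_less)
    then show "v \<in> half_cone u" using v K by (auto simp: half_cone_def)
  qed
qed

lemma closure_half_cone:
  assumes "timelike u" "z \<in> closure (half_cone u)"
  shows "z \<in> UI Q \<real> e e'" "0 \<le> Re (bil Q z z)" "0 \<le> Re (bil Q z u)" "z \<noteq> 0 \<Longrightarrow> 0 < Re (bil Q z u)"
proof -
  let ?A = "{x. (\<forall>i. x $ i \<in> \<real>) \<and> bil Q x e = 0 \<and> bil Q x e' = 0 \<and> 0 \<le> Re (bil Q x x) \<and> 0 \<le> Re (bil Q x u)}"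
  have "closed ?A"
    unfolding complex_is_Real_iff
    by (intro closed_Collect_conj closed_Collect_all closed_Collect_eq closed_Collect_le continuous_intros)
  moreover have "half_cone u \<subseteq> ?A" by (auto simp: half_cone_def timelike_def UI_iff vecs_def)
  ultimately have z: "z \<in> ?A" using closure_minimal assms(2) by blast
  then show 1: "z \<in> UI Q \<real> e e'" "0 \<le> Re (bil Q z z)" "0 \<le> Re (bil Q z u)" by (auto simp: UI_iff vecs_def)
  show "0 < Re (bil Q z u)" if "z \<noteq> 0"
    using timelike_pairing[of u z] assms(1) 1 that by (auto simp: timelike_def)
qed

text \<open>
  Approach \<open>z\<close> by adding small multiples of \<open>u\<close>.
\<close>

lemma isotropic_in_closure:
  assumes u: "timelike u" and z: "z \<in> UI Q \<real> e e'" "0 \<le> Re (bil Q z z)" "0 < Re (bil Q z u)"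
  shows "z \<in> closure (half_cone u)"
proof -
  have "(\<lambda>n. z + of_real (1 / real (Suc n)) *s u) \<longlonglongrightarrow> z + of_real 0 *s u"
    unfolding scaleR_eq[symmetric] by (intro tendsto_intros LIMSEQ_Suc lim_1_over_n)
  moreover have "z + of_real (1 / real (Suc n)) *s u \<in> half_cone u" for n
    using half_cone_add[OF u half_cone_scale[OF half_cone_self[OF u]] z, of "1 / real (Suc n)"] by (simp add: add.commute)
  ultimately show ?thesis unfolding closure_sequential by (intro exI conjI allI) auto
qed

lemma half_cone_add_closure:
  assumes u: "timelike u" and v: "v \<in> half_cone u" and z: "z \<in> closure (half_cone u)" and "t \<ge> 0"
  shows "v + of_real t *s z \<in> half_cone u"
proof (cases "t = 0 \<or> z = 0")
  case True then show ?thesis using v by auto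
next
  case False
  note c = closure_half_cone[OF u z]
  show ?thesis
    by (rule half_cone_add[OF u v]) (use c False assms(4) in \<open>auto simp: bil_simps intro!: UI_Reals_arith mult_nonneg_nonneg\<close>)
qed

definition tube_over :: "complex^'N \<Rightarrow> (complex^'N) set" where
  "tube_over u = {Z \<in> UI Q UNIV e e'. vec_Im Z \<in> half_cone u}"

lemma tube_tube_over:
  assumes u: "timelike u" shows "tube (tube_over u) (UI Q \<real> e e')"
proof
  show "0 \<in> UI Q \<real> e e'" by (rule UI_Reals_arith)
  show "x + y \<in> UI Q \<real> e e'" if "x \<in> UI Q \<real> e e'" "y \<in> UI Q \<real> e e'" for x y using that by (rule UI_Reals_arith)
  show "of_real r *s x \<in> UI Q \<real> e e'" if "x \<in> UI Q \<real> e e'" for r x using that by (intro UI_Reals_arith) auto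
  show "Z + x \<in> tube_over u" if "Z \<in> tube_over u" "x \<in> UI Q \<real> e e'" for Z x
    using that by (auto simp: tube_over_def vec_Im_add vec_Im_of_real UI_iff bil_simps)
  have im: "vec_Im (Z + s *s b) = vec_Im Z + of_real (Im s) *s b" if "b \<in> UI Q \<real> e e'" for Z s b
    using that by (simp add: vec_Im_add vec_Im_scale UI_iff)
  show "\<exists>\<delta>>0. \<forall>y\<in>UI Q \<real> e e'. norm y < \<delta> \<longrightarrow> Z + \<i> *s y \<in> tube_over u" if Z: "Z \<in> tube_over u" for Z
  proof -
    obtain d where d: "d > 0" "\<forall>y\<in>UI Q \<real> e e'. norm y < d \<longrightarrow> vec_Im Z + y \<in> half_cone u"
      using half_cone_open[of "vec_Im Z" u] Z by (auto simp: tube_over_def)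
    have "Z + \<i> *s y \<in> tube_over u" if "y \<in> UI Q \<real> e e'" "norm y < d" for y
    proof -
      have "Z + \<i> *s y \<in> UI Q UNIV e e'" using Z UI_mono[OF that(1)] by (auto simp: tube_over_def intro!: UI_arith)
      then show ?thesis using d(2) that im[OF that(1), of Z "\<i>"] by (simp add: tube_over_def)
    qed
    then show ?thesis using d(1) by blast
  qed
  show "convex {s. Z + s *s b \<in> tube_over u}" if Z: "Z \<in> tube_over u" and b: "b \<in> UI Q \<real> e e'" for Z b
  proof (rule convexI)
    fix s t :: complex and a c :: real
    assume st: "s \<in> {s. Z + s *s b \<in> tube_over u}" "t \<in> {s. Z + s *s b \<in> tube_over u}" and ac: "0 \<le> a" "0 \<le> c" "a + c = 1"
    have "of_real a *s (vec_Im Z + of_real (Im s) *s b) + of_real c *s (vec_Im Z + of_real (Im t) *s b) \<in> half_cone u"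
      using st im[OF b] by (intro half_cone_combination u ac) (auto simp: tube_over_def)
    moreover have "of_real a *s (vec_Im Z + of_real (Im s) *s b) + of_real c *s (vec_Im Z + of_real (Im t) *s b)
      = of_real (a + c) *s vec_Im Z + of_real (a * Im s + c * Im t) *s b"
      by (simp add: vec_eq_iff algebra_simps)
    moreover have "vec_Im (Z + (a *\<^sub>R s + c *\<^sub>R t) *s b) = of_real (a + c) *s vec_Im Z + of_real (a * Im s + c * Im t) *s b"
      unfolding im[OF b] ac(3) by simp
    ultimately have "vec_Im (Z + (a *\<^sub>R s + c *\<^sub>R t) *s b) \<in> half_cone u"
      by (simp only:)
    moreover have "Z + (a *\<^sub>R s + c *\<^sub>R t) *s b \<in> UI Q UNIV e e'"
      using Z UI_mono[OF b] by (auto simp: tube_over_def intro!: UI_arith)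
    ultimately show "a *\<^sub>R s + c *\<^sub>R t \<in> {s. Z + s *s b \<in> tube_over u}" by (simp add: tube_over_def)
  qed
  show "\<exists>x\<in>UI Q \<real> e e'. \<exists>y\<in>UI Q \<real> e e'. Z' = Z + x + \<i> *s y" if "Z \<in> tube_over u" "Z' \<in> tube_over u" for Z Z'
  proof -
    have "Z' - Z \<in> UI Q UNIV e e'" using that by (auto simp: tube_over_def intro: UI_arith)
    note w = vecs_Re_UI[OF e_real e'_real this]
    have "Z' = Z + (vec_Re (Z' - Z) + \<i> *s vec_Im (Z' - Z))" unfolding vec_Re_Im[symmetric] by simp
    then have "Z' = Z + vec_Re (Z' - Z) + \<i> *s vec_Im (Z' - Z)" by (simp only: add.assoc)
    then show ?thesis using w by blast
  qed
qed

subsection \<open>The parametrization by the tube domain\<close>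

abbreviation tpt :: "complex^'N \<Rightarrow> complex^'N" where "tpt \<equiv> tube_pt Q e e'"
abbreviation tco :: "complex^'N \<Rightarrow> complex^'N" where "tco \<equiv> tube_coord Q e e'"

lemma tube_pt_bil:
  assumes "Z \<in> UI Q UNIV e e'"
  shows "bil Q (tpt Z) e = 1" "bil Q (tpt Z) (tpt Z) = 0" "bil Q (tpt Z) e' = - (1 / 2 * bil Q Z Z)"
proof -
  have Z: "bil Q Z e = 0" "bil Q Z e' = 0" "bil Q e Z = 0" "bil Q e' Z = 0"
    using assms bil_sym[of e Z] bil_sym[of e' Z] by (auto simp: UI_iff)
  show "bil Q (tpt Z) e = 1" "bil Q (tpt Z) (tpt Z) = 0" "bil Q (tpt Z) e' = - (1 / 2 * bil Q Z Z)"
    by (simp_all add: tube_pt_def bil_simps cusp_bil Z)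
qed

lemma tube_coord_pt: "Z \<in> UI Q UNIV e e' \<Longrightarrow> tco (tpt Z) = Z"
  using tube_pt_bil[of Z] by (simp add: tube_coord_def tube_pt_def vec_eq_iff)

lemma tube_coord_UI: "bil Q \<omega> e \<noteq> 0 \<Longrightarrow> tco \<omega> \<in> UI Q UNIV e e'"
  by (simp add: tube_coord_def UI_iff bil_simps cusp_bil)

lemma tube_pt_coord:
  assumes "bil Q \<omega> \<omega> = 0" "bil Q \<omega> e \<noteq> 0" shows "\<omega> = bil Q \<omega> e *s tpt (tco \<omega>)"
proof -
  define t s where "t = bil Q \<omega> e" "s = bil Q \<omega> e' / bil Q \<omega> e"
  have t: "t \<noteq> 0" using assms by (simp add: t_s_def)
  define Z where "Z = tco \<omega>"
  have Z: "Z = (1 / t) *s \<omega> - e' - s *s e" by (simp add: Z_def tube_coord_def t_s_def)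
  have zu: "bil Q Z e = 0" "bil Q Z e' = 0" "bil Q e Z = 0" "bil Q e' Z = 0"
    using tube_coord_UI[OF assms(2)] bil_sym[of e Z] bil_sym[of e' Z] by (auto simp: UI_iff Z_def)
  have w: "\<omega> = t *s (Z + e' + s *s e)" unfolding Z using t by (simp add: vec_eq_iff)
  have "0 = bil Q \<omega> \<omega>" using assms by simp
  also have "\<dots> = t * t * (bil Q Z Z + 2 * s)" by (simp add: w bil_simps cusp_bil zu algebra_simps)
  finally have "bil Q Z Z + 2 * s = 0" using t by simp
  then have "s = - (1 / 2 * bil Q Z Z)" by (simp add: eq_neg_iff_add_eq_0 field_simps)
  then show ?thesis unfolding Z_def[symmetric] t_s_def(1)[symmetric] tube_pt_def
    by (subst w) (simp add: vec_eq_iff)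
qed

lemma tube_pt_cnj:
  assumes Z: "Z \<in> UI Q UNIV e e'"
  shows "Re (bil Q (tpt Z) (vec_cnj (tpt Z))) = 2 * Re (bil Q (vec_Im Z) (vec_Im Z))"
proof -
  define X Y where "X = vec_Re Z" "Y = vec_Im Z"
  have XY: "X \<in> UI Q \<real> e e'" "Y \<in> UI Q \<real> e e'" using vecs_Re_UI[OF e_real e'_real Z] by (auto simp: X_Y_def)
  have ZXY: "Z = X + \<i> *s Y" using vec_Re_Im by (simp add: X_Y_def)
  define q where "q = 1 / 2 * bil Q Z Z"
  have real: "vec_cnj x = x" if "x \<in> vecs \<real>" for x :: "complex^'N"
    using that by (auto simp: vec_eq_iff vec_cnj_def vecs_def Reals_cnj_iff)
  have cn: "vec_cnj (tpt Z) = e' + (X - \<i> *s Y) - cnj q *s e"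
  proof -
    have "vec_cnj (tpt Z) = vec_cnj e' + vec_cnj Z - cnj q *s vec_cnj e"
      by (simp add: tube_pt_def q_def vec_eq_iff vec_cnj_def)
    then show ?thesis using real[OF e_real] real[OF e'_real] vec_cnj_eq[of Z] by (simp add: X_Y_def)
  qed
  have z: "bil Q X e = 0" "bil Q X e' = 0" "bil Q e X = 0" "bil Q e' X = 0"
    "bil Q Y e = 0" "bil Q Y e' = 0" "bil Q e Y = 0" "bil Q e' Y = 0"
    using XY bil_sym[of e X] bil_sym[of e' X] bil_sym[of e Y] bil_sym[of e' Y] by (auto simp: UI_iff)
  have "bil Q (tpt Z) (vec_cnj (tpt Z)) = bil Q X X + bil Q Y Y - q - cnj q"
    unfolding cn unfolding tube_pt_def q_def[symmetric] unfolding ZXY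
    by (simp add: bil_simps cusp_bil z bil_sym[of Y X] algebra_simps)
  moreover have "Im (bil Q X Y) = 0" using bil_UI_real[OF XY(1,2)] by (metis Im_complex_of_real)
  then have "Re q = (Re (bil Q X X) - Re (bil Q Y Y)) / 2"
    by (simp add: q_def ZXY bil_simps bil_sym[of Y X] algebra_simps)
  ultimately show ?thesis by (simp add: X_Y_def)
qed

text \<open>
  The real and imaginary parts of \<open>\<omega>\<close> span a positive plane.  If \<open>\<omega>\<close> were orthogonal to the isotropic real
  vector \<open>e\<close>, this plane would be, too, against the signature.
\<close>

lemma period_not_perp:
  assumes "bil Q \<omega> \<omega> = 0" "0 < Re (bil Q \<omega> (vec_cnj \<omega>))" shows "bil Q \<omega> e \<noteq> 0"
proof
  assume 0: "bil Q \<omega> e = 0"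
  define x y where "x = vec_Re \<omega>" "y = vec_Im \<omega>"
  have w: "\<omega> = x + \<i> *s y" and cn: "vec_cnj \<omega> = x - \<i> *s y"
    using vec_Re_Im vec_cnj_eq by (auto simp: x_y_def)
  have xy: "x \<in> vecs \<real>" "y \<in> vecs \<real>" by (auto simp: x_y_def)
  have r: "bil Q x y = of_real (Re (bil Q x y))" "bil Q x x = of_real (Re (bil Q x x))" "bil Q y y = of_real (Re (bil Q y y))"
    using xy by (auto intro: bil_of_Re)
  have "bil Q x x - bil Q y y + 2 * \<i> * bil Q x y = 0"
    using assms(1) unfolding w by (simp add: bil_simps bil_sym[of y x] algebra_simps)
  moreover have "Im (bil Q x x) = 0" "Im (bil Q y y) = 0" "Im (bil Q x y) = 0"
    using r by (metis Im_complex_of_real)+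
  ultimately have 1: "Re (bil Q x x) = Re (bil Q y y)" "Re (bil Q x y) = 0"
    by (simp_all add: complex_eq_iff)
  have "Re (bil Q \<omega> (vec_cnj \<omega>)) = Re (bil Q x x) + Re (bil Q y y)"
    unfolding cn unfolding w by (simp add: bil_simps bil_sym[of y x])
  then have pos: "0 < Re (bil Q x x)" "0 < Re (bil Q y y)" using assms(2) 1 by auto
  have "e = 0"
  proof (rule orthogonal_to_positive_plane[OF xy e_real pos])
    show "bil Q x y = 0" using r(1) 1(2) by simp
    show "bil Q e x = 0" "bil Q e y = 0"
      using bil_real_Re[OF e_real, of Q \<omega>] bil_real_Im[OF e_real, of Q \<omega>] 0 bil_sym[of e x] bil_sym[of e y]
      by (auto simp: x_y_def)
  qed (simp add: ee)
  then show False using ee' by simp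
qed

lemma tube_pt_period:
  assumes "Z \<in> UI Q UNIV e e'" "timelike (vec_Im Z)"
  shows "tpt Z \<noteq> 0" "line (tpt Z) \<in> period_space Q"
  using tube_pt_bil[OF assms(1)] tube_pt_cnj[OF assms(1)] assms(2)
  by (auto simp: period_space_iff timelike_def)

lemma period_timelike:
  assumes "bil Q \<omega> \<omega> = 0" "0 < Re (bil Q \<omega> (vec_cnj \<omega>))"
  shows "timelike (vec_Im (tco \<omega>))" "line (tpt (tco \<omega>)) = line \<omega>"
proof -
  have ne: "bil Q \<omega> e \<noteq> 0" by (rule period_not_perp[OF assms])
  note U = tube_coord_UI[OF ne]
  show l: "line (tpt (tco \<omega>)) = line \<omega>"
    using tube_pt_coord[OF assms(1) ne] line_scale[OF ne] by metis
  then have "line (tpt (tco \<omega>)) \<in> period_space Q" using assms by (simp add: period_space_iff)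
  then show "timelike (vec_Im (tco \<omega>))"
    using vecs_Re_UI[OF e_real e'_real U] tube_pt_cnj[OF U] by (simp add: timelike_def period_space_iff)
qed

text \<open>
  The sign of this function tells in which half of the cone the imaginary part of the tube coordinate lies.
  Unlike the tube coordinate it is defined on all of \<open>L\<^sub>\<complex>\<close>, and it is homogeneous, so that its sign gives open subsets of
  projective space.
\<close>

definition orient :: "complex^'N \<Rightarrow> complex^'N \<Rightarrow> real" where
  "orient u \<omega> = Im (bil Q \<omega> u * cnj (bil Q \<omega> e))"

lemma orient_tube_coord:
  assumes "timelike u" "bil Q \<omega> e \<noteq> 0"
  shows "orient u \<omega> = (norm (bil Q \<omega> e))\<^sup>2 * Re (bil Q (vec_Im (tco \<omega>)) u)"
proof -
  have u: "u \<in> vecs \<real>" "bil Q e u = 0" "bil Q e' u = 0"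
    using assms(1) bil_sym[of e u] bil_sym[of e' u] by (auto simp: timelike_def UI_iff)
  have "bil Q (tco \<omega>) u = bil Q \<omega> u / bil Q \<omega> e"
    by (simp add: tube_coord_def bil_simps u)
  then have "bil Q (tco \<omega>) u = (bil Q \<omega> u * cnj (bil Q \<omega> e)) / of_real ((norm (bil Q \<omega> e))\<^sup>2)"
    using complex_div_cnj[of "bil Q \<omega> u" "bil Q \<omega> e"] by (simp add: complex_norm_square)
  then have "Im (bil Q (tco \<omega>) u) = orient u \<omega> / (norm (bil Q \<omega> e))\<^sup>2"
    by (simp only: Im_divide_of_real orient_def)
  then show ?thesis using assms(2) bil_real_Im[OF u(1), of Q "tco \<omega>"] by (simp add: field_simps)
qed

lemma orient_scale: "orient u (c *s \<omega>) = (norm c)\<^sup>2 * orient u \<omega>"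
proof -
  have "bil Q (c *s \<omega>) u * cnj (bil Q (c *s \<omega>) e) = of_real ((norm c)\<^sup>2) * (bil Q \<omega> u * cnj (bil Q \<omega> e))"
    unfolding complex_norm_square by (simp add: bil_simps mult_ac)
  then show ?thesis by (simp add: orient_def)
qed

lemma openin_orient:
  assumes "\<sigma> = 1 \<or> \<sigma> = (-1::real)"
  shows "openin proj_space (line ` {\<omega>. 0 < \<sigma> * orient u \<omega>})"
  unfolding openin_proj_space
proof
  have nz: "\<omega> \<noteq> 0" if "0 < \<sigma> * orient u \<omega>" for \<omega> using that by (auto simp: orient_def)
  then show "line ` {\<omega>. 0 < \<sigma> * orient u \<omega>} \<subseteq> line ` (- {0})" by auto
  have "0 < \<sigma> * orient u \<omega>" if w: "\<omega> \<noteq> 0" "line \<omega> = line w" "0 < \<sigma> * orient u w" for \<omega> w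
  proof -
    obtain c where "c \<noteq> 0" "\<omega> = c *s w" using line_eqD[OF w(2,1)] by blast
    moreover have "0 < (norm c)\<^sup>2 * (\<sigma> * orient u w)" using w(3) \<open>c \<noteq> 0\<close> by simp
    ultimately show ?thesis by (simp add: orient_scale mult.left_commute)
  qed
  then have "{\<omega>. \<omega> \<noteq> 0 \<and> line \<omega> \<in> line ` {\<omega>. 0 < \<sigma> * orient u \<omega>}} = {\<omega>. 0 < \<sigma> * orient u \<omega>}"
    using nz by auto
  moreover have "open {\<omega>. 0 < \<sigma> * orient u \<omega>}"
    unfolding orient_def by (intro open_Collect_less continuous_intros)
  ultimately show "open {\<omega>. \<omega> \<noteq> 0 \<and> line \<omega> \<in> line ` {\<omega>. 0 < \<sigma> * orient u \<omega>}}" by simp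
qed

text \<open>
  The image of the tube over one half of the cone is connected, hence inside the component that it
  meets.  Conversely, the two signs of \<open>orient\<close> cover the period space by disjoint open sets, so the component cannot
  meet the image of the other half.
\<close>

lemma period_domain_tube:
  assumes D: "period_domain Q D"
  shows "\<exists>u. timelike u \<and> D = (\<lambda>Z. line (tpt Z)) ` tube_over u"
proof -
  have ne: "D \<noteq> {}" and conn: "connectedin (subtopology proj_space (period_space Q)) D"
    using D nonempty_connected_components_of connectedin_connected_components_of
    unfolding period_domain_def by blast+
  have DP: "D \<subseteq> period_space Q" "connectedin proj_space D" using conn by (auto simp: connectedin_subtopology)
  obtain p where "p \<in> D" using ne by blast
  then obtain \<omega>0 where w0: "p = line \<omega>0" "bil Q \<omega>0 \<omega>0 = 0" "0 < Re (bil Q \<omega>0 (vec_cnj \<omega>0))"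
    using DP(1) by (auto simp: period_space_def)
  define u where "u = vec_Im (tco \<omega>0)"
  have u: "timelike u" unfolding u_def by (rule period_timelike[OF w0(2,3)])
  have Z0: "tco \<omega>0 \<in> tube_over u"
    using tube_coord_UI[OF period_not_perp[OF w0(2,3)]] half_cone_self[OF u] by (simp add: tube_over_def u_def)
  interpret tube "tube_over u" "UI Q \<real> e e'" by (rule tube_tube_over[OF u])
  let ?R = "(\<lambda>Z. line (tpt Z)) ` tube_over u"
  have per: "tpt Z \<noteq> 0" "line (tpt Z) \<in> period_space Q" if "Z \<in> tube_over u" for Z
    using tube_pt_period[of Z] that by (auto simp: tube_over_def half_cone_def)
  have convT: "convex (tube_over u)"
  proof (rule convexI)
    fix x y :: "complex^'N" and a b :: real
    assume xy: "x \<in> tube_over u" "y \<in> tube_over u" and ab: "0 \<le> a" "0 \<le> b" "a + b = 1"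
    have "vec_Im (of_real a *s x + of_real b *s y) = of_real a *s vec_Im x + of_real b *s vec_Im y"
      by (simp add: vec_Im_def vec_eq_iff)
    then show "a *\<^sub>R x + b *\<^sub>R y \<in> tube_over u"
      using xy half_cone_combination[OF u _ _ ab] unfolding scaleR_eq tube_over_def by (auto intro!: UI_arith)
  qed
  have "continuous_on (tube_over u) tpt"
    unfolding tube_pt_def by (intro continuous_intros continuous_on_vec_scale)
  then have "connectedin proj_space ?R"
    by (rule connectedin_line_image) (use per convT convex_connected in auto)
  then have "connectedin (subtopology proj_space (period_space Q)) ?R"
    using per by (auto simp: connectedin_subtopology)
  moreover have "p \<in> ?R" using Z0 period_timelike(2)[OF w0(2,3)] w0(1) by (metis image_eqI)
  ultimately have RD: "?R \<subseteq> D"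
    using connected_components_of_maximal[of D _ ?R] D \<open>p \<in> D\<close> unfolding period_domain_def disjnt_def by blast
  let ?U = "\<lambda>\<sigma>. line ` {\<omega>. 0 < \<sigma> * orient u \<omega>}"
  have sgn: "orient u \<omega> \<noteq> 0" "0 < orient u \<omega> \<Longrightarrow> line \<omega> \<in> ?R"
    if "bil Q \<omega> \<omega> = 0" "0 < Re (bil Q \<omega> (vec_cnj \<omega>))" for \<omega>
  proof -
    have ne: "bil Q \<omega> e \<noteq> 0" by (rule period_not_perp[OF that])
    let ?Y = "vec_Im (tco \<omega>)"
    have Y: "timelike ?Y" by (rule period_timelike[OF that])
    then have "?Y \<noteq> 0" by (auto simp: timelike_def)
    then have "Re (bil Q ?Y u) \<noteq> 0" using timelike_pairing[of u ?Y] u Y by (auto simp: timelike_def)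
    then show "orient u \<omega> \<noteq> 0" using orient_tube_coord[OF u ne] ne by simp
    assume "0 < orient u \<omega>"
    then have "0 < Re (bil Q ?Y u)" using orient_tube_coord[OF u ne] by (simp add: zero_less_mult_iff)
    then have "tco \<omega> \<in> tube_over u" using Y tube_coord_UI[OF ne] by (simp add: tube_over_def half_cone_def)
    then show "line \<omega> \<in> ?R" using period_timelike(2)[OF that] by (metis image_eqI)
  qed
  have cover: "D \<subseteq> ?U 1 \<union> ?U (-1)"
  proof
    fix q assume "q \<in> D"
    then obtain \<omega> where w: "q = line \<omega>" "bil Q \<omega> \<omega> = 0" "0 < Re (bil Q \<omega> (vec_cnj \<omega>))"
      using DP(1) by (auto simp: period_space_def)
    then show "q \<in> ?U 1 \<union> ?U (-1)" using sgn(1)[OF w(2,3)] by (cases "0 < orient u \<omega>") auto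
  qed
  have signs: "0 < orient u w" if w: "line \<omega> = line w" "0 < orient u \<omega>" for \<omega> w
  proof -
    have "\<omega> \<noteq> 0" using w(2) by (auto simp: orient_def)
    then obtain c where "c \<noteq> 0" "\<omega> = c *s w" using line_eqD[OF w(1)] by blast
    then show ?thesis using w(2) by (simp add: orient_scale zero_less_mult_iff)
  qed
  have disj: "?U 1 \<inter> ?U (-1) \<inter> D = {}"
  proof -
    have False if q: "q \<in> ?U 1" "q \<in> ?U (-1)" for q
    proof -
      obtain \<omega> where 1: "q = line \<omega>" "0 < orient u \<omega>" using q(1) by auto
      obtain w where 2: "q = line w" "orient u w < 0" using q(2) by auto
      have "line \<omega> = line w" using 1 2 by simp
      from signs[OF this 1(2)] show False using 2(2) by simp
    qed
    then show ?thesis by blast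
  qed
  have "p \<in> ?U 1"
  proof -
    have "0 < orient u \<omega>0"
      using orient_tube_coord[OF u period_not_perp[OF w0(2,3)]] period_not_perp[OF w0(2,3)] u
      by (simp add: u_def[symmetric] timelike_def)
    then show ?thesis using w0(1) by auto
  qed
  then have "?U (-1) \<inter> D = {}"
    using connectedinD[OF DP(2) openin_orient[of 1 u] openin_orient[of "-1" u] cover disj] \<open>p \<in> D\<close> by blast
  have "D \<subseteq> ?R"
  proof
    fix q assume "q \<in> D"
    then obtain \<omega> where w: "q = line \<omega>" "bil Q \<omega> \<omega> = 0" "0 < Re (bil Q \<omega> (vec_cnj \<omega>))"
      using DP(1) by (auto simp: period_space_def)
    have "q \<notin> ?U (-1)" using \<open>q \<in> D\<close> \<open>?U (-1) \<inter> D = {}\<close> by blast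
    then have "\<not> 0 < -1 * orient u \<omega>" using w(1) by blast
    then have "0 < orient u \<omega>" using sgn(1)[OF w(2,3)] by simp
    then show "q \<in> ?R" using sgn(2)[OF w(2,3)] w(1) by simp
  qed
  then show ?thesis using RD u by blast
qed

end

locale tube_realization = cusp Q n e e' for Q :: "int^'N^'N" and n e e' +
  fixes D :: "(complex^'N) set set"
  assumes D: "period_domain Q D"
begin

lemma pos_cone_ex: "\<exists>u. timelike u \<and> pos_cone Q D e e' = half_cone u \<and> D = (\<lambda>Z. line (tpt Z)) ` tube_over u"
proof -
  obtain u where u: "timelike u" "D = (\<lambda>Z. line (tpt Z)) ` tube_over u" using period_domain_tube[OF D] by blast
  have S: "{v \<in> UI Q \<real> e e'. 0 < Re (bil Q v v)} = {v. timelike v}" by (auto simp: timelike_def)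
  have im: "{line (tpt Z) |Z. Z \<in> UI Q UNIV e e' \<and> vec_Im Z \<in> half_cone u'} = (\<lambda>Z. line (tpt Z)) ` tube_over u'" for u'
    by (auto simp: tube_over_def)
  have "pos_cone Q D e e' = half_cone u"
    unfolding pos_cone_def S
  proof (rule the_equality)
    have "half_cone u \<in> components {v. timelike v}"
      using half_cone_component[OF u(1)] u(1) unfolding components_def by blast
    then show "half_cone u \<in> components {v. timelike v} \<and>
        {line (tpt Z) |Z. Z \<in> UI Q UNIV e e' \<and> vec_Im Z \<in> half_cone u} = D"
      using im u(2) by simp
  next
    fix C assume C: "C \<in> components {v. timelike v} \<and>
        {line (tpt Z) |Z. Z \<in> UI Q UNIV e e' \<and> vec_Im Z \<in> C} = D"
    then obtain u' where u': "timelike u'" "C = half_cone u'"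
      using half_cone_component unfolding components_def by blast
    let ?Z = "\<i> *s u'"
    have Z: "?Z \<in> UI Q UNIV e e'" using u'(1) UI_mono by (auto simp: timelike_def intro!: UI_arith)
    have imZ: "vec_Im ?Z = u'" using u'(1) vec_Im_scale[of u' \<i>] by (auto simp: timelike_def UI_iff)
    have "line (tpt ?Z) \<in> D" using C Z imZ half_cone_self[OF u'(1)] u'(2) by auto
    then obtain Z2 where Z2: "Z2 \<in> tube_over u" "line (tpt ?Z) = line (tpt Z2)" using u(2) by auto
    have "tpt ?Z \<noteq> 0" using tube_pt_period(1)[OF Z] u'(1) imZ by simp
    then obtain c where c: "c \<noteq> 0" "tpt ?Z = c *s tpt Z2" using line_eqD[OF Z2(2)] by blast
    have "?Z = tco (tpt ?Z)" using tube_coord_pt[OF Z] by simp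
    also have "\<dots> = tco (tpt Z2)" unfolding c(2) by (rule tube_coord_scale[OF c(1)])
    also have "\<dots> = Z2" using Z2(1) by (intro tube_coord_pt) (auto simp: tube_over_def)
    finally have "u' \<in> half_cone u" using Z2(1) imZ by (simp add: tube_over_def)
    then show "C = half_cone u" using half_cone_eq[OF u(1)] u'(2) by simp
  qed
  then show ?thesis using u by blast
qed

text \<open>
  A base point of the positive cone.  Fourier coefficients are estimated at the point \<open>\<i> u0\<close> of the tube
  domain.
\<close>

definition u0 :: "complex^'N" where
  "u0 = (SOME u. timelike u \<and> pos_cone Q D e e' = half_cone u \<and> D = (\<lambda>Z. line (tpt Z)) ` tube_over u)"

lemma u0: "timelike u0" "pos_cone Q D e e' = half_cone u0" "D = (\<lambda>Z. line (tpt Z)) ` tube_over u0"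
  using someI_ex[OF pos_cone_ex, folded u0_def] by auto

lemma tube_domain_eq: "tube_domain Q D e e' = tube_over u0"
  by (simp add: tube_domain_def tube_over_def u0(2))

abbreviation TD :: "(complex^'N) set" where "TD \<equiv> tube_domain Q D e e'"

sublocale tube "tube_domain Q D e e'" "UI Q \<real> e e'"
  unfolding tube_domain_eq by (rule tube_tube_over[OF u0(1)])

lemma TD_UI: "Z \<in> TD \<Longrightarrow> Z \<in> UI Q UNIV e e'"
  by (simp add: tube_domain_def)

lemma TD_nonempty: "\<i> *s u0 \<in> TD"
  using u0(1) UI_mono vec_Im_scale[of u0 \<i>] half_cone_self[OF u0(1)]
  by (auto simp: tube_domain_eq tube_over_def timelike_def UI_iff bil_simps)

lemma tube_pt_cone: "Z \<in> TD \<Longrightarrow> tpt Z \<in> cone D"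
  using tube_pt_period(1)[of Z] u0(3) by (auto simp: cone_def tube_domain_eq tube_over_def half_cone_def)

lemma cone_scale: "t \<noteq> 0 \<Longrightarrow> \<omega> \<in> cone D \<Longrightarrow> t *s \<omega> \<in> cone D"
  by (auto simp: cone_def line_scale)

lemma cone_iff: "\<omega> \<in> cone D \<longleftrightarrow> bil Q \<omega> \<omega> = 0 \<and> bil Q \<omega> e \<noteq> 0 \<and> tco \<omega> \<in> TD"
proof
  assume "\<omega> \<in> cone D"
  then obtain Z where Z: "Z \<in> TD" "line \<omega> = line (tpt Z)" "\<omega> \<noteq> 0"
    using u0(3) by (auto simp: cone_def tube_domain_eq)
  obtain c where c: "c \<noteq> 0" "\<omega> = c *s tpt Z" using line_eqD[OF Z(2,3)] by blast
  show "bil Q \<omega> \<omega> = 0 \<and> bil Q \<omega> e \<noteq> 0 \<and> tco \<omega> \<in> TD"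
    unfolding c(2) tube_coord_scale[OF c(1)] tube_coord_pt[OF TD_UI[OF Z(1)]]
    using tube_pt_bil[OF TD_UI[OF Z(1)]] c(1) Z(1) by (simp add: bil_simps)
next
  assume a: "bil Q \<omega> \<omega> = 0 \<and> bil Q \<omega> e \<noteq> 0 \<and> tco \<omega> \<in> TD"
  then show "\<omega> \<in> cone D" using tube_pt_coord[of \<omega>] cone_scale[OF _ tube_pt_cone[of "tco \<omega>"], of "bil Q \<omega> e"] by simp
qed

lemma cone_not_perp: "\<omega> \<in> cone D \<Longrightarrow> bil Q \<omega> e \<noteq> 0" and cone_isotropic: "\<omega> \<in> cone D \<Longrightarrow> bil Q \<omega> \<omega> = 0"
  and cone_tube_coord: "\<omega> \<in> cone D \<Longrightarrow> tco \<omega> \<in> TD"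
  by (auto simp: cone_iff)

end

section \<open>Eichler transvections and arithmetic groups\<close>

lemma eichler_apply:
  "eichler Q z e *v v = v - bil Q z v *s e + bil Q e v *s z - (1 / 2 * bil Q z z * bil Q e v) *s e"
  unfolding eichler_def by (rule matrix_apply) (simp_all add: bil_simps vec_eq_iff algebra_simps)

lemma matrix_eqI: "(\<And>x :: complex^'N. A *v x = B *v x) \<Longrightarrow> A = B"
  by (simp add: matrix_eq)

lemma eichler_zero [simp]: "eichler Q 0 e = mat 1"
  by (rule matrix_eqI) (simp add: eichler_apply)

lemma mv_scale: "A *v (c *s x) = c *s (A *v (x :: complex^'N))"
  by (simp add: vector_scalar_commute)

lemma mult_line: "(*v) g ` line \<omega> = line (g *v \<omega>)"
  unfolding line_eq by (auto simp: mv_scale image_iff) (metis mv_scale)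

lemma isometry_iso: "g \<in> isometries Q F \<Longrightarrow> bil Q (g *v x) (g *v y) = bil Q x y"
  by (simp add: isometries_def)

lemma isometry_vecs: "g \<in> isometries Q F \<Longrightarrow> x \<in> vecs F \<Longrightarrow> g *v x \<in> vecs F"
  by (auto simp: isometries_def)

context lat begin

lemma eichler_isometry:
  assumes "bil Q e e = 0" "bil Q z e = 0"
  shows "bil Q (eichler Q z e *v x) (eichler Q z e *v y) = bil Q x y"
  using assms bil_sym[of e z] bil_sym[of x e] bil_sym[of x z]
  by (simp add: eichler_apply bil_simps algebra_simps)

lemma eichler_mult:
  assumes "bil Q e e = 0" "bil Q z e = 0" "bil Q z' e = 0"
  shows "eichler Q z e ** eichler Q z' e = eichler Q (z + z') e"
proof (rule matrix_eqI)
  fix x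
  have s: "bil Q e z = 0" "bil Q e z' = 0" using assms bil_sym by metis+
  show "(eichler Q z e ** eichler Q z' e) *v x = eichler Q (z + z') e *v x"
    unfolding matrix_vector_mul_assoc[symmetric]
    by (simp add: eichler_apply bil_simps assms s bil_sym[of z' z] vec_eq_iff algebra_simps)
qed

lemma eichler_inverse:
  assumes "bil Q e e = 0" "bil Q z e = 0"
  shows "eichler Q z e *v (eichler Q (- z) e *v x) = x"
  using eichler_mult[OF assms, of "- z"] assms(2)
  by (simp add: matrix_vector_mul_assoc bil_simps)

lemma vec_cnj_real: "x \<in> vecs \<real> \<Longrightarrow> vec_cnj x = x"
  by (auto simp: vec_eq_iff vec_cnj_def vecs_def Reals_cnj_iff)

lemma eichler_cnj:
  assumes "z \<in> vecs \<real>" "e \<in> vecs \<real>"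
  shows "vec_cnj (eichler Q z e *v x) = eichler Q z e *v vec_cnj x"
proof -
  have "cnj (bil Q z x) = bil Q z (vec_cnj x)" "cnj (bil Q e x) = bil Q e (vec_cnj x)" "cnj (bil Q z z) = bil Q z z"
    using bil_cnj[of Q z x] bil_cnj[of Q e x] bil_cnj[of Q z z] vec_cnj_real[OF assms(1)] vec_cnj_real[OF assms(2)]
    by simp_all
  moreover have "cnj (z $ i) = z $ i" "cnj (e $ i) = e $ i" for i
    using assms by (auto simp: vecs_def Reals_cnj_iff)
  ultimately show ?thesis by (simp add: eichler_apply vec_cnj_def vec_eq_iff)
qed

lemma cone_period:
  assumes "period_domain Q D" "\<omega> \<in> cone D"
  shows "bil Q \<omega> \<omega> = 0" "0 < Re (bil Q \<omega> (vec_cnj \<omega>))"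
proof -
  have "D \<subseteq> topspace (subtopology proj_space (period_space Q))"
    using assms(1) connected_components_of_subset unfolding period_domain_def by blast
  then have "line \<omega> \<in> period_space Q" using assms(2) by (auto simp: cone_def)
  then show "bil Q \<omega> \<omega> = 0" "0 < Re (bil Q \<omega> (vec_cnj \<omega>))" by (auto simp: period_space_iff)
qed

lemma D_eq_lines:
  assumes "period_domain Q D" shows "D = line ` cone D"
proof -
  have "D \<subseteq> topspace (subtopology proj_space (period_space Q))"
    using assms(1) connected_components_of_subset unfolding period_domain_def by blast
  then have "D \<subseteq> line ` (- {0})" by (auto simp: topspace_proj_space)
  then show ?thesis by (auto simp: cone_def)
qed

text \<open>
  The transvections by real multiples of \<open>z\<close> form a path of isometries that starts at the identity.
\<close>

lemma eichler_cone:
  assumes D: "period_domain Q D" and "\<omega> \<in> cone D" and real: "z \<in> vecs \<real>" "e \<in> vecs \<real>"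
    and iso: "bil Q e e = 0" "bil Q z e = 0"
  shows "eichler Q z e *v \<omega> \<in> cone D"
proof -
  define \<gamma> where "\<gamma> t = eichler Q (of_real t *s z) e *v \<omega>" for t :: real
  have "\<gamma> 1 \<in> cone D"
  proof (rule cone_path[OF D])
    show "continuous_on {0..1} \<gamma>" unfolding \<gamma>_def eichler_apply
      by (intro continuous_intros continuous_on_vec_scale)
    show "\<gamma> 0 \<in> cone D" using assms(2) by (simp add: \<gamma>_def)
    fix t :: real
    have tz: "of_real t *s z \<in> vecs \<real>" "bil Q (of_real t *s z) e = 0"
      using real iso by (auto simp: bil_simps intro: vecs_Reals_arith)
    have "vec_cnj (\<gamma> t) = eichler Q (of_real t *s z) e *v vec_cnj \<omega>"
      unfolding \<gamma>_def by (rule eichler_cnj[OF tz(1) real(2)])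
    then show "bil Q (\<gamma> t) (\<gamma> t) = 0 \<and> 0 < Re (bil Q (\<gamma> t) (vec_cnj (\<gamma> t)))"
      using cone_period[OF D assms(2)] by (simp add: \<gamma>_def eichler_isometry[OF iso(1) tz(2)])
  qed
  then show ?thesis by (simp add: \<gamma>_def)
qed

lemma inverse_exists:
  assumes g: "g \<in> carrier (Oplus Q D)"
  shows "\<exists>h\<in>carrier (Oplus Q D). g ** h = mat 1 \<and> h ** g = mat 1"
proof -
  have gi: "g \<in> isometries Q \<int>" and gD: "(\<lambda>p. (*v) g ` p) ` D = D" using g by (auto simp: Oplus_def)
  have "\<exists>x\<in>vecs \<int>. g *v x = axis i 1" for i
  proof -
    have "axis i 1 \<in> vecs \<int>" by (auto simp: vecs_def axis_def)
    then have "axis i 1 \<in> (*v) g ` vecs \<int>" using gi by (simp add: isometries_def)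
    then show ?thesis by (metis imageE)
  qed
  then obtain X where X: "\<And>i. X i \<in> vecs \<int>" "\<And>i. g *v X i = axis i 1" by metis
  define h :: "complex^'N^'N" where "h = (\<chi> r c. X c $ r)"
  have gh: "g ** h = mat 1"
  proof -
    have "(g ** h) $ r $ c = (g *v X c) $ r" for r c
      by (simp add: matrix_matrix_mult_def matrix_vector_mult_def h_def)
    then show ?thesis using X(2) by (simp add: vec_eq_iff mat_def axis_def)
  qed
  then have hg: "h ** g = mat 1" using matrix_left_right_inverse by blast
  have inv1: "g *v (h *v x) = x" "h *v (g *v x) = x" for x
    using gh hg by (simp_all add: matrix_vector_mul_assoc)
  have "h \<in> isometries Q \<int>"
    unfolding isometries_def
  proof (intro CollectI conjI allI)
    have "(*v) h ` vecs \<int> = (*v) h ` (*v) g ` vecs \<int>" using gi by (simp add: isometries_def)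
    then show "(*v) h ` vecs \<int> = vecs \<int>" by (simp add: image_image inv1)
    show "bil Q (h *v x) (h *v y) = bil Q x y" for x y
      using isometry_iso[OF gi, of "h *v x" "h *v y"] by (simp add: inv1)
  qed
  moreover have "(\<lambda>p. (*v) h ` p) ` D = D"
  proof -
    have "(\<lambda>p. (*v) h ` p) ` D = (\<lambda>p. (*v) h ` p) ` (\<lambda>p. (*v) g ` p) ` D" using gD by simp
    also have "\<dots> = D" by (simp add: image_image inv1)
    finally show ?thesis .
  qed
  ultimately show ?thesis using gh hg by (auto simp: Oplus_def)
qed

end

locale arithmetic = lat Q n for Q :: "int^'N^'N" and n +
  fixes D :: "(complex^'N) set set" and \<Gamma> :: "(complex^'N^'N) set"
  assumes D: "period_domain Q D"
    and \<Gamma>: "subgroup \<Gamma> (Oplus Q D)" "finite (rcosets\<^bsub>Oplus Q D\<^esub> \<Gamma>)"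
begin

lemma \<Gamma>_carrier: "g \<in> \<Gamma> \<Longrightarrow> g \<in> carrier (Oplus Q D)"
  using subgroup.subset[OF \<Gamma>(1)] by blast

lemma \<Gamma>_mult: "g \<in> \<Gamma> \<Longrightarrow> h \<in> \<Gamma> \<Longrightarrow> g ** h \<in> \<Gamma>"
  using subgroup.m_closed[OF \<Gamma>(1), of g h] by (simp add: Oplus_def)

lemma \<Gamma>_one: "mat 1 \<in> \<Gamma>"
  using subgroup.one_closed[OF \<Gamma>(1)] by (simp add: Oplus_def)

lemma \<Gamma>_inverse:
  assumes "g \<in> \<Gamma>" shows "\<exists>h\<in>\<Gamma>. g ** h = mat 1 \<and> h ** g = mat 1"
proof -
  let ?G = "Oplus Q D"
  obtain h where h: "h \<in> carrier ?G" "g ** h = mat 1" "h ** g = mat 1"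
    using inverse_exists[OF \<Gamma>_carrier[OF assms]] by blast
  have "m_inv ?G g = h"
    unfolding m_inv_def
  proof (rule the_equality)
    show "h \<in> carrier ?G \<and> g \<otimes>\<^bsub>?G\<^esub> h = \<one>\<^bsub>?G\<^esub> \<and> h \<otimes>\<^bsub>?G\<^esub> g = \<one>\<^bsub>?G\<^esub>" using h by (simp add: Oplus_def)
    fix y assume "y \<in> carrier ?G \<and> g \<otimes>\<^bsub>?G\<^esub> y = \<one>\<^bsub>?G\<^esub> \<and> y \<otimes>\<^bsub>?G\<^esub> g = \<one>\<^bsub>?G\<^esub>"
    then have "y ** g = mat 1" by (simp add: Oplus_def)
    then have "y ** (g ** h) = h" by (simp add: matrix_mul_assoc)
    then show "y = h" using h(2) by simp
  qed
  then show ?thesis using subgroup.m_inv_closed[OF \<Gamma>(1) assms] h by auto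
qed

lemma \<Gamma>_isometry: "g \<in> \<Gamma> \<Longrightarrow> g \<in> isometries Q \<int>"
  using \<Gamma>_carrier by (auto simp: Oplus_def)

lemma \<Gamma>_bil: "g \<in> \<Gamma> \<Longrightarrow> bil Q (g *v x) (g *v y) = bil Q x y"
  using \<Gamma>_isometry isometry_iso by blast

lemma carrier_cone:
  assumes "g \<in> carrier (Oplus Q D)" "\<omega> \<in> cone D" shows "g *v \<omega> \<in> cone D"
proof -
  obtain h where h: "h ** g = mat 1" using inverse_exists[OF assms(1)] by blast
  have "h *v (g *v \<omega>) = \<omega>" using h by (simp add: matrix_vector_mul_assoc)
  then have nz: "g *v \<omega> \<noteq> 0" using assms(2) by (auto simp: cone_def)
  have "(*v) g ` line \<omega> \<in> (\<lambda>p. (*v) g ` p) ` D" using assms(2) by (auto simp: cone_def)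
  then have "line (g *v \<omega>) \<in> D" using assms(1) by (simp add: Oplus_def mult_line)
  then show ?thesis using nz by (simp add: cone_def)
qed

lemma \<Gamma>_cone: "g \<in> \<Gamma> \<Longrightarrow> \<omega> \<in> cone D \<Longrightarrow> g *v \<omega> \<in> cone D"
  using carrier_cone \<Gamma>_carrier by blast

lemma \<Gamma>_real: "g \<in> \<Gamma> \<Longrightarrow> x \<in> vecs \<int> \<Longrightarrow> g *v x \<in> vecs \<int>" "g \<in> \<Gamma> \<Longrightarrow> x \<in> vecs \<rat> \<Longrightarrow> g *v x \<in> vecs \<rat>"
  "g \<in> \<Gamma> \<Longrightarrow> x \<in> vecs \<real> \<Longrightarrow> g *v x \<in> vecs \<real>"
proof -
  assume g: "g \<in> \<Gamma>"
  show i: "x \<in> vecs \<int> \<Longrightarrow> g *v x \<in> vecs \<int>" for x using isometry_vecs[OF \<Gamma>_isometry[OF g]] by blast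
  have ent: "g $ r $ c \<in> \<int>" for r c
  proof -
    have "axis c 1 \<in> vecs \<int>" by (auto simp: vecs_def axis_def)
    from i[OF this] have "(g *v axis c 1) $ r \<in> \<int>" by (simp add: vecs_def)
    then show ?thesis by (simp add: matrix_vector_mult_def axis_def if_distrib cong: if_cong)
  qed
  then have "g $ r $ c \<in> \<rat>" "g $ r $ c \<in> \<real>" for r c
    using Ints_subset_Rats Rats_subset_Reals_complex by blast+
  then show "x \<in> vecs \<rat> \<Longrightarrow> g *v x \<in> vecs \<rat>" "x \<in> vecs \<real> \<Longrightarrow> g *v x \<in> vecs \<real>" for x
    by (auto simp: vecs_def matrix_vector_mult_def intro!: Rats_sum Rats_mult sum_in_Reals Reals_mult)
qed

text \<open>
  Multiples by a common denominator, doubled because of the coefficient one half, preserve the lattice.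
\<close>

lemma eichler_integral:
  assumes z: "z \<in> vecs \<rat>" and e: "e \<in> vecs \<rat>" "bil Q e e = 0" "bil Q z e = 0"
  obtains M :: int where "M > 0" "\<And>k::int. eichler Q (of_int (k * M) *s z) e \<in> carrier (Oplus Q D)"
proof -
  obtain d1 where d1: "d1 > 0" "of_int d1 *s z \<in> vecs \<int>" using rational_scale_to_int[OF z] by blast
  obtain d2 where d2: "d2 > 0" "of_int d2 *s e \<in> vecs \<int>" using rational_scale_to_int[OF e(1)] by blast
  define M where "M = 2 * d1 * d2"
  let ?E = "\<lambda>k. eichler Q (of_int (k * M) *s z) e"
  have zk: "bil Q (of_int k *s z) e = 0" for k :: int using e(3) by (simp add: bil_simps)
  have int: "?E k *v x \<in> vecs \<int>" if x: "x \<in> vecs \<int>" for k x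
  proof -
    define z1 e1 where "z1 = of_int d1 *s z" "e1 = of_int d2 *s e"
    have "?E k *v x = x - (of_int (2 * k) * bil Q z1 x) *s e1 + (of_int (2 * k) * bil Q e1 x) *s z1
       - (of_int (2 * k * k) * bil Q z1 z1 * bil Q e1 x) *s e1"
      by (simp add: eichler_apply M_def z1_e1_def bil_simps vec_eq_iff algebra_simps)
    moreover have "z1 \<in> vecs \<int>" "e1 \<in> vecs \<int>" using d1 d2 by (auto simp: z1_e1_def)
    ultimately show ?thesis using x
      by (simp only:) (intro vecs_Ints_arith Ints_mult bil_Ints Ints_of_int)
  qed
  have "?E k \<in> carrier (Oplus Q D)" for k
  proof -
    have inv: "?E k *v (?E (- k) *v x) = x" for x k
      using eichler_inverse[OF e(2) zk, of "k * M" x] by simp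
    have "(*v) (?E k) ` vecs \<int> = vecs \<int>"
    proof
      show "(*v) (?E k) ` vecs \<int> \<subseteq> vecs \<int>" using int by auto
      show "vecs \<int> \<subseteq> (*v) (?E k) ` vecs \<int>"
      proof
        fix x :: "complex^'N" assume "x \<in> vecs \<int>"
        then show "x \<in> (*v) (?E k) ` vecs \<int>" using inv[of k x] int by (metis image_eqI)
      qed
    qed
    moreover have "bil Q (?E k *v x) (?E k *v y) = bil Q x y" for x y
      by (rule eichler_isometry[OF e(2) zk])
    moreover have cn: "?E k *v \<omega> \<in> cone D" if "\<omega> \<in> cone D" for \<omega> k
      by (rule eichler_cone[OF D that]) (use z e zk vecs_Rats_Reals in \<open>auto simp: bil_simps intro!: vecs_Reals_arith\<close>)
    have "(\<lambda>p. (*v) (?E k) ` p) ` D = D"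
    proof
      show "(\<lambda>p. (*v) (?E k) ` p) ` D \<subseteq> D"
      proof
        fix q assume "q \<in> (\<lambda>p. (*v) (?E k) ` p) ` D"
        then obtain p where p: "p \<in> D" "q = (*v) (?E k) ` p" by blast
        then obtain \<omega> where "\<omega> \<in> cone D" "p = line \<omega>" using D_eq_lines[OF D] by blast
        then show "q \<in> D" using p cn by (auto simp: mult_line cone_def)
      qed
      show "D \<subseteq> (\<lambda>p. (*v) (?E k) ` p) ` D"
      proof
        fix p assume "p \<in> D"
        then obtain \<omega> where w: "\<omega> \<in> cone D" "p = line \<omega>" using D_eq_lines[OF D] by blast
        have "?E (- k) *v \<omega> \<in> cone D" by (rule cn[OF w(1)])
        then have "line (?E (- k) *v \<omega>) \<in> D" by (simp only: cone_def mem_Collect_eq)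
        moreover have "(*v) (?E k) ` line (?E (- k) *v \<omega>) = p" unfolding mult_line inv using w by simp
        ultimately show "p \<in> (\<lambda>p. (*v) (?E k) ` p) ` D" by blast
      qed
    qed
    ultimately show ?thesis by (simp add: Oplus_def isometries_def)
  qed
  then show ?thesis using that[of M] d1(1) d2(1) by (simp add: M_def)
qed

text \<open>
  Two powers of an integral transvection lie in the same coset of a subgroup of finite index, hence their quotient
  is in the subgroup.
\<close>

lemma eichler_in_\<Gamma>:
  assumes z: "z \<in> vecs \<rat>" and e: "e \<in> vecs \<rat>" "bil Q e e = 0" "bil Q z e = 0"
  shows "\<exists>M::int. M > 0 \<and> eichler Q (of_int M *s z) e \<in> \<Gamma>"
proof -
  let ?G = "Oplus Q D"
  obtain M :: int where M: "M > 0" "\<And>k::int. eichler Q (of_int (k * M) *s z) e \<in> carrier ?G"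
    by (rule eichler_integral[OF assms]) blast
  define h where "h k = eichler Q (of_int (int k * M) *s z) e" for k
  have "(\<lambda>k. \<Gamma> #>\<^bsub>?G\<^esub> h k) ` UNIV \<subseteq> rcosets\<^bsub>?G\<^esub> \<Gamma>"
  proof -
    have "h k \<in> carrier ?G" for k unfolding h_def by (rule M(2))
    then show ?thesis by (auto simp: RCOSETS_def)
  qed
  then have "finite (range (\<lambda>k. \<Gamma> #>\<^bsub>?G\<^esub> h k))" using \<Gamma>(2) finite_subset by blast
  then have "\<not> inj (\<lambda>k. \<Gamma> #>\<^bsub>?G\<^esub> h k)" using finite_imageD infinite_UNIV_nat by blast
  then obtain i j where ij: "i < j" "\<Gamma> #>\<^bsub>?G\<^esub> h i = \<Gamma> #>\<^bsub>?G\<^esub> h j"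
    unfolding inj_def by (metis linorder_neqE_nat)
  have "h j \<in> \<Gamma> #>\<^bsub>?G\<^esub> h j" using \<Gamma>_one by (auto simp: r_coset_def Oplus_def intro: bexI[of _ "mat 1"])
  then have "h j \<in> \<Gamma> #>\<^bsub>?G\<^esub> h i" using ij(2) by simp
  then obtain g where g: "g \<in> \<Gamma>" "h j = g ** h i" by (auto simp: r_coset_def Oplus_def)
  have zk: "bil Q (of_int k *s z) e = 0" for k :: int using e(3) by (simp add: bil_simps)
  have "g = g ** (h i ** eichler Q (of_int (- (int i * M)) *s z) e)"
    unfolding h_def eichler_mult[OF e(2) zk zk] by (simp add: vec.scale_left_distrib[symmetric])
  also have "\<dots> = h j ** eichler Q (of_int (- (int i * M)) *s z) e" using g(2) by (simp add: matrix_mul_assoc)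
  also have "\<dots> = eichler Q (of_int (int (j - i) * M) *s z) e"
    unfolding h_def eichler_mult[OF e(2) zk zk] using ij(1)
    by (simp add: vec.scale_left_distrib[symmetric] of_nat_diff algebra_simps)
  finally have "eichler Q (of_int (int (j - i) * M) *s z) e \<in> \<Gamma>" using g(1) by simp
  then show ?thesis using ij(1) M(1) by (intro exI[of _ "int (j - i) * M"]) simp
qed

lemma eichler_\<Gamma>_multiple:
  assumes "bil Q e e = 0" "bil Q z e = 0" "eichler Q z e \<in> \<Gamma>"
  shows "eichler Q (of_nat k *s z) e \<in> \<Gamma>"
proof (induction k)
  case 0 then show ?case using \<Gamma>_one by simp
next
  case (Suc k)
  have "eichler Q z e ** eichler Q (of_nat k *s z) e \<in> \<Gamma>" by (intro \<Gamma>_mult assms(3) Suc)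
  then show ?case using eichler_mult[OF assms(1,2), of "of_nat k *s z"] assms(2)
    by (simp add: bil_simps vec.scale_left_distrib)
qed

lemma eichler_\<Gamma>_minus:
  assumes "bil Q e e = 0" "bil Q z e = 0" "eichler Q z e \<in> \<Gamma>"
  shows "eichler Q (- z) e \<in> \<Gamma>"
proof -
  obtain h where h: "h \<in> \<Gamma>" "h ** eichler Q z e = mat 1" using \<Gamma>_inverse[OF assms(3)] by blast
  have "h = h ** (eichler Q z e ** eichler Q (- z) e)"
    using eichler_mult[OF assms(1,2), of "- z"] assms(2) by (simp add: bil_simps)
  also have "\<dots> = eichler Q (- z) e" using h(2) by (simp add: matrix_mul_assoc)
  finally show ?thesis using h(1) by simp
qed

lemma fspan_image:
  "fspan F ((*v) g ` S) = (*v) (g :: complex^'N^'N) ` fspan F S" if inj: "inj ((*v) g)"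
proof
  show "fspan F ((*v) g ` S) \<subseteq> (*v) g ` fspan F S"
  proof
    fix x assume "x \<in> fspan F ((*v) g ` S)"
    then obtain A c where A: "x = (\<Sum>x\<in>A. c x *s x)" "finite A" "A \<subseteq> (*v) g ` S" "\<forall>x\<in>A. c x \<in> F"
      by (auto simp: fspan_def)
    obtain B where B: "B \<subseteq> S" "A = (*v) g ` B" using A(3) by (metis subset_image_iff)
    have inB: "inj_on ((*v) g) B" using inj inj_on_subset by blast
    have "x = (\<Sum>y\<in>B. c (g *v y) *s (g *v y))" unfolding A(1) B(2) by (simp add: sum.reindex[OF inB])
    also have "\<dots> = g *v (\<Sum>y\<in>B. c (g *v y) *s y)"
      by (simp add: vec.linear_sum[OF matrix_vector_mul_linear_gen] mv_scale)
    finally have "x = g *v (\<Sum>y\<in>B. c (g *v y) *s y)" .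
    moreover have "finite B" using A(2) B(2) inB finite_imageD by blast
    ultimately show "x \<in> (*v) g ` fspan F S" using A(4) B unfolding fspan_def
      by (intro image_eqI[where x = "\<Sum>y\<in>B. c (g *v y) *s y"] CollectI exI[of _ B] exI[of _ "\<lambda>y. c (g *v y)"]) auto
  qed
  show "(*v) g ` fspan F S \<subseteq> fspan F ((*v) g ` S)"
  proof
    fix x assume "x \<in> (*v) g ` fspan F S"
    then obtain A c where A: "x = g *v (\<Sum>x\<in>A. c x *s x)" "finite A" "A \<subseteq> S" "\<forall>x\<in>A. c x \<in> F"
      by (auto simp: fspan_def)
    have inA: "inj_on ((*v) g) A" using inj inj_on_subset by blast
    have "x = (\<Sum>y\<in>A. c y *s (g *v y))"
      by (simp add: A(1) vec.linear_sum[OF matrix_vector_mul_linear_gen] mv_scale)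
    also have "\<dots> = (\<Sum>y\<in>(*v) g ` A. c (inv_into A ((*v) g) y) *s y)"
      by (simp add: sum.reindex[OF inA] inv_into_f_f[OF inA])
    finally show "x \<in> fspan F ((*v) g ` S)" unfolding fspan_def
      using A inA by (intro CollectI exI[of _ "(*v) g ` A"] exI[of _ "\<lambda>y. c (inv_into A ((*v) g) y)"]) (auto simp: inv_into_f_f)
  qed
qed

lemma \<Gamma>_inj: "g \<in> \<Gamma> \<Longrightarrow> inj ((*v) g)"
  using \<Gamma>_inverse[of g] by (metis inj_on_inverseI matrix_vector_mul_assoc matrix_vector_mul_lid)

lemma primitive_isotropic_image:
  assumes g: "g \<in> \<Gamma>" and M: "primitive_isotropic Q r M"
  shows "primitive_isotropic Q r ((*v) g ` M)"
proof -
  obtain h where h: "h \<in> \<Gamma>" "g ** h = mat 1" "h ** g = mat 1" using \<Gamma>_inverse[OF g] by blast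
  have inv: "g *v (h *v x) = x" "h *v (g *v x) = x" for x using h by (simp_all add: matrix_vector_mul_assoc)
  have "vec.dim ((*v) g ` M) = vec.dim M"
    by (rule vec.dim_image_eq[OF matrix_vector_mul_linear_gen]) (use \<Gamma>_inj[OF g] inj_on_subset in blast)
  moreover have "x \<in> (*v) g ` M" if "x \<in> vecs \<int>" "c \<in> \<int>" "c \<noteq> 0" "c *s x \<in> (*v) g ` M" for x c
  proof -
    have "c *s (h *v x) \<in> M" using that(4) inv by (auto simp: mv_scale[symmetric])
    then have "h *v x \<in> M" using M that \<Gamma>_real(1)[OF h(1) that(1)] by (auto simp: primitive_isotropic_def)
    then show ?thesis using inv by (metis image_eqI)
  qed
  ultimately show ?thesis using M \<Gamma>_real(1)[OF g] \<Gamma>_bil[OF g] fspan_image[OF \<Gamma>_inj[OF g]]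
    unfolding primitive_isotropic_def by auto
qed

lemma cusp_data_image:
  assumes g: "g \<in> \<Gamma>" and c: "(e, e') \<in> cusp_data Q" shows "(g *v e, g *v e') \<in> cusp_data Q"
proof -
  have "(*v) g ` fspan \<int> {e} = fspan \<int> {g *v e}" using fspan_image[OF \<Gamma>_inj[OF g], of \<int> "{e}"] by simp
  then show ?thesis using c primitive_isotropic_image[OF g, of 1 "fspan \<int> {e}"] \<Gamma>_real(2)[OF g] \<Gamma>_bil[OF g]
    by (auto simp: cusp_data_def)
qed

text \<open>
  Transport of structure: conjugating the transvection of \<open>z \<otimes> e\<close> by \<open>g\<close> gives that of \<open>gz \<otimes> ge\<close>.
\<close>

lemma eichler_conj:
  assumes g: "g \<in> \<Gamma>" shows "eichler Q (g *v z) (g *v e) *v (g *v x) = g *v (eichler Q z e *v x)"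
  by (simp add: eichler_apply \<Gamma>_bil[OF g] matrix_vector_right_distrib matrix_vector_mult_diff_distrib
      mv_scale)

end

section \<open>The one-dimensional cusp\<close>

lemma fspan_subset:
  assumes "0 \<in> V" "\<And>x y. x \<in> V \<Longrightarrow> y \<in> V \<Longrightarrow> x + y \<in> V" "\<And>c x. c \<in> F \<Longrightarrow> x \<in> S \<Longrightarrow> c *s x \<in> V"
  shows "fspan F S \<subseteq> V"
proof
  fix x assume "x \<in> fspan F S"
  then obtain A c where A: "x = (\<Sum>x\<in>A. c x *s x)" "finite A" "A \<subseteq> S" "\<forall>x\<in>A. c x \<in> F" by (auto simp: fspan_def)
  have "(\<Sum>x\<in>A. c x *s x) \<in> V" using A(2,3,4)
    by (induction A rule: finite_induct) (use assms in auto)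
  then show "x \<in> V" using A(1) by simp
qed

lemma fspan_two:
  assumes "x \<in> S" "y \<in> S" "x \<noteq> y" "a \<in> F" "b \<in> F" shows "a *s x + b *s y \<in> fspan F S"
proof -
  have "a *s x + b *s y = (\<Sum>z\<in>{x, y}. (if z = x then a else b) *s z)" using assms by simp
  then show ?thesis unfolding fspan_def using assms
    by (intro CollectI exI[of _ "{x, y}"] exI[of _ "\<lambda>z. if z = x then a else b"]) auto
qed

lemma fspan_one: "x \<in> S \<Longrightarrow> a \<in> F \<Longrightarrow> a *s x \<in> fspan F S"
  unfolding fspan_def by (intro CollectI exI[of _ "{x}"] exI[of _ "\<lambda>z. a"]) auto

lemma fspan_singleton: "0 \<in> F \<Longrightarrow> fspan F {v} = {k *s v |k. k \<in> F}"
proof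
  assume F: "0 \<in> F"
  show "fspan F {v} \<subseteq> {k *s v |k. k \<in> F}"
  proof
    fix x assume "x \<in> fspan F {v}"
    then obtain A c where A: "x = (\<Sum>x\<in>A. c x *s x)" "A \<subseteq> {v}" "\<forall>x\<in>A. c x \<in> F" by (auto simp: fspan_def)
    then consider "A = {}" | "A = {v}" by blast
    then show "x \<in> {k *s v |k. k \<in> F}"
      by cases (use A F in \<open>auto intro: exI[of _ 0]\<close>)
  qed
  show "{k *s v |k. k \<in> F} \<subseteq> fspan F {v}" using fspan_one[of v "{v}"] by auto
qed

text \<open>
  Bounded denominators provide an element of least positive value, and division with remainder shows that it
  generates.
\<close>

lemma cyclic_subgroup:
  fixes G :: "complex set"
  assumes sub: "\<And>a b. a \<in> G \<Longrightarrow> b \<in> G \<Longrightarrow> a - b \<in> G" and nz: "a0 \<in> G" "a0 \<noteq> 0"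
    and d: "\<delta> \<noteq> 0" "\<And>a. a \<in> G \<Longrightarrow> \<delta> * a \<in> \<int>"
  shows "\<exists>g\<in>G. g \<noteq> 0 \<and> G = {of_int k * g |k. True}"
proof -
  have zero: "0 \<in> G" using sub[OF nz(1) nz(1)] by simp
  have neg: "- a \<in> G" if "a \<in> G" for a using sub[OF zero that] by simp
  have add: "a + b \<in> G" if "a \<in> G" "b \<in> G" for a b using sub[OF that(1) neg[OF that(2)]] by simp
  have natm: "of_nat k * a \<in> G" if "a \<in> G" for k a
    by (induction k) (use zero add that in \<open>auto simp: distrib_right\<close>)
  have intm: "of_int k * a \<in> G" if "a \<in> G" for k a
    using natm[OF that, of "nat k"] neg[OF natm[OF that, of "nat (- k)"]] by (cases "k \<ge> 0") auto
  define P where "P k \<longleftrightarrow> k > 0 \<and> (\<exists>a\<in>G. \<delta> * a = of_nat k)" for k :: nat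
  have "\<exists>k. P k"
  proof -
    obtain m where m: "\<delta> * a0 = of_int m" using d(2)[OF nz(1)] by (auto elim: Ints_cases)
    have "m \<noteq> 0" using m nz d(1) by auto
    show ?thesis
    proof (cases "m > 0")
      case True
      then show ?thesis using m nz(1) unfolding P_def by (intro exI[of _ "nat m"]) auto
    next
      case False
      then have "\<delta> * (- a0) = of_nat (nat (- m))" using m \<open>m \<noteq> 0\<close> by simp
      then show ?thesis using neg[OF nz(1)] False \<open>m \<noteq> 0\<close> unfolding P_def
        by (intro exI[of _ "nat (- m)"] conjI bexI[of _ "- a0"]) auto
    qed
  qed
  define k where "k = (LEAST k. P k)"
  have "P k" unfolding k_def using LeastI_ex[OF \<open>\<exists>k. P k\<close>] .
  then obtain g where g: "g \<in> G" "\<delta> * g = of_nat k" "k > 0" by (auto simp: P_def)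
  have "g \<noteq> 0" using g by auto
  moreover have "a \<in> {of_int k * g |k. True}" if a: "a \<in> G" for a
  proof -
    obtain m where m: "\<delta> * a = of_int m" using d(2)[OF a] by (auto elim: Ints_cases)
    define r where "r = m mod int k"
    have mr: "m = (m div int k) * int k + r" by (simp add: r_def)
    define b where "b = a - of_int (m div int k) * g"
    have b: "b \<in> G" unfolding b_def by (intro sub a intm g)
    have "\<delta> * b = of_int m - of_int (m div int k) * of_nat k" by (simp add: b_def right_diff_distrib m g(2)[symmetric])
    also have "\<dots> = of_int (m - (m div int k) * int k)" by simp
    also have "m - (m div int k) * int k = r" using mr by simp
    finally have db: "\<delta> * b = of_int r" .
    have "0 \<le> r" "r < int k" using g(3) by (auto simp: r_def)
    have "r = 0"
    proof (rule ccontr)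
      assume "r \<noteq> 0"
      then have "P (nat r)" using b db \<open>0 \<le> r\<close> by (auto simp: P_def intro!: bexI[of _ b])
      then have "k \<le> nat r" unfolding k_def by (rule Least_le)
      then show False using \<open>r < int k\<close> \<open>0 \<le> r\<close> by simp
    qed
    then have "b = 0" using db d(1) by simp
    then show ?thesis by (auto simp: b_def)
  qed
  moreover have "{of_int k * g |k. True} \<subseteq> G" using intm[OF g(1)] by auto
  ultimately show ?thesis using g(1) by blast
qed

locale jcusp = tube_realization Q n e e' D + arithmetic Q n D \<Gamma>
  for Q :: "int^'N^'N" and n e e' D \<Gamma> +
  fixes J :: "(complex^'N) set"
  assumes J: "primitive_isotropic Q 2 J" and eJ: "e \<in> J"
begin

lemma J_int: "x \<in> J \<Longrightarrow> x \<in> vecs \<int>" and J_isotropic: "x \<in> J \<Longrightarrow> y \<in> J \<Longrightarrow> bil Q x y = 0"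
  and J_dim: "vec.dim J = 2"
  using J by (auto simp: primitive_isotropic_def)

text \<open>
  The vector \<open>v\<close> spans the line that \<open>J\<close> cuts out in \<open>{e, e'}\<^sup>\<bottom>\<close>, over the rationals and over the complex numbers.  This
  line is \<open>U(J)\<close> as a subgroup of \<open>U(I)\<close>.
\<close>

definition jgen :: "complex^'N \<Rightarrow> bool" where
  "jgen v \<longleftrightarrow> v \<in> UI Q \<rat> e e' \<and> v \<noteq> 0 \<and> bil Q v v = 0 \<and>
     fspan \<rat> J = {a *s e + b *s v |a b. a \<in> \<rat> \<and> b \<in> \<rat>} \<and> vec.span J = {a *s e + b *s v |a b. True}"

lemma e_nz: "e \<noteq> 0" using ee' by auto

lemma jgen_ex: "\<exists>v. jgen v"
proof -
  have sp_e: "vec.span {e} = {c *s e |c. True}" by (auto simp: vec.span_singleton)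
  have "\<not> J \<subseteq> vec.span {e}"
  proof
    assume "J \<subseteq> vec.span {e}"
    then have "vec.dim J \<le> card {e}" by (intro vec.dim_le_card) auto
    then show False using J_dim by simp
  qed
  then obtain j where j: "j \<in> J" "j \<notin> vec.span {e}" by blast
  have ind: "vec.independent {e, j}"
    using j(2) e_nz by (subst insert_commute) (auto simp: vec.independent_insert vec.dependent_single)
  have jne: "j \<noteq> e" using j(2) vec.span_base[of e "{e}"] by auto
  have J1: "J \<subseteq> vec.span {e, j}"
    by (rule vec.card_ge_dim_independent) (use ind eJ j jne J_dim in auto)
  then have spJ: "vec.span J = vec.span {e, j}"
    using vec.span_mono[of "{e, j}" J] vec.span_minimal[OF J1 vec.subspace_span] eJ j(1) by blast
  have sp2: "vec.span {e, j} = {a *s e + b *s j |a b. True}"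
  proof
    show "vec.span {e, j} \<subseteq> {a *s e + b *s j |a b. True}"
    proof
      fix x assume "x \<in> vec.span {e, j}"
      then obtain k where "x - k *s e \<in> vec.span {j}" by (auto simp: vec.span_insert)
      then obtain b where "x - k *s e = b *s j" by (auto simp: vec.span_singleton)
      then have "x = k *s e + b *s j" by (simp add: algebra_simps)
      then show "x \<in> {a *s e + b *s j |a b. True}" by blast
    qed
    have "a *s e + b *s j \<in> vec.span {e, j}" for a b
      by (intro vec.span_add vec.span_scale vec.span_base) auto
    then show "{a *s e + b *s j |a b. True} \<subseteq> vec.span {e, j}" by blast
  qed
  define q where "q = bil Q j e'"
  define v where "v = j - q *s e"
  have q: "q \<in> \<rat>" unfolding q_def by (intro bil_Rats e'_rat vecs_Ints_Rats J_int j)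
  have jv: "j = q *s e + v" by (simp add: v_def)
  have vr: "v \<in> vecs \<rat>" unfolding v_def by (intro vecs_Rats_arith q e_rat vecs_Ints_Rats J_int j)
  have vU: "v \<in> UI Q \<rat> e e'" using vr J_isotropic[OF j(1) eJ] by (simp add: UI_iff v_def bil_simps cusp_bil q_def)
  have "v \<noteq> 0"
  proof
    assume "v = 0"
    then have "j = q *s e" by (simp add: v_def)
    then show False using j(2) sp_e by blast
  qed
  moreover have "bil Q v v = 0"
    using J_isotropic[OF j(1) eJ] J_isotropic[OF eJ j(1)] J_isotropic[OF j(1) j(1)] by (simp add: v_def bil_simps ee)
  moreover have spv: "vec.span J = {a *s e + b *s v |a b. True}"
  proof -
    have 1: "a *s e + b *s j = (a + b * q) *s e + b *s v" for a b by (simp add: v_def vec_eq_iff algebra_simps)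
    have 2: "a *s e + b *s v = (a - b * q) *s e + b *s j" for a b by (simp add: v_def vec_eq_iff algebra_simps)
    show ?thesis unfolding spJ sp2 by (rule Collect_cong) (metis 1 2)
  qed
  moreover have "fspan \<rat> J = {a *s e + b *s v |a b. a \<in> \<rat> \<and> b \<in> \<rat>}"
  proof
    have rat: "\<exists>a b. a \<in> \<rat> \<and> b \<in> \<rat> \<and> x = a *s e + b *s v" if x: "x \<in> J" for x
    proof -
      have "x \<in> vec.span J" using x by (rule vec.span_base)
      then obtain a b where ab: "x = a *s e + b *s v" using spv by auto
      have "bil Q x e' = a" using vU by (simp add: ab bil_simps cusp_bil UI_iff)
      then have a: "a \<in> \<rat>" using bil_Rats[OF vecs_Ints_Rats[OF J_int[OF x]] e'_rat, of Q] by simp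
      have "b *s v = x - a *s e" using ab by simp
      then have bv: "b *s v \<in> vecs \<rat>" using vecs_Ints_Rats[OF J_int[OF x]] a e_rat by (auto intro: vecs_Rats_arith)
      obtain i where i: "v $ i \<noteq> 0" using \<open>v \<noteq> 0\<close> by (auto simp: vec_eq_iff)
      have "b * v $ i \<in> \<rat>" "v $ i \<in> \<rat>" using bv vr by (auto simp: vecs_def)
      then have "(b * v $ i) / v $ i \<in> \<rat>" by (rule Rats_divide)
      then have "b \<in> \<rat>" using i by simp
      then show ?thesis using a ab by blast
    qed
    show "fspan \<rat> J \<subseteq> {a *s e + b *s v |a b. a \<in> \<rat> \<and> b \<in> \<rat>}"
    proof (rule fspan_subset)
      show "0 \<in> {a *s e + b *s v |a b. a \<in> \<rat> \<and> b \<in> \<rat>}"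
        by (rule CollectI, rule exI[of _ 0], rule exI[of _ 0]) simp
      show "x + y \<in> {a *s e + b *s v |a b. a \<in> \<rat> \<and> b \<in> \<rat>}"
        if xy: "x \<in> {a *s e + b *s v |a b. a \<in> \<rat> \<and> b \<in> \<rat>}" "y \<in> {a *s e + b *s v |a b. a \<in> \<rat> \<and> b \<in> \<rat>}" for x y
      proof -
        obtain a b where ab: "x = a *s e + b *s v" "a \<in> \<rat>" "b \<in> \<rat>" using xy(1) by auto
        obtain a' b' where ab': "y = a' *s e + b' *s v" "a' \<in> \<rat>" "b' \<in> \<rat>" using xy(2) by auto
        show ?thesis
          by (rule CollectI, rule exI[of _ "a + a'"], rule exI[of _ "b + b'"])
             (use ab ab' in \<open>auto simp: vec_eq_iff algebra_simps\<close>)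
      qed
      show "c *s x \<in> {a *s e + b *s v |a b. a \<in> \<rat> \<and> b \<in> \<rat>}" if cx: "c \<in> \<rat>" "x \<in> J" for c x
      proof -
        obtain a b where ab: "a \<in> \<rat>" "b \<in> \<rat>" "x = a *s e + b *s v" using rat[OF cx(2)] by blast
        show ?thesis
          by (rule CollectI, rule exI[of _ "c * a"], rule exI[of _ "c * b"])
             (use ab cx in \<open>auto simp: vec_eq_iff algebra_simps\<close>)
      qed
    qed
    show "{a *s e + b *s v |a b. a \<in> \<rat> \<and> b \<in> \<rat>} \<subseteq> fspan \<rat> J"
    proof
      fix x assume "x \<in> {a *s e + b *s v |a b. a \<in> \<rat> \<and> b \<in> \<rat>}"
      then obtain a b where ab: "x = a *s e + b *s v" "a \<in> \<rat>" "b \<in> \<rat>" by blast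
      have "x = (a - b * q) *s e + b *s j" by (simp add: ab v_def vec_eq_iff algebra_simps)
      moreover have "(a - b * q) *s e + b *s j \<in> fspan \<rat> J"
        by (rule fspan_two[OF eJ j(1)]) (use jne ab q in auto)
      ultimately show "x \<in> fspan \<rat> J" by (simp only:)
    qed
  qed
  ultimately show ?thesis using vU unfolding jgen_def by blast
qed

lemma jgen_scale:
  assumes v: "jgen v" and c: "c \<in> \<rat>" "c \<noteq> 0" shows "jgen (c *s v)"
proof -
  have e1: "a *s e + b *s (c *s v) = a *s e + (b * c) *s v" for a b by (simp add: vector_smult_assoc)
  have e2: "a *s e + b *s v = a *s e + (b / c) *s (c *s v)" for a b using c by (simp add: vector_smult_assoc)
  have "{a *s e + b *s v |a b. a \<in> \<rat> \<and> b \<in> \<rat>} = {a *s e + b *s (c *s v) |a b. a \<in> \<rat> \<and> b \<in> \<rat>}"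
  proof (intro equalityI subsetI; elim CollectE exE conjE)
    fix x a b assume h: "x = a *s e + b *s v" "a \<in> \<rat>" "b \<in> \<rat>"
    show "x \<in> {a *s e + b *s (c *s v) |a b. a \<in> \<rat> \<and> b \<in> \<rat>}"
    proof -
      have "x = a *s e + (b / c) *s (c *s v)" unfolding h(1) by (rule e2)
      moreover have "b / c \<in> \<rat>" using h c by simp
      ultimately show ?thesis using h(2) by blast
    qed
  next
    fix x a b assume h: "x = a *s e + b *s (c *s v)" "a \<in> \<rat>" "b \<in> \<rat>"
    show "x \<in> {a *s e + b *s v |a b. a \<in> \<rat> \<and> b \<in> \<rat>}"
    proof -
      have "x = a *s e + (b * c) *s v" unfolding h(1) by (rule e1)
      moreover have "b * c \<in> \<rat>" using h c by simp
      ultimately show ?thesis using h(2) by blast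
    qed
  qed
  moreover have "{a *s e + b *s v |a b. True} = {a *s e + b *s (c *s v) |a b. True}"
    by (rule Collect_cong) (metis e1 e2)
  ultimately show ?thesis using v c unfolding jgen_def
    by (auto simp: bil_simps intro!: UI_Rats_arith)
qed

lemma jgen_bil:
  assumes "jgen v"
  shows "bil Q v v = 0" "bil Q v e = 0" "bil Q e v = 0" "bil Q v e' = 0" "bil Q e' v = 0" "v \<in> vecs \<rat>" "v \<in> vecs \<real>"
  using assms bil_sym[of e v] bil_sym[of e' v] by (auto simp: jgen_def UI_iff vecs_Rats_Reals)

lemma perp_J_iff:
  assumes v: "jgen v" shows "x \<in> perp Q J \<longleftrightarrow> bil Q x e = 0 \<and> bil Q x v = 0"
proof
  assume x: "x \<in> perp Q J"
  have "v \<in> {a *s e + b *s v |a b. a \<in> \<rat> \<and> b \<in> \<rat>}"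
    by (rule CollectI, rule exI[of _ 0], rule exI[of _ 1]) simp
  then have "v \<in> fspan \<rat> J" using v by (simp only: jgen_def)
  moreover have "fspan \<rat> J \<subseteq> {y. bil Q x y = 0}"
    by (rule fspan_subset) (use x in \<open>auto simp: bil_simps perp_def\<close>)
  ultimately show "bil Q x e = 0 \<and> bil Q x v = 0" using x eJ by (auto simp: perp_def)
next
  assume x: "bil Q x e = 0 \<and> bil Q x v = 0"
  have "bil Q x y = 0" if "y \<in> J" for y
  proof -
    have "y \<in> vec.span J" using that by (rule vec.span_base)
    then obtain a b where "y = a *s e + b *s v" using v unfolding jgen_def by auto
    then show ?thesis using x by (simp add: bil_simps)
  qed
  then show "x \<in> perp Q J" by (simp add: perp_def)
qed

lemma eichler_jgen_fixes:
  assumes v: "jgen v" and x: "bil Q x e = 0" "bil Q x v = 0" shows "eichler Q (b *s v) e *v x = x"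
  using x bil_sym[of e x] bil_sym[of v x] by (simp add: eichler_apply bil_simps)

lemma eichler_jgen_UJ:
  assumes v: "jgen v" and b: "b \<in> \<rat>" shows "eichler Q (b *s v) e \<in> UJ Q \<rat> J"
proof -
  note vb = jgen_bil[OF v]
  let ?E = "\<lambda>b. eichler Q (b *s v) e"
  have zb: "bil Q (b *s v) e = 0" for b using vb by (simp add: bil_simps)
  have rat: "?E b *v x \<in> vecs \<rat>" if "x \<in> vecs \<rat>" "b \<in> \<rat>" for x b
    unfolding eichler_apply using that vb e_rat
    by (intro vecs_Rats_arith bil_Rats Rats_mult Rats_divide) auto
  have inv: "?E b *v (?E (- b) *v x) = x" for x b
    using eichler_inverse[OF ee zb, of b x] by simp
  have fixJ: "?E b *v x = x" if x: "x \<in> fspan \<rat> J" for x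
  proof -
    obtain a c where "x = a *s e + c *s v" using x v unfolding jgen_def by auto
    then show ?thesis by (intro eichler_jgen_fixes v) (auto simp: bil_simps vb ee)
  qed
  have "?E b \<in> isometries Q \<rat>"
    unfolding isometries_def
  proof (intro CollectI conjI allI)
    show "(*v) (?E b) ` vecs \<rat> = vecs \<rat>"
    proof
      show "(*v) (?E b) ` vecs \<rat> \<subseteq> vecs \<rat>" using rat[OF _ b] by auto
      show "vecs \<rat> \<subseteq> (*v) (?E b) ` vecs \<rat>"
      proof
        fix x :: "complex^'N" assume "x \<in> vecs \<rat>"
        then have "?E (- b) *v x \<in> vecs \<rat>" using b by (intro rat) auto
        then show "x \<in> (*v) (?E b) ` vecs \<rat>" using inv[of b x] by (metis image_eqI)
      qed
    qed
    show "bil Q (?E b *v x) (?E b *v y) = bil Q x y" for x y by (rule eichler_isometry[OF ee zb])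
  qed
  moreover have "(*v) (?E b) ` fspan \<rat> J = fspan \<rat> J" using fixJ by (simp cong: image_cong)
  moreover have pf: "?E b *v x = x" if "x \<in> vecs \<rat> \<inter> perp Q J" for x
    using that perp_J_iff[OF v] by (intro eichler_jgen_fixes v) auto
  moreover have "0 \<in> fspan \<rat> J" using fspan_one[OF eJ, of 0 \<rat>] by simp
  ultimately show ?thesis unfolding UJ_def GammaJ_def using fixJ by auto
qed

text \<open>
  Correct any rational vector that pairs nontrivially with \<open>v\<close> by a multiple of \<open>v\<close>, and rescale.
\<close>

lemma isotropic_partner:
  assumes v: "jgen v"
  shows "\<exists>l. l \<in> UI Q \<rat> e e' \<and> bil Q l l = 0 \<and> bil Q v l = 1"
proof -
  have "v \<in> UI Q UNIV e e'" "v \<noteq> 0" using v by (auto simp: jgen_def UI_iff)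
  then obtain y where y: "y \<in> UI Q \<rat> e e'" "bil Q v y \<noteq> 0" using UI_nondegenerate[of v] by blast
  define c where "c = bil Q v y"
  have c: "c \<noteq> 0" "c \<in> \<rat>" using y jgen_bil[OF v] by (auto simp: c_def UI_iff intro!: bil_Rats)
  have yy: "bil Q y y \<in> \<rat>" using y by (auto simp: UI_iff intro!: bil_Rats)
  define l where "l = (1 / c) *s (y - (bil Q y y / (2 * c)) *s v)"
  have "l \<in> UI Q \<rat> e e'" unfolding l_def
    using y v c yy by (intro UI_Rats_arith) (auto simp: jgen_def)
  moreover have "bil Q v l = 1" using c jgen_bil[OF v] by (simp add: l_def bil_simps c_def)
  moreover have "bil Q l l = 0"
    using c jgen_bil[OF v] bil_sym[of y v] by (simp add: l_def bil_simps c_def[symmetric])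
  ultimately show ?thesis by blast
qed

text \<open>
  A transvection \<open>E\<^bsub>z \<otimes> e\<^esub>\<close> fixes \<open>J\<^sup>\<bottom>\<close> pointwise only if \<open>z\<close> is orthogonal to \<open>J\<^sup>\<bottom>\<close>, and then \<open>z\<close> is in the span of \<open>v\<close>
  by nondegeneracy.
\<close>

lemma UJ_rat_eq:
  assumes v: "jgen v" shows "UJ_rat Q J e e' = {b *s v |b. b \<in> \<rat>}"
proof
  show "{b *s v |b. b \<in> \<rat>} \<subseteq> UJ_rat Q J e e'"
    using eichler_jgen_UJ[OF v] v by (auto simp: UJ_rat_def jgen_def intro: UI_Rats_arith)
  show "UJ_rat Q J e e' \<subseteq> {b *s v |b. b \<in> \<rat>}"
  proof
    fix z assume z: "z \<in> UJ_rat Q J e e'"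
    then have zU: "z \<in> UI Q \<rat> e e'" and zf: "\<And>x. x \<in> vecs \<rat> \<inter> perp Q J \<Longrightarrow> eichler Q z e *v x = x"
      by (auto simp: UJ_rat_def UJ_def)
    have zperp: "bil Q z x = 0" if "x \<in> vecs \<rat>" "bil Q x e = 0" "bil Q x v = 0" for x
    proof -
      have "eichler Q z e *v x = x" using zf that perp_J_iff[OF v] by simp
      then have "bil Q z x *s e = 0" using that(2) bil_sym[of e x] by (simp add: eichler_apply)
      then show ?thesis using e_nz by simp
    qed
    obtain l where l: "l \<in> UI Q \<rat> e e'" "bil Q l l = 0" "bil Q v l = 1" using isotropic_partner[OF v] by blast
    define b where "b = bil Q z l"
    have b: "b \<in> \<rat>" using zU l by (auto simp: b_def UI_iff intro!: bil_Rats)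
    have "z - b *s v = 0"
    proof (rule UI_nondegenerate)
      show "z - b *s v \<in> UI Q UNIV e e'" using zU jgen_bil[OF v] by (auto simp: UI_iff bil_simps)
      fix x assume x: "x \<in> UI Q \<rat> e e'"
      have xv: "bil Q x v \<in> \<rat>" using x jgen_bil[OF v] by (auto simp: UI_iff intro!: bil_Rats)
      have "bil Q z (x - bil Q x v *s l) = 0"
        by (rule zperp) (use x l xv bil_sym[of l v] in \<open>auto simp: UI_iff bil_simps intro!: vecs_Rats_arith\<close>)
      then show "bil Q (z - b *s v) x = 0" by (simp add: bil_simps b_def bil_sym[of v x])
    qed
    then show "z \<in> {b *s v |b. b \<in> \<rat>}" using b by auto
  qed
qed

text \<open>
  Finite index makes the group nonzero and integrality of its elements bounds the denominators, so it is infinite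
  cyclic.  A nonzero isotropic vector has nonzero pairing with \<open>u0\<close>, so exactly one of the two generators is in the closure of
  the positive cone.
\<close>

lemma UJ_int_generator:
  "\<exists>v. jgen v \<and> UJ_int Q \<Gamma> J e e' = fspan \<int> {v} \<and> v \<in> closure (half_cone u0)"
proof -
  obtain v where v: "jgen v" using jgen_ex by blast
  note vb = jgen_bil[OF v]
  have zb: "bil Q (b *s v) e = 0" for b using vb by (simp add: bil_simps)
  define G where "G = {b \<in> \<rat>. eichler Q (b *s v) e \<in> \<Gamma>}"
  have UJG: "UJ_int Q \<Gamma> J e e' = {b *s v |b. b \<in> G}"
    using UJ_rat_eq[OF v] unfolding UJ_rat_def UJ_int_def G_def by auto
  have "\<exists>g\<in>G. g \<noteq> 0 \<and> G = {of_int k * g |k. True}"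
  proof -
    obtain M :: int where M: "M > 0" "eichler Q (of_int M *s v) e \<in> \<Gamma>"
      using eichler_in_\<Gamma>[OF vb(6) e_rat ee vb(2)] by blast
    obtain c where c: "c > 0" "of_int c *s e' \<in> vecs \<int>" using rational_scale_to_int[OF e'_rat] by blast
    obtain i where i: "v $ i \<noteq> 0" using v by (auto simp: jgen_def vec_eq_iff)
    show ?thesis
    proof (rule cyclic_subgroup[where \<delta> = "of_int c * v $ i"])
      show "a - b \<in> G" if "a \<in> G" "b \<in> G" for a b
      proof -
        have "eichler Q (a *s v) e ** eichler Q (- (b *s v)) e \<in> \<Gamma>"
          using that by (intro \<Gamma>_mult eichler_\<Gamma>_minus ee zb) (auto simp: G_def)
        then have "eichler Q (a *s v + - (b *s v)) e \<in> \<Gamma>"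
          using eichler_mult[OF ee zb, of "- (b *s v)" a] zb by (simp add: bil_simps)
        then show ?thesis using that by (auto simp: G_def vec.scale_left_diff_distrib)
      qed
      show "of_int M \<in> G" "of_int M \<noteq> (0 :: complex)" using M by (auto simp: G_def)
      show "of_int c * v $ i \<noteq> 0" using c i by simp
      \<comment> \<open>The transvection by \<open>av\<close> adds \<open>ca v\<close> to the integral vector \<open>ce'\<close>.\<close>
      show "of_int c * v $ i * a \<in> \<int>" if a: "a \<in> G" for a
      proof -
        have "eichler Q (a *s v) e *v (of_int c *s e') = of_int c *s e' + (of_int c * a) *s v"
          by (simp add: eichler_apply bil_simps vb cusp_bil vec_eq_iff)
        moreover have "eichler Q (a *s v) e *v (of_int c *s e') \<in> vecs \<int>"
          using a c by (intro \<Gamma>_real) (auto simp: G_def)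
        ultimately have "of_int c *s e' + (of_int c * a) *s v \<in> vecs \<int>" by simp
        then have "(of_int c *s e' + (of_int c * a) *s v) - of_int c *s e' \<in> vecs \<int>"
          using c(2) by (rule vecs_Ints_arith(2))
        then show ?thesis by (simp add: vecs_def mult_ac)
      qed
    qed
  qed
  then obtain g where g: "g \<in> G" "g \<noteq> 0" "G = {of_int k * g |k. True}" by blast
  have key: "jgen w \<and> UJ_int Q \<Gamma> J e e' = fspan \<int> {w}" if w: "w = (\<sigma> * g) *s v" "\<sigma> = 1 \<or> \<sigma> = -1" for w \<sigma>
  proof
    show "jgen w" unfolding w(1) by (rule jgen_scale[OF v]) (use g w(2) in \<open>auto simp: G_def\<close>)
    have "b *s v \<in> {k *s w |k. k \<in> \<int>}" if "b \<in> G" for b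
    proof -
      obtain k where "b = of_int k * g" using \<open>b \<in> G\<close> g(3) by auto
      then have "b *s v = (of_int k * \<sigma>) *s w" using w by (auto simp: vector_smult_assoc)
      then show ?thesis using w(2) by (intro CollectI exI[of _ "of_int k * \<sigma>"]) auto
    qed
    moreover have "k *s w \<in> {b *s v |b. b \<in> G}" if k: "k \<in> \<int>" for k
    proof -
      obtain k' where "k = of_int k'" using k by (auto elim: Ints_cases)
      then have "k *s w = (of_int (if \<sigma> = 1 then k' else - k') * g) *s v" using w by (auto simp: vector_smult_assoc)
      then show ?thesis using g(3) by blast
    qed
    ultimately show "UJ_int Q \<Gamma> J e e' = fspan \<int> {w}" unfolding UJG fspan_singleton[OF Ints_0] by blast
  qed
  have gr: "of_int s * g \<in> \<real>" for s using g(1) Rats_subset_Reals_complex by (auto simp: G_def)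
  let ?w = "\<lambda>\<sigma> :: complex. (\<sigma> * g) *s v"
  have wr: "?w 1 \<in> UI Q \<real> e e'" "?w 1 \<noteq> 0"
    using key[of "?w 1" 1] by (auto simp: jgen_def intro: UI_Rats_Reals)
  have ne: "Re (bil Q (?w 1) u0) \<noteq> 0"
    by (rule timelike_pairing) (use wr u0(1) vb in \<open>auto simp: timelike_def bil_simps\<close>)
  define \<sigma> :: complex where "\<sigma> = (if Re (bil Q (?w 1) u0) > 0 then 1 else -1)"
  have s: "\<sigma> = 1 \<or> \<sigma> = -1" by (simp add: \<sigma>_def)
  have "?w \<sigma> \<in> closure (half_cone u0)"
  proof (rule isotropic_in_closure[OF u0(1)])
    show "?w \<sigma> \<in> UI Q \<real> e e'" using wr s by (auto simp: UI_iff bil_minus_left intro: vecs_Reals_arith)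
    show "0 \<le> Re (bil Q (?w \<sigma>) (?w \<sigma>))" using vb by (simp add: bil_simps)
    show "0 < Re (bil Q (?w \<sigma>) u0)" using ne by (auto simp: \<sigma>_def bil_simps)
  qed
  then show ?thesis using key[of "?w \<sigma>" \<sigma>] s by blast
qed

abbreviation vv :: "complex^'N" where "vv \<equiv> vJ Q D \<Gamma> J e e'"

lemma vJ_props: "jgen vv" "UJ_int Q \<Gamma> J e e' = fspan \<int> {vv}" "vv \<in> closure (half_cone u0)"
  and vJ_unique: "\<And>v. v \<in> closure (half_cone u0) \<Longrightarrow> UJ_int Q \<Gamma> J e e' = fspan \<int> {v} \<Longrightarrow> v = vv"
proof -
  obtain v where v: "jgen v" "UJ_int Q \<Gamma> J e e' = fspan \<int> {v}" "v \<in> closure (half_cone u0)"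
    using UJ_int_generator by blast
  have un: "w = v" if w: "w \<in> closure (half_cone u0)" "UJ_int Q \<Gamma> J e e' = fspan \<int> {w}" for w
  proof -
    have eq: "{k *s w |k. k \<in> \<int>} = {k *s v |k. k \<in> \<int>}" using w(2) v(2) by (simp add: fspan_singleton)
    have "1 *s w \<in> {k *s w |k. k \<in> \<int>}" "1 *s v \<in> {k *s v |k. k \<in> \<int>}" using Ints_1 by blast+
    then have "w \<in> {k *s v |k. k \<in> \<int>}" "v \<in> {k *s w |k. k \<in> \<int>}" using eq by auto
    then obtain k l where kl: "k \<in> \<int>" "w = k *s v" "l \<in> \<int>" "v = l *s w" by blast
    obtain a where a: "k = of_int a" using kl(1) by (auto elim: Ints_cases)
    obtain b where b: "l = of_int b" using kl(3) by (auto elim: Ints_cases)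
    have ab: "w = of_int a *s v" "v = of_int b *s w" using kl a b by simp_all
    have vn: "v \<noteq> 0" using v(1) by (simp add: jgen_def)
    have "v = of_int (b * a) *s v"
    proof -
      have "of_int (b * a) *s v = of_int b *s (of_int a *s v)" by (simp add: vector_smult_assoc)
      then show ?thesis by (simp only: ab[symmetric])
    qed
    then have "(1 - of_int (b * a)) *s v = 0" by (simp add: vec.scale_left_diff_distrib)
    then have "1 - of_int (b * a) = (0 :: complex)" using vn by (simp only: vec.scale_eq_0_iff simp_thms)
    then have "of_int (b * a) = (1 :: complex)" by simp
    then have "b * a = 1" by (metis of_int_eq_1_iff)
    then have "a = 1 \<or> a = -1" by (metis zmult_eq_1_iff)
    moreover have "w \<noteq> 0" using ab vn by auto
    moreover have "0 < Re (bil Q w u0)" "0 < Re (bil Q v u0)"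
      using closure_half_cone(4)[OF u0(1)] w(1) v(3) vn \<open>w \<noteq> 0\<close> by auto
    ultimately show "w = v" using ab(1) by (auto simp: bil_simps)
  qed
  have "vv = v" unfolding vJ_def u0(2)
    by (rule the_equality) (rule conjI[OF v(3) v(2)], elim conjE, rule un)
  then have e: "vv = v" .
  show "jgen vv" "UJ_int Q \<Gamma> J e e' = fspan \<int> {vv}" "vv \<in> closure (half_cone u0)"
    unfolding e by (rule v)+
  show "w = vv" if "w \<in> closure (half_cone u0)" "UJ_int Q \<Gamma> J e e' = fspan \<int> {w}" for w
    unfolding e by (rule un[OF that])
qed

lemmas vv_bil = jgen_bil[OF vJ_props(1)]

lemma vv_UI: "vv \<in> UI Q \<rat> e e'" "vv \<in> UI Q \<real> e e'" "vv \<in> UI Q UNIV e e'" and vv_nz: "vv \<noteq> 0"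
  using vJ_props(1) UI_mono UI_Rats_Reals by (auto simp: jgen_def)

lemma eichler_vv_\<Gamma>: "eichler Q vv e \<in> \<Gamma>"
proof -
  have "1 *s vv \<in> fspan \<int> {vv}" by (rule fspan_one) auto
  then show ?thesis using vJ_props(2) by (auto simp: UJ_int_def)
qed

text \<open>
  In the tube coordinate, \<open>E\<^bsub>sv\<^esub>\<close> is the translation by \<open>sv\<close>.
\<close>

lemma tube_coord_vv:
  assumes "bil Q \<omega> e \<noteq> 0"
  shows "tco (eichler Q (s *s vv) e *v \<omega>) = tco \<omega> + s *s vv" "bil Q (eichler Q (s *s vv) e *v \<omega>) e = bil Q \<omega> e"
proof -
  have b: "bil Q (eichler Q (s *s vv) e *v \<omega>) e = bil Q \<omega> e"
    by (simp add: eichler_apply bil_simps vv_bil ee)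
  then show "bil Q (eichler Q (s *s vv) e *v \<omega>) e = bil Q \<omega> e" .
  have "bil Q (eichler Q (s *s vv) e *v \<omega>) e' = bil Q \<omega> e' - s * bil Q vv \<omega>"
    by (simp add: eichler_apply bil_simps vv_bil cusp_bil)
  then show "tco (eichler Q (s *s vv) e *v \<omega>) = tco \<omega> + s *s vv"
    unfolding tube_coord_def b using assms bil_sym[of e \<omega>]
    by (simp add: eichler_apply bil_simps vv_bil ee' vec_eq_iff field_simps)
qed

lemma eichler_vv_cone:
  assumes "\<omega> \<in> cone D" "0 \<le> Im s" shows "eichler Q (s *s vv) e *v \<omega> \<in> cone D"
proof -
  have ne: "bil Q \<omega> e \<noteq> 0" and Z: "tco \<omega> \<in> TD" using assms(1) cone_iff by auto
  have "tco \<omega> + s *s vv \<in> TD"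
  proof -
    have "vec_Im (tco \<omega> + s *s vv) = vec_Im (tco \<omega>) + of_real (Im s) *s vv"
      using vv_bil by (simp add: vec_Im_add vec_Im_scale)
    then have "vec_Im (tco \<omega> + s *s vv) \<in> half_cone u0"
      using half_cone_add_closure[OF u0(1) _ vJ_props(3) assms(2)] Z by (simp add: tube_domain_eq tube_over_def)
    then show ?thesis using TD_UI[OF Z] vv_UI(3) by (simp add: tube_domain_eq tube_over_def UI_arith)
  qed
  moreover have "bil Q (eichler Q (s *s vv) e *v \<omega>) (eichler Q (s *s vv) e *v \<omega>) = 0"
    using eichler_isometry[OF ee, of "s *s vv" \<omega> \<omega>] assms(1) cone_iff vv_bil by (simp add: bil_simps)
  ultimately show ?thesis using ne tube_coord_vv[OF ne] by (simp add: cone_iff)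
qed

text \<open>
  The coordinate on the upper half plane over which \<open>\<D>\<close> lies.  It is positive because both \<open>v\<close> and the
  imaginary part of the tube coordinate are on the positive side of the light cone.
\<close>

lemma vv_upper_half:
  assumes "\<omega> \<in> cone D" shows "0 < Im (bil Q \<omega> vv / bil Q \<omega> e)"
proof -
  have Z: "tco \<omega> \<in> TD" and ne: "bil Q \<omega> e \<noteq> 0" using assms cone_iff by auto
  have "0 < Re (bil Q vv (vec_Im (tco \<omega>)))"
  proof (rule same_side(2)[of u0])
    show "0 < Re (bil Q vv u0)" using closure_half_cone(4)[OF u0(1) vJ_props(3) vv_nz] .
  qed (use u0(1) vv_UI vv_bil Z in \<open>auto simp: timelike_def tube_domain_eq tube_over_def half_cone_def\<close>)
  also have "bil Q vv (vec_Im (tco \<omega>)) = of_real (Im (bil Q (tco \<omega>) vv))"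
    using bil_real_Im[OF vv_bil(7), of Q "tco \<omega>"] bil_sym[of vv] by simp
  also have "bil Q (tco \<omega>) vv = bil Q \<omega> vv / bil Q \<omega> e"
    by (simp add: tube_coord_def bil_simps vv_bil)
  finally show ?thesis by simp
qed

text \<open>
  A condition on the positive generator of \<open>U(J)\<close> that mentions neither \<open>e\<close> nor \<open>e'\<close>.  It decides which
  of the two generators is positive independently of the cusp.
\<close>

lemma unipotent_sign:
  assumes "\<omega> \<in> cone D" shows "Im (bil Q (eichler Q vv e *v \<omega> - \<omega>) (vec_cnj \<omega>)) < 0"
proof -
  let ?a = "bil Q \<omega> e" and ?b = "bil Q \<omega> vv"
  have ne: "?a \<noteq> 0" using assms cone_iff by auto
  have c: "bil Q e (vec_cnj \<omega>) = cnj ?a" "bil Q vv (vec_cnj \<omega>) = cnj ?b"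
    using bil_cnj[of Q e \<omega>] bil_cnj[of Q vv \<omega>] vec_cnj_real[OF e_real] vec_cnj_real[OF vv_bil(7)]
      bil_sym[of e \<omega>] bil_sym[of vv \<omega>] by auto
  have "bil Q (eichler Q vv e *v \<omega> - \<omega>) (vec_cnj \<omega>) = ?a * cnj ?b - ?b * cnj ?a"
    using bil_sym[of e \<omega>] bil_sym[of vv \<omega>] by (simp add: eichler_apply bil_simps vv_bil c)
  then have "Im (bil Q (eichler Q vv e *v \<omega> - \<omega>) (vec_cnj \<omega>)) = - 2 * Im (?b * cnj ?a)"
    by simp
  also have "?b * cnj ?a = of_real ((norm ?a)\<^sup>2) * (?b / ?a)"
    unfolding complex_norm_square using ne by (simp add: field_simps)
  also have "Im \<dots> = (norm ?a)\<^sup>2 * Im (?b / ?a)" by (simp only: times_complex.sel Re_complex_of_real Im_complex_of_real mult_zero_left add_0_right)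
  finally show ?thesis using vv_upper_half[OF assms] ne by (simp add: mult_neg_pos)
qed

text \<open>
  The operator \<open>E\<^bsub>sv\<^esub> - 1\<close> is contraction with \<open>s\<close> times the bivector \<open>e \<wedge> v\<close>, and \<open>\<wedge>\<^sup>2J\<close> is one-dimensional.
  The factor is an integer because the transvections for \<open>s = 1\<close> belong to \<open>\<Gamma>\<close>.
\<close>

lemma unipotent_multiple:
  assumes "jcusp Q n e2 e2' D \<Gamma> J"
  shows "\<exists>r::int. \<forall>s. eichler Q (s *s vJ Q D \<Gamma> J e2 e2') e2 = eichler Q ((s * of_int r) *s vv) e"
proof -
  interpret c2: jcusp Q n e2 e2' D \<Gamma> J by fact
  let ?v2 = "vJ Q D \<Gamma> J e2 e2'"
  have fs: "fspan \<rat> J = {a *s e + b *s vv |a b. a \<in> \<rat> \<and> b \<in> \<rat>}" using vJ_props(1) by (simp add: jgen_def)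
  have "1 *s e2 \<in> fspan \<rat> J" by (rule fspan_one[OF c2.eJ]) simp
  then obtain \<alpha> \<beta> where e2: "e2 = \<alpha> *s e + \<beta> *s vv" "\<alpha> \<in> \<rat>" "\<beta> \<in> \<rat>" using fs by auto
  have "?v2 \<in> {a *s e2 + b *s ?v2 |a b. a \<in> \<rat> \<and> b \<in> \<rat>}"
    by (rule CollectI, rule exI[of _ 0], rule exI[of _ 1]) simp
  then have "?v2 \<in> fspan \<rat> J" using c2.vJ_props(1) by (simp only: c2.jgen_def)
  then obtain \<gamma> \<delta> where v2: "?v2 = \<gamma> *s e + \<delta> *s vv" "\<gamma> \<in> \<rat>" "\<delta> \<in> \<rat>" using fs by auto
  define \<rho> where "\<rho> = \<alpha> * \<delta> - \<beta> * \<gamma>"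
  have rat: "\<rho> \<in> \<rat>" using e2 v2 by (simp add: \<rho>_def)
  have E: "eichler Q (s *s ?v2) e2 = eichler Q ((s * \<rho>) *s vv) e" for s
  proof (rule matrix_eqI)
    fix x
    have "eichler Q (s *s ?v2) e2 *v x = x - (s * bil Q ?v2 x) *s e2 + (s * bil Q e2 x) *s ?v2"
      by (simp add: eichler_apply bil_simps c2.vv_bil vec_eq_iff algebra_simps)
    also have "\<dots> = x - (s * \<rho> * bil Q vv x) *s e + (s * \<rho> * bil Q e x) *s vv"
      unfolding v2(1) by (simp add: e2(1) bil_simps \<rho>_def vec_eq_iff algebra_simps)
    also have "\<dots> = eichler Q ((s * \<rho>) *s vv) e *v x"
      by (simp add: eichler_apply bil_simps vv_bil vec_eq_iff algebra_simps)
    finally show "eichler Q (s *s ?v2) e2 *v x = eichler Q ((s * \<rho>) *s vv) e *v x" .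
  qed
  have "eichler Q (\<rho> *s vv) e \<in> \<Gamma>" using E[of 1] c2.eichler_vv_\<Gamma> by simp
  moreover have "eichler Q (\<rho> *s vv) e \<in> UJ Q \<rat> J" by (rule eichler_jgen_UJ[OF vJ_props(1) rat])
  ultimately have "\<rho> *s vv \<in> UJ_int Q \<Gamma> J e e'" using vv_UI rat by (auto simp: UJ_int_def intro: UI_Rats_arith)
  then obtain k where k: "k \<in> \<int>" "\<rho> *s vv = k *s vv" using vJ_props(2) by (auto simp: fspan_singleton)
  then have "(\<rho> - k) *s vv = 0" by (simp add: vec.scale_left_diff_distrib)
  then have "\<rho> - k = 0" using vv_nz by (simp only: vec.scale_eq_0_iff simp_thms)
  then obtain r where "\<rho> = of_int r" using k(1) by (auto elim: Ints_cases)
  then show ?thesis using E by blast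
qed

text \<open>
  Each of the two positive generators is an integral multiple of the other, so they agree up to sign, and the sign
  is fixed by \<open>unipotent_sign\<close>.
\<close>

lemma unipotent_same:
  assumes "jcusp Q n e2 e2' D \<Gamma> J"
  shows "eichler Q (s *s vJ Q D \<Gamma> J e2 e2') e2 = eichler Q (s *s vv) e"
proof -
  interpret c2: jcusp Q n e2 e2' D \<Gamma> J by fact
  obtain r :: int where r: "\<And>s. eichler Q (s *s vJ Q D \<Gamma> J e2 e2') e2 = eichler Q ((s * of_int r) *s vv) e"
    using unipotent_multiple[OF assms] by blast
  obtain r' :: int where r': "\<And>s. eichler Q (s *s vv) e = eichler Q ((s * of_int r') *s vJ Q D \<Gamma> J e2 e2') e2"
    using c2.unipotent_multiple[OF jcusp_axioms] by blast
  have "eichler Q (1 *s vv) e = eichler Q ((of_int r' * of_int r) *s vv) e" using r'[of 1] r[of "of_int r'"] by simp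
  then have "eichler Q (1 *s vv) e *v e' = eichler Q ((of_int r' * of_int r) *s vv) e *v e'" by (simp only:)
  then have "vv = (of_int r' * of_int r) *s vv" by (simp add: eichler_apply bil_simps vv_bil ee')
  then have "(1 - of_int r' * of_int r) *s vv = 0" by (simp add: vec.scale_left_diff_distrib)
  then have "1 - of_int r' * of_int r = (0 :: complex)" using vv_nz by (simp only: vec.scale_eq_0_iff simp_thms)
  then have "of_int (r' * r) = (1 :: complex)" by simp
  then have "r' * r = 1" by (metis of_int_eq_1_iff)
  then have "r = 1 \<or> r = -1" by (metis mult.commute zmult_eq_1_iff)
  moreover have "r \<noteq> -1"
  proof
    assume m: "r = -1"
    have w: "tpt (\<i> *s u0) \<in> cone D" by (rule tube_pt_cone[OF TD_nonempty])
    let ?w = "tpt (\<i> *s u0)"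
    have "eichler Q (vJ Q D \<Gamma> J e2 e2') e2 *v ?w - ?w = - (eichler Q vv e *v ?w - ?w)"
    proof -
      have "eichler Q (vJ Q D \<Gamma> J e2 e2') e2 = eichler Q (- vv) e" using r[of 1] m by simp
      then show ?thesis by (simp only:) (simp add: eichler_apply bil_simps vv_bil vec_eq_iff algebra_simps)
    qed
    then show False using unipotent_sign[OF w] c2.unipotent_sign[OF w] by (simp add: bil_minus_left bil_diff_left)
  qed
  ultimately show ?thesis using r by simp
qed

end

section \<open>Trivializations of the automorphic bundles\<close>

lemma to_VI_apply:
  "to_VI Q e e' \<omega> *v u = (u - (bil Q u e / bil Q \<omega> e) *s \<omega>) - bil Q (u - (bil Q u e / bil Q \<omega> e) *s \<omega>) e' *s e"
  unfolding to_VI_def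
  by (subst matrix_apply) (simp_all add: Let_def bil_simps vec_eq_iff algebra_simps add_divide_distrib)

lemma from_VI_apply: "from_VI Q e \<omega> *v z = z - (bil Q z \<omega> / bil Q \<omega> e) *s e"
  unfolding from_VI_def
  by (subst matrix_apply) (simp_all add: bil_simps vec_eq_iff algebra_simps add_divide_distrib)

lemma tscale_apply: "tscale c T xs = c * T xs"
  by (simp add: tscale_def)

lemma tsubspaceD:
  assumes "tsubspace V"
  shows "(\<lambda>xs. 0) \<in> V" "S \<in> V \<Longrightarrow> T \<in> V \<Longrightarrow> (\<lambda>xs. S xs + T xs) \<in> V" "T \<in> V \<Longrightarrow> (\<lambda>xs. c * T xs) \<in> V" "T \<in> V \<Longrightarrow> tscale c T \<in> V"
  using assms by (auto simp: tsubspace_def tscale_def)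

lemma tsubspace_sum:
  assumes "tsubspace V" "\<And>s. s \<in> S \<Longrightarrow> B s \<in> V" "finite S" shows "(\<lambda>xs. \<Sum>s\<in>S. c s * B s xs) \<in> V"
  using assms(3,2)
proof (induction S rule: finite_induct)
  case empty then show ?case using tsubspaceD(1)[OF assms(1)] by simp
next
  case (insert x F)
  have "(\<lambda>xs. c x * B x xs) \<in> V" by (rule tsubspaceD(3)[OF assms(1)]) (use insert in auto)
  moreover have "(\<lambda>xs. \<Sum>s\<in>F. c s * B s xs) \<in> V" using insert by auto
  ultimately show ?case using tsubspaceD(2)[OF assms(1)] insert.hyps by simp
qed

context cusp begin

lemma to_VI_perp: "u \<in> perp Q {\<omega>} \<Longrightarrow> bil Q \<omega> e \<noteq> 0 \<Longrightarrow> to_VI Q e e' \<omega> *v u \<in> perp Q {e, e'}"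
  by (simp add: to_VI_apply perp_def bil_simps cusp_bil)

lemma to_VI_line: "w \<in> line \<omega> \<Longrightarrow> bil Q \<omega> e \<noteq> 0 \<Longrightarrow> to_VI Q e e' \<omega> *v w = 0"
  by (auto simp: to_VI_apply line_eq bil_simps)

text \<open>
  Neither the projection along \<open>\<omega>\<close>, which is in the radical of \<open>\<omega>\<^sup>\<bottom>\<close>, nor the one along \<open>e\<close> changes the
  form.
\<close>

lemma to_VI_isometry:
  assumes "u \<in> perp Q {\<omega>}" "v \<in> perp Q {\<omega>}" "bil Q \<omega> e \<noteq> 0" "bil Q \<omega> \<omega> = 0"
  shows "bil Q (to_VI Q e e' \<omega> *v u) (to_VI Q e e' \<omega> *v v) = bil Q u v"
proof -
  define y z where "y = u - (bil Q u e / bil Q \<omega> e) *s \<omega>" "z = v - (bil Q v e / bil Q \<omega> e) *s \<omega>"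
  have "bil Q y e = 0" "bil Q z e = 0" using assms(3) by (simp_all add: y_z_def bil_simps)
  then have "bil Q (to_VI Q e e' \<omega> *v u) (to_VI Q e e' \<omega> *v v) = bil Q y z"
    unfolding to_VI_apply y_z_def[symmetric] using bil_sym[of e z] by (simp add: bil_simps ee)
  also have "\<dots> = bil Q u v"
    using assms bil_sym[of \<omega> v] by (simp add: y_z_def bil_simps perp_def)
  finally show ?thesis .
qed

text \<open>
  So the tensor power of \<open>to_VI\<close> induces a map from the fibre to \<open>V(I)\<^sub>\<lambda>\<close>, which may be computed on any
  representative.
\<close>

lemma fibre_to_VI:
  assumes A: "A \<in> E_fibre Q lam \<omega>" and S: "S \<in> A" and w: "bil Q \<omega> e \<noteq> 0" "bil Q \<omega> \<omega> = 0"
  shows "tmap (to_VI Q e e' \<omega>) ` A = {tmap (to_VI Q e e' \<omega>) S}" "tmap (to_VI Q e e' \<omega>) S \<in> V_lam Q lam e e'"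
proof -
  let ?M = "to_VI Q e e' \<omega>"
  obtain T where T: "A = tcoset (sum_list lam) (perp Q {\<omega>}) (line \<omega>) T" "T \<in> schur Q lam (perp Q {\<omega>}) (line \<omega>)"
    using A by (auto simp: E_fibre_def)
  have im: "tmap ?M ` A = {tmap ?M T}"
    unfolding T(1) by (rule tmap_tcoset[OF to_VI_perp[OF _ w(1)] to_VI_line[OF _ w(1)]])
  then have "tmap ?M S = tmap ?M T" using S by blast
  then show "tmap ?M ` A = {tmap ?M S}" using im by simp
  have "tmap ?M T \<in> schur Q lam (perp Q {e, e'}) {0}"
    by (rule tmap_schur[OF T(2)]) (use to_VI_perp to_VI_line to_VI_isometry w in auto)
  then show "tmap ?M S \<in> V_lam Q lam e e'" using \<open>tmap ?M S = tmap ?M T\<close> by (simp add: V_lam_def)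
qed

lemma I_triv_eq:
  assumes "A \<in> E_fibre Q lam \<omega>" "S \<in> A" "bil Q \<omega> e \<noteq> 0" "bil Q \<omega> \<omega> = 0"
  shows "I_triv Q k e e' \<omega> A = tscale (bil Q \<omega> e powi k) (tmap (to_VI Q e e' \<omega>) S)"
    "I_triv Q k e e' \<omega> A \<in> V_lam Q lam e e'"
  using fibre_to_VI[OF assms] tsubspaceD(4)[OF tsubspace_schur]
  by (auto simp: I_triv_def V_lam_def)

end

lemma E_fibre_nonempty: "A \<in> E_fibre Q lam \<omega> \<Longrightarrow> \<exists>S. S \<in> A"
proof -
  assume "A \<in> E_fibre Q lam \<omega>"
  then obtain T where T: "A = tcoset (sum_list lam) (perp Q {\<omega>}) (line \<omega>) T" by (auto simp: E_fibre_def)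
  have "(\<lambda>xs. 0) \<in> tkernel (sum_list lam) (perp Q {\<omega>}) (line \<omega>)" unfolding tkernel_def by (rule tspan_zero)
  then have "(\<lambda>xs. T xs + (\<lambda>xs. 0) xs) \<in> A"
    unfolding T tcoset_def by (intro CollectI exI[of _ "\<lambda>xs. 0"] conjI) simp_all
  then show ?thesis by blast
qed

lemma holomorphic_vec_compose:
  fixes \<gamma> :: "complex \<Rightarrow> complex^'N"
  assumes F: "holomorphic_vec F U" "open U" "\<gamma> s \<in> U"
    and \<gamma>: "\<And>i. (\<lambda>s. \<gamma> s $ i) field_differentiable at s"
  shows "(\<lambda>s. F (\<gamma> s)) field_differentiable at s"
proof -
  obtain d where d: "\<And>i. ((\<lambda>s. \<gamma> s $ i) has_field_derivative d i) (at s)"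
    using \<gamma> unfolding field_differentiable_def by metis
  obtain c where c: "(F has_derivative (\<lambda>h. \<Sum>i\<in>UNIV. c $ i * h $ i)) (at (\<gamma> s))"
    using F at_within_open[OF F(3,2)] unfolding holomorphic_vec_def by metis
  have "(\<gamma> has_derivative (\<lambda>h. \<chi> i. d i * h)) (at s)"
  proof -
    have bl: "bounded_linear (\<lambda>c :: complex. c *s (axis i 1 :: complex^'N))" for i
      by (rule linear_conv_bounded_linear[THEN iffD1], rule linearI)
         (auto simp: vec_eq_iff algebra_simps)
    have ax: "(\<Sum>i\<in>UNIV. x $ i *s axis i 1) = x" for x :: "complex^'N"
      by (simp add: vec_eq_iff axis_def if_distrib cong: if_cong)
    have "((\<lambda>s. \<Sum>i\<in>UNIV. \<gamma> s $ i *s (axis i 1 :: complex^'N)) has_derivative (\<lambda>h. \<Sum>i\<in>UNIV. (d i * h) *s axis i 1)) (at s)"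
      using d by (intro has_derivative_sum bounded_linear.has_derivative[OF bl]) (simp add: has_field_derivative_def)
    moreover have "(\<Sum>i\<in>UNIV. (d i * h) *s axis i 1) = (\<chi> i. d i * h)" for h
      using ax[of "\<chi> i. d i * h"] by simp
    ultimately show ?thesis by (simp only: ax)
  qed
  from diff_chain_at[OF this c]
  have "((\<lambda>s. F (\<gamma> s)) has_derivative (\<lambda>h. (\<Sum>i\<in>UNIV. c $ i * d i) * h)) (at s)"
    by (simp add: o_def sum_distrib_right mult.assoc)
  then show ?thesis unfolding field_differentiable_def has_field_derivative_def by blast
qed

lemma holomorphic_vec_isCont: "holomorphic_vec F U \<Longrightarrow> open U \<Longrightarrow> x \<in> U \<Longrightarrow> isCont F x"
  unfolding holomorphic_vec_def by (metis at_within_open has_derivative_continuous)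

lemma bil_field_differentiable:
  fixes \<gamma> :: "complex \<Rightarrow> complex^'N"
  assumes "\<And>i. (\<lambda>s. \<gamma> s $ i) field_differentiable at s"
  shows "(\<lambda>s. bil Q (\<gamma> s) x) field_differentiable at s" "(\<lambda>s. bil Q x (\<gamma> s)) field_differentiable at s"
  unfolding bil_def
  by (intro derivative_intros field_differentiable_sum field_differentiable_mult field_differentiable_const assms)+

lemma (in tube) hol_mult: "hol g \<Longrightarrow> hol h \<Longrightarrow> hol (\<lambda>Z. g Z * h Z)"
  unfolding hol_def by (auto intro!: continuous_intros holomorphic_intros)

lemma (in tube) hol_qexp: "hol (qexp Q l)"
proof -
  have "(\<lambda>s. qexp Q l (Z + s *s b)) holomorphic_on A" for Z b A
    unfolding qexp_def bil_add_right bil_scale_right by (intro holomorphic_intros)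
  then show ?thesis unfolding hol_def by (auto simp: qexp_def[abs_def] intro!: continuous_intros)
qed

lemma qexp_ee: "qexp Q l Z = ee (bil Q l Z)"
  by (simp add: qexp_def ee_def)

lemma qexp_add: "qexp Q l (Z + z) = qexp Q l Z * ee (bil Q l z)"
  by (simp add: qexp_ee bil_simps ee_add)

lemma qexp_nz [simp]: "qexp Q l Z \<noteq> 0"
  by (simp add: qexp_ee)

locale cusp_arith = tube_realization Q n e e' D + arithmetic Q n D \<Gamma>
  for Q :: "int^'N^'N" and n e e' D \<Gamma>

sublocale jcusp \<subseteq> cusp_arith ..

context cusp_arith begin

lemma TD_iff: "Z \<in> TD \<longleftrightarrow> Z \<in> UI Q UNIV e e' \<and> tpt Z \<in> cone D"
  using tube_pt_cone TD_UI cone_iff[of "tpt Z"] tube_coord_pt[of Z] by auto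

lemma UI_int_rat: "z \<in> UI_int Q \<Gamma> e e' \<Longrightarrow> z \<in> UI Q \<rat> e e'" and UI_int_\<Gamma>: "z \<in> UI_int Q \<Gamma> e e' \<Longrightarrow> eichler Q z e \<in> \<Gamma>"
  by (auto simp: UI_int_def)

text \<open>
  The Eichler transvections act on the tube domain by translations.
\<close>

lemma tube_pt_add:
  assumes "Z \<in> UI Q UNIV e e'" "z \<in> UI Q UNIV e e'"
  shows "eichler Q z e *v tpt Z = tpt (Z + z)"
proof -
  have Z: "bil Q Z e = 0" "bil Q Z e' = 0" "bil Q e Z = 0" "bil Q e' Z = 0"
    "bil Q z e = 0" "bil Q z e' = 0" "bil Q e z = 0" "bil Q e' z = 0"
    using assms bil_sym[of e Z] bil_sym[of e' Z] bil_sym[of e z] bil_sym[of e' z] by (auto simp: UI_iff)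
  show ?thesis
    by (simp add: eichler_apply tube_pt_def bil_simps cusp_bil Z bil_sym[of Z z] vec_eq_iff algebra_simps)
qed

lemma UI_axis: "x \<in> UI Q UNIV e e' \<Longrightarrow> x = (\<Sum>i\<in>UNIV. x $ i *s proj_UI (axis i 1))"
proof -
  assume x: "x \<in> UI Q UNIV e e'"
  have lin: "proj_UI (a + b) = proj_UI a + proj_UI b" "proj_UI (c *s a) = c *s proj_UI a" for a b c
    by (simp_all add: proj_UI_def bil_simps vec_eq_iff algebra_simps)
  have "proj_UI x = x" using x by (simp add: proj_UI_def UI_iff)
  have prs: "proj_UI (\<Sum>i\<in>A. x $ i *s axis i 1) = (\<Sum>i\<in>A. x $ i *s proj_UI (axis i 1))" if "finite A" for A
  proof -
    have "proj_UI 0 = 0" by (simp add: proj_UI_def)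
    with that show ?thesis by (induction A rule: finite_induct) (auto simp: lin)
  qed
  have ax: "(\<Sum>i\<in>UNIV. x $ i *s axis i 1) = x"
    by (simp add: vec_eq_iff axis_def if_distrib cong: if_cong)
  have "x = proj_UI (\<Sum>i\<in>UNIV. x $ i *s axis i 1)" unfolding ax by (rule \<open>proj_UI x = x\<close>[symmetric])
  also have "\<dots> = (\<Sum>i\<in>UNIV. x $ i *s proj_UI (axis i 1))" by (rule prs) simp
  finally show ?thesis .
qed

text \<open>
  A basis of \<open>U(I)\<^sub>\<rat>\<close>, scaled into the period lattice, with a dual family of rational vectors.  The period
  lattice need not be spanned by it.  It is enough for separating the exponents of a Fourier series.
\<close>

lemma dual_bases:
  "\<exists>S b l. finite (S :: 'N set) \<and> (\<forall>s\<in>S. b s \<in> UI_int Q \<Gamma> e e' \<and> l s \<in> UI Q \<rat> e e') \<and>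
     (\<forall>s\<in>S. \<forall>t\<in>S. bil Q (l s) (b t) = (if s = t then 1 else 0)) \<and>
     (\<forall>u\<in>UI Q UNIV e e'. u = (\<Sum>s\<in>S. bil Q (l s) u *s b s))"
proof -
  define V where "V = (\<lambda>x :: complex^'N. ($) x) ` UI Q \<rat> e e'"
  have "\<exists>S B. S \<subseteq> UNIV \<and> (\<forall>s\<in>S. B s \<in> V) \<and> (\<forall>f\<in>V. f = (\<lambda>x. \<Sum>s\<in>S. f s * B s x)) \<and>
      (\<forall>s\<in>S. \<forall>t\<in>S. B s t = (if s = t then 1 else 0))"
  proof (rule echelon_basis[where F = \<rat>])
    show "(\<lambda>x. f x + c * g x) \<in> V" if fg: "f \<in> V" "g \<in> V" "c \<in> \<rat>" for f g c
    proof -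
      obtain x y where xy: "x \<in> UI Q \<rat> e e'" "y \<in> UI Q \<rat> e e'" "f = ($) x" "g = ($) y" using fg by (auto simp: V_def)
      then have "(\<lambda>i. f i + c * g i) = ($) (x + c *s y)" by auto
      moreover have "x + c *s y \<in> UI Q \<rat> e e'" using xy fg by (intro UI_Rats_arith)
      ultimately show ?thesis unfolding V_def by (metis image_eqI)
    qed
    show "f x \<in> \<rat>" if "f \<in> V" for f x using that by (auto simp: V_def UI_iff vecs_def)
  qed auto
  then obtain S B where S: "\<forall>s\<in>S. B s \<in> V" "\<forall>f\<in>V. f = (\<lambda>x. \<Sum>s\<in>S. f s * B s x)"
    "\<forall>s\<in>S. \<forall>t\<in>S. B s t = (if s = t then 1 else 0)" by (elim exE conjE) (rule that; assumption)
  define b0 where "b0 s = (\<chi> i. B s i)" for s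
  have b0: "b0 s \<in> UI Q \<rat> e e'" if "s \<in> S" for s
  proof -
    obtain x where "x \<in> UI Q \<rat> e e'" "B s = ($) x" using S(1) \<open>s \<in> S\<close> by (auto simp: V_def)
    then show ?thesis by (simp add: b0_def)
  qed
  have exp0: "x = (\<Sum>s\<in>S. x $ s *s b0 s)" if "x \<in> UI Q \<rat> e e'" for x
  proof -
    have "($) x \<in> V" using that by (auto simp: V_def)
    from bspec[OF S(2) this] have h: "($) x = (\<lambda>i. \<Sum>s\<in>S. x $ s * B s i)" .
    have "x $ i = (\<Sum>s\<in>S. x $ s *s b0 s) $ i" for i
      using fun_cong[OF h, of i] by (simp add: b0_def)
    then show ?thesis unfolding vec_eq_iff by blast
  qed
  have exp1: "x = (\<Sum>s\<in>S. x $ s *s b0 s)" if x: "x \<in> UI Q UNIV e e'" for x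
  proof -
    let ?p = "\<lambda>i. proj_UI (axis i 1)"
    have p: "?p i \<in> UI Q \<rat> e e'" for i by (intro proj_UI_rat) (auto simp: vecs_def axis_def)
    have "x = (\<Sum>i\<in>UNIV. x $ i *s (\<Sum>s\<in>S. ?p i $ s *s b0 s))"
      using UI_axis[OF x] exp0[OF p] by simp
    also have "\<dots> = (\<Sum>s\<in>S. (\<Sum>i\<in>UNIV. x $ i * ?p i $ s) *s b0 s)"
      by (simp add: vec.scale_sum_right vec.scale_sum_left vector_smult_assoc) (rule sum.swap)
    also have "\<dots> = (\<Sum>s\<in>S. x $ s *s b0 s)"
    proof (intro sum.cong refl)
      fix s
      have "x $ s = (\<Sum>i\<in>UNIV. x $ i *s ?p i) $ s" using UI_axis[OF x] by simp
      then show "(\<Sum>i\<in>UNIV. x $ i * ?p i $ s) *s b0 s = x $ s *s b0 s" by simp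
    qed
    finally show ?thesis .
  qed
  obtain \<kappa> :: "'N \<Rightarrow> complex^'N" where \<kappa>: "\<forall>i. \<kappa> i \<in> vecs \<rat>" "\<forall>i x. bil Q (\<kappa> i) x = x $ i"
    using dual_basis by blast
  have "\<forall>s\<in>S. \<exists>M::int. M > 0 \<and> eichler Q (of_int M *s b0 s) e \<in> \<Gamma>"
    using eichler_in_\<Gamma>[OF _ e_rat ee] b0 by (auto simp: UI_iff)
  then obtain M :: "'N \<Rightarrow> int" where M: "\<forall>s\<in>S. M s > 0 \<and> eichler Q (of_int (M s) *s b0 s) e \<in> \<Gamma>" by metis
  define b where "b s = of_int (M s) *s b0 s" for s
  define l where "l s = (1 / of_int (M s)) *s proj_UI (\<kappa> s)" for s
  have lb: "bil Q (l s) x = x $ s / of_int (M s)" if "x \<in> UI Q UNIV e e'" for s x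
    using bil_proj_UI[OF that, of "\<kappa> s"] \<kappa>(2) bil_sym[of "proj_UI (\<kappa> s)" x] bil_sym[of "\<kappa> s" x] by (simp add: l_def bil_simps)
  have p1: "b s \<in> UI_int Q \<Gamma> e e' \<and> l s \<in> UI Q \<rat> e e'" if "s \<in> S" for s
    using M that b0[OF that] proj_UI_rat \<kappa>(1) by (auto simp: b_def l_def UI_int_def intro!: UI_Rats_arith)
  have p2: "bil Q (l s) (b t) = (if s = t then 1 else 0)" if "s \<in> S" "t \<in> S" for s t
  proof -
    have "b t \<in> UI Q UNIV e e'" using UI_mono[OF b0[OF that(2)]] by (simp add: b_def UI_arith)
    then have "bil Q (l s) (b t) = of_int (M t) * B t s / of_int (M s)" by (simp add: lb b_def b0_def)
    then show ?thesis using S(3) that M by auto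
  qed
  have p3: "u = (\<Sum>s\<in>S. bil Q (l s) u *s b s)" if "u \<in> UI Q UNIV e e'" for u
  proof -
    have "(\<Sum>s\<in>S. bil Q (l s) u *s b s) = (\<Sum>s\<in>S. u $ s *s b0 s)"
      using M by (intro sum.cong) (auto simp: lb[OF that] b_def vector_smult_assoc)
    then show ?thesis using exp1[OF that] by simp
  qed
  show ?thesis
    by (rule exI[of _ S], rule exI[of _ b], rule exI[of _ l], intro conjI ballI)
       (rule finite, use p1 in blast, use p1 in blast, rule p2, assumption+, rule p3)
qed

lemma dual_bases_list:
  "\<exists>ss b l. distinct (ss :: 'N list) \<and> (\<forall>s\<in>set ss. b s \<in> UI_int Q \<Gamma> e e' \<and> l s \<in> UI Q \<rat> e e') \<and>
     (\<forall>s\<in>set ss. \<forall>t\<in>set ss. bil Q (l s) (b t) = (if s = t then 1 else 0)) \<and>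
     (\<forall>u\<in>UI Q UNIV e e'. u = (\<Sum>s\<in>set ss. bil Q (l s) u *s b s))"
proof -
  obtain S b l where *: "finite (S :: 'N set)" "\<forall>s\<in>S. b s \<in> UI_int Q \<Gamma> e e' \<and> l s \<in> UI Q \<rat> e e'"
     "\<forall>s\<in>S. \<forall>t\<in>S. bil Q (l s) (b t) = (if s = t then 1 else 0)"
     "\<forall>u\<in>UI Q UNIV e e'. u = (\<Sum>s\<in>S. bil Q (l s) u *s b s)"
    using dual_bases by (elim exE conjE) (rule that; assumption)
  obtain ss where ss: "set ss = S" "distinct ss" using finite_distinct_list[OF *(1)] by blast
  show ?thesis
    by (rule exI[of _ ss], rule exI[of _ b], rule exI[of _ l], unfold ss(1), intro conjI ss(2) *(2-4))
qed

lemma UI_dual_int: "l \<in> UI_dual Q \<Gamma> e e' \<Longrightarrow> z \<in> UI_int Q \<Gamma> e e' \<Longrightarrow> bil Q l z = of_int \<lfloor>Re (bil Q l z)\<rfloor>"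
  by (auto simp: UI_dual_def elim!: Ints_cases dest!: bspec)

text \<open>
  The coefficients are repeated modes of the function: the frequencies along the vectors \<open>b s\<close> determine the
  exponent.
\<close>

lemma fourier_unique:
  assumes "\<And>Z. Z \<in> TD \<Longrightarrow> ((\<lambda>l. c l * qexp Q l Z) has_sum g Z) (UI_dual Q \<Gamma> e e')"
    and "\<And>Z. Z \<in> TD \<Longrightarrow> ((\<lambda>l. c' l * qexp Q l Z) has_sum g Z) (UI_dual Q \<Gamma> e e')"
    and "l0 \<in> UI_dual Q \<Gamma> e e'"
  shows "c l0 = c' l0"
proof -
  obtain ss b l where B: "\<forall>s\<in>set (ss :: 'N list). b s \<in> UI_int Q \<Gamma> e e' \<and> l s \<in> UI Q \<rat> e e'"
     "\<forall>u\<in>UI Q UNIV e e'. u = (\<Sum>s\<in>set ss. bil Q (l s) u *s b s)"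
    using dual_bases_list by blast
  let ?bs = "map b ss" and ?k = "\<lambda>b l. \<lfloor>Re (bil Q l b)\<rfloor>" and ?Z = "\<i> *s u0"
  let ?ns = "map (\<lambda>b. ?k b l0) ?bs"
  have bI: "set ?bs \<subseteq> UI_int Q \<Gamma> e e'" using B(1) by auto
  have bW: "set ?bs \<subseteq> UI Q \<real> e e'" using B(1) UI_int_rat UI_Rats_Reals by auto
  have sumW: "(\<Sum>(t, b)\<leftarrow>zip ts bs. of_real t *s b) \<in> UI Q \<real> e e'" if "set bs \<subseteq> UI Q \<real> e e'" for ts :: "real list" and bs
    using that
  proof (induction ts bs rule: list_induct2')
    case (4 t ts b bs) then show ?case by (auto intro!: UI_Reals_arith)
  qed (auto intro: UI_Reals_arith)
  have bilsum: "bil Q m (\<Sum>(t, b)\<leftarrow>zip ts bs. of_real t *s b) = (\<Sum>(t, b)\<leftarrow>zip ts bs. of_int (?k b m) * of_real t)"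
    if "m \<in> UI_dual Q \<Gamma> e e'" "set bs \<subseteq> UI_int Q \<Gamma> e e'" for m and ts :: "real list" and bs
    using that(2)
  proof (induction ts bs rule: list_induct2')
    case (4 t ts b bs)
    then show ?case using UI_dual_int[OF that(1), of b] by (simp add: bil_simps mult.commute)
  qed auto
  have key: "a l0 * qexp Q l0 ?Z = modes ?bs ?ns g ?Z"
    if a: "\<And>Z. Z \<in> TD \<Longrightarrow> ((\<lambda>l. a l * qexp Q l Z) has_sum g Z) (UI_dual Q \<Gamma> e e')" for a
  proof -
    have "((\<lambda>l. a l * qexp Q l ?Z) has_sum modes ?bs ?ns g ?Z) {l \<in> UI_dual Q \<Gamma> e e'. map (\<lambda>b. ?k b l) ?bs = ?ns}"
    proof (rule modes_has_sum_extract)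
      fix ts :: "real list"
      let ?S = "\<Sum>(t, b)\<leftarrow>zip ts ?bs. of_real t *s b"
      have "?Z + ?S \<in> TD" by (rule T_real[OF TD_nonempty sumW[OF bW]])
      from a[OF this]
      show "((\<lambda>l. a l * qexp Q l ?Z * ee (\<Sum>(t, b)\<leftarrow>zip ts ?bs. of_int (?k b l) * of_real t)) has_sum g (?Z + ?S)) (UI_dual Q \<Gamma> e e')"
        by (rule has_sum_cong[THEN iffD1, rotated]) (simp add: qexp_add bilsum[OF _ bI] mult.assoc)
    qed simp
    moreover have "{l \<in> UI_dual Q \<Gamma> e e'. map (\<lambda>b. ?k b l) ?bs = ?ns} = {l0}"
    proof -
      have "m = l0" if m: "m \<in> UI_dual Q \<Gamma> e e'" "map (\<lambda>b. ?k b m) ?bs = ?ns" for m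
      proof -
        have bb: "bil Q m (b s) = bil Q l0 (b s)" if "s \<in> set ss" for s
        proof -
          have "?k (b s) m = ?k (b s) l0" using m(2) that by auto
          then show ?thesis using UI_dual_int[OF m(1)] UI_dual_int[OF assms(3)] B(1) that by metis
        qed
        have "m - l0 = 0"
        proof (rule UI_nondegenerate)
          show "m - l0 \<in> UI Q UNIV e e'" using m(1) assms(3) by (auto simp: UI_dual_def UI_iff bil_simps)
          fix y assume "y \<in> UI Q \<rat> e e'"
          then have y: "y = (\<Sum>s\<in>set ss. bil Q (l s) y *s b s)" using B(2) UI_mono by blast
          have "bil Q (m - l0) (\<Sum>s\<in>A. bil Q (l s) y *s b s) = 0" if "A \<subseteq> set ss" for A
            using finite_subset[OF that finite_set] that
            by (induction A rule: finite_induct) (auto simp: bil_simps bb)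
          then show "bil Q (m - l0) y = 0" using y by (metis subset_refl)
        qed
        then show ?thesis by simp
      qed
      then show ?thesis using assms(3) by auto
    qed
    ultimately have "((\<lambda>l. a l * qexp Q l ?Z) has_sum modes ?bs ?ns g ?Z) {l0}" by simp
    then show ?thesis
      using has_sum_finite[of "{l0}" "\<lambda>l. a l * qexp Q l ?Z"] has_sum_unique by fastforce
  qed
  have "c l0 * qexp Q l0 ?Z = c' l0 * qexp Q l0 ?Z" using key[OF assms(1)] key[OF assms(2)] by simp
  then show ?thesis by simp
qed

lemma modes_translate:
  assumes "\<And>Z. Z \<in> TD \<Longrightarrow> g (Z + z) = g Z" "z \<in> UI Q \<real> e e'" "set bs \<subseteq> UI Q \<real> e e'" "length ns = length bs" "Z \<in> TD"
  shows "modes bs ns g (Z + z) = modes bs ns g Z"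
  using assms
proof (induction bs arbitrary: g ns)
  case (Cons b bs)
  obtain m ns' where ns: "ns = m # ns'" "length ns' = length bs" using Cons.prems(4) by (cases ns) auto
  have "modes bs ns' (mode b m g) (Z + z) = modes bs ns' (mode b m g) Z"
  proof (rule Cons.IH)
    show "mode b m g (Z + z) = mode b m g Z" if "Z \<in> TD" for Z
      by (rule mode_translate) (use Cons.prems that in auto)
  qed (use Cons.prems ns in auto)
  then show ?case using ns by simp
qed simp

text \<open>
  The repeated mode for a list of frequencies transforms under real translations like the exponential with
  exponent \<open>L ns\<close>, so their quotient is constant by \<open>hol_invariant_const\<close>.  The list of frequencies refers to
  a sublattice of the periods only, but a mode whose exponent is not in the dual lattice vanishes, because it is
  periodic under all periods.
\<close>

lemma fourier_exists:
  assumes g: "hol g" and per: "\<And>Z z. Z \<in> TD \<Longrightarrow> z \<in> UI_int Q \<Gamma> e e' \<Longrightarrow> g (Z + z) = g Z"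
  shows "\<exists>c. (\<forall>l. l \<notin> UI_dual Q \<Gamma> e e' \<longrightarrow> c l = 0) \<and> (\<forall>Z\<in>TD. ((\<lambda>l. c l * qexp Q l Z) has_sum g Z) (UI_dual Q \<Gamma> e e'))"
proof -
  obtain ss b l where ss: "distinct (ss :: 'N list)" "\<forall>s\<in>set ss. b s \<in> UI_int Q \<Gamma> e e' \<and> l s \<in> UI Q \<rat> e e'"
     "\<forall>s\<in>set ss. \<forall>t\<in>set ss. bil Q (l s) (b t) = (if s = t then 1 else 0)"
     "\<forall>u\<in>UI Q UNIV e e'. u = (\<Sum>s\<in>set ss. bil Q (l s) u *s b s)"
    using dual_bases_list by (elim exE conjE) (rule that; assumption)
  define N where "N = length ss"
  let ?bs = "map b ss"
  have bI: "b (ss ! i) \<in> UI_int Q \<Gamma> e e'" "l (ss ! i) \<in> UI Q \<rat> e e'" if "i < N" for i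
    using ss(2) that by (auto simp: N_def)
  have bW: "set ?bs \<subseteq> UI Q \<real> e e'" using ss(2) UI_int_rat UI_Rats_Reals by auto
  have dual: "bil Q (l (ss ! i)) (b (ss ! j)) = (if i = j then 1 else 0)" if "i < N" "j < N" for i j
    using ss(1,3) that by (auto simp: N_def nth_eq_iff_index_eq)
  define L where "L ns = (\<Sum>i<N. of_int (ns ! i) *s l (ss ! i))" for ns :: "int list"
  have LQ: "L ns \<in> UI Q \<rat> e e'" for ns
  proof -
    have "(\<Sum>i\<in>A. of_int (ns ! i) *s l (ss ! i)) \<in> UI Q \<rat> e e'" if "A \<subseteq> {..<N}" for A
      using finite_subset[OF that finite_lessThan] that
      by (induction A rule: finite_induct) (auto intro!: UI_Rats_arith bI)
    then show ?thesis unfolding L_def by blast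
  qed
  have Lb: "bil Q (L ns) (b (ss ! j)) = of_int (ns ! j)" if "j < N" for ns j
  proof -
    have "bil Q (\<Sum>i\<in>A. of_int (ns ! i) *s l (ss ! i)) (b (ss ! j)) = (\<Sum>i\<in>A. if i = j then of_int (ns ! i) else 0)"
      if "A \<subseteq> {..<N}" for A
      using finite_subset[OF that finite_lessThan] that
      by (induction A rule: finite_induct) (use dual \<open>j < N\<close> in \<open>auto simp: bil_simps\<close>)
    from this[of "{..<N}"] show ?thesis using that by (simp add: L_def)
  qed
  have perb: "g (Z + b') = g Z" if "Z \<in> TD" "b' \<in> set ?bs" for Z b' using per that ss(2) by auto
  let ?Z0 = "\<i> *s u0"
  define a where "a ns = modes ?bs ns g ?Z0 * qexp Q (- L ns) ?Z0" for ns
  have inv: "qexp Q (- m) Z * qexp Q m Z = 1" for m Z by (simp add: qexp_ee bil_simps ee_add[symmetric])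
  have const: "modes ?bs ns g Z = a ns * qexp Q (L ns) Z" if ns: "length ns = N" and Z: "Z \<in> TD" for ns Z
  proof -
    define h where "h Z = modes ?bs ns g Z * qexp Q (- L ns) Z" for Z
    have len: "length ns = length ?bs" using ns by (simp add: N_def)
    have hh: "hol h" unfolding h_def by (intro hol_mult modes_hol g bW hol_qexp len)
    have step: "h (Z + of_real t *s b (ss ! j)) = h Z" if "Z \<in> TD" "j < N" for Z t j
    proof -
      have "modes ?bs ns g (Z + of_real t *s (?bs ! j)) = ee (of_int (ns ! j) * of_real t) * modes ?bs ns g Z"
      proof (rule modes_shift[OF g perb bW len])
        show "Z + of_real t *s ?bs ! j \<in> TD"
          using that bW by (intro T_real_scale) (auto simp: N_def)
      qed (use that in \<open>auto simp: N_def\<close>)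
      then show ?thesis using Lb[OF that(2), of ns] that
        by (simp add: h_def qexp_add N_def bil_simps mult_ac) (simp add: ee_minus)
    qed
    have "h (Z + x) = h Z" if Z: "Z \<in> TD" and x: "x \<in> UI Q \<real> e e'" for Z x
    proof -
      define t where "t i = Re (bil Q (l (ss ! i)) x)" for i
      have tr: "bil Q (l (ss ! i)) x = of_real (t i)" if "i < N" for i
        unfolding t_def by (rule bil_UI_real[OF UI_Rats_Reals[OF bI(2)[OF that]] x])
      have "x = (\<Sum>s\<in>set ss. bil Q (l s) x *s b s)" using ss(4) UI_mono[OF x] by blast
      also have "\<dots> = (\<Sum>i<N. bil Q (l (ss ! i)) x *s b (ss ! i))"
        using sum.reindex_bij_betw[OF bij_betw_nth[OF ss(1) refl refl], of "\<lambda>s. bil Q (l s) x *s b s"] by (simp add: N_def)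
      finally have xe: "x = (\<Sum>i<N. of_real (t i) *s b (ss ! i))" using tr by simp
      have "Z + (\<Sum>i<j. of_real (t i) *s b (ss ! i)) \<in> TD \<and> h (Z + (\<Sum>i<j. of_real (t i) *s b (ss ! i))) = h Z" if "j \<le> N" for j
        using that
      proof (induction j)
        case 0 then show ?case using Z by simp
      next
        case (Suc j)
        let ?Y = "Z + (\<Sum>i<j. of_real (t i) *s b (ss ! i))"
        have Y: "?Y \<in> TD" "h ?Y = h Z" using Suc by auto
        have "?Y + of_real (t j) *s b (ss ! j) \<in> TD"
          using Suc.prems bW by (intro T_real_scale Y) (auto simp: N_def)
        then show ?case using step[OF Y(1), of j "t j"] Y(2) Suc.prems by (simp add: add.assoc)
      qed
      from this[of N] show ?thesis using xe by simp
    qed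
    from hol_invariant_const[OF hh this TD_nonempty Z] have "h Z = a ns" by (simp add: h_def a_def)
    then show ?thesis using inv[of "L ns" Z] by (simp add: h_def) (metis mult.assoc mult.right_neutral)
  qed
  define \<kappa> where "\<kappa> m = map (\<lambda>s. \<lfloor>Re (bil Q m (b s))\<rfloor>) ss" for m
  have \<kappa>L: "\<kappa> (L ns) = ns" if "length ns = N" for ns
    by (rule nth_equalityI) (use that Lb in \<open>auto simp: \<kappa>_def N_def\<close>)
  have L\<kappa>: "L (\<kappa> m) = m" if m: "m \<in> UI_dual Q \<Gamma> e e'" for m
  proof -
    have mb: "bil Q (L (\<kappa> m)) (b s) = bil Q m (b s)" if s: "s \<in> set ss" for s
    proof -
      obtain j where j: "j < N" "s = ss ! j" using s by (auto simp: in_set_conv_nth N_def)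
      then have "\<kappa> m ! j = \<lfloor>Re (bil Q m (b s))\<rfloor>" by (simp add: \<kappa>_def N_def)
      then show ?thesis using Lb[OF j(1), of "\<kappa> m"] j UI_dual_int[OF m bI(1)[OF j(1)]] by simp
    qed
    have "L (\<kappa> m) - m = 0"
    proof (rule UI_nondegenerate)
      show "L (\<kappa> m) - m \<in> UI Q UNIV e e'" using m UI_mono[OF LQ[of "\<kappa> m"]] by (auto simp: UI_dual_def UI_iff bil_simps)
      fix y assume "y \<in> UI Q \<rat> e e'"
      then have y: "y = (\<Sum>s\<in>set ss. bil Q (l s) y *s b s)" using ss(4) UI_mono by blast
      have "bil Q (L (\<kappa> m) - m) (\<Sum>s\<in>A. bil Q (l s) y *s b s) = 0" if "A \<subseteq> set ss" for A
        using finite_subset[OF that finite_set] that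
        by (induction A rule: finite_induct) (auto simp: bil_simps mb)
      then show "bil Q (L (\<kappa> m) - m) y = 0" using y by (metis subset_refl)
    qed
    then show ?thesis by simp
  qed
  have a\<kappa>0: "a (\<kappa> m) = 0" if m: "m \<in> L ` {ns. length ns = N} - UI_dual Q \<Gamma> e e'" for m
  proof -
    obtain ns where ns: "m = L ns" "length ns = N" using m by blast
    have "\<exists>z\<in>UI_int Q \<Gamma> e e'. bil Q m z \<notin> \<int>" using m LQ[of ns] ns(1) by (auto simp: UI_dual_def)
    then obtain z where z: "z \<in> UI_int Q \<Gamma> e e'" "bil Q m z \<notin> \<int>" by blast
    have zW: "z \<in> UI Q \<real> e e'" using z UI_int_rat UI_Rats_Reals by blast
    have len: "length ns = length ?bs" using ns by (simp add: N_def)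
    have "modes ?bs ns g (?Z0 + z) = modes ?bs ns g ?Z0"
      by (rule modes_translate[OF _ zW bW len TD_nonempty]) (use per z in blast)
    then have "a ns * qexp Q m ?Z0 * ee (bil Q m z) = a ns * qexp Q m ?Z0"
      using const[OF ns(2) TD_nonempty] const[OF ns(2) T_real[OF TD_nonempty zW]] ns(1) by (simp add: qexp_add mult.assoc)
    then have "a ns = 0" using z(2) ee_eq_1_iff by auto
    then show ?thesis using \<kappa>L ns by simp
  qed
  define c where "c m = (if m \<in> UI_dual Q \<Gamma> e e' then a (\<kappa> m) else 0)" for m
  have "((\<lambda>m. c m * qexp Q m Z) has_sum g Z) (UI_dual Q \<Gamma> e e')" if Z: "Z \<in> TD" for Z
  proof -
    have "((\<lambda>ns. modes ?bs ns g Z) has_sum g Z) {ns. length ns = length ?bs}"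
      by (rule modes_has_sum[OF g perb bW Z])
    then have "((\<lambda>ns. modes ?bs ns g Z) has_sum g Z) {ns. length ns = N}" by (simp add: N_def)
    then have "((\<lambda>ns. a (\<kappa> (L ns)) * qexp Q (L ns) Z) has_sum g Z) {ns. length ns = N}"
      by (rule has_sum_cong[THEN iffD1, rotated]) (use const Z \<kappa>L in auto)
    moreover have "inj_on L {ns. length ns = N}" by (rule inj_on_inverseI[where g = \<kappa>]) (use \<kappa>L in auto)
    ultimately have "((\<lambda>m. a (\<kappa> m) * qexp Q m Z) has_sum g Z) (L ` {ns. length ns = N})"
      by (subst has_sum_reindex) (simp_all add: o_def)
    then show ?thesis
    proof (rule has_sum_cong_neutral[THEN iffD1, rotated 3])
      fix m assume "m \<in> UI_dual Q \<Gamma> e e' - L ` {ns. length ns = N}"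
      then show "c m * qexp Q m Z = 0" using L\<kappa>[of m] by (auto simp: image_iff \<kappa>_def N_def) (metis length_map)
    qed (use a\<kappa>0 in \<open>auto simp: c_def\<close>)
  qed
  then show ?thesis by (intro exI[of _ c]) (auto simp: c_def)
qed

end

section \<open>Fourier coefficients of modular forms\<close>

lemma has_sum_finite_sum:
  fixes F :: "'s \<Rightarrow> 'l \<Rightarrow> complex"
  assumes "finite S" "\<And>s. s \<in> S \<Longrightarrow> (F s has_sum G s) A"
  shows "((\<lambda>l. \<Sum>s\<in>S. F s l) has_sum (\<Sum>s\<in>S. G s)) A"
  using assms by (induction S rule: finite_induct) (auto intro!: has_sum_add)

lemma finite_lists_length [simp]: "finite {ys :: 'a::finite list. length ys = d}"
  using finite_lists_length_eq[of "UNIV :: 'a set" d] by simp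

lemma has_sum_tmap:
  assumes "\<And>ys. length ys = length xs \<Longrightarrow> ((\<lambda>l. a l ys * c l) has_sum F ys) A"
  shows "((\<lambda>l. tmap g (a l) xs * c l) has_sum tmap g F xs) A"
proof -
  let ?P = "\<lambda>ys. \<Prod>i<length xs. g $ (xs ! i) $ (ys ! i)"
  have "((\<lambda>l. \<Sum>ys | length ys = length xs. ?P ys * (a l ys * c l)) has_sum (\<Sum>ys | length ys = length xs. ?P ys * F ys)) A"
    by (intro has_sum_finite_sum has_sum_cmult_right) (use assms in auto)
  then show ?thesis by (simp add: tmap_def sum_distrib_right mult.assoc)
qed

lemma tmap_inverse: "h ** g = mat 1 \<Longrightarrow> tmap h (tmap g T) = T"
  by (simp add: tmap_compose tmap_id)

context cusp begin

lemma eichler_bil_e: "bil Q z e = 0 \<Longrightarrow> bil Q (eichler Q z e *v u) e = bil Q u e"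
  by (simp add: eichler_apply bil_simps ee)

text \<open>
  The transvections attached to the cusp fix \<open>e\<close> and act trivially on \<open>e\<^sup>\<bottom>/\<complex>e\<close>, hence the trivialization is
  invariant under them.
\<close>

lemma to_VI_eichler:
  assumes z: "bil Q z e = 0" and ne: "bil Q \<omega> e \<noteq> 0"
  shows "to_VI Q e e' (eichler Q z e *v \<omega>) ** eichler Q z e = to_VI Q e e' \<omega>"
proof (rule matrix_eqI)
  fix u
  let ?E = "eichler Q z e"
  define y where "y = u - (bil Q u e / bil Q \<omega> e) *s \<omega>"
  have ye: "bil Q e y = 0" using ne bil_sym[of e] by (simp add: y_def bil_simps)
  have "?E *v u - (bil Q (?E *v u) e / bil Q (?E *v \<omega>) e) *s (?E *v \<omega>) = ?E *v y"
    unfolding eichler_bil_e[OF z] y_def by (simp add: matrix_vector_mult_diff_distrib mv_scale)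
  also have "?E *v y = y - bil Q z y *s e" using ye by (simp add: eichler_apply)
  finally have F: "?E *v u - (bil Q (?E *v u) e / bil Q (?E *v \<omega>) e) *s (?E *v \<omega>) = y - bil Q z y *s e" .
  show "(to_VI Q e e' (?E *v \<omega>) ** ?E) *v u = to_VI Q e e' \<omega> *v u"
    unfolding matrix_vector_mul_assoc[symmetric] to_VI_apply y_def[symmetric] F
    by (simp add: bil_simps ee' vec_eq_iff algebra_simps)
qed

end

locale modular = cusp_arith Q n e e' D \<Gamma>
  for Q :: "int^'N^'N" and n e e' D \<Gamma> +
  fixes lam :: "nat list" and k :: int and f :: "complex^'N \<Rightarrow> 'N tensor set"
  assumes f: "f \<in> modular_forms Q D \<Gamma> lam k"
begin

lemma f_fibre: "\<omega> \<in> cone D \<Longrightarrow> f \<omega> \<in> E_fibre Q lam \<omega>"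
  and f_scale: "\<omega> \<in> cone D \<Longrightarrow> t \<noteq> 0 \<Longrightarrow> f (t *s \<omega>) = tscale (t powi (- k)) ` f \<omega>"
  and f_inv: "g \<in> \<Gamma> \<Longrightarrow> \<omega> \<in> cone D \<Longrightarrow> f (g *v \<omega>) = tmap g ` f \<omega>"
  using f by (auto simp: modular_forms_def)

lemma f_hol: "\<omega>0 \<in> cone D \<Longrightarrow> \<exists>U S. open U \<and> \<omega>0 \<in> U \<and> (\<forall>xs. holomorphic_vec (\<lambda>\<omega>. S \<omega> xs) U) \<and>
        (\<forall>\<omega>\<in>U \<inter> cone D. S \<omega> \<in> f \<omega>)"
  using f by (simp add: modular_forms_def)

abbreviation Psi :: "complex^'N \<Rightarrow> 'N tensor" where "Psi \<omega> \<equiv> I_triv Q k e e' \<omega> (f \<omega>)"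

lemma Psi_eq: "\<omega> \<in> cone D \<Longrightarrow> S \<in> f \<omega> \<Longrightarrow> Psi \<omega> = tscale (bil Q \<omega> e powi k) (tmap (to_VI Q e e' \<omega>) S)"
  by (rule I_triv_eq(1)[OF f_fibre]) (auto simp: cone_not_perp cone_isotropic)

lemma f_nonempty: "\<omega> \<in> cone D \<Longrightarrow> \<exists>S. S \<in> f \<omega>"
  using E_fibre_nonempty f_fibre by blast

lemma Psi_V: "\<omega> \<in> cone D \<Longrightarrow> Psi \<omega> \<in> V_lam Q lam e e'"
  using I_triv_eq(2)[OF f_fibre] f_nonempty cone_not_perp cone_isotropic by metis

lemma Psi_scale:
  assumes w: "\<omega> \<in> cone D" and t: "t \<noteq> 0" shows "Psi (t *s \<omega>) = Psi \<omega>"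
proof -
  obtain S where S: "S \<in> f \<omega>" using f_nonempty[OF w] by blast
  have S': "tscale (t powi (- k)) S \<in> f (t *s \<omega>)" using f_scale[OF w t] S by blast
  have M: "to_VI Q e e' (t *s \<omega>) = to_VI Q e e' \<omega>"
    by (rule matrix_eqI) (use t in \<open>simp add: to_VI_apply bil_simps vector_smult_assoc\<close>)
  have "(t * bil Q \<omega> e) powi k * t powi (- k) = bil Q \<omega> e powi k"
    using t by (simp add: power_int_mult_distrib power_int_minus)
  then show ?thesis
    unfolding Psi_eq[OF w S] Psi_eq[OF cone_scale[OF t w] S'] M tmap_tscale
    by (simp add: tscale_def bil_simps mult.assoc[symmetric])
qed

lemma Psi_image:
  assumes g: "g \<in> \<Gamma>" and w: "\<omega> \<in> cone D"
  shows "I_triv Q k (g *v e) (g *v e') (g *v \<omega>) (f (g *v \<omega>)) = tmap g (Psi \<omega>)"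
proof -
  obtain S where S: "S \<in> f \<omega>" using f_nonempty[OF w] by blast
  have gS: "tmap g S \<in> f (g *v \<omega>)" using f_inv[OF g w] S by blast
  interpret c2: cusp_arith Q n "g *v e" "g *v e'" D \<Gamma>
    by unfold_locales (use cusp_data_image[OF g cusp] D in auto)
  have M: "to_VI Q (g *v e) (g *v e') (g *v \<omega>) ** g = g ** to_VI Q e e' \<omega>"
    by (rule matrix_eqI)
       (simp add: matrix_vector_mul_assoc[symmetric] to_VI_apply \<Gamma>_bil[OF g] mv_scale matrix_vector_mult_diff_distrib
          bil_diff_left bil_scale_left)
  have "I_triv Q k (g *v e) (g *v e') (g *v \<omega>) (f (g *v \<omega>)) =
      tscale (bil Q (g *v \<omega>) (g *v e) powi k) (tmap (to_VI Q (g *v e) (g *v e') (g *v \<omega>)) (tmap g S))"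
    by (rule c2.I_triv_eq(1)[OF f_fibre gS]) (use \<Gamma>_cone[OF g w] c2.cone_iff in auto)
  also have "\<dots> = tscale (bil Q \<omega> e powi k) (tmap g (tmap (to_VI Q e e' \<omega>) S))"
    by (simp add: \<Gamma>_bil[OF g] tmap_compose M)
  also have "\<dots> = tmap g (Psi \<omega>)" unfolding Psi_eq[OF w S] by (simp add: tmap_tscale)
  finally show ?thesis .
qed

lemma Psi_eichler:
  assumes z: "bil Q z e = 0" "eichler Q z e \<in> \<Gamma>" and w: "\<omega> \<in> cone D"
  shows "Psi (eichler Q z e *v \<omega>) = Psi \<omega>"
proof -
  let ?E = "eichler Q z e"
  obtain S where S: "S \<in> f \<omega>" using f_nonempty[OF w] by blast
  have ES: "tmap ?E S \<in> f (?E *v \<omega>)" using f_inv[OF z(2) w] S by blast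
  have ne: "bil Q \<omega> e \<noteq> 0" by (rule cone_not_perp[OF w])
  note M = to_VI_eichler[OF z(1) ne] and fix_e = eichler_bil_e[OF z(1)]
  show ?thesis
    unfolding Psi_eq[OF w S] Psi_eq[OF \<Gamma>_cone[OF z(2) w] ES] tmap_compose M fix_e ..
qed

lemma Psi_period:
  assumes "Z \<in> TD" "z \<in> UI_int Q \<Gamma> e e'" shows "Psi (tpt (Z + z)) = Psi (tpt Z)"
proof -
  have zU: "z \<in> UI Q UNIV e e'" using UI_mono[OF UI_int_rat[OF assms(2)]] .
  then show ?thesis
    using Psi_eichler[OF _ UI_int_\<Gamma>[OF assms(2)] tube_pt_cone[OF assms(1)]] tube_pt_add[OF TD_UI[OF assms(1)] zU]
    by (simp add: UI_iff)
qed

text \<open>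
  Locally \<open>f\<close> has holomorphic representatives, and the entries of the trivialization are rational functions of
  \<open>\<omega>\<close> with denominator \<open>(\<omega>, e)\<close>.
\<close>

lemma Psi_hol: "hol (\<lambda>Z. Psi (tpt Z) xs)"
proof -
  define ent where "ent i j \<omega> = (axis j 1 $ i - bil Q (axis j 1) e / bil Q \<omega> e * \<omega> $ i)
     - (bil Q (axis j 1) e' - bil Q (axis j 1) e / bil Q \<omega> e * bil Q \<omega> e') * e $ i" for i j \<omega>
  have ent: "to_VI Q e e' \<omega> $ i $ j = ent i j \<omega>" for i j \<omega>
  proof -
    have "to_VI Q e e' \<omega> $ i $ j = (to_VI Q e e' \<omega> *v axis j 1) $ i"
      by (simp add: matrix_vector_mult_def axis_def if_distrib cong: if_cong)
    then show ?thesis by (simp add: to_VI_apply ent_def bil_simps algebra_simps)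
  qed
  define H where "H S \<omega> = (\<Sum>ys | length ys = length xs. (\<Prod>i<length xs. ent (xs ! i) (ys ! i) \<omega>) * S \<omega> ys)"
    for S :: "complex^'N \<Rightarrow> 'N tensor" and \<omega>
  have loc: "\<exists>U S. open U \<and> tpt Z0 \<in> U \<and> (\<forall>xs. holomorphic_vec (\<lambda>\<omega>. S \<omega> xs) U) \<and>
      (\<forall>Z\<in>TD. tpt Z \<in> U \<longrightarrow> Psi (tpt Z) xs = H S (tpt Z))" if Z0: "Z0 \<in> TD" for Z0
  proof -
    obtain U S where US: "open U" "tpt Z0 \<in> U" "\<forall>xs. holomorphic_vec (\<lambda>\<omega>. S \<omega> xs) U" "\<forall>\<omega>\<in>U \<inter> cone D. S \<omega> \<in> f \<omega>"
      using f_hol[OF tube_pt_cone[OF Z0]] by blast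
    have "Psi (tpt Z) xs = H S (tpt Z)" if Z: "Z \<in> TD" "tpt Z \<in> U" for Z
      using Psi_eq[OF tube_pt_cone[OF Z(1)], of "S (tpt Z)"] US(4) Z tube_pt_cone[OF Z(1)] tube_pt_bil(1)[OF TD_UI[OF Z(1)]]
      by (simp add: H_def tmap_def ent tscale_def)
    then show ?thesis using US(1-3) by blast
  qed
  have tptc: "continuous_on UNIV tpt"
    unfolding tube_pt_def by (intro continuous_intros continuous_on_vec_scale)
  show ?thesis unfolding hol_def
  proof (intro conjI ballI)
    show "continuous_on TD (\<lambda>Z. Psi (tpt Z) xs)"
      unfolding continuous_on_eq_continuous_within
    proof
      fix Z0 assume Z0: "Z0 \<in> TD"
      obtain U S where US: "open U" "tpt Z0 \<in> U" "\<forall>xs. holomorphic_vec (\<lambda>\<omega>. S \<omega> xs) U"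
        "\<forall>Z\<in>TD. tpt Z \<in> U \<longrightarrow> Psi (tpt Z) xs = H S (tpt Z)" using loc[OF Z0] by blast
      have "isCont (\<lambda>\<omega>. S \<omega> ys) (tpt Z0)" for ys using US holomorphic_vec_isCont by blast
      moreover have "isCont (ent i j) (tpt Z0)" for i j
      proof -
        have bc: "isCont (\<lambda>\<omega>. bil Q \<omega> x) p" for x p unfolding bil_def by (intro continuous_intros)
        show ?thesis unfolding ent_def using cone_not_perp[OF tube_pt_cone[OF Z0]]
          by (intro continuous_intros bc) auto
      qed
      ultimately have "isCont (H S) (tpt Z0)" unfolding H_def by (intro continuous_intros)
      moreover have "isCont tpt Z0" using tptc by (simp add: continuous_on_eq_continuous_at)
      ultimately have "isCont (\<lambda>Z. H S (tpt Z)) Z0" using isCont_o2 by blast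
      then have c: "continuous (at Z0 within TD) (\<lambda>Z. H S (tpt Z))" using continuous_at_imp_continuous_at_within by blast
      have op: "open (tpt -` U)" using open_vimage[OF US(1) tptc] .
      show "continuous (at Z0 within TD) (\<lambda>Z. Psi (tpt Z) xs)"
        unfolding continuous_within
      proof (rule Lim_transform_eventually)
        show "((\<lambda>Z. H S (tpt Z)) \<longlongrightarrow> Psi (tpt Z0) xs) (at Z0 within TD)"
          using c US(2,4) Z0 by (simp add: continuous_within)
        show "\<forall>\<^sub>F Z in at Z0 within TD. H S (tpt Z) = Psi (tpt Z) xs"
          unfolding eventually_at_topological using op US(2,4) by (intro exI[of _ "tpt -` U"]) auto
      qed
    qed
  next
    fix Z b assume Z: "Z \<in> TD" and b: "b \<in> UI Q \<real> e e'"
    let ?A = "{s. Z + s *s b \<in> TD}" and ?\<gamma> = "\<lambda>s. tpt (Z + s *s b)"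
    have "(\<lambda>s. Psi (?\<gamma> s) xs) field_differentiable at s0" if s0: "s0 \<in> ?A" for s0
    proof -
      have ZT: "Z + s0 *s b \<in> TD" using s0 by simp
      obtain U S where US: "open U" "tpt (Z + s0 *s b) \<in> U" "\<forall>xs. holomorphic_vec (\<lambda>\<omega>. S \<omega> xs) U"
        "\<forall>Z\<in>TD. tpt Z \<in> U \<longrightarrow> Psi (tpt Z) xs = H S (tpt Z)" using loc[OF ZT] by blast
      have lin: "(\<lambda>s. (Z + s *s b) $ i) field_differentiable at s0" for i
        by (simp, intro derivative_intros)
      have \<gamma>d: "(\<lambda>s. ?\<gamma> s $ i) field_differentiable at s0" for i
      proof -
        have "(\<lambda>s. bil Q (Z + s *s b) (Z + s *s b)) field_differentiable at s0"
          unfolding bil_def by (intro field_differentiable_sum field_differentiable_mult field_differentiable_const lin)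
        then have "(\<lambda>s. e' $ i + (Z + s *s b) $ i - (1 / 2 * bil Q (Z + s *s b) (Z + s *s b)) * e $ i) field_differentiable at s0"
          by (intro field_differentiable_diff field_differentiable_add field_differentiable_mult field_differentiable_const lin)
        then show ?thesis by (simp add: tube_pt_def)
      qed
      have Sd: "(\<lambda>s. S (?\<gamma> s) ys) field_differentiable at s0" for ys
        using holomorphic_vec_compose[where F = "\<lambda>\<omega>. S \<omega> ys" and \<gamma> = ?\<gamma>, OF _ US(1,2) \<gamma>d] US(3) by blast
      have entd: "(\<lambda>s. ent i j (?\<gamma> s)) field_differentiable at s0" for i j
        unfolding ent_def using cone_not_perp[OF tube_pt_cone[OF ZT]]
        by (intro field_differentiable_diff field_differentiable_mult field_differentiable_divide
            field_differentiable_const \<gamma>d bil_field_differentiable)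
      have prodd: "(\<lambda>s. \<Prod>i\<in>I. ent (xs ! i) (ys ! i) (?\<gamma> s)) field_differentiable at s0" if "finite I" for I ys
        using that by (induction I rule: finite_induct) (auto intro!: field_differentiable_mult entd)
      have Hd: "(\<lambda>s. H S (?\<gamma> s)) field_differentiable at s0"
        unfolding H_def by (intro field_differentiable_sum field_differentiable_mult prodd Sd) simp
      have "continuous_on UNIV ?\<gamma>"
        by (rule continuous_on_compose2[OF tptc]) (intro continuous_intros continuous_on_vec_scale, simp)
      then have "open (?\<gamma> -` U)" by (rule open_vimage[OF US(1)])
      then have op: "open (?A \<inter> ?\<gamma> -` U)" using strip_open[OF b] by blast
      obtain d where "((\<lambda>s. H S (?\<gamma> s)) has_field_derivative d) (at s0)" using Hd by (auto simp: field_differentiable_def)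
      then have "((\<lambda>s. Psi (?\<gamma> s) xs) has_field_derivative d) (at s0)"
        by (rule has_field_derivative_transform_within_open[OF _ op]) (use s0 US(2,4) in auto)
      then show ?thesis by (auto simp: field_differentiable_def)
    qed
    then show "(\<lambda>s. Psi (?\<gamma> s) xs) holomorphic_on ?A"
      by (simp add: holomorphic_on_def field_differentiable_at_within)
  qed
qed

definition is_fourier_expansion :: "(complex^'N \<Rightarrow> 'N tensor) \<Rightarrow> bool" where
  "is_fourier_expansion a \<longleftrightarrow> (\<forall>l. a l \<in> V_lam Q lam e e') \<and>
     (\<forall>l. l \<notin> UI_dual Q \<Gamma> e e' \<longrightarrow> a l = (\<lambda>xs. 0)) \<and>
     (\<forall>Z\<in>TD. \<forall>xs. ((\<lambda>l. a l xs * qexp Q l Z) has_sum Psi (tpt Z) xs) (UI_dual Q \<Gamma> e e'))"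

lemma V_lam_subspace: "tsubspace (V_lam Q lam e e')"
  unfolding V_lam_def by (rule tsubspace_schur)

lemma V_lam_length: "T \<in> V_lam Q lam e e' \<Longrightarrow> length xs \<noteq> sum_list lam \<Longrightarrow> T xs = 0"
  unfolding V_lam_def by (rule schur_length)

text \<open>
  Membership in \<open>V(I)\<^sub>\<lambda>\<close> is expressed by finitely many linear relations between the entries, which pass to sums of
  series of tensors.
\<close>

lemma V_lam_echelon:
  "\<exists>S B. finite S \<and> (\<forall>s\<in>S. B s \<in> V_lam Q lam e e') \<and> (\<forall>T\<in>V_lam Q lam e e'. T = (\<lambda>xs. \<Sum>s\<in>S. T s * B s xs))"
proof -
  have "\<exists>S B. S \<subseteq> {xs. length xs = sum_list lam} \<and> (\<forall>s\<in>S. B s \<in> V_lam Q lam e e') \<and>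
     (\<forall>T\<in>V_lam Q lam e e'. T = (\<lambda>xs. \<Sum>s\<in>S. T s * B s xs)) \<and> (\<forall>s\<in>S. \<forall>t\<in>S. B s t = (if s = t then 1 else 0))"
    by (rule echelon_basis[where F = UNIV])
       (auto intro: tsubspaceD(2)[OF V_lam_subspace] tsubspaceD(3)[OF V_lam_subspace] V_lam_length)
  then obtain S B where "S \<subseteq> {xs. length xs = sum_list lam}" "\<forall>s\<in>S. B s \<in> V_lam Q lam e e'"
     "\<forall>T\<in>V_lam Q lam e e'. T = (\<lambda>xs. \<Sum>s\<in>S. T s * B s xs)" by (elim exE conjE) (rule that; assumption)
  moreover from this(1) have "finite S" using finite_subset finite_lists_length by blast
  ultimately show ?thesis by (intro exI[where x = S]) blast
qed

lemma fourier_expansion_unique: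
  assumes "is_fourier_expansion a" "is_fourier_expansion a'" shows "a = a'"
proof (intro ext)
  fix l xs
  show "a l xs = a' l xs"
  proof (cases "l \<in> UI_dual Q \<Gamma> e e'")
    case True
    then show ?thesis
      using fourier_unique[of "\<lambda>l. a l xs" "\<lambda>Z. Psi (tpt Z) xs" "\<lambda>l. a' l xs" l] assms by (auto simp: is_fourier_expansion_def)
  next
    case False then show ?thesis using assms by (simp add: is_fourier_expansion_def)
  qed
qed

lemma fourier_expansion_exists: "\<exists>a. is_fourier_expansion a"
proof -
  obtain S B where SB: "finite S" "\<forall>s\<in>S. B s \<in> V_lam Q lam e e'"
    "\<forall>T\<in>V_lam Q lam e e'. T = (\<lambda>xs. \<Sum>s\<in>S. T s * B s xs)" using V_lam_echelon by blast
  have "\<forall>s. \<exists>c. (\<forall>l. l \<notin> UI_dual Q \<Gamma> e e' \<longrightarrow> c l = 0) \<and>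
      (\<forall>Z\<in>TD. ((\<lambda>l. c l * qexp Q l Z) has_sum Psi (tpt Z) s) (UI_dual Q \<Gamma> e e'))"
    using fourier_exists[OF Psi_hol] Psi_period by simp
  then obtain c where c: "\<And>s l. l \<notin> UI_dual Q \<Gamma> e e' \<Longrightarrow> c s l = 0"
    "\<And>s Z. Z \<in> TD \<Longrightarrow> ((\<lambda>l. c s l * qexp Q l Z) has_sum Psi (tpt Z) s) (UI_dual Q \<Gamma> e e')" by metis
  define a where "a l = (\<lambda>xs. \<Sum>s\<in>S. c s l * B s xs)" for l
  have "((\<lambda>l. a l xs * qexp Q l Z) has_sum Psi (tpt Z) xs) (UI_dual Q \<Gamma> e e')" if Z: "Z \<in> TD" for Z xs
  proof -
    have "((\<lambda>l. \<Sum>s\<in>S. c s l * qexp Q l Z * B s xs) has_sum (\<Sum>s\<in>S. Psi (tpt Z) s * B s xs)) (UI_dual Q \<Gamma> e e')"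
      by (intro has_sum_finite_sum SB has_sum_cmult_left c Z)
    moreover have "Psi (tpt Z) xs = (\<Sum>s\<in>S. Psi (tpt Z) s * B s xs)"
      using fun_cong[OF bspec[OF SB(3) Psi_V[OF tube_pt_cone[OF Z]]], of xs] .
    ultimately show ?thesis by (simp add: a_def sum_distrib_right sum_distrib_left mult_ac)
  qed
  moreover have "a l \<in> V_lam Q lam e e'" for l
    unfolding a_def by (rule tsubspace_sum[OF V_lam_subspace]) (use SB in auto)
  ultimately have "is_fourier_expansion a" unfolding is_fourier_expansion_def using c(1) by (simp add: a_def)
  then show ?thesis by blast
qed

abbreviation coeff :: "complex^'N \<Rightarrow> 'N tensor" where "coeff \<equiv> fourier_coeff Q D \<Gamma> lam k f e e'"

lemma fourier_expansion_coeff: "is_fourier_expansion coeff"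
proof -
  have "coeff = (THE a. is_fourier_expansion a)" by (simp add: fourier_coeff_def is_fourier_expansion_def)
  moreover have "\<exists>!a. is_fourier_expansion a" using fourier_expansion_exists fourier_expansion_unique by blast
  ultimately show ?thesis using theI' by metis
qed

lemma coeff_V: "coeff l \<in> V_lam Q lam e e'"
  and coeff_0: "l \<notin> UI_dual Q \<Gamma> e e' \<Longrightarrow> coeff l = (\<lambda>xs. 0)"
  and coeff_has_sum: "Z \<in> TD \<Longrightarrow> ((\<lambda>l. coeff l xs * qexp Q l Z) has_sum Psi (tpt Z) xs) (UI_dual Q \<Gamma> e e')"
  using fourier_expansion_coeff by (auto simp: is_fourier_expansion_def)

end

context cusp_arith begin

lemma cusp_arith_image: "g \<in> \<Gamma> \<Longrightarrow> cusp_arith Q n (g *v e) (g *v e') D \<Gamma>"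
  by unfold_locales (use cusp_data_image[OF _ cusp] D in auto)

lemma UI_image:
  assumes "g \<in> \<Gamma>" shows "z \<in> UI Q \<rat> e e' \<Longrightarrow> g *v z \<in> UI Q \<rat> (g *v e) (g *v e')"
    "z \<in> UI Q \<real> e e' \<Longrightarrow> g *v z \<in> UI Q \<real> (g *v e) (g *v e')"
    "z \<in> UI Q UNIV e e' \<Longrightarrow> g *v z \<in> UI Q UNIV (g *v e) (g *v e')"
  using \<Gamma>_real[OF assms] \<Gamma>_bil[OF assms] by (auto simp: UI_iff)

lemma eichler_image_\<Gamma>:
  assumes g: "g \<in> \<Gamma>" and "eichler Q z e \<in> \<Gamma>" shows "eichler Q (g *v z) (g *v e) \<in> \<Gamma>"
proof -
  obtain h where h: "h \<in> \<Gamma>" "g ** h = mat 1" "h ** g = mat 1" using \<Gamma>_inverse[OF g] by blast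
  have "eichler Q (g *v z) (g *v e) = g ** (eichler Q z e ** h)"
  proof (rule matrix_eqI)
    fix x
    have "g *v (h *v x) = x" using h by (simp add: matrix_vector_mul_assoc)
    then show "eichler Q (g *v z) (g *v e) *v x = (g ** (eichler Q z e ** h)) *v x"
      using eichler_conj[OF g, of z e "h *v x"] by (simp add: matrix_vector_mul_assoc[symmetric])
  qed
  then show ?thesis using \<Gamma>_mult[OF g \<Gamma>_mult[OF assms(2) h(1)]] by simp
qed

lemma UI_int_image: "g \<in> \<Gamma> \<Longrightarrow> z \<in> UI_int Q \<Gamma> e e' \<Longrightarrow> g *v z \<in> UI_int Q \<Gamma> (g *v e) (g *v e')"
  using UI_image(1) eichler_image_\<Gamma> by (auto simp: UI_int_def)

lemma UI_dual_image:
  assumes g: "g \<in> \<Gamma>" and l: "l \<in> UI_dual Q \<Gamma> e e'" shows "g *v l \<in> UI_dual Q \<Gamma> (g *v e) (g *v e')"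
proof -
  obtain h where h: "h \<in> \<Gamma>" "g ** h = mat 1" "h ** g = mat 1" using \<Gamma>_inverse[OF g] by blast
  have inv: "g *v (h *v x) = x" "h *v (g *v x) = x" for x using h by (simp_all add: matrix_vector_mul_assoc)
  interpret c2: cusp_arith Q n "g *v e" "g *v e'" D \<Gamma> by (rule cusp_arith_image[OF g])
  have "bil Q (g *v l) z \<in> \<int>" if "z \<in> UI_int Q \<Gamma> (g *v e) (g *v e')" for z
  proof -
    have "h *v z \<in> UI_int Q \<Gamma> e e'" using c2.UI_int_image[OF h(1) that] by (simp add: inv)
    moreover have "bil Q (g *v l) z = bil Q l (h *v z)" using \<Gamma>_bil[OF g, of l "h *v z"] by (simp add: inv)
    ultimately show ?thesis using l by (auto simp: UI_dual_def)
  qed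
  then show ?thesis using l UI_image(1)[OF g] by (auto simp: UI_dual_def)
qed

lemma tube_pt_image: "g \<in> \<Gamma> \<Longrightarrow> g *v tpt Z = tube_pt Q (g *v e) (g *v e') (g *v Z)"
  by (simp add: tube_pt_def \<Gamma>_bil matrix_vector_right_distrib matrix_vector_mult_diff_distrib mv_scale)

lemma tube_coord_image: "g \<in> \<Gamma> \<Longrightarrow> g *v tco \<omega> = tube_coord Q (g *v e) (g *v e') (g *v \<omega>)"
  by (simp add: tube_coord_def \<Gamma>_bil matrix_vector_mult_diff_distrib mv_scale)

lemma TD_image:
  assumes g: "g \<in> \<Gamma>" and Z: "Z \<in> TD" shows "g *v Z \<in> tube_domain Q D (g *v e) (g *v e')"
proof -
  interpret c2: cusp_arith Q n "g *v e" "g *v e'" D \<Gamma> by (rule cusp_arith_image[OF g])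
  show ?thesis
    using \<Gamma>_cone[OF g tube_pt_cone[OF Z]] UI_image(3)[OF g TD_UI[OF Z]] by (simp add: c2.TD_iff tube_pt_image[OF g])
qed

lemma V_lam_image: "g \<in> \<Gamma> \<Longrightarrow> T \<in> V_lam Q lam e e' \<Longrightarrow> tmap g T \<in> V_lam Q lam (g *v e) (g *v e')"
  unfolding V_lam_def by (rule tmap_schur) (auto simp: perp_def \<Gamma>_bil)

end

context modular begin

text \<open>
  Naturality: \<open>g\<close> carries all the data of the cusp \<open>(e, e')\<close> to those of \<open>(ge, ge')\<close>, and Fourier expansions
  are unique.
\<close>

lemma coeff_image:
  assumes g: "g \<in> \<Gamma>"
  shows "fourier_coeff Q D \<Gamma> lam k f (g *v e) (g *v e') (g *v l) = tmap g (coeff l)"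
proof -
  obtain h where h: "h \<in> \<Gamma>" "g ** h = mat 1" "h ** g = mat 1" using \<Gamma>_inverse[OF g] by blast
  have inv: "g *v (h *v x) = x" "h *v (g *v x) = x" for x using h by (simp_all add: matrix_vector_mul_assoc)
  interpret c2: modular Q n "g *v e" "g *v e'" D \<Gamma> lam k f
    using cusp_arith_image[OF g] f by (simp add: modular_def modular_axioms_def)
  have "c2.is_fourier_expansion (\<lambda>l. tmap g (coeff (h *v l)))"
    unfolding c2.is_fourier_expansion_def
  proof (intro conjI allI impI ballI)
    fix l show "tmap g (coeff (h *v l)) \<in> V_lam Q lam (g *v e) (g *v e')"
      by (rule V_lam_image[OF g coeff_V])
  next
    fix l assume "l \<notin> UI_dual Q \<Gamma> (g *v e) (g *v e')"
    then have "h *v l \<notin> UI_dual Q \<Gamma> e e'" using UI_dual_image[OF g, of "h *v l"] by (auto simp: inv)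
    then show "tmap g (coeff (h *v l)) = (\<lambda>xs. 0)" by (simp add: coeff_0)
  next
    fix Z xs assume Z: "Z \<in> c2.TD"
    have hZ: "h *v Z \<in> TD" using c2.TD_image[OF h(1) Z] by (simp add: inv)
    have "((\<lambda>l. tmap g (coeff l) xs * qexp Q l (h *v Z)) has_sum tmap g (Psi (tpt (h *v Z))) xs) (UI_dual Q \<Gamma> e e')"
      by (intro has_sum_tmap coeff_has_sum hZ)
    moreover have "tmap g (Psi (tpt (h *v Z))) = c2.Psi (c2.tpt Z)"
      using Psi_image[OF g tube_pt_cone[OF hZ]] by (simp add: tube_pt_image[OF g] inv)
    moreover have "UI_dual Q \<Gamma> e e' = (*v) h ` UI_dual Q \<Gamma> (g *v e) (g *v e')"
    proof
      show "UI_dual Q \<Gamma> e e' \<subseteq> (*v) h ` UI_dual Q \<Gamma> (g *v e) (g *v e')"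
      proof
        fix l assume "l \<in> UI_dual Q \<Gamma> e e'"
        then show "l \<in> (*v) h ` UI_dual Q \<Gamma> (g *v e) (g *v e')"
          using UI_dual_image[OF g] inv(2)[of l] by (metis image_eqI)
      qed
      show "(*v) h ` UI_dual Q \<Gamma> (g *v e) (g *v e') \<subseteq> UI_dual Q \<Gamma> e e'"
        using c2.UI_dual_image[OF h(1)] by (auto simp: inv)
    qed
    moreover have "qexp Q (h *v l) (h *v Z) = qexp Q l Z" for l by (simp add: qexp_def \<Gamma>_bil[OF h(1)])
    ultimately show "((\<lambda>l. tmap g (coeff (h *v l)) xs * qexp Q l Z) has_sum c2.Psi (c2.tpt Z) xs) (UI_dual Q \<Gamma> (g *v e) (g *v e'))"
      by (simp add: has_sum_reindex[OF inj_on_subset[OF \<Gamma>_inj[OF h(1)]]] o_def)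
  qed
  then have "c2.coeff = (\<lambda>l. tmap g (coeff (h *v l)))" using c2.fourier_expansion_unique c2.fourier_expansion_coeff by blast
  then show ?thesis by (simp add: inv)
qed

end

section \<open>The Koecher principle\<close>

lemma has_sum_bounded_terms:
  fixes F :: "'a \<Rightarrow> complex"
  assumes "(F has_sum s) A" shows "\<exists>K. \<forall>x\<in>A. norm (F x) \<le> K"
proof -
  have "F summable_on A" using assms by (auto simp: summable_on_def)
  then have s: "(\<lambda>x. norm (F x)) summable_on A" by (simp add: summable_on_iff_abs_summable_on_complex)
  have "norm (F x) \<le> infsum (\<lambda>x. norm (F x)) A" if "x \<in> A" for x
    using finite_sum_le_infsum[OF s, of "{x}"] that by simp
  then show ?thesis by blast
qed

lemma polynomial_gauss_tendsto_0:
  assumes "\<gamma> > (0::real)"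
  shows "(\<lambda>k. C * (1 + real k) ^ p * exp (2 * pi * (\<alpha> + \<beta> * real k - \<gamma> * (real k)^2))) \<longlonglongrightarrow> 0"
  using assms by real_asymp

lemma norm_tmap_le:
  fixes g :: "complex^'N^'N"
  assumes g: "\<And>i j. norm (g $ i $ j) \<le> E" and T: "\<And>ys. length ys = length xs \<Longrightarrow> norm (T ys) \<le> B" and "0 \<le> B"
  shows "norm (tmap g T xs) \<le> real (card {ys :: 'N list. length ys = length xs}) * (E ^ length xs * B)"
proof -
  have "E \<ge> 0" using order_trans[OF norm_ge_zero g] .
  have "norm ((\<Prod>i<length xs. g $ (xs ! i) $ (ys ! i)) * T ys) \<le> E ^ length xs * B" if "length ys = length xs" for ys
  proof -
    have "norm (\<Prod>i<length xs. g $ (xs ! i) $ (ys ! i)) \<le> (\<Prod>i<length xs. E)"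
      unfolding prod_norm[symmetric] by (rule prod_mono) (use g in auto)
    then show ?thesis unfolding norm_mult using T[OF that] \<open>E \<ge> 0\<close> \<open>0 \<le> B\<close> by (intro mult_mono) auto
  qed
  then show ?thesis unfolding tmap_def using sum_norm_bound[of "{ys :: 'N list. length ys = length xs}"
      "\<lambda>ys. (\<Prod>i<length xs. g $ (xs ! i) $ (ys ! i)) * T ys" "E ^ length xs * B"] by simp
qed

context modular begin

text \<open>
  The terms of the series at the point \<open>\<i> u0\<close> are bounded.
\<close>

lemma coeff_bounded: "\<exists>K\<ge>0. \<forall>l xs. norm (coeff l xs) \<le> K * exp (2 * pi * Re (bil Q l u0))"
proof -
  have norm_q: "norm (qexp Q l (\<i> *s u0)) = exp (- (2 * pi * Re (bil Q l u0)))" for l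
    by (simp add: qexp_ee norm_ee bil_simps)
  have "\<exists>K\<ge>0. \<forall>l. norm (coeff l xs) \<le> K * exp (2 * pi * Re (bil Q l u0))" for xs
  proof -
    obtain K where K: "\<And>l. l \<in> UI_dual Q \<Gamma> e e' \<Longrightarrow> norm (coeff l xs * qexp Q l (\<i> *s u0)) \<le> K"
      using has_sum_bounded_terms[OF coeff_has_sum[OF TD_nonempty]] by blast
    have "norm (coeff l xs) \<le> max K 0 * exp (2 * pi * Re (bil Q l u0))" for l
    proof (cases "l \<in> UI_dual Q \<Gamma> e e'")
      case True
      have "norm (coeff l xs) * exp (- (2 * pi * Re (bil Q l u0))) \<le> max K 0"
        using K[OF True] by (simp add: norm_mult norm_q)
      then have "norm (coeff l xs) * exp (- (2 * pi * Re (bil Q l u0))) * exp (2 * pi * Re (bil Q l u0))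
          \<le> max K 0 * exp (2 * pi * Re (bil Q l u0))" by (rule mult_right_mono) simp
      then show ?thesis by (simp add: mult.assoc flip: exp_add)
    qed (simp add: coeff_0)
    then show ?thesis by (intro exI[of _ "max K 0"]) auto
  qed
  then obtain K where K: "\<And>xs. K xs \<ge> 0" "\<And>xs l. norm (coeff l xs) \<le> K xs * exp (2 * pi * Re (bil Q l u0))" by metis
  let ?S = "{ys :: 'N list. length ys = sum_list lam}"
  have nn: "0 \<le> sum K ?S" by (intro sum_nonneg K(1))
  have "norm (coeff l xs) \<le> sum K ?S * exp (2 * pi * Re (bil Q l u0))" for l xs
  proof (cases "length xs = sum_list lam")
    case True
    then have "K xs \<le> sum K ?S" using member_le_sum[of xs ?S K] K(1) by auto
    then show ?thesis using K(2)[of l xs] by (meson mult_right_mono exp_ge_zero order_trans)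
  next
    case False
    then show ?thesis using V_lam_length[OF coeff_V False, of l] nn by simp
  qed
  then show ?thesis using nn by blast
qed

text \<open>
  The transvections along \<open>w\<close> with axis \<open>v'\<close> fix \<open>e\<close> and \<open>e'\<close>, so a nonzero coefficient would
  persist, up to polynomial factors, along the orbit of \<open>l0\<close>.  On the orbit the pairing with \<open>u0\<close> is a quadratic
  polynomial in \<open>k\<close> whose leading coefficient is a positive multiple of \<open>- (w, w) (l0, v') (v', u0) < 0\<close>, and
  \<open>coeff_bounded\<close> forces the coefficient to vanish.
\<close>

lemma coeff_unipotent_vanishing:
  assumes v: "v' \<in> UI Q \<rat> e e'" "bil Q v' v' = 0" and w: "w \<in> UI Q \<rat> e e'" "bil Q w v' = 0" "Re (bil Q w w) < 0"
    and pos: "0 < Re (bil Q v' u0)" and l0: "l0 \<in> UI Q \<rat> e e'" "Re (bil Q l0 v') < 0"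
  shows "coeff l0 = (\<lambda>xs. 0)"
proof -
  have vq: "v' \<in> vecs \<rat>" and wq: "w \<in> vecs \<rat>" using v w by (auto simp: UI_iff)
  obtain M :: int where M: "M > 0" "eichler Q (of_int M *s w) v' \<in> \<Gamma>" using eichler_in_\<Gamma>[OF wq vq v(2) w(2)] by blast
  define w1 where "w1 = of_int M *s w"
  have w1: "w1 \<in> UI Q \<rat> e e'" "bil Q w1 v' = 0" using w M unfolding w1_def by (auto intro!: UI_Rats_arith simp: bil_simps)
  have "Re (bil Q w1 w1) = (of_int M)\<^sup>2 * Re (bil Q w w)"
    by (simp add: w1_def bil_simps power2_eq_square mult.assoc)
  then have w1neg: "Re (bil Q w1 w1) < 0" using w(3) M(1) by (simp add: mult_pos_neg)
  define g where "g k = eichler Q (of_nat k *s w1) v'" for k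
  define h where "h k = eichler Q (of_nat k *s (- w1)) v'" for k
  have w1v: "bil Q v' w1 = 0" using w1(2) bil_sym by metis
  have g\<Gamma>: "g k \<in> \<Gamma>" for k unfolding g_def
    by (rule eichler_\<Gamma>_multiple) (use v w1 M in \<open>auto simp: w1_def\<close>)
  have hg: "h k ** g k = mat 1" for k
    unfolding h_def g_def by (subst eichler_mult) (use v w1 in \<open>auto simp: bil_simps\<close>)
  have fix_e: "g k *v e = e" "g k *v e' = e'" for k
    using v(1) w1(1) bil_sym[of v' e] bil_sym[of v' e'] unfolding g_def eichler_apply by (auto simp: UI_iff bil_simps)
  have cf: "coeff (g k *v l0) = tmap (g k) (coeff l0)" for k
    using coeff_image[OF g\<Gamma>[of k], of l0] by (simp only: fix_e)
  have inv: "coeff l0 = tmap (h k) (coeff (g k *v l0))" for k unfolding cf by (rule tmap_inverse[OF hg, symmetric])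
  obtain K where K: "K \<ge> 0" "\<And>l xs. norm (coeff l xs) \<le> K * exp (2 * pi * Re (bil Q l u0))" using coeff_bounded by blast
  \<comment> \<open>The entries of the inverse transvections grow at most quadratically.\<close>
  define a where "a i j = norm (axis j 1 $ i :: complex) + norm ((bil Q w1 (axis j 1) *s v' - bil Q v' (axis j 1) *s w1) $ i)
    + norm (((1 / 2 * bil Q w1 w1 * bil Q v' (axis j 1)) *s v') $ i)" for i j :: 'N
  define E where "E = (\<Sum>i\<in>UNIV. \<Sum>j\<in>UNIV. a i j)"
  have a0: "0 \<le> a i j" for i j by (simp add: a_def)
  have aE: "a i j \<le> E" for i j
  proof -
    have "a i j \<le> (\<Sum>j\<in>UNIV. a i j)" by (rule member_le_sum) (use a0 in auto)
    also have "\<dots> \<le> E" unfolding E_def by (rule member_le_sum[of i UNIV "\<lambda>i. \<Sum>j\<in>UNIV. a i j"]) (use a0 in \<open>auto intro: sum_nonneg\<close>)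
    finally show ?thesis .
  qed
  have entry: "norm (h k $ i $ j) \<le> E * (1 + real k)\<^sup>2" for k i j
  proof -
    have "h k $ i $ j = (h k *v axis j 1) $ i" by (simp add: matrix_vector_mult_def axis_def if_distrib cong: if_cong)
    also have "\<dots> = axis j 1 $ i + of_nat k * (bil Q w1 (axis j 1) *s v' - bil Q v' (axis j 1) *s w1) $ i
        - (of_nat k)\<^sup>2 * ((1 / 2 * bil Q w1 w1 * bil Q v' (axis j 1)) *s v') $ i"
      unfolding h_def eichler_apply by (simp add: bil_simps algebra_simps power2_eq_square)
    finally have eq: "h k $ i $ j = axis j 1 $ i + of_nat k * (bil Q w1 (axis j 1) *s v' - bil Q v' (axis j 1) *s w1) $ i
        - (of_nat k)\<^sup>2 * ((1 / 2 * bil Q w1 w1 * bil Q v' (axis j 1)) *s v') $ i" .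
    have gen: "norm (x + of_nat k * y - (of_nat k)\<^sup>2 * z) \<le> (norm x + norm y + norm z) * (1 + real k)\<^sup>2" for x y z :: complex
    proof -
      have "norm (x + of_nat k * y - (of_nat k)\<^sup>2 * z) \<le> norm x + real k * norm y + (real k)\<^sup>2 * norm z"
        using norm_triangle_ineq4[of "x + of_nat k * y" "(of_nat k)\<^sup>2 * z"] norm_triangle_ineq[of x "of_nat k * y"]
        by (simp add: norm_mult norm_power)
      also have "\<dots> \<le> (1 + real k)\<^sup>2 * norm x + (1 + real k)\<^sup>2 * norm y + (1 + real k)\<^sup>2 * norm z"
        by (intro add_mono mult_right_mono) (auto simp: power2_eq_square algebra_simps mult_le_cancel_right1)
      finally show ?thesis by (simp add: algebra_simps)
    qed
    have "norm (h k $ i $ j) \<le> a i j * (1 + real k)\<^sup>2" unfolding eq a_def by (rule gen)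
    also have "\<dots> \<le> E * (1 + real k)\<^sup>2" by (intro mult_right_mono aE) simp
    finally show ?thesis .
  qed
  have real_bil: "bil Q x y = of_real (Re (bil Q x y))" if "x \<in> UI Q \<rat> e e'" "y \<in> UI Q \<rat> e e'" for x y
    by (rule bil_UI_real) (use that UI_Rats_Reals in auto)
  have real_u0: "bil Q x u0 = of_real (Re (bil Q x u0))" if "x \<in> UI Q \<rat> e e'" for x
    by (rule bil_UI_real) (use that UI_Rats_Reals u0(1) in \<open>auto simp: timelike_def\<close>)
  define \<alpha> where "\<alpha> = Re (bil Q l0 u0)"
  define \<beta> where "\<beta> = Re (bil Q v' l0) * Re (bil Q w1 u0) - Re (bil Q w1 l0) * Re (bil Q v' u0)"
  define \<gamma> where "\<gamma> = 1/2 * Re (bil Q w1 w1) * Re (bil Q v' l0) * Re (bil Q v' u0)"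
  have "Re (bil Q v' l0) < 0" using l0(2) bil_sym by metis
  then have \<gamma>: "\<gamma> > 0" unfolding \<gamma>_def using mult_pos_pos[OF mult_neg_neg[OF w1neg] pos] by simp
  have growth: "Re (bil Q (g k *v l0) u0) = \<alpha> + \<beta> * real k - \<gamma> * (real k)\<^sup>2" for k
  proof -
    have "bil Q (g k *v l0) u0 = bil Q l0 u0 + of_nat k * (bil Q v' l0 * bil Q w1 u0 - bil Q w1 l0 * bil Q v' u0)
       - (of_nat k)\<^sup>2 * (1/2 * bil Q w1 w1 * bil Q v' l0 * bil Q v' u0)"
      unfolding g_def eichler_apply by (simp add: bil_simps algebra_simps power2_eq_square)
    moreover have "x1 = of_real (Re x1) \<Longrightarrow> x2 = of_real (Re x2) \<Longrightarrow> x3 = of_real (Re x3) \<Longrightarrow> x4 = of_real (Re x4) \<Longrightarrow>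
        x5 = of_real (Re x5) \<Longrightarrow> x6 = of_real (Re x6) \<Longrightarrow>
      Re (x1 + of_nat k * (x2 * x3 - x4 * x5) - (of_nat k)\<^sup>2 * (1/2 * x6 * x2 * x5)) =
      Re x1 + (Re x2 * Re x3 - Re x4 * Re x5) * real k - (1/2 * Re x6 * Re x2 * Re x5) * (real k)\<^sup>2" for x1 x2 x3 x4 x5 x6
      by (simp add: complex_eq_iff algebra_simps power2_eq_square)
    note this[OF real_u0[OF l0(1)] real_bil[OF v(1) l0(1)] real_u0[OF w1(1)] real_bil[OF w1(1) l0(1)] real_u0[OF v(1)] real_bil[OF w1(1) w1(1)]]
    ultimately show ?thesis unfolding \<alpha>_def \<beta>_def \<gamma>_def by (simp only:)
  qed
  show ?thesis
  proof (rule ext)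
    fix xs :: "'N list"
    let ?C = "real (card {ys :: 'N list. length ys = length xs}) * E ^ length xs * K"
    have "norm (coeff l0 xs) \<le> ?C * (1 + real k) ^ (2 * length xs) * exp (2 * pi * (\<alpha> + \<beta> * real k - \<gamma> * (real k)\<^sup>2))" for k
    proof -
      have "norm (tmap (h k) (coeff (g k *v l0)) xs) \<le> real (card {ys :: 'N list. length ys = length xs}) *
         ((E * (1 + real k)\<^sup>2) ^ length xs * (K * exp (2 * pi * Re (bil Q (g k *v l0) u0))))"
        by (rule norm_tmap_le[OF entry K(2)]) (use K(1) in auto)
      then show ?thesis unfolding inv[of k, symmetric] growth by (simp add: power_mult_distrib mult_ac flip: power_mult)
    qed
    then have "norm (coeff l0 xs) \<le> 0"
      by (intro LIMSEQ_le_const[OF polynomial_gauss_tendsto_0[OF \<gamma>, of ?C "2 * length xs" \<alpha> \<beta>]]) auto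
    then show "coeff l0 xs = 0" by simp
  qed
qed

end

locale modular_jcusp = modular Q n e e' D \<Gamma> lam k f + jcusp Q n e e' D \<Gamma> J
  for Q :: "int^'N^'N" and n e e' D \<Gamma> lam k f J
begin

text \<open>
  Here \<open>n \<ge> 3\<close> enters: the rank is at least 5, so the four vectors do not span.
\<close>

lemma orthogonal_complement_nontrivial:
  assumes n: "n \<ge> 3" and v: "v \<in> UI Q \<rat> e e'" "v' \<in> UI Q \<rat> e e'" "bil Q v v = 0" "bil Q v' v' = 0" "bil Q v v' = 1"
  shows "\<exists>w. w \<in> UI Q \<rat> e e' \<and> bil Q w v = 0 \<and> bil Q w v' = 0 \<and> w \<noteq> 0"
proof (rule ccontr)
  assume no: "\<not> ?thesis"
  have vv': "bil Q v' v = 1" using v(5) bil_sym by metis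
  have axis: "axis i 1 \<in> vec.span {e, e', v, v'}" for i :: 'N
  proof -
    let ?x = "axis i 1 :: complex^'N"
    define w where "w = proj_UI ?x - bil Q (proj_UI ?x) v' *s v - bil Q (proj_UI ?x) v *s v'"
    have ax: "?x \<in> vecs \<rat>" by (auto simp: vecs_def axis_def)
    have wU: "w \<in> UI Q \<rat> e e'" unfolding w_def
      by (intro UI_Rats_arith proj_UI_rat v ax bil_Rats) (use v proj_UI_rat[OF ax] in \<open>auto simp: UI_iff\<close>)
    have "bil Q w v = 0" "bil Q w v' = 0" using v vv' by (simp_all add: w_def bil_simps)
    then have "w = 0" using no wU by blast
    then have "proj_UI ?x = bil Q (proj_UI ?x) v' *s v + bil Q (proj_UI ?x) v *s v'" by (simp add: w_def algebra_simps)
    then have "?x = bil Q ?x e' *s e + bil Q ?x e *s e' + (bil Q (proj_UI ?x) v' *s v + bil Q (proj_UI ?x) v *s v')"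
      by (simp add: proj_UI_def[of ?x] algebra_simps)
    moreover have "bil Q ?x e' *s e + bil Q ?x e *s e' + (bil Q (proj_UI ?x) v' *s v + bil Q (proj_UI ?x) v *s v') \<in> vec.span {e, e', v, v'}"
      by (intro vec.span_add vec.span_scale vec.span_base) auto
    ultimately show ?thesis by simp
  qed
  have "x \<in> vec.span {e, e', v, v'}" for x :: "complex^'N"
  proof -
    have "x = (\<Sum>i\<in>UNIV. x $ i *s axis i 1)" by (simp add: basis_expansion)
    also have "\<dots> \<in> vec.span {e, e', v, v'}" by (intro vec.span_sum vec.span_scale axis)
    finally show ?thesis .
  qed
  then have "vec.dim (UNIV :: (complex^'N) set) \<le> card {e, e', v, v'}" by (intro vec.dim_le_card) auto
  also have "\<dots> \<le> 4" by (simp add: card_insert_if)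
  finally have "vec.dim (UNIV :: (complex^'N) set) \<le> 4" .
  moreover have "vec.dim (UNIV :: (complex^'N) set) = CARD('N)" by (rule vec_dim_card)
  ultimately show False using card_N n by simp
qed

text \<open>
  Write \<open>l0 = m l + s v + r\<close> with \<open>l\<close> isotropic, \<open>(v, l) = 1\<close> and \<open>r\<close> orthogonal to both.  The isotropic
  vector \<open>v' = l + r/m - ((r, r)/(2m\<^sup>2)) v\<close> satisfies \<open>(v, v') = 1\<close> and \<open>(l0, v') = (l0, l0)/(2m)\<close>, so
  that it violates positivity on \<open>l0\<close> as soon as \<open>(l0, l0) < 0\<close>.
\<close>

lemma koecher:
  assumes n: "n \<ge> 3" and nz: "coeff l0 \<noteq> (\<lambda>xs. 0)" and m: "bil Q l0 vv = of_nat m" "m > 0"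
  shows "0 \<le> Re (bil Q l0 l0)"
proof (rule ccontr)
  assume neg: "\<not> ?thesis"
  have l0: "l0 \<in> UI Q \<rat> e e'" using nz coeff_0 by (auto simp: UI_dual_def)
  have l0q: "l0 \<in> vecs \<rat>" using l0 by (simp add: UI_iff)
  obtain l where l: "l \<in> UI Q \<rat> e e'" "bil Q l l = 0" "bil Q vv l = 1" using isotropic_partner[OF vJ_props(1)] by blast
  have lv: "bil Q l vv = 1" using l(3) bil_sym by metis
  have lq: "l \<in> vecs \<rat>" using l by (simp add: UI_iff)
  have vl0: "bil Q vv l0 = of_nat m" using m bil_sym by metis
  define s where "s = bil Q l0 l"
  have s: "s \<in> \<rat>" "bil Q l l0 = s" unfolding s_def by (auto intro: bil_Rats l0q lq bil_sym)
  define r where "r = l0 - of_nat m *s l - s *s vv"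
  have r: "r \<in> UI Q \<rat> e e'" unfolding r_def by (intro UI_Rats_arith l0 l vv_UI s) auto
  have rv: "bil Q r vv = 0" "bil Q r l = 0" by (simp_all add: r_def bil_simps m lv l vv_bil s_def)
  then have vr: "bil Q vv r = 0" "bil Q l r = 0" using bil_sym by metis+
  have l0eq: "l0 = of_nat m *s l + s *s vv + r" by (simp add: r_def)
  define c where "c = bil Q r r / (2 * of_nat m ^ 2)"
  have c: "c \<in> \<rat>" unfolding c_def using r by (intro Rats_divide bil_Rats) (auto simp: UI_iff)
  define v' where "v' = l + (1 / of_nat m) *s r - c *s vv"
  have v': "v' \<in> UI Q \<rat> e e'" unfolding v'_def by (intro UI_Rats_arith l r vv_UI c) auto
  have mne: "of_nat m \<noteq> (0::complex)" using m by simp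
  have v'v': "bil Q v' v' = 0" using mne
    by (simp add: v'_def bil_simps rv vr l lv vv_bil c_def field_simps power2_eq_square)
  have vv': "bil Q vv v' = 1" by (simp add: v'_def bil_simps vr l vv_bil)
  have ll: "bil Q l0 l0 = 2 * of_nat m * s + bil Q r r"
    by (subst (1 2) l0eq) (simp add: bil_simps rv vr l lv vv_bil)
  have l0v': "bil Q l0 v' = bil Q l0 l0 / of_nat (2 * m)" unfolding ll
    by (subst l0eq) (use mne in \<open>simp add: v'_def bil_simps rv vr l lv vv_bil c_def field_simps power2_eq_square\<close>)
  have "Re (bil Q l0 v') = Re (bil Q l0 l0) / real (2 * m)" unfolding l0v' by (subst Re_divide_of_nat) simp
  then have neg': "Re (bil Q l0 v') < 0" using neg m(2) by (simp add: divide_neg_pos)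
  have u0R: "u0 \<in> UI Q \<real> e e'" "0 < Re (bil Q u0 u0)" using u0(1) by (auto simp: timelike_def)
  have vpos: "0 < Re (bil Q vv u0)" using closure_half_cone(4)[OF u0(1) vJ_props(3) vv_nz] .
  have v'R: "v' \<in> UI Q \<real> e e'" using v' UI_Rats_Reals by blast
  have "v' \<noteq> 0" using vv' by auto
  then have v'ne: "Re (bil Q v' u0) \<noteq> 0" using timelike_pairing[OF u0R v'R] v'v' by simp
  have v'pos: "0 < Re (bil Q v' u0)"
  proof (rule ccontr)
    assume "\<not> 0 < Re (bil Q v' u0)"
    then have "0 < Re (bil Q (- v') u0)" using v'ne by (simp add: bil_simps)
    then have "0 \<le> Re (bil Q vv (- v'))"
      using same_side(1)[OF u0R vv_UI(2) _ vpos, of "- v'"] v'R v'v' vv_bil(1) UI_Reals_arith(5) by (simp add: bil_simps)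
    then show False using vv' by (simp add: bil_simps)
  qed
  obtain w where w: "w \<in> UI Q \<rat> e e'" "bil Q w vv = 0" "bil Q w v' = 0" "w \<noteq> 0"
    using orthogonal_complement_nontrivial[OF n vv_UI(1) v' vv_bil(1) v'v' vv'] by blast
  have y: "vv + v' \<in> UI Q \<real> e e'" using vv_UI(2) v'R by (rule UI_Reals_arith)
  have v'v: "bil Q v' vv = 1" using vv' bil_sym by metis
  have "Re (bil Q w w) < 0"
  proof (rule ccontr)
    assume "\<not> Re (bil Q w w) < 0"
    then have "w = 0" using timelike_complement[OF y _ UI_Rats_Reals[OF w(1)]] w v'v vv' vv_bil(1) v'v'
      by (simp add: bil_simps)
    then show False using w by simp
  qed
  then have "coeff l0 = (\<lambda>xs. 0)" using coeff_unipotent_vanishing[OF v' v'v' w(1) w(3) _ v'pos l0 neg'] by blast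
  then show False using nz by simp
qed

end

section \<open>Fourier-Jacobi series\<close>

lemma VJ_pt_cong:
  assumes "x - c *s y \<in> vec.span J" "c \<noteq> 0" shows "VJ_pt J x = VJ_pt J y"
proof -
  have "x \<in> vec.span (insert y J)" using assms(1) by (auto simp: vec.span_insert)
  moreover have "y \<in> vec.span (insert x J)"
  proof -
    have "y - (1 / c) *s x = (- (1 / c)) *s (x - c *s y)"
      using assms(2) by (simp add: vec_eq_iff field_simps)
    also have "\<dots> \<in> vec.span J" by (intro vec.span_scale assms)
    finally show ?thesis by (auto simp: vec.span_insert)
  qed
  ultimately have "insert x J \<subseteq> vec.span (insert y J)" "insert y J \<subseteq> vec.span (insert x J)"
    by (auto intro: vec.span_base)
  then show ?thesis unfolding VJ_pt_def by (intro equalityI vec.span_minimal) auto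
qed

lemma (in cusp) tube_coord_proj_UI: "bil Q \<omega> e \<noteq> 0 \<Longrightarrow> tco \<omega> = (1 / bil Q \<omega> e) *s proj_UI \<omega>"
  by (simp add: tube_coord_def proj_UI_def vec_eq_iff field_simps)

context jcusp begin

lemma span_J: "vec.span J = {a *s e + b *s vv |a b. True}"
  using vJ_props(1) by (simp add: jgen_def)

text \<open>
  The fibres of \<open>\<D> \<rightarrow> \<V>\<^sub>J\<close> lie in complex lines of the tube domain in direction \<open>v\<close>.
\<close>

lemma VJ_pt_tube_coord:
  assumes ne: "bil Q \<omega>1 e \<noteq> 0" "bil Q \<omega>2 e \<noteq> 0" and p: "VJ_pt J \<omega>1 = VJ_pt J \<omega>2"
  shows "\<exists>s. tco \<omega>2 = tco \<omega>1 + s *s vv"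
proof -
  have "\<omega>2 \<in> vec.span (insert \<omega>1 J)" using p by (auto simp: VJ_pt_def intro: vec.span_base)
  then obtain c where "\<omega>2 - c *s \<omega>1 \<in> vec.span J" by (auto simp: vec.span_insert)
  then obtain a b where "\<omega>2 - c *s \<omega>1 = a *s e + b *s vv" using span_J by auto
  then have w2: "\<omega>2 = c *s \<omega>1 + a *s e + b *s vv" by (simp add: algebra_simps)
  have we: "bil Q \<omega>2 e = c * bil Q \<omega>1 e" by (simp add: w2 bil_simps ee vv_bil)
  then have c: "c \<noteq> 0" using ne by auto
  have "proj_UI \<omega>2 = c *s proj_UI \<omega>1 + b *s vv"
    by (simp add: proj_UI_def w2 bil_simps ee ee' vv_bil vec_eq_iff algebra_simps)
  then have "tco \<omega>2 = tco \<omega>1 + (b / (c * bil Q \<omega>1 e)) *s vv"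
    unfolding tube_coord_proj_UI[OF ne(1)] tube_coord_proj_UI[OF ne(2)] we using c ne by (simp add: vec_eq_iff field_simps)
  then show ?thesis by blast
qed

lemma eichler_vv_apply: "eichler Q (s *s vv) e *v x = x - (s * bil Q vv x) *s e + (s * bil Q e x) *s vv"
  by (simp add: eichler_apply bil_simps vv_bil vec_eq_iff)

lemma VJ_pt_eichler: "VJ_pt J (eichler Q (s *s vv) e *v x) = VJ_pt J x"
proof (rule VJ_pt_cong[of _ 1])
  have "eichler Q (s *s vv) e *v x - 1 *s x = (- (s * bil Q vv x)) *s e + (s * bil Q e x) *s vv"
    by (simp add: eichler_vv_apply vec_eq_iff)
  then show "eichler Q (s *s vv) e *v x - 1 *s x \<in> vec.span J" using span_J by blast
qed simp

lemma vv_period: "vv \<in> UI_int Q \<Gamma> e e'"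
  using vv_UI(1) eichler_vv_\<Gamma> by (simp add: UI_int_def)

lemma UJ_perp_iff: "l \<in> UJ_perp Q J e e' \<longleftrightarrow> l \<in> UI Q \<rat> e e' \<and> bil Q l vv = 0"
  unfolding UJ_perp_def UJ_rat_eq[OF vJ_props(1)]
proof
  assume l: "l \<in> UI Q \<rat> e e' \<inter> perp Q {b *s vv |b. b \<in> \<rat>}"
  have "1 *s vv \<in> {b *s vv |b. b \<in> \<rat>}" by (intro CollectI exI[of _ 1] conjI refl Rats_1)
  then have "bil Q l (1 *s vv) = 0" using l unfolding perp_def by blast
  then show "l \<in> UI Q \<rat> e e' \<and> bil Q l vv = 0" using l by simp
qed (auto simp: perp_def bil_simps)

end

locale fj = modular_jcusp Q n e e' D \<Gamma> lam k f J
  for Q :: "int^'N^'N" and n e e' D \<Gamma> lam k f J +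
  fixes lJ :: "complex^'N" and m :: nat
  assumes lJ: "lJ \<in> UI Q \<rat> e e'" "bil Q lJ lJ = 0" "bil Q vv lJ = 1"
begin

abbreviation bc :: "complex^'N \<Rightarrow> complex^'N" where "bc \<equiv> base_coord Q D \<Gamma> J (e, e', lJ)"
abbreviation wJ :: "complex^'N \<Rightarrow> complex" where "wJ \<equiv> omegaJ Q (e, e', lJ)"
abbreviation fjs :: "(complex^'N) set \<Rightarrow> 'N tensor" where "fjs \<equiv> fj_series Q D \<Gamma> J lam k f m (e, e', lJ)"

lemma lJ_vv: "bil Q lJ vv = 1" using lJ(3) bil_sym by metis

lemma bc_eq: "bc \<omega> = tco \<omega> - bil Q lJ (tco \<omega>) *s vv" and wJ_eq: "wJ \<omega> = ee (bil Q lJ (tco \<omega>))"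
  by (simp_all add: base_coord_def omegaJ_def Let_def qexp_ee)

lemma wJ_nz [simp]: "wJ \<omega> \<noteq> 0" by (simp add: wJ_eq)

lemma bc_fibre:
  assumes "bil Q \<omega>1 e \<noteq> 0" "bil Q \<omega>2 e \<noteq> 0" "VJ_pt J \<omega>1 = VJ_pt J \<omega>2" shows "bc \<omega>2 = bc \<omega>1"
proof -
  obtain s where s: "tco \<omega>2 = tco \<omega>1 + s *s vv" using VJ_pt_tube_coord[OF assms] by blast
  show ?thesis by (simp add: bc_eq s bil_simps lJ_vv vec_eq_iff algebra_simps)
qed

lemma Delta_coord_eq:
  assumes w: "\<omega> \<in> cone D" shows "Delta_coord Q D \<Gamma> J (e, e', lJ) (VJ_pt J \<omega>) = bc \<omega>"
  unfolding Delta_coord_def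
proof (rule the_equality)
  fix u assume "\<exists>\<omega>'\<in>cone D. VJ_pt J \<omega> = VJ_pt J \<omega>' \<and> u = bc \<omega>'"
  then show "u = bc \<omega>" using bc_fibre[of \<omega>] w cone_not_perp by blast
qed (use w in blast)

lemma qexp_bc: "bil Q l vv = 0 \<Longrightarrow> qexp Q l (bc \<omega>) = qexp Q l (tco \<omega>)"
  by (simp add: qexp_ee bc_eq bil_simps)

text \<open>
  The exponents \<open>l + m l\<^sub>J\<close> with \<open>l\<close> orthogonal to \<open>v\<close> are those of frequency \<open>m\<close> along the period \<open>v\<close>.
\<close>

lemma fj_has_sum_mode:
  assumes w: "\<omega> \<in> cone D"
  shows "((\<lambda>l. coeff (l + of_nat m *s lJ) xs * qexp Q l (bc \<omega>)) has_sum
     (mode vv (int m) (\<lambda>Z. Psi (tpt Z) xs) (tco \<omega>) / wJ \<omega> ^ m)) (UJ_perp Q J e e')"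
proof -
  let ?Z = "tco \<omega>" and ?P = "UJ_perp Q J e e'" and ?D = "UI_dual Q \<Gamma> e e'"
  let ?M = "mode vv (int m) (\<lambda>Z. Psi (tpt Z) xs) ?Z"
  have Z: "?Z \<in> TD" using w cone_iff by blast
  have int: "bil Q l vv = of_int \<lfloor>Re (bil Q l vv)\<rfloor>" if "l \<in> ?D" for l
    by (rule UI_dual_int[OF that vv_period])
  have "((\<lambda>l. coeff l xs * qexp Q l ?Z * ee (of_int \<lfloor>Re (bil Q l vv)\<rfloor> * of_real t)) has_sum
      Psi (tpt (?Z + of_real t *s vv)) xs) ?D" for t
  proof -
    have "?Z + of_real t *s vv \<in> TD" by (rule T_real_scale[OF Z vv_UI(2)])
    from coeff_has_sum[OF this, of xs] show ?thesis
    proof (rule has_sum_cong[THEN iffD1, rotated])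
      fix l assume "l \<in> ?D"
      from int[OF this] show "coeff l xs * qexp Q l (?Z + of_real t *s vv) =
          coeff l xs * qexp Q l ?Z * ee (of_int \<lfloor>Re (bil Q l vv)\<rfloor> * of_real t)"
        by (simp add: qexp_add bil_scale_right mult.assoc) (metis mult.commute)
    qed
  qed
  then have "((\<lambda>l. coeff l xs * qexp Q l ?Z) has_sum ?M) {l \<in> ?D. \<lfloor>Re (bil Q l vv)\<rfloor> = int m}"
    by (intro mode_has_sum) auto
  also have "?this \<longleftrightarrow> ((\<lambda>l. coeff l xs * qexp Q l ?Z) has_sum ?M) ((\<lambda>l. l + of_nat m *s lJ) ` ?P)"
  proof (rule has_sum_cong_neutral)
    fix l assume "l \<in> (\<lambda>l. l + of_nat m *s lJ) ` ?P - {l \<in> ?D. \<lfloor>Re (bil Q l vv)\<rfloor> = int m}"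
    then have "bil Q l vv = of_nat m" "l \<notin> ?D \<or> \<lfloor>Re (bil Q l vv)\<rfloor> \<noteq> int m"
      by (auto simp: UJ_perp_iff bil_simps lJ_vv)
    then have "l \<notin> ?D" by simp
    then show "coeff l xs * qexp Q l ?Z = 0" by (simp add: coeff_0)
  next
    fix l assume l: "l \<in> {l \<in> ?D. \<lfloor>Re (bil Q l vv)\<rfloor> = int m} - (\<lambda>l. l + of_nat m *s lJ) ` ?P"
    then have "bil Q l vv = of_nat m" using int[of l] by simp
    moreover have "l \<in> UI Q \<rat> e e'" using l by (simp add: UI_dual_def)
    ultimately have "l - of_nat m *s lJ \<in> ?P" unfolding UJ_perp_iff
      by (intro conjI UI_Rats_arith lJ) (auto simp: bil_simps lJ_vv)
    then have "(l - of_nat m *s lJ) + of_nat m *s lJ \<in> (\<lambda>l. l + of_nat m *s lJ) ` ?P" by (rule imageI)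
    then show "coeff l xs * qexp Q l ?Z = 0" using l by simp
  qed simp
  also have "\<dots> \<longleftrightarrow> (((\<lambda>l. coeff l xs * qexp Q l ?Z) \<circ> (\<lambda>l. l + of_nat m *s lJ)) has_sum ?M) ?P"
    by (rule has_sum_reindex) (simp add: inj_on_def)
  finally have "((\<lambda>l. coeff (l + of_nat m *s lJ) xs * qexp Q (l + of_nat m *s lJ) ?Z * (1 / wJ \<omega> ^ m)) has_sum ?M * (1 / wJ \<omega> ^ m)) ?P"
    unfolding o_def by (rule has_sum_cmult_left)
  then show ?thesis
  proof (subst (asm) has_sum_cong)
    fix l assume "l \<in> ?P"
    then have "qexp Q (l + of_nat m *s lJ) ?Z = qexp Q l (bc \<omega>) * wJ \<omega> ^ m"
      by (subst qexp_bc) (auto simp: UJ_perp_iff qexp_ee wJ_eq ee_power bil_simps ee_add)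
    then show "coeff (l + of_nat m *s lJ) xs * qexp Q (l + of_nat m *s lJ) ?Z * (1 / wJ \<omega> ^ m) =
       coeff (l + of_nat m *s lJ) xs * qexp Q l (bc \<omega>)" by simp
  qed simp
qed

lemma fjs_eq_mode: "\<omega> \<in> cone D \<Longrightarrow> fjs (VJ_pt J \<omega>) xs = mode vv (int m) (\<lambda>Z. Psi (tpt Z) xs) (tco \<omega>) / wJ \<omega> ^ m"
  using infsumI[OF fj_has_sum_mode] by (simp add: fj_series_def Delta_coord_eq)

lemma fjs_has_sum:
  "\<omega> \<in> cone D \<Longrightarrow> ((\<lambda>l. coeff (l + of_nat m *s lJ) xs * qexp Q l (bc \<omega>)) has_sum fjs (VJ_pt J \<omega>) xs) (UJ_perp Q J e e')"
  using fj_has_sum_mode by (simp add: fjs_eq_mode)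

lemma fjs_V:
  assumes w: "\<omega> \<in> cone D" shows "fjs (VJ_pt J \<omega>) \<in> V_lam Q lam e e'"
proof -
  obtain S B where SB: "finite S" "\<forall>s\<in>S. B s \<in> V_lam Q lam e e'"
    "\<forall>T\<in>V_lam Q lam e e'. T = (\<lambda>xs. \<Sum>s\<in>S. T s * B s xs)" using V_lam_echelon by blast
  have "fjs (VJ_pt J \<omega>) xs = (\<Sum>s\<in>S. fjs (VJ_pt J \<omega>) s * B s xs)" for xs
  proof (rule has_sum_unique[OF fjs_has_sum[OF w, of xs]])
    have "((\<lambda>l. \<Sum>s\<in>S. coeff (l + of_nat m *s lJ) s * qexp Q l (bc \<omega>) * B s xs) has_sum
        (\<Sum>s\<in>S. fjs (VJ_pt J \<omega>) s * B s xs)) (UJ_perp Q J e e')"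
      by (intro has_sum_finite_sum SB has_sum_cmult_left fjs_has_sum w)
    moreover have "coeff l xs * q = (\<Sum>s\<in>S. coeff l s * q * B s xs)" for l q
      by (subst fun_cong[OF bspec[OF SB(3) coeff_V[of l]], of xs]) (simp add: sum_distrib_left mult_ac)
    ultimately show "((\<lambda>l. coeff (l + of_nat m *s lJ) xs * qexp Q l (bc \<omega>)) has_sum
        (\<Sum>s\<in>S. fjs (VJ_pt J \<omega>) s * B s xs)) (UJ_perp Q J e e')"
      by (simp only:)
  qed
  then have "fjs (VJ_pt J \<omega>) = (\<lambda>xs. \<Sum>s\<in>S. fjs (VJ_pt J \<omega>) s * B s xs)" by blast
  moreover have "(\<lambda>xs. \<Sum>s\<in>S. fjs (VJ_pt J \<omega>) s * B s xs) \<in> V_lam Q lam e e'"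
    by (rule tsubspace_sum[OF V_lam_subspace]) (use SB in auto)
  ultimately show ?thesis by simp
qed

text \<open>
  The intrinsic form of the Fourier-Jacobi series, as a Fourier integral over the orbit of the one-parameter
  group \<open>U(J)\<^sub>\<real>\<close>.
\<close>

lemma fjs_has_integral:
  assumes w: "\<omega> \<in> cone D"
  shows "((\<lambda>t. Psi (eichler Q (of_real t *s vv) e *v \<omega>) xs * ee (- (of_nat m * of_real t))) has_integral
    fjs (VJ_pt J \<omega>) xs * wJ \<omega> ^ m) {0..1}"
proof -
  let ?Z = "tco \<omega>"
  have Z: "?Z \<in> TD" and ne: "bil Q \<omega> e \<noteq> 0" using w cone_iff by auto
  have t: "?Z + of_real t *s vv \<in> TD" for t by (rule T_real_scale[OF Z vv_UI(2)])
  have P: "Psi (eichler Q (of_real t *s vv) e *v \<omega>) = Psi (tpt (?Z + of_real t *s vv))" for t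
  proof -
    have "eichler Q (of_real t *s vv) e *v \<omega> = bil Q \<omega> e *s (eichler Q (of_real t *s vv) e *v tpt ?Z)"
      using tube_pt_coord[OF cone_isotropic[OF w] ne] mv_scale by metis
    also have "eichler Q (of_real t *s vv) e *v tpt ?Z = tpt (?Z + of_real t *s vv)"
      by (rule tube_pt_add[OF TD_UI[OF Z]]) (intro UI_arith vv_UI)
    finally show ?thesis using Psi_scale[OF tube_pt_cone[OF t] ne] by simp
  qed
  have "continuous_on {0..1} (\<lambda>t. Psi (tpt (?Z + of_real t *s vv)) xs * ee (- (of_nat m * of_real t)))"
    by (intro continuous_intros continuous_on_compose2[OF hol_cont[OF Psi_hol]] continuous_on_vec_scale) (use t in auto)
  then have "(\<lambda>t. Psi (tpt (?Z + of_real t *s vv)) xs * ee (- (of_nat m * of_real t))) integrable_on {0..1}"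
    by (rule integrable_continuous_real)
  then have "((\<lambda>t. Psi (tpt (?Z + of_real t *s vv)) xs * ee (- (of_nat m * of_real t))) has_integral
      mode vv (int m) (\<lambda>Z. Psi (tpt Z) xs) ?Z) {0..1}"
    unfolding mode_def by (simp add: has_integral_integral)
  then show ?thesis unfolding P by (simp add: fjs_eq_mode[OF w])
qed

end

section \<open>Change of trivialization\<close>

lemma tmap_cong_tpower:
  assumes "T \<in> tpower d W" "\<And>w. w \<in> W \<Longrightarrow> A *v w = B *v w" shows "tmap A T = tmap B T"
  using assms(1) unfolding tpower_def
proof (induction rule: tspan_induct)
  case (step c T R)
  then obtain vs where vs: "T = pure_tensor vs" "set vs \<subseteq> W" by auto
  have "map ((*v) A) vs = map ((*v) B) vs" using vs(2) assms(2) by auto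
  then have "tmap A T = tmap B T" by (simp only: vs(1) tmap_pure)
  then show ?case using step.IH by (simp add: tmap_add tmap_cmult)
qed simp

lemma tmap_cong_schur:
  assumes "T \<in> schur Q lam W K" "\<And>w. w \<in> W \<Longrightarrow> A *v w = B *v w" shows "tmap A T = tmap B T"
proof -
  obtain S where S: "T = young_symmetrizer lam S" "S \<in> tpower (sum_list lam) W" using assms(1) by (auto simp: schur_def)
  have "tmap C T = young_symmetrizer lam (tmap C S)" for C
    unfolding S(1) using tpower_length[OF S(2)] by (intro tmap_young_symmetrizer[symmetric])
  then show ?thesis using tmap_cong_tpower[OF S(2) assms(2)] by simp
qed

text \<open>
  The entries of tensors over \<open>\<omega>\<^sup>\<bottom>\<close> only see the restriction of a linear map to \<open>\<omega>\<^sup>\<bottom>\<close>.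
\<close>

lemma tmap_cong_E_fibre:
  assumes "F \<in> E_fibre Q lam \<omega>" "S \<in> F" "\<And>w. w \<in> perp Q {\<omega>} \<Longrightarrow> A *v w = B *v w" shows "tmap A S = tmap B S"
proof -
  obtain T where T: "T \<in> schur Q lam (perp Q {\<omega>}) (line \<omega>)" "F = tcoset (sum_list lam) (perp Q {\<omega>}) (line \<omega>) T"
    using assms(1) by (auto simp: E_fibre_def)
  then obtain R where R: "S = (\<lambda>xs. T xs + R xs)" "R \<in> tkernel (sum_list lam) (perp Q {\<omega>}) (line \<omega>)"
    using assms(2) by (auto simp: tcoset_def)
  have "R \<in> tpower (sum_list lam) (perp Q {\<omega>})" using R(2) tkernel_subset_tpower by blast
  then show ?thesis unfolding R(1) tmap_add using tmap_cong_schur[OF T(1) assms(3)] tmap_cong_tpower[OF _ assms(3)] by simp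
qed

lemma tscale_tscale: "tscale a (tscale b T) = tscale (a * b) T"
  by (simp add: tscale_def mult.assoc)

lemma transition_compose:
  "transition Q k m (e1, e1', l1) (e2, e2', l2) \<omega> T =
     tscale ((omegaJ Q (e1, e1', l1) \<omega> / omegaJ Q (e2, e2', l2) \<omega>) ^ m * (bil Q \<omega> e2 / bil Q \<omega> e1) powi k)
       (tmap (to_VI Q e2 e2' \<omega> ** from_VI Q e1 \<omega>) T)"
  by (simp add: transition_def tmap_compose)

text \<open>
  So \<open>from_VI\<close> inverts \<open>to_VI\<close> on \<open>\<omega>\<^sup>\<bottom>/\<complex>\<omega>\<close>.
\<close>

lemma (in cusp) from_to_VI:
  assumes "bil Q \<omega> e \<noteq> 0" "bil Q \<omega> \<omega> = 0" "u \<in> perp Q {\<omega>}"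
  shows "from_VI Q e \<omega> *v (to_VI Q e e' \<omega> *v u) = u - (bil Q u e / bil Q \<omega> e) *s \<omega>"
  using assms bil_sym[of e \<omega>] unfolding to_VI_apply from_VI_apply
  by (simp add: bil_simps perp_def vec_eq_iff field_simps)

lemma (in modular) Psi_change:
  assumes c2: "modular Q n e2 e2' D \<Gamma> lam k f" and w: "\<omega> \<in> cone D"
  shows "I_triv Q k e2 e2' \<omega> (f \<omega>) =
    tscale ((bil Q \<omega> e2 / bil Q \<omega> e) powi k) (tmap (to_VI Q e2 e2' \<omega> ** from_VI Q e \<omega>) (Psi \<omega>))"
proof -
  interpret c2: modular Q n e2 e2' D \<Gamma> lam k f by fact
  have ne: "bil Q \<omega> e \<noteq> 0" and ne2: "bil Q \<omega> e2 \<noteq> 0" using cone_not_perp[OF w] c2.cone_not_perp[OF w] .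
  obtain S where S: "S \<in> f \<omega>" using f_nonempty[OF w] by blast
  have "tmap ((to_VI Q e2 e2' \<omega> ** from_VI Q e \<omega>) ** to_VI Q e e' \<omega>) S = tmap (to_VI Q e2 e2' \<omega>) S"
  proof (rule tmap_cong_E_fibre[OF f_fibre[OF w] S])
    fix u assume u: "u \<in> perp Q {\<omega>}"
    have "to_VI Q e2 e2' \<omega> *v \<omega> = 0" by (rule c2.to_VI_line[OF _ ne2]) (simp add: line_def vec.span_base)
    then show "((to_VI Q e2 e2' \<omega> ** from_VI Q e \<omega>) ** to_VI Q e e' \<omega>) *v u = to_VI Q e2 e2' \<omega> *v u"
      unfolding matrix_vector_mul_assoc[symmetric] from_to_VI[OF ne cone_isotropic[OF w] u]
      by (simp add: matrix_vector_mult_diff_distrib mv_scale)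
  qed
  then have "tmap (to_VI Q e2 e2' \<omega> ** from_VI Q e \<omega>) (tmap (to_VI Q e e' \<omega>) S) = tmap (to_VI Q e2 e2' \<omega>) S"
    by (simp only: tmap_compose)
  moreover have "(bil Q \<omega> e2 / bil Q \<omega> e) powi k * bil Q \<omega> e powi k = bil Q \<omega> e2 powi k"
    using ne by (simp add: power_int_divide_distrib)
  ultimately show ?thesis unfolding Psi_eq[OF w S] c2.Psi_eq[OF w S] tmap_tscale tscale_tscale by simp
qed

text \<open>
  The transvection \<open>E\<^bsub>sv\<^esub>\<close> is attached to both cusps, and each of the two trivializations is invariant under it.
  As \<open>s\<close> may be complex, this holds on the whole fibre over a point of \<open>\<V>\<^sub>J\<close>.
\<close>

lemma (in jcusp) change_eichler:
  assumes c2: "jcusp Q n e2 e2' D \<Gamma> J" and ne: "bil Q \<omega> e \<noteq> 0" "bil Q \<omega> e2 \<noteq> 0" and z: "z \<in> perp Q {e, e'}"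
  shows "(to_VI Q e2 e2' (eichler Q (s *s vv) e *v \<omega>) ** from_VI Q e (eichler Q (s *s vv) e *v \<omega>)) *v z =
     (to_VI Q e2 e2' \<omega> ** from_VI Q e \<omega>) *v z"
    "bil Q (eichler Q (s *s vv) e *v \<omega>) e2 = bil Q \<omega> e2"
proof -
  interpret c2: jcusp Q n e2 e2' D \<Gamma> J by fact
  let ?E = "eichler Q (s *s vv) e"
  have E2: "?E = eichler Q (s *s c2.vv) e2" using unipotent_same[OF c2] by simp
  have v2: "bil Q (s *s c2.vv) e2 = 0" by (simp add: bil_simps c2.vv_bil)
  have T: "to_VI Q e2 e2' (?E *v \<omega>) ** ?E = to_VI Q e2 e2' \<omega>" unfolding E2 by (rule c2.to_VI_eichler[OF v2 ne(2)])
  show "bil Q (?E *v \<omega>) e2 = bil Q \<omega> e2" unfolding E2 by (rule c2.eichler_bil_e[OF v2])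
  have z': "bil Q e z = 0" "bil Q z e = 0" using z bil_sym[of e z] by (auto simp: perp_def)
  have Ee: "bil Q (?E *v \<omega>) e = bil Q \<omega> e" by (rule eichler_bil_e) (simp add: bil_simps vv_bil)
  have F: "from_VI Q e (?E *v \<omega>) *v z = ?E *v (from_VI Q e \<omega> *v z)"
    unfolding from_VI_apply Ee eichler_vv_apply using ne z' bil_sym[of z vv] bil_sym[of e \<omega>]
    by (simp add: bil_simps ee vv_bil vec_eq_iff field_simps)
  show "(to_VI Q e2 e2' (?E *v \<omega>) ** from_VI Q e (?E *v \<omega>)) *v z = (to_VI Q e2 e2' \<omega> ** from_VI Q e \<omega>) *v z"
    unfolding matrix_vector_mul_assoc[symmetric] F using T by (metis matrix_vector_mul_assoc)
qed

context fj begin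

lemma wJ_eichler: "bil Q \<omega> e \<noteq> 0 \<Longrightarrow> wJ (eichler Q (s *s vv) e *v \<omega>) = wJ \<omega> * ee s"
  by (simp add: wJ_eq tube_coord_vv(1) bil_simps lJ_vv ee_add)

lemma bc_eichler: "bil Q \<omega> e \<noteq> 0 \<Longrightarrow> bc (eichler Q (s *s vv) e *v \<omega>) = bc \<omega>"
  by (simp add: bc_eq tube_coord_vv(1) bil_simps lJ_vv vec_eq_iff algebra_simps)

text \<open>
  Both functions \<open>\<omega>\<^sub>J\<close> get multiplied by \<open>exp(2\<pi>is)\<close>, so their quotient does not change.
\<close>

lemma transition_eichler:
  assumes c2: "fj Q n e2 e2' D \<Gamma> lam k f J l2" and ne: "bil Q \<omega> e \<noteq> 0" "bil Q \<omega> e2 \<noteq> 0" and T: "T \<in> V_lam Q lam e e'"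
  shows "transition Q k m (e, e', lJ) (e2, e2', l2) (eichler Q (s *s vv) e *v \<omega>) T =
     transition Q k m (e, e', lJ) (e2, e2', l2) \<omega> T"
proof -
  interpret c2: fj Q n e2 e2' D \<Gamma> lam k f J l2 m by fact
  let ?E = "eichler Q (s *s vv) e"
  have J2: "jcusp Q n e2 e2' D \<Gamma> J" by (rule c2.jcusp_axioms)
  have E2: "?E = eichler Q (s *s c2.vv) e2" using unipotent_same[OF J2] by simp
  have w2: "c2.wJ (?E *v \<omega>) = c2.wJ \<omega> * ee s" unfolding E2 by (rule c2.wJ_eichler[OF ne(2)])
  have be: "bil Q (?E *v \<omega>) e = bil Q \<omega> e" by (rule eichler_bil_e) (simp add: bil_simps vv_bil)
  have "tmap (to_VI Q e2 e2' (?E *v \<omega>) ** from_VI Q e (?E *v \<omega>)) T = tmap (to_VI Q e2 e2' \<omega> ** from_VI Q e \<omega>) T"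
    by (rule tmap_cong_schur[OF T[unfolded V_lam_def]]) (rule change_eichler(1)[OF J2 ne])
  then show ?thesis unfolding transition_compose be change_eichler(2)[OF J2 ne UI_arith(4)[unfolded UI_def, THEN IntD2]] w2 wJ_eichler[OF ne(1)]
    by simp
qed

text \<open>
  The linear map from one trivialization to the other is constant along the path of integration in
  \<open>fjs_has_integral\<close>.
\<close>

lemma transition_fjs:
  assumes c2: "fj Q n e2 e2' D \<Gamma> lam k f J l2" and w: "\<omega> \<in> cone D"
  shows "transition Q k m (e, e', lJ) (e2, e2', l2) \<omega> (fjs (VJ_pt J \<omega>)) =
    fj_series Q D \<Gamma> J lam k f m (e2, e2', l2) (VJ_pt J \<omega>)"
proof (rule ext)
  fix xs
  interpret c2: fj Q n e2 e2' D \<Gamma> lam k f J l2 m by fact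
  have J2: "jcusp Q n e2 e2' D \<Gamma> J" by (rule c2.jcusp_axioms)
  have ne: "bil Q \<omega> e \<noteq> 0" and ne2: "bil Q \<omega> e2 \<noteq> 0" using cone_not_perp[OF w] c2.cone_not_perp[OF w] .
  let ?E = "\<lambda>t::real. eichler Q (of_real t *s vv) e" and ?M = "to_VI Q e2 e2' \<omega> ** from_VI Q e \<omega>"
  let ?c = "(bil Q \<omega> e2 / bil Q \<omega> e) powi k" and ?x = "\<lambda>t::real. ee (- (of_nat m * of_real t))"
  have E2: "?E t = eichler Q (of_real t *s c2.vv) e2" for t using unipotent_same[OF J2] by simp
  have cone: "?E t *v \<omega> \<in> cone D" for t by (rule eichler_vv_cone[OF w]) simp
  have be: "bil Q (?E t *v \<omega>) e = bil Q \<omega> e" for t by (rule eichler_bil_e) (simp add: bil_simps vv_bil)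
  have Psi2: "c2.Psi (?E t *v \<omega>) xs = ?c * tmap ?M (Psi (?E t *v \<omega>)) xs" for t
  proof -
    have "tmap (to_VI Q e2 e2' (?E t *v \<omega>) ** from_VI Q e (?E t *v \<omega>)) (Psi (?E t *v \<omega>)) = tmap ?M (Psi (?E t *v \<omega>))"
      by (rule tmap_cong_schur[OF Psi_V[OF cone, unfolded V_lam_def]]) (rule change_eichler(1)[OF J2 ne ne2])
    then show ?thesis
      unfolding Psi_change[OF c2.modular_axioms cone] be change_eichler(2)[OF J2 ne ne2 UI_arith(4)[unfolded UI_def, THEN IntD2]]
      by (simp add: tscale_apply)
  qed
  have "((\<lambda>t. ?c * (\<Sum>ys | length ys = length xs. (\<Prod>i<length xs. ?M $ (xs ! i) $ (ys ! i)) * (Psi (?E t *v \<omega>) ys * ?x t)))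
     has_integral ?c * (\<Sum>ys | length ys = length xs. (\<Prod>i<length xs. ?M $ (xs ! i) $ (ys ! i)) * (fjs (VJ_pt J \<omega>) ys * wJ \<omega> ^ m))) {0..1}"
    by (intro has_integral_mult_right has_integral_sum fjs_has_integral[OF w] finite_lists_length)
  also have "(\<lambda>t. ?c * (\<Sum>ys | length ys = length xs. (\<Prod>i<length xs. ?M $ (xs ! i) $ (ys ! i)) * (Psi (?E t *v \<omega>) ys * ?x t)))
     = (\<lambda>t. c2.Psi (?E t *v \<omega>) xs * ?x t)"
    unfolding Psi2 by (simp add: tmap_def sum_distrib_left sum_distrib_right mult_ac)
  finally have "fj_series Q D \<Gamma> J lam k f m (e2, e2', l2) (VJ_pt J \<omega>) xs * c2.wJ \<omega> ^ m =
     ?c * (\<Sum>ys | length ys = length xs. (\<Prod>i<length xs. ?M $ (xs ! i) $ (ys ! i)) * (fjs (VJ_pt J \<omega>) ys * wJ \<omega> ^ m))"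
    using has_integral_unique[OF c2.fjs_has_integral[OF w, of xs, folded E2]] by blast
  also have "\<dots> = ?c * wJ \<omega> ^ m * tmap ?M (fjs (VJ_pt J \<omega>)) xs"
    by (simp add: tmap_def sum_distrib_left mult_ac)
  finally have *: "fj_series Q D \<Gamma> J lam k f m (e2, e2', l2) (VJ_pt J \<omega>) xs * c2.wJ \<omega> ^ m =
    ?c * wJ \<omega> ^ m * tmap ?M (fjs (VJ_pt J \<omega>)) xs" .
  show "transition Q k m (e, e', lJ) (e2, e2', l2) \<omega> (fjs (VJ_pt J \<omega>)) xs =
    fj_series Q D \<Gamma> J lam k f m (e2, e2', l2) (VJ_pt J \<omega>) xs"
    unfolding transition_compose tscale_apply using * by (simp add: power_divide field_simps)
qed

end

section \<open>The Fourier condition\<close>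

lemma fspan_add:
  assumes F: "\<And>a b. a \<in> F \<Longrightarrow> b \<in> F \<Longrightarrow> a + b \<in> F" "0 \<in> F" and x: "x \<in> fspan F S" "y \<in> fspan F S"
  shows "x + y \<in> fspan F S"
proof -
  obtain A c where A: "x = (\<Sum>v\<in>A. c v *s v)" "finite A" "A \<subseteq> S" "\<forall>v\<in>A. c v \<in> F" using x(1) by (auto simp: fspan_def)
  obtain B d where B: "y = (\<Sum>v\<in>B. d v *s v)" "finite B" "B \<subseteq> S" "\<forall>v\<in>B. d v \<in> F" using x(2) by (auto simp: fspan_def)
  have "x = (\<Sum>v\<in>A \<union> B. (if v \<in> A then c v else 0) *s v)" unfolding A(1) using A B
    by (intro sum.mono_neutral_cong_left) auto
  moreover have "y = (\<Sum>v\<in>A \<union> B. (if v \<in> B then d v else 0) *s v)" unfolding B(1) using A B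
    by (intro sum.mono_neutral_cong_left) auto
  ultimately have "x + y = (\<Sum>v\<in>A \<union> B. ((if v \<in> A then c v else 0) + (if v \<in> B then d v else 0)) *s v)"
    by (simp add: sum.distrib vec.scale_left_distrib)
  moreover have "\<forall>v\<in>A \<union> B. (if v \<in> A then c v else 0) + (if v \<in> B then d v else 0) \<in> F" using A B F by auto
  ultimately show ?thesis unfolding fspan_def using A(2,3) B(2,3)
    by (intro CollectI exI[of _ "A \<union> B"] exI[of _ "\<lambda>v. (if v \<in> A then c v else 0) + (if v \<in> B then d v else 0)"]) simp
qed

lemma fspan_sum:
  assumes F: "\<And>a b. a \<in> F \<Longrightarrow> b \<in> F \<Longrightarrow> a + b \<in> F" "0 \<in> F" and S: "finite S" "\<And>s. s \<in> S \<Longrightarrow> c s \<in> F" "\<And>s. s \<in> S \<Longrightarrow> B s \<in> X"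
  shows "(\<Sum>s\<in>S. c s *s B s) \<in> fspan F X"
  using S
proof (induction S rule: finite_induct)
  case empty
  show ?case unfolding fspan_def by (intro CollectI exI[of _ "{}"]) auto
next
  case (insert s S)
  then show ?case by (auto intro!: fspan_add[OF F] fspan_one)
qed

text \<open>
  The expansion of an exponent in terms of its values on periods.  These are integers for exponents in the dual lattice.
\<close>

lemma (in cusp_arith) dual_expansion:
  "\<exists>S b l. finite (S :: 'N set) \<and> (\<forall>s\<in>S. b s \<in> UI_int Q \<Gamma> e e' \<and> l s \<in> UI Q \<rat> e e') \<and>
     (\<forall>u\<in>UI Q UNIV e e'. u = (\<Sum>s\<in>S. bil Q u (b s) *s l s)) \<and> (\<forall>u\<in>UI Q UNIV e e'. u = (\<Sum>s\<in>S. bil Q (l s) u *s b s))"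
proof -
  obtain S b l where S: "finite (S :: 'N set)" "\<forall>s\<in>S. b s \<in> UI_int Q \<Gamma> e e' \<and> l s \<in> UI Q \<rat> e e'"
     "\<forall>u\<in>UI Q UNIV e e'. u = (\<Sum>s\<in>S. bil Q (l s) u *s b s)" using dual_bases by (elim exE conjE) (rule that; assumption)
  have "u = (\<Sum>s\<in>S. bil Q u (b s) *s l s)" if u: "u \<in> UI Q UNIV e e'" for u
  proof -
    let ?x = "\<Sum>s\<in>S. bil Q u (b s) *s l s"
    have x: "?x \<in> UI Q UNIV e e'" using S(1,2)
      by (induction S rule: finite_induct) (auto intro!: UI_arith UI_mono simp: UI_arith)
    have sum_l: "bil Q (\<Sum>s\<in>S. c s *s g s) y = (\<Sum>s\<in>S. c s * bil Q (g s) y)" for c g y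
      using S(1) by (induction S rule: finite_induct) (auto simp: bil_simps)
    have sum_r: "bil Q y (\<Sum>s\<in>S. c s *s g s) = (\<Sum>s\<in>S. c s * bil Q y (g s))" for c g y
      using S(1) by (induction S rule: finite_induct) (auto simp: bil_simps)
    have "u - ?x = 0"
    proof (rule UI_nondegenerate)
      show "u - ?x \<in> UI Q UNIV e e'" using u x by (rule UI_arith)
      fix y assume "y \<in> UI Q \<rat> e e'"
      then have "y = (\<Sum>s\<in>S. bil Q (l s) y *s b s)" using S(3) UI_mono by blast
      then have "bil Q u y = bil Q u (\<Sum>s\<in>S. bil Q (l s) y *s b s)" by simp
      also have "\<dots> = (\<Sum>s\<in>S. bil Q (l s) y * bil Q u (b s))" by (rule sum_r)
      also have "\<dots> = bil Q ?x y" unfolding sum_l by (simp add: mult.commute)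
      finally show "bil Q (u - ?x) y = 0" by (simp add: bil_simps)
    qed
    then show ?thesis by simp
  qed
  then show ?thesis using S by blast
qed

context fj begin

text \<open>
  The map \<open>q x = x - (x, v) l\<^sub>J\<close> projects \<open>U(I)\<^sub>\<rat>\<close> onto \<open>U(J)\<^sub>\<rat>\<^sup>\<bottom>\<close> and annihilates \<open>l\<^sub>J\<close>.  The projections of the
  vectors \<open>l s\<close> of \<open>dual_expansion\<close> therefore span a lattice that contains all exponents of the series.
\<close>

lemma fourier_condition_fjs:
  assumes \<phi>: "\<And>p. p \<in> Delta D J \<Longrightarrow> \<phi> p (e, e', lJ) = fjs p"
    and P: "\<And>l. coeff l \<noteq> (\<lambda>xs. 0) \<Longrightarrow> bil Q l vv = of_nat m \<Longrightarrow> P (Re (bil Q l l))"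
  shows "fourier_condition Q D \<Gamma> J m P (e, e', lJ) \<phi>"
proof -
  obtain S b l where S: "finite (S :: 'N set)" "\<forall>s\<in>S. b s \<in> UI_int Q \<Gamma> e e' \<and> l s \<in> UI Q \<rat> e e'"
     "\<forall>u\<in>UI Q UNIV e e'. u = (\<Sum>s\<in>S. bil Q u (b s) *s l s)" using dual_expansion by (elim exE conjE) (rule that; assumption)
  define q where "q x = x - bil Q x vv *s lJ" for x
  have q_sum: "q (\<Sum>s\<in>S. c s *s g s) = (\<Sum>s\<in>S. c s *s q (g s))" for c g
    using S(1) by (induction S rule: finite_induct) (auto simp: q_def bil_simps vec_eq_iff algebra_simps)
  let ?B = "(\<lambda>s. q (l s)) ` S"
  have qP: "q x \<in> UJ_perp Q J e e'" if "x \<in> UI Q \<rat> e e'" for x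
    unfolding UJ_perp_iff q_def
    by (intro conjI UI_Rats_arith that lJ bil_Rats) (use that vv_bil in \<open>auto simp: UI_iff bil_simps lJ_vv\<close>)
  have perp_span: "fspan \<rat> ?B \<subseteq> UJ_perp Q J e e'"
    by (rule fspan_subset) (use S(2) qP in \<open>auto simp: UJ_perp_iff bil_simps intro!: UI_Rats_arith\<close>)
  have "fspan \<int> ?B \<subseteq> fspan \<rat> ?B" unfolding fspan_def using Ints_subset_Rats by blast
  then have sub: "fspan \<int> ?B \<subseteq> UJ_perp Q J e e'" using perp_span by blast
  have span: "fspan \<rat> ?B = UJ_perp Q J e e'"
  proof (rule equalityI[OF perp_span subsetI])
    fix x assume x: "x \<in> UJ_perp Q J e e'"
    then have xU: "x \<in> UI Q \<rat> e e'" and "q x = x" by (simp_all add: UJ_perp_iff q_def)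
    then have "x = q (\<Sum>s\<in>S. bil Q x (b s) *s l s)" using S(3) UI_mono[OF xU] by simp
    also have "\<dots> = (\<Sum>s\<in>S. bil Q x (b s) *s q (l s))" by (rule q_sum)
    also have "\<dots> \<in> fspan \<rat> ?B"
      by (rule fspan_sum) (use S xU UI_int_rat in \<open>auto intro!: bil_Rats simp: UI_iff\<close>)
    finally show "x \<in> fspan \<rat> ?B" .
  qed
  have lattice: "x \<in> fspan \<int> ?B" if x: "x \<in> UJ_perp Q J e e'" and d: "x + of_nat m *s lJ \<in> UI_dual Q \<Gamma> e e'" for x
  proof -
    let ?y = "x + of_nat m *s lJ"
    have y: "?y \<in> UI Q UNIV e e'" using d UI_mono by (auto simp: UI_dual_def)
    have "x = q ?y" using x by (simp add: UJ_perp_iff q_def bil_simps lJ_vv)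
    also have "q ?y = q (\<Sum>s\<in>S. bil Q ?y (b s) *s l s)" using S(3) y by simp
    also have "\<dots> = (\<Sum>s\<in>S. bil Q ?y (b s) *s q (l s))" by (rule q_sum)
    also have "\<dots> \<in> fspan \<int> ?B"
      by (rule fspan_sum) (use S d in \<open>auto simp: UI_dual_def\<close>)
    finally show ?thesis .
  qed
  have "((\<lambda>l. coeff (l + of_nat m *s lJ) xs * qexp Q l (Delta_coord Q D \<Gamma> J (e, e', lJ) p)) has_sum \<phi> p (e, e', lJ) xs) (fspan \<int> ?B)"
    if p: "p \<in> Delta D J" for p xs
  proof -
    obtain \<omega> where w: "\<omega> \<in> cone D" "p = VJ_pt J \<omega>" using p by (auto simp: Delta_def)
    have "((\<lambda>l. coeff (l + of_nat m *s lJ) xs * qexp Q l (bc \<omega>)) has_sum fjs p xs) (fspan \<int> ?B) \<longleftrightarrow>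
       ((\<lambda>l. coeff (l + of_nat m *s lJ) xs * qexp Q l (bc \<omega>)) has_sum fjs p xs) (UJ_perp Q J e e')"
    proof (rule has_sum_cong_neutral)
      fix x assume "x \<in> UJ_perp Q J e e' - fspan \<int> ?B"
      then have "x + of_nat m *s lJ \<notin> UI_dual Q \<Gamma> e e'" using lattice by blast
      then show "coeff (x + of_nat m *s lJ) xs * qexp Q x (bc \<omega>) = 0" by (simp add: coeff_0)
    qed (use sub in auto)
    then show ?thesis using fjs_has_sum[OF w(1), of xs] Delta_coord_eq[OF w(1)] \<phi>[OF p] by (simp add: w(2))
  qed
  moreover have "P (Re (bil Q (of_nat m *s lJ + x) (of_nat m *s lJ + x)))"
    if "x \<in> fspan \<int> ?B" "coeff (x + of_nat m *s lJ) \<noteq> (\<lambda>xs. 0)" for x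
  proof -
    have "bil Q (x + of_nat m *s lJ) vv = of_nat m" using that(1) sub by (auto simp: UJ_perp_iff bil_simps lJ_vv)
    from P[OF that(2) this] show ?thesis by (simp add: add.commute)
  qed
  ultimately show ?thesis unfolding fourier_condition_def prod.case
    using S(1) span
    by (intro exI[of _ "fspan \<int> ?B"], intro exI[of _ "\<lambda>l. coeff (l + of_nat m *s lJ)"], intro conjI, intro exI[of _ ?B]) auto
qed

end

section \<open>Boundary values\<close>

lemma isCont_bil: "isCont g x \<Longrightarrow> isCont (\<lambda>u. bil Q (g u) y) x" "isCont g x \<Longrightarrow> isCont (\<lambda>u. bil Q y (g u)) x"
  unfolding isCont_def by (auto intro!: tendsto_intros)

lemma isCont_nth: "isCont g x \<Longrightarrow> isCont (\<lambda>u. g u $ i) x"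
  unfolding isCont_def by (rule tendsto_vec_nth)

lemma isCont_tmap:
  assumes "\<And>i j. isCont (\<lambda>u. A u $ i $ j) x" "\<And>ys. isCont (\<lambda>u. T u ys) x"
  shows "isCont (\<lambda>u. tmap (A u) (T u) xs) x"
  unfolding tmap_def by (intro continuous_sum continuous_mult continuous_prod assms)

lemma matrix_entry: "A $ i $ j = (A *v axis j (1 :: complex)) $ i"
  by (simp add: matrix_vector_mult_def axis_def if_distrib cong: if_cong)

text \<open>
  The transition functions are rational in \<open>\<omega>\<close>, up to exponentials of such functions.
\<close>

lemma isCont_transition:
  assumes g: "isCont g x" and ne: "bil Q (g x) e \<noteq> 0" "bil Q (g x) e2 \<noteq> 0"
  shows "isCont (\<lambda>u. transition Q k m (e, e', l) (e2, e2', l2) (g u) T xs) x"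
proof -
  note c = isCont_bil[OF g] isCont_nth[OF g]
  have from_c: "isCont (\<lambda>u. from_VI Q e (g u) $ i $ j) x" for i j
    unfolding matrix_entry from_VI_apply using ne by (auto intro!: continuous_intros c)
  have to_c: "isCont (\<lambda>u. to_VI Q e2 e2' (g u) $ i $ j) x" for i j
    unfolding matrix_entry to_VI_apply using ne by (auto intro!: continuous_intros c simp: bil_simps)
  have om: "isCont (\<lambda>u. omegaJ Q (e, e', l) (g u)) x" "isCont (\<lambda>u. omegaJ Q (e2, e2', l2) (g u)) x"
    unfolding omegaJ_def prod.case qexp_def tube_coord_def bil_simps using ne by (auto intro!: continuous_intros c)
  have om2: "omegaJ Q (e2, e2', l2) (g x) \<noteq> 0" by (simp add: omegaJ_def)
  have "isCont (\<lambda>u. (bil Q (g u) e2 / bil Q (g u) e) powi k) x"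
    unfolding isCont_def using ne
    by (intro tendsto_power_int tendsto_divide) (use c(1)[unfolded isCont_def] in auto)
  moreover have "isCont (\<lambda>u. (omegaJ Q (e, e', l) (g u) / omegaJ Q (e2, e2', l2) (g u)) ^ m) x"
    using om2 by (intro continuous_intros om)
  ultimately show ?thesis unfolding transition_def prod.case tscale_apply
    by (intro continuous_mult isCont_tmap to_c from_c continuous_const)
qed

lemma transition_scale:
  assumes "c \<noteq> 0" shows "transition Q k m (e, e', l) (e2, e2', l2) (c *s \<omega>) T = transition Q k m (e, e', l) (e2, e2', l2) \<omega> T"
proof -
  have "to_VI Q e2 e2' (c *s \<omega>) = to_VI Q e2 e2' \<omega>"
    by (rule matrix_eqI) (use assms in \<open>simp add: to_VI_apply bil_simps vector_smult_assoc\<close>)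
  moreover have "from_VI Q e (c *s \<omega>) = from_VI Q e \<omega>"
    by (rule matrix_eqI) (use assms in \<open>simp add: from_VI_apply bil_simps vector_smult_assoc\<close>)
  ultimately show ?thesis using assms
    by (simp add: transition_def omegaJ_def tube_coord_scale bil_simps)
qed

context fj begin

text \<open>
  Move \<open>\<omega>\<close> along its fibre to the point of \<open>L\<^sub>\<complex>\<close> with coordinate \<open>bc \<omega>\<close>.  This point is outside
  \<open>\<D>\<close> in general, but the formula for the transition function still makes sense there.
\<close>

lemma transition_base_coord:
  assumes c2: "fj Q n e2 e2' D \<Gamma> lam k f J l2" and w: "\<omega> \<in> cone D" and T: "T \<in> V_lam Q lam e e'"
  shows "transition Q k m (e, e', lJ) (e2, e2', l2) \<omega> T = transition Q k m (e, e', lJ) (e2, e2', l2) (tpt (bc \<omega>)) T"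
    "bil Q (tpt (bc \<omega>)) e \<noteq> 0" "bil Q (tpt (bc \<omega>)) e2 \<noteq> 0"
proof -
  interpret c2: fj Q n e2 e2' D \<Gamma> lam k f J l2 m by fact
  have ne: "bil Q \<omega> e \<noteq> 0" and ne2: "bil Q \<omega> e2 \<noteq> 0" using cone_not_perp[OF w] c2.cone_not_perp[OF w] .
  define s where "s = - bil Q lJ (tco \<omega>)"
  let ?E = "eichler Q (s *s vv) e"
  have "?E *v \<omega> = bil Q \<omega> e *s (?E *v tpt (tco \<omega>))"
    using tube_pt_coord[OF cone_isotropic[OF w] ne] mv_scale by metis
  also have "?E *v tpt (tco \<omega>) = tpt (tco \<omega> + s *s vv)"
    by (rule tube_pt_add[OF tube_coord_UI[OF ne]]) (intro UI_arith vv_UI)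
  also have "tco \<omega> + s *s vv = bc \<omega>" by (simp add: bc_eq s_def vec_eq_iff)
  finally have E: "?E *v \<omega> = bil Q \<omega> e *s tpt (bc \<omega>)" .
  show "transition Q k m (e, e', lJ) (e2, e2', l2) \<omega> T = transition Q k m (e, e', lJ) (e2, e2', l2) (tpt (bc \<omega>)) T"
    using transition_eichler[OF c2 ne ne2 T, of s] unfolding E transition_scale[OF ne] by simp
  have "bil Q (?E *v \<omega>) e = bil Q \<omega> e" by (rule eichler_bil_e) (simp add: bil_simps vv_bil)
  moreover have "bil Q (?E *v \<omega>) e2 = bil Q \<omega> e2"
    by (rule change_eichler(2)[OF c2.jcusp_axioms ne ne2 UI_arith(4)[unfolded UI_def, THEN IntD2]])
  ultimately show "bil Q (tpt (bc \<omega>)) e \<noteq> 0" "bil Q (tpt (bc \<omega>)) e2 \<noteq> 0"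
    using ne ne2 unfolding E by (auto simp: bil_simps)
qed

text \<open>
  As a function of the base coordinate the transition function is continuous, and along the filter the
  base coordinate converges.
\<close>

lemma transition_tendsto:
  assumes c2: "fj Q n e2 e2' D \<Gamma> lam k f J l2" and w: "\<omega>0 \<in> cone D" and T: "T \<in> V_lam Q lam e e'"
  shows "((\<lambda>\<omega>. transition Q k m (e, e', lJ) (e2, e2', l2) \<omega> T xs) \<longlongrightarrow> transition Q k m (e, e', lJ) (e2, e2', l2) \<omega>0 T xs)
     (to_boundary Q D \<Gamma> J (e, e', lJ) (VJ_pt J \<omega>0))"
proof -
  let ?F = "to_boundary Q D \<Gamma> J (e, e', lJ) (VJ_pt J \<omega>0)"
  let ?H = "\<lambda>u. transition Q k m (e, e', lJ) (e2, e2', l2) (tpt u) T xs"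
  have "filterlim (\<lambda>\<omega>. (bc \<omega>, wJ \<omega>)) (nhds (bc \<omega>0, 0)) ?F"
    unfolding to_boundary_def Delta_coord_eq[OF w] by (rule filterlim_mono[OF filterlim_filtercomap]) auto
  from tendsto_fst[OF this] have "(bc \<longlongrightarrow> bc \<omega>0) ?F" by simp
  moreover have "isCont ?H (bc \<omega>0)"
  proof (rule isCont_transition)
    have "continuous_on UNIV tpt" unfolding tube_pt_def
      by (intro continuous_intros continuous_on_vec_scale)
    then show "isCont tpt (bc \<omega>0)" by (simp add: continuous_on_eq_continuous_at)
  qed (rule transition_base_coord[OF c2 w T])+
  ultimately have "((\<lambda>\<omega>. ?H (bc \<omega>)) \<longlongrightarrow> ?H (bc \<omega>0)) ?F" by (rule isCont_tendsto_compose[rotated])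
  moreover have "eventually (\<lambda>\<omega>. \<omega> \<in> cone D) ?F"
    unfolding to_boundary_def inf_commute[of "principal _"] eventually_inf_principal by simp
  then have "eventually (\<lambda>\<omega>. ?H (bc \<omega>) = transition Q k m (e, e', lJ) (e2, e2', l2) \<omega> T xs) ?F"
    by eventually_elim (simp add: transition_base_coord(1)[OF c2 _ T])
  ultimately show ?thesis unfolding transition_base_coord(1)[OF c2 w T] by (rule Lim_transform_eventually)
qed

text \<open>
  Going up a fibre of \<open>\<D> \<rightarrow> \<V>\<^sub>J\<close> leads to the boundary point.  Hence limits along
  the filter are unique, which is what the definition of the Fourier-Jacobi coefficient relies on.
\<close>

lemma to_boundary_nontrivial:
  assumes w: "\<omega> \<in> cone D" shows "to_boundary Q D \<Gamma> J (e, e', lJ) (VJ_pt J \<omega>) \<noteq> bot"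
proof -
  let ?F = "to_boundary Q D \<Gamma> J (e, e', lJ) (VJ_pt J \<omega>)"
  define X where "X j = eichler Q ((\<i> * of_nat j) *s vv) e *v \<omega>" for j :: nat
  have X: "X j \<in> cone D" "bc (X j) = bc \<omega>" "wJ (X j) = wJ \<omega> * ee (\<i> * of_nat j)" for j
    using eichler_vv_cone[OF w, of "\<i> * of_nat j"] bc_eichler[OF cone_not_perp[OF w]] wJ_eichler[OF cone_not_perp[OF w]]
    by (auto simp: X_def)
  have "(\<lambda>j. exp (- (2 * pi * real j))) \<longlonglongrightarrow> 0" by real_asymp
  then have "(\<lambda>j. norm (ee (\<i> * of_nat j))) \<longlonglongrightarrow> 0" by (simp add: norm_ee)
  then have "(\<lambda>j. ee (\<i> * of_nat j)) \<longlonglongrightarrow> 0" by (rule tendsto_norm_zero_cancel)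
  then have "(\<lambda>j. wJ \<omega> * ee (\<i> * of_nat j)) \<longlonglongrightarrow> wJ \<omega> * 0" by (rule tendsto_mult[OF tendsto_const])
  then have "(\<lambda>j. (bc \<omega>, wJ \<omega> * ee (\<i> * of_nat j))) \<longlonglongrightarrow> (bc \<omega>, 0)" by (intro tendsto_Pair) auto
  then have "filterlim X ?F sequentially"
    unfolding to_boundary_def filterlim_inf filterlim_principal filterlim_filtercomap_iff Delta_coord_eq[OF w] o_def X(2,3)
    using X(1) by simp
  then have "filtermap X sequentially \<le> ?F" by (simp add: filterlim_def)
  then show ?thesis by (auto simp: bot_unique filtermap_bot_iff)
qed

lemma fj_coeff_eq:
  assumes c2: "fj Q n e2 e2' D \<Gamma> lam k f J l2" and w: "\<omega> \<in> cone D"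
  shows "fj_coeff Q D \<Gamma> J lam k f m (e, e', lJ) (VJ_pt J \<omega>) (e2, e2', l2) = fj_series Q D \<Gamma> J lam k f m (e2, e2', l2) (VJ_pt J \<omega>)"
proof (rule ext)
  fix xs
  show "fj_coeff Q D \<Gamma> J lam k f m (e, e', lJ) (VJ_pt J \<omega>) (e2, e2', l2) xs = fj_series Q D \<Gamma> J lam k f m (e2, e2', l2) (VJ_pt J \<omega>) xs"
    unfolding fj_coeff_def J_fibre_point_def
    using tendsto_Lim[OF to_boundary_nontrivial[OF w] transition_tendsto[OF c2 w fjs_V[OF w], of xs]]
    by (simp add: transition_fjs[OF c2 w])
qed

end

section \<open>Invariance\<close>

lemma fspan_Rats_Ints:
  assumes "x \<in> fspan \<rat> S" shows "\<exists>c::int. c \<noteq> 0 \<and> of_int c *s x \<in> fspan \<int> S"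
proof -
  obtain A c where A: "x = (\<Sum>v\<in>A. c v *s v)" "finite A" "A \<subseteq> S" "\<forall>v\<in>A. c v \<in> \<rat>" using assms by (auto simp: fspan_def)
  have "\<exists>N::int. N \<noteq> 0 \<and> (\<forall>v\<in>A. of_int N * c v \<in> \<int>)" using A(2,4)
  proof (induction A rule: finite_induct)
    case empty then show ?case by (intro exI[of _ 1]) simp
  next
    case (insert a A)
    then obtain N :: int where N: "N \<noteq> 0" "\<forall>v\<in>A. of_int N * c v \<in> \<int>" by auto
    have "(\<chi> i. c a) \<in> vecs \<rat>" using insert.prems by (simp add: vecs_def)
    then obtain M :: int where M: "M > 0" "of_int M *s (\<chi> i. c a) \<in> vecs \<int>" by (rule rational_scale_to_int)
    then have "of_int M * c a \<in> \<int>" by (auto simp: vecs_def)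
    then have "of_int N * (of_int M * c a) \<in> \<int>" by (rule Ints_mult[OF Ints_of_int])
    moreover have "of_int M * (of_int N * c v) \<in> \<int>" if "v \<in> A" for v
      by (rule Ints_mult[OF Ints_of_int]) (use N that in blast)
    ultimately show ?case using N(1) M(1) by (intro exI[of _ "N * M"]) (auto simp: mult_ac)
  qed
  then obtain N :: int where N: "N \<noteq> 0" "\<forall>v\<in>A. of_int N * c v \<in> \<int>" by blast
  have "of_int N *s x = (\<Sum>v\<in>A. (of_int N * c v) *s v)" by (simp add: A(1) vec.scale_sum_right vector_smult_assoc)
  then show ?thesis unfolding fspan_def using A N
    by (intro exI[of _ N] conjI CollectI exI[of _ A], simp, intro exI[of _ "\<lambda>v. of_int N * c v"]) auto
qed

text \<open>
  The infinitesimal form of the transvection only depends on the bivector \<open>e \<wedge> z\<close>.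
\<close>

lemma wedge_contract:
  "(bil Q e x *s z - bil Q z x *s e) $ i = (\<Sum>a\<in>UNIV. \<Sum>b\<in>UNIV. of_int (Q $ a $ b) * x $ b * wedge e z $ a $ i)"
  by (simp add: bil_def wedge_def sum_distrib_left sum_distrib_right sum_subtractf right_diff_distrib mult_ac)

context jcusp begin

lemma J_eq_integral: "J = fspan \<rat> J \<inter> vecs \<int>"
proof (intro equalityI subsetI IntI)
  fix x assume x: "x \<in> J"
  show "x \<in> fspan \<rat> J" using fspan_one[OF x, of 1 \<rat>] by simp
  show "x \<in> vecs \<int>" using x by (rule J_int)
next
  fix x assume x: "x \<in> fspan \<rat> J \<inter> vecs \<int>"
  then obtain c :: int where "c \<noteq> 0" "of_int c *s x \<in> fspan \<int> J" using fspan_Rats_Ints by blast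
  then show "x \<in> J" using J x unfolding primitive_isotropic_def by (metis IntD2 Ints_of_int of_int_eq_0_iff)
qed

text \<open>
  An element of \<open>\<Gamma>(J)\<close> preserves the bivector \<open>e \<wedge> v\<close>, so the transvections of \<open>gv \<otimes> ge\<close> and of
  \<open>v \<otimes> e\<close> coincide, and the latter is also that of the positive generator at the cusp \<open>ge\<close>.
\<close>

lemma GammaJ_image:
  assumes g: "g \<in> GammaJ Q \<rat> J \<inter> \<Gamma>"
  shows "(*v) g ` J = J" "(*v) g ` VJ_pt J \<omega> = VJ_pt J (g *v \<omega>)" "jcusp Q n (g *v e) (g *v e') D \<Gamma> J"
    "vJ Q D \<Gamma> J (g *v e) (g *v e') = g *v vv"
proof -
  have g\<Gamma>: "g \<in> \<Gamma>" using g by blast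
  have "(*v) g ` J = (*v) g ` fspan \<rat> J \<inter> (*v) g ` vecs \<int>"
    by (subst J_eq_integral) (rule image_Int[OF \<Gamma>_inj[OF g\<Gamma>]])
  also have "\<dots> = J" using g \<Gamma>_isometry[OF g\<Gamma>] J_eq_integral by (simp add: GammaJ_def isometries_def)
  finally show gJ: "(*v) g ` J = J" .
  have "(*v) g ` vec.span (insert \<omega> J) = vec.span ((*v) g ` insert \<omega> J)"
    by (rule vec.linear_span_image[OF matrix_vector_mul_linear_gen, symmetric])
  then show "(*v) g ` VJ_pt J \<omega> = VJ_pt J (g *v \<omega>)" by (simp add: VJ_pt_def gJ)
  have "g *v e \<in> J" using gJ eJ by blast
  then show J2: "jcusp Q n (g *v e) (g *v e') D \<Gamma> J"
    by unfold_locales (use cusp_data_image[OF g\<Gamma> cusp] D J in auto)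
  interpret c2: jcusp Q n "g *v e" "g *v e'" D \<Gamma> J by (rule J2)
  have "e \<in> {a *s e + b *s vv |a b. a \<in> \<rat> \<and> b \<in> \<rat>}"
    by (rule CollectI, rule exI[of _ 1], rule exI[of _ 0]) simp
  moreover have "vv \<in> {a *s e + b *s vv |a b. a \<in> \<rat> \<and> b \<in> \<rat>}"
    by (rule CollectI, rule exI[of _ 0], rule exI[of _ 1]) simp
  ultimately have "e \<in> fspan \<rat> J" "vv \<in> fspan \<rat> J" using vJ_props(1) by (simp_all only: jgen_def)
  then have W: "wedge (g *v e) (g *v vv) = wedge e vv" using g by (simp add: GammaJ_def)
  have "bil Q (g *v e) x *s (g *v vv) - bil Q (g *v vv) x *s (g *v e) = bil Q e x *s vv - bil Q vv x *s e" for x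
    unfolding vec_eq_iff wedge_contract W by simp
  note W' = this[of "g *v e'"]
  have "eichler Q (1 *s c2.vv) (g *v e) *v (g *v e') = eichler Q (1 *s vv) e *v (g *v e')"
    unfolding unipotent_same[OF J2] ..
  moreover have "x - a + b = x - c + d \<Longrightarrow> b - a = d - c" for x a b c d :: "complex^'N" by (simp add: algebra_simps)
  ultimately have "bil Q (g *v e) (g *v e') *s c2.vv - bil Q c2.vv (g *v e') *s (g *v e)
      = bil Q (g *v e) (g *v e') *s (g *v vv) - bil Q (g *v vv) (g *v e') *s (g *v e)"
    unfolding eichler_vv_apply c2.eichler_vv_apply W' mult_1_left by blast
  then show "vJ Q D \<Gamma> J (g *v e) (g *v e') = g *v vv"
    using c2.vv_bil c2.cusp_bil \<Gamma>_bil[OF g\<Gamma>] vv_bil by simp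
qed

end

context fj begin

lemma fj_image:
  assumes g: "g \<in> GammaJ Q \<rat> J \<inter> \<Gamma>" shows "fj Q n (g *v e) (g *v e') D \<Gamma> lam k f J (g *v lJ)"
proof -
  have g\<Gamma>: "g \<in> \<Gamma>" using g by blast
  interpret c2: jcusp Q n "g *v e" "g *v e'" D \<Gamma> J by (rule GammaJ_image[OF g])
  show ?thesis
    by unfold_locales (use f UI_image(1)[OF g\<Gamma>] lJ \<Gamma>_bil[OF g\<Gamma>] GammaJ_image(4)[OF g] in auto)
qed

text \<open>
  Every ingredient of the series is carried by \<open>g\<close> to the corresponding one at the cusp \<open>ge\<close>.
\<close>

lemma fjs_image:
  assumes g: "g \<in> GammaJ Q \<rat> J \<inter> \<Gamma>" and w: "\<omega> \<in> cone D"
  shows "fj_series Q D \<Gamma> J lam k f m (g *v e, g *v e', g *v lJ) ((*v) g ` VJ_pt J \<omega>) = tmap g (fjs (VJ_pt J \<omega>))"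
proof (rule ext)
  fix xs
  have g\<Gamma>: "g \<in> \<Gamma>" using g by blast
  obtain h where h: "h \<in> \<Gamma>" "g ** h = mat 1" "h ** g = mat 1" using \<Gamma>_inverse[OF g\<Gamma>] by blast
  have inv: "g *v (h *v x) = x" "h *v (g *v x) = x" for x using h by (simp_all add: matrix_vector_mul_assoc)
  interpret c2: fj Q n "g *v e" "g *v e'" D \<Gamma> lam k f J "g *v lJ" m by (rule fj_image[OF g])
  have v2: "c2.vv = g *v vv" by (rule GammaJ_image(4)[OF g])
  have bc2: "c2.bc (g *v \<omega>) = g *v bc \<omega>"
    unfolding c2.bc_eq bc_eq v2 tube_coord_image[OF g\<Gamma>, symmetric] \<Gamma>_bil[OF g\<Gamma>]
    by (simp add: matrix_vector_mult_diff_distrib mv_scale)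
  have perp2: "UJ_perp Q J (g *v e) (g *v e') = (*v) g ` UJ_perp Q J e e'"
  proof (intro equalityI subsetI)
    fix x assume x: "x \<in> UJ_perp Q J (g *v e) (g *v e')"
    then have "h *v x \<in> UJ_perp Q J e e'"
      using \<Gamma>_real(2)[OF h(1)] \<Gamma>_bil[OF g\<Gamma>, of "h *v x"] unfolding UJ_perp_iff c2.UJ_perp_iff UI_iff v2 by (simp add: inv)
    then show "x \<in> (*v) g ` UJ_perp Q J e e'" using inv(1) by (metis image_eqI)
  qed (use UI_image(1)[OF g\<Gamma>] \<Gamma>_bil[OF g\<Gamma>] in \<open>auto simp: UJ_perp_iff c2.UJ_perp_iff v2\<close>)
  have co: "c2.coeff (g *v l + of_nat m *s (g *v lJ)) = tmap g (coeff (l + of_nat m *s lJ))" for l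
    using coeff_image[OF g\<Gamma>, of "l + of_nat m *s lJ"] by (simp add: matrix_vector_right_distrib mv_scale)
  have "((\<lambda>l. c2.coeff (l + of_nat m *s (g *v lJ)) xs * qexp Q l (c2.bc (g *v \<omega>))) has_sum c2.fjs (VJ_pt J (g *v \<omega>)) xs)
      ((*v) g ` UJ_perp Q J e e')"
    using c2.fjs_has_sum[OF \<Gamma>_cone[OF g\<Gamma> w], of xs] by (simp only: perp2)
  then have "((\<lambda>l. tmap g (coeff (l + of_nat m *s lJ)) xs * qexp Q l (bc \<omega>)) has_sum c2.fjs (VJ_pt J (g *v \<omega>)) xs)
      (UJ_perp Q J e e')"
    by (subst (asm) has_sum_reindex) (use \<Gamma>_inj[OF g\<Gamma>] in \<open>auto simp: o_def co bc2 qexp_ee \<Gamma>_bil[OF g\<Gamma>] intro: inj_on_subset\<close>)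
  moreover have "((\<lambda>l. tmap g (coeff (l + of_nat m *s lJ)) xs * qexp Q l (bc \<omega>)) has_sum tmap g (fjs (VJ_pt J \<omega>)) xs)
      (UJ_perp Q J e e')"
    by (rule has_sum_tmap) (rule fjs_has_sum[OF w])
  ultimately show "fj_series Q D \<Gamma> J lam k f m (g *v e, g *v e', g *v lJ) ((*v) g ` VJ_pt J \<omega>) xs = tmap g (fjs (VJ_pt J \<omega>)) xs"
    unfolding GammaJ_image(2)[OF g] by (rule has_sum_unique)
qed

end

section \<open>Holomorphy\<close>

lemma norm_exp_remainder: "norm (exp z - 1 - z) \<le> exp (norm z) * (norm z)\<^sup>2" for z :: complex
proof -
  have "norm (exp z - 1 - z) \<le> exp \<bar>Re z\<bar> * (norm z)\<^sup>2"
    using Taylor_exp[of z 1] by (simp add: numeral_2_eq_2 diff_diff_eq)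
  also have "\<dots> \<le> exp (norm z) * (norm z)\<^sup>2" by (intro mult_right_mono) (auto simp: abs_Re_le_cmod)
  finally show ?thesis .
qed

lemma has_sum_difference:
  fixes F G :: "'l \<Rightarrow> complex"
  assumes "(F has_sum s) A" "(G has_sum t) A" shows "((\<lambda>l. F l - G l) has_sum (s - t)) A"
  using has_sum_add[OF assms(1), of "\<lambda>l. - G l" "- t"] assms(2) by (simp add: has_sum_uminus)

lemma abs_summable_on_le:
  fixes F :: "'l \<Rightarrow> complex"
  assumes "N summable_on A" "\<And>l. l \<in> A \<Longrightarrow> norm (F l) \<le> N l" shows "(\<lambda>l. norm (F l)) summable_on A"
  by (rule summable_on_comparison_test[OF assms(1)]) (use assms(2) in auto)

lemma has_sum_norm_le:
  fixes F :: "'l \<Rightarrow> complex"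
  assumes "(F has_sum s) A" "N summable_on A" "\<And>l. l \<in> A \<Longrightarrow> norm (F l) \<le> N l" shows "norm s \<le> infsum N A"
proof -
  have a: "(\<lambda>l. norm (F l)) summable_on A" by (rule abs_summable_on_le[OF assms(2,3)])
  have "norm s = norm (infsum F A)" using infsumI[OF assms(1)] by simp
  also have "\<dots> \<le> infsum (\<lambda>l. norm (F l)) A" by (rule norm_infsum_bound[OF a])
  also have "\<dots> \<le> infsum N A" by (rule infsum_mono[OF a assms(2,3)])
  finally show ?thesis .
qed

text \<open>
  The remainder of each exponential is bounded by the square of its argument times an exponential.  Half of the
  margin \<open>\<delta>\<close> absorbs the exponential and the other half the square, so the remainders add up to \<open>O(|h|\<^sup>2)\<close>.
\<close>

lemma exponential_series_has_derivative:
  fixes d :: "'l \<Rightarrow> complex" and \<kappa> :: "'l \<Rightarrow> 's \<Rightarrow> real" and g :: "'s \<Rightarrow> complex^'N"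
  defines "x \<equiv> \<lambda>s (h :: complex^'N). \<Sum>i\<in>UNIV. g s $ i * h $ i"
  assumes S: "finite S" and \<delta>: "\<delta> > 0"
    and M: "(\<lambda>l. norm (d l) * exp (2 * pi * \<delta> * (\<Sum>s\<in>S. \<bar>\<kappa> l s\<bar>))) summable_on A"
    and F: "\<And>Z. Z \<in> D \<Longrightarrow> ((\<lambda>l. d l * ee (\<Sum>s\<in>S. x s (Z - Z0) * of_real (\<kappa> l s))) has_sum F Z) A"
    and Z0: "Z0 \<in> D"
  shows "\<exists>c. (F has_derivative (\<lambda>h. \<Sum>i\<in>UNIV. c $ i * h $ i)) (at Z0 within D)"
proof -
  define a where "a l = (\<Sum>s\<in>S. \<bar>\<kappa> l s\<bar>)" for l
  define N where "N l = norm (d l) * exp (2 * pi * \<delta> * a l)" for l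
  have N: "N summable_on A" using M by (simp add: N_def[abs_def] a_def)
  have a0: "0 \<le> a l" for l by (simp add: a_def sum_nonneg)
  have ka: "\<bar>\<kappa> l s\<bar> \<le> a l" if "s \<in> S" for l s unfolding a_def by (rule member_le_sum) (use that S in auto)
  define dd where "dd s = infsum (\<lambda>l. d l * (2 * of_real pi * \<i> * of_real (\<kappa> l s))) A" for s
  have dd: "((\<lambda>l. d l * (2 * of_real pi * \<i> * of_real (\<kappa> l s))) has_sum dd s) A" if s: "s \<in> S" for s
  proof -
    have "norm (d l * (2 * of_real pi * \<i> * of_real (\<kappa> l s))) \<le> (1 / \<delta>) * N l" for l
    proof -
      have "2 * pi * \<bar>\<kappa> l s\<bar> \<le> 2 * pi * a l" using ka[OF s] by simp
      also have "\<dots> = (1 / \<delta>) * (2 * pi * \<delta> * a l)" using \<delta> by simp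
      also have "\<dots> \<le> (1 / \<delta>) * exp (2 * pi * \<delta> * a l)"
      proof (rule mult_left_mono)
        show "2 * pi * \<delta> * a l \<le> exp (2 * pi * \<delta> * a l)" using exp_ge_add_one_self[of "2 * pi * \<delta> * a l"] by linarith
      qed (use \<delta> in simp)
      finally have "norm (d l) * (2 * pi * \<bar>\<kappa> l s\<bar>) \<le> norm (d l) * ((1 / \<delta>) * exp (2 * pi * \<delta> * a l))"
        by (rule mult_left_mono) simp
      then show ?thesis by (simp add: norm_mult N_def mult_ac)
    qed
    then have "(\<lambda>l. norm (d l * (2 * of_real pi * \<i> * of_real (\<kappa> l s)))) summable_on A"
      by (intro abs_summable_on_le[OF summable_on_cmult_right[OF N, of "1 / \<delta>"]])
    then show ?thesis unfolding dd_def by (intro has_sum_infsum) (simp add: summable_on_iff_abs_summable_on_complex)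
  qed
  define c where "c = (\<chi> i. \<Sum>s\<in>S. dd s * g s $ i)"
  have lin: "(\<Sum>i\<in>UNIV. c $ i * h $ i) = (\<Sum>s\<in>S. x s h * dd s)" for h
    unfolding c_def x_def by (simp add: sum_distrib_left sum_distrib_right mult_ac) (rule sum.swap)
  define X where "X h = (\<Sum>s\<in>S. norm (x s h))" for h
  define B where "B = (\<Sum>s\<in>S. \<Sum>i\<in>UNIV. norm (g s $ i))"
  have B0: "0 \<le> B" by (auto simp: B_def intro!: sum_nonneg)
  have XB: "X h \<le> B * norm h" for h
  proof -
    have "norm (x s h) \<le> (\<Sum>i\<in>UNIV. norm (g s $ i)) * norm h" for s
      unfolding x_def sum_distrib_right
      by (rule sum_norm_le) (simp add: norm_mult mult_left_mono Finite_Cartesian_Product.norm_nth_le)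
    then show ?thesis unfolding X_def B_def sum_distrib_right[of _ S] by (intro sum_mono)
  qed
  have remainder: "norm (F Z - F Z0 - (\<Sum>i\<in>UNIV. c $ i * (Z - Z0) $ i)) \<le> (8 / \<delta>\<^sup>2 * infsum N A) * (X (Z - Z0))\<^sup>2"
    if Z: "Z \<in> D" and small: "X (Z - Z0) \<le> \<delta> / 2" for Z
  proof -
    let ?h = "Z - Z0"
    define L where "L l = (\<Sum>s\<in>S. x s ?h * of_real (\<kappa> l s))" for l
    have X0: "0 \<le> X ?h" by (auto simp: X_def intro!: sum_nonneg)
    have "((\<lambda>l. d l * ee (L l)) has_sum F Z) A" using F[OF Z] by (simp add: L_def)
    moreover have "(d has_sum F Z0) A" using F[OF Z0] by (simp add: x_def)
    moreover have "((\<lambda>l. \<Sum>s\<in>S. x s ?h * (d l * (2 * of_real pi * \<i> * of_real (\<kappa> l s)))) has_sum (\<Sum>s\<in>S. x s ?h * dd s)) A"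
      by (intro has_sum_finite_sum S has_sum_cmult_right dd)
    ultimately have "((\<lambda>l. d l * ee (L l) - d l - (\<Sum>s\<in>S. x s ?h * (d l * (2 * of_real pi * \<i> * of_real (\<kappa> l s)))))
       has_sum (F Z - F Z0 - (\<Sum>s\<in>S. x s ?h * dd s))) A"
      by (intro has_sum_difference)
    moreover have "d l * ee (L l) - d l - (\<Sum>s\<in>S. x s ?h * (d l * (2 * of_real pi * \<i> * of_real (\<kappa> l s)))) =
        d l * (exp (2 * of_real pi * \<i> * L l) - 1 - 2 * of_real pi * \<i> * L l)" for l
      by (simp add: ee_def L_def right_diff_distrib sum_distrib_left mult_ac)
    ultimately have hs: "((\<lambda>l. d l * (exp (2 * of_real pi * \<i> * L l) - 1 - 2 * of_real pi * \<i> * L l)) has_sum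
       (F Z - F Z0 - (\<Sum>i\<in>UNIV. c $ i * ?h $ i))) A" unfolding lin by (simp only:)
    have "norm (d l * (exp (2 * of_real pi * \<i> * L l) - 1 - 2 * of_real pi * \<i> * L l)) \<le> (8 / \<delta>\<^sup>2 * (X ?h)\<^sup>2) * N l" for l
    proof -
      let ?z = "2 * of_real pi * \<i> * L l"
      let ?y = "pi * \<delta> * a l"
      have y0: "0 \<le> ?y" using \<delta> a0 by simp
      have "norm (L l) \<le> (\<Sum>s\<in>S. norm (x s ?h) * a l)" unfolding L_def
        by (rule sum_norm_le) (use ka in \<open>simp add: norm_mult mult_left_mono\<close>)
      then have "norm (L l) \<le> X ?h * a l" by (simp add: X_def sum_distrib_right)
      then have nz: "norm ?z \<le> 2 * pi * (X ?h * a l)" by (simp add: norm_mult)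
      also have "\<dots> \<le> 2 * pi * (\<delta> / 2 * a l)" using small a0 by (intro mult_left_mono mult_right_mono) auto
      finally have zy: "norm ?z \<le> ?y" by simp
      have "norm (exp ?z - 1 - ?z) \<le> exp (norm ?z) * (norm ?z)\<^sup>2" by (rule norm_exp_remainder)
      also have "\<dots> \<le> exp ?y * (2 * pi * (X ?h * a l))\<^sup>2"
        using nz zy by (intro mult_mono power_mono) auto
      also have "(2 * pi * (X ?h * a l))\<^sup>2 = 8 / \<delta>\<^sup>2 * (X ?h)\<^sup>2 * (?y\<^sup>2 / 2)" using \<delta>
        by (simp add: power2_eq_square field_simps)
      also have "exp ?y * (8 / \<delta>\<^sup>2 * (X ?h)\<^sup>2 * (?y\<^sup>2 / 2)) \<le> exp ?y * (8 / \<delta>\<^sup>2 * (X ?h)\<^sup>2 * exp ?y)"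
        using exp_lower_Taylor_quadratic[OF y0] y0 by (intro mult_left_mono) auto
      also have "\<dots> = 8 / \<delta>\<^sup>2 * (X ?h)\<^sup>2 * exp (2 * pi * \<delta> * a l)" by (simp add: mult_ac flip: exp_add)
      finally have "norm (d l) * norm (exp ?z - 1 - ?z) \<le> norm (d l) * (8 / \<delta>\<^sup>2 * (X ?h)\<^sup>2 * exp (2 * pi * \<delta> * a l))"
        by (rule mult_left_mono) simp
      then show ?thesis by (simp add: norm_mult N_def mult_ac)
    qed
    then have "norm (F Z - F Z0 - (\<Sum>i\<in>UNIV. c $ i * ?h $ i)) \<le> infsum (\<lambda>l. (8 / \<delta>\<^sup>2 * (X ?h)\<^sup>2) * N l) A"
      by (intro has_sum_norm_le[OF hs] summable_on_cmult_right N)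
    also have "\<dots> = (8 / \<delta>\<^sup>2 * infsum N A) * (X ?h)\<^sup>2" by (subst infsum_cmult_right) (use N \<delta> in simp_all)
    finally show ?thesis .
  qed
  let ?K = "8 / \<delta>\<^sup>2 * infsum N A * B\<^sup>2"
  have K0: "0 \<le> 8 / \<delta>\<^sup>2 * infsum N A" by (intro mult_nonneg_nonneg infsum_nonneg) (auto simp: N_def)
  have "(F has_derivative (\<lambda>h. \<Sum>i\<in>UNIV. c $ i * h $ i)) (at Z0 within D)"
  proof (rule has_derivativeI_sandwich[where e = "\<delta> / (2 * (B + 1))" and H = "\<lambda>Z. ?K * norm (Z - Z0)"])
    show "0 < \<delta> / (2 * (B + 1))" using \<delta> B0 by simp
    show "bounded_linear (\<lambda>h. \<Sum>i\<in>UNIV. c $ i * h $ i)"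
      by (intro bounded_linear_sum bounded_linear_const_mult bounded_linear_vec_nth)
    show "((\<lambda>Z. ?K * norm (Z - Z0)) \<longlongrightarrow> 0) (at Z0 within D)"
      by (intro tendsto_mult_right_zero tendsto_norm_zero LIM_zero tendsto_ident_at)
    fix Z assume Z: "Z \<in> D" "Z \<noteq> Z0" "dist Z Z0 < \<delta> / (2 * (B + 1))"
    have "X (Z - Z0) \<le> B * norm (Z - Z0)" by (rule XB)
    also have "\<dots> \<le> (B + 1) * (\<delta> / (2 * (B + 1)))" using Z(3) B0 by (intro mult_mono) (auto simp: dist_norm)
    also have "\<dots> = \<delta> / 2" using B0 by (simp add: field_simps)
    finally have "norm (F Z - F Z0 - (\<Sum>i\<in>UNIV. c $ i * (Z - Z0) $ i)) \<le> (8 / \<delta>\<^sup>2 * infsum N A) * (X (Z - Z0))\<^sup>2"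
      by (rule remainder[OF Z(1)])
    also have "\<dots> \<le> (8 / \<delta>\<^sup>2 * infsum N A) * (B * norm (Z - Z0))\<^sup>2"
      by (intro mult_left_mono power_mono XB K0) (auto simp: X_def intro: sum_nonneg)
    also have "\<dots> = ?K * norm (Z - Z0) * norm (Z - Z0)" by (simp add: power2_eq_square mult_ac)
    finally show "norm (F Z - F Z0 - (\<Sum>i\<in>UNIV. c $ i * (Z - Z0) $ i)) / norm (Z - Z0) \<le> ?K * norm (Z - Z0)"
      using Z(2) by (simp add: divide_le_eq)
  qed
  then show ?thesis by blast
qed

text \<open>
  Absolute convergence at the finitely many corners of a box, one for each choice of signs \<open>\<epsilon>\<close>, gives
  the majorant needed in \<open>exponential_series_has_derivative\<close>.
\<close>

lemma exp_sum_abs_le: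
  fixes \<kappa> :: "'s \<Rightarrow> real"
  assumes "finite S"
  shows "exp (t * (\<Sum>s\<in>S. \<bar>\<kappa> s\<bar>)) \<le> (\<Sum>\<epsilon>\<in>PiE S (\<lambda>s. {1, -1}). exp (- t * (\<Sum>s\<in>S. \<epsilon> s * \<kappa> s)))"
proof -
  let ?e = "restrict (\<lambda>s. if \<kappa> s \<ge> 0 then -1 else 1 :: real) S"
  have "(\<Sum>s\<in>S. ?e s * \<kappa> s) = - (\<Sum>s\<in>S. \<bar>\<kappa> s\<bar>)" unfolding sum_negf[symmetric] by (intro sum.cong) auto
  then have "exp (t * (\<Sum>s\<in>S. \<bar>\<kappa> s\<bar>)) = exp (- t * (\<Sum>s\<in>S. ?e s * \<kappa> s))" by simp
  also have "\<dots> \<le> (\<Sum>\<epsilon>\<in>PiE S (\<lambda>s. {1, -1}). exp (- t * (\<Sum>s\<in>S. \<epsilon> s * \<kappa> s)))"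
    by (rule member_le_sum) (use assms in \<open>auto intro: finite_PiE split: if_splits\<close>)
  finally show ?thesis .
qed

context fj begin

text \<open>
  The exponents are orthogonal to \<open>v\<close>, so the series is defined on all translates of the tube by
  complex multiples of \<open>v\<close>.
\<close>

lemma fjs_has_sum_tube:
  assumes Z: "Z \<in> UI Q UNIV e e'" and p: "VJ_pt J (tpt Z) \<in> Delta D J"
  shows "((\<lambda>l. coeff (l + of_nat m *s lJ) xs * qexp Q l Z) has_sum fjs (VJ_pt J (tpt Z)) xs) (UJ_perp Q J e e')"
    "\<exists>s. Z + s *s vv \<in> TD"
proof -
  obtain \<omega> where w: "\<omega> \<in> cone D" "VJ_pt J (tpt Z) = VJ_pt J \<omega>" using p by (auto simp: Delta_def)
  obtain s where s: "tco \<omega> = Z + s *s vv"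
    using VJ_pt_tube_coord[OF _ cone_not_perp[OF w(1)] w(2)] tube_pt_bil(1)[OF Z] tube_coord_pt[OF Z] by auto
  then show "\<exists>s. Z + s *s vv \<in> TD" using cone_tube_coord[OF w(1)] by metis
  have "qexp Q l (bc \<omega>) = qexp Q l Z" if "l \<in> UJ_perp Q J e e'" for l
    using that by (subst qexp_bc) (auto simp: UJ_perp_iff s qexp_ee bil_simps)
  then show "((\<lambda>l. coeff (l + of_nat m *s lJ) xs * qexp Q l Z) has_sum fjs (VJ_pt J (tpt Z)) xs) (UJ_perp Q J e e')"
    using fjs_has_sum[OF w(1), of xs] unfolding w(2) by (subst (asm) has_sum_cong) auto
qed

lemma Delta_open:
  assumes Z: "Z \<in> UI Q UNIV e e'" and p: "VJ_pt J (tpt Z) \<in> Delta D J"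
  shows "\<exists>\<delta>>0. \<forall>y\<in>UI Q \<real> e e'. norm y < \<delta> \<longrightarrow> Z + \<i> *s y \<in> UI Q UNIV e e' \<and> VJ_pt J (tpt (Z + \<i> *s y)) \<in> Delta D J"
proof -
  obtain s where s: "Z + s *s vv \<in> TD" using fjs_has_sum_tube(2)[OF assms] by blast
  obtain \<delta> where \<delta>: "\<delta> > 0" "\<And>y. y \<in> UI Q \<real> e e' \<Longrightarrow> norm y < \<delta> \<Longrightarrow> Z + s *s vv + \<i> *s y \<in> TD"
    using T_open[OF s] by blast
  have "Z + \<i> *s y \<in> UI Q UNIV e e' \<and> VJ_pt J (tpt (Z + \<i> *s y)) \<in> Delta D J" if y: "y \<in> UI Q \<real> e e'" "norm y < \<delta>" for y
  proof
    show U: "Z + \<i> *s y \<in> UI Q UNIV e e'" by (intro UI_arith Z UI_mono[OF y(1)])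
    have "tpt (Z + s *s vv + \<i> *s y) \<in> cone D" by (rule tube_pt_cone[OF \<delta>(2)[OF y]])
    moreover have "Z + s *s vv + \<i> *s y = Z + \<i> *s y + s *s vv" by simp
    then have "tpt (Z + s *s vv + \<i> *s y) = eichler Q (s *s vv) e *v tpt (Z + \<i> *s y)"
      using tube_pt_add[OF U UI_arith(3)[OF vv_UI(3), of s]] by (simp only:)
    ultimately show "VJ_pt J (tpt (Z + \<i> *s y)) \<in> Delta D J"
      unfolding Delta_def using VJ_pt_eichler[of s "tpt (Z + \<i> *s y)"] by (metis image_eqI)
  qed
  then show ?thesis using \<delta>(1) by blast
qed

lemma fjs_holomorphic:
  "holomorphic_vec (\<lambda>Z. fjs (VJ_pt J (tpt Z)) xs) {Z \<in> UI Q UNIV e e'. VJ_pt J (tpt Z) \<in> Delta D J}"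
  unfolding holomorphic_vec_def
proof
  let ?R = "{Z \<in> UI Q UNIV e e'. VJ_pt J (tpt Z) \<in> Delta D J}" and ?P = "UJ_perp Q J e e'"
  fix Z0 assume Z0: "Z0 \<in> ?R"
  obtain S b l where S: "finite (S :: 'N set)" "\<forall>s\<in>S. b s \<in> UI_int Q \<Gamma> e e' \<and> l s \<in> UI Q \<rat> e e'"
     "\<forall>u\<in>UI Q UNIV e e'. u = (\<Sum>s\<in>S. bil Q (l s) u *s b s)" using dual_bases by (elim exE conjE) (rule that; assumption)
  have bR: "b s \<in> UI Q \<real> e e'" if "s \<in> S" for s using S(2) that UI_int_rat UI_Rats_Reals by blast
  obtain \<delta> where \<delta>: "\<delta> > 0" "\<And>y. y \<in> UI Q \<real> e e' \<Longrightarrow> norm y < \<delta> \<Longrightarrow> Z0 + \<i> *s y \<in> ?R"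
    using Delta_open Z0 by blast
  \<comment> \<open>With this scale the corners of the box stay within the margin \<open>\<delta>\<close>.\<close>
  define \<eta> where "\<eta> = \<delta> / (1 + (\<Sum>s\<in>S. norm (b s)))"
  have nb: "0 \<le> (\<Sum>s\<in>S. norm (b s))" by (rule sum_nonneg) simp
  have \<eta>: "\<eta> > 0" using \<delta>(1) nb by (simp add: \<eta>_def)
  define \<kappa> where "\<kappa> x s = Re (bil Q x (b s))" for x s
  have bil_sum: "bil Q x (\<Sum>s\<in>S. c s *s b s) = (\<Sum>s\<in>S. c s * bil Q x (b s))" for x c
    using S(1) by (induction S rule: finite_induct) (auto simp: bil_simps)
  have \<kappa>: "bil Q x (b s) = of_real (\<kappa> x s)" if "x \<in> ?P" "s \<in> S" for x s
    unfolding \<kappa>_def by (rule bil_UI_real) (use that bR UI_Rats_Reals in \<open>auto simp: UJ_perp_iff\<close>)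
  define d where "d x = coeff (x + of_nat m *s lJ) xs * qexp Q x Z0" for x
  have sm: "(\<lambda>x. norm (d x) * exp (- (2 * pi * \<eta>) * (\<Sum>s\<in>S. \<epsilon> s * \<kappa> x s))) summable_on ?P"
    if \<epsilon>: "\<epsilon> \<in> PiE S (\<lambda>s. {1, -1})" for \<epsilon>
  proof -
    let ?y = "\<Sum>s\<in>S. of_real (\<eta> * \<epsilon> s) *s b s"
    have y: "?y \<in> UI Q \<real> e e'" using S(1) bR
      by (induction S rule: finite_induct) (auto intro!: UI_Reals_arith simp: UI_Reals_arith)
    have "norm ?y \<le> (\<Sum>s\<in>S. \<eta> * norm (b s))"
      by (rule sum_norm_le) (use \<epsilon> \<eta> in \<open>auto simp: norm_of_real_vector_scale abs_mult dest!: PiE_mem\<close>)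
    also have "\<dots> < \<eta> * (1 + (\<Sum>s\<in>S. norm (b s)))" using \<eta> by (simp add: sum_distrib_left distrib_left)
    also have "\<dots> = \<delta>" using nb by (simp add: \<eta>_def)
    finally have "Z0 + \<i> *s ?y \<in> ?R" by (rule \<delta>(2)[OF y])
    then have "((\<lambda>x. coeff (x + of_nat m *s lJ) xs * qexp Q x (Z0 + \<i> *s ?y)) has_sum fjs (VJ_pt J (tpt (Z0 + \<i> *s ?y))) xs) ?P"
      using fjs_has_sum_tube(1) by blast
    then have "(\<lambda>x. norm (coeff (x + of_nat m *s lJ) xs * qexp Q x (Z0 + \<i> *s ?y))) summable_on ?P"
      unfolding summable_on_iff_abs_summable_on_complex[symmetric] by (rule has_sum_imp_summable)
    moreover have "norm (coeff (x + of_nat m *s lJ) xs * qexp Q x (Z0 + \<i> *s ?y)) =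
       norm (d x) * exp (- (2 * pi * \<eta>) * (\<Sum>s\<in>S. \<epsilon> s * \<kappa> x s))" if x: "x \<in> ?P" for x
    proof -
      have "bil Q x ?y = (\<Sum>s\<in>S. of_real (\<eta> * \<epsilon> s) * of_real (\<kappa> x s))"
        unfolding bil_sum using \<kappa>[OF x] by (intro sum.cong) auto
      also have "\<dots> = of_real (\<eta> * (\<Sum>s\<in>S. \<epsilon> s * \<kappa> x s))" by (simp add: sum_distrib_left mult_ac)
      finally have "norm (ee (bil Q x (\<i> *s ?y))) = exp (- (2 * pi * \<eta>) * (\<Sum>s\<in>S. \<epsilon> s * \<kappa> x s))"
        by (simp add: norm_ee bil_simps)
      then show ?thesis by (simp add: d_def qexp_add norm_mult)
    qed
    ultimately show ?thesis by (subst (asm) summable_on_cong) auto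
  qed
  have "(\<lambda>x. \<Sum>\<epsilon>\<in>PiE S (\<lambda>s. {1, -1}). norm (d x) * exp (- (2 * pi * \<eta>) * (\<Sum>s\<in>S. \<epsilon> s * \<kappa> x s))) summable_on ?P"
  proof -
    have fin: "finite (PiE S (\<lambda>s. {1, -1 :: real}))" using S(1) by (intro finite_PiE) auto
    have "(\<lambda>x. \<Sum>\<epsilon>\<in>E. norm (d x) * exp (- (2 * pi * \<eta>) * (\<Sum>s\<in>S. \<epsilon> s * \<kappa> x s))) summable_on ?P"
      if "finite E" "E \<subseteq> PiE S (\<lambda>s. {1, -1})" for E
      using that
    proof (induction E rule: finite_induct)
      case (insert \<epsilon> E)
      then show ?case unfolding sum.insert[OF insert.hyps] by (intro summable_on_add sm) auto
    qed simp
    from this[OF fin order_refl] show ?thesis .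
  qed
  then have M: "(\<lambda>x. norm (d x) * exp (2 * pi * \<eta> * (\<Sum>s\<in>S. \<bar>\<kappa> x s\<bar>))) summable_on ?P"
  proof (rule summable_on_comparison_test)
    fix x
    show "norm (d x) * exp (2 * pi * \<eta> * (\<Sum>s\<in>S. \<bar>\<kappa> x s\<bar>)) \<le>
      (\<Sum>\<epsilon>\<in>PiE S (\<lambda>s. {1, -1}). norm (d x) * exp (- (2 * pi * \<eta>) * (\<Sum>s\<in>S. \<epsilon> s * \<kappa> x s)))"
      unfolding sum_distrib_left[symmetric] by (intro mult_left_mono exp_sum_abs_le S) simp
  qed simp
  define g where "g s = (\<chi> i. \<Sum>j\<in>UNIV. of_int (Q $ j $ i) * l s $ j)" for s
  have g: "(\<Sum>i\<in>UNIV. g s $ i * h $ i) = bil Q (l s) h" for s h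
    unfolding g_def bil_def by (subst sum.swap) (simp add: sum_distrib_left mult_ac)
  show "\<exists>c. ((\<lambda>Z. fjs (VJ_pt J (tpt Z)) xs) has_derivative (\<lambda>h. \<Sum>i\<in>UNIV. c $ i * h $ i)) (at Z0 within ?R)"
  proof (rule exponential_series_has_derivative[OF S(1) \<eta> M _ Z0, where g = g])
    fix Z assume Z: "Z \<in> ?R"
    have "qexp Q x Z = qexp Q x Z0 * ee (\<Sum>s\<in>S. (\<Sum>i\<in>UNIV. g s $ i * (Z - Z0) $ i) * of_real (\<kappa> x s))" if x: "x \<in> ?P" for x
    proof -
      have "Z - Z0 \<in> UI Q UNIV e e'" using Z Z0 by (intro UI_arith) auto
      then have "Z - Z0 = (\<Sum>s\<in>S. bil Q (l s) (Z - Z0) *s b s)" using S(3) by blast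
      then have "bil Q x (Z - Z0) = bil Q x (\<Sum>s\<in>S. bil Q (l s) (Z - Z0) *s b s)" by (rule arg_cong)
      also have "\<dots> = (\<Sum>s\<in>S. bil Q (l s) (Z - Z0) * of_real (\<kappa> x s))" unfolding bil_sum using \<kappa>[OF x] by (intro sum.cong) auto
      finally have "bil Q x (Z - Z0) = (\<Sum>s\<in>S. bil Q (l s) (Z - Z0) * of_real (\<kappa> x s))" .
      then show ?thesis using qexp_add[of Q x Z0 "Z - Z0"] unfolding g by simp
    qed
    note q = this
    show "((\<lambda>x. d x * ee (\<Sum>s\<in>S. (\<Sum>i\<in>UNIV. g s $ i * (Z - Z0) $ i) * of_real (\<kappa> x s))) has_sum fjs (VJ_pt J (tpt Z)) xs) ?P"
    proof (rule has_sum_cong[THEN iffD1, OF _ fjs_has_sum_tube(1)])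
      fix x assume "x \<in> ?P"
      from q[OF this] show "coeff (x + of_nat m *s lJ) xs * qexp Q x Z =
          d x * ee (\<Sum>s\<in>S. (\<Sum>i\<in>UNIV. g s $ i * (Z - Z0) $ i) * of_real (\<kappa> x s))"
        unfolding d_def mult.assoc by (rule arg_cong)
    qed (use Z in auto)
  qed
qed

end

section \<open>Fourier-Jacobi coefficients are Jacobi forms\<close>

lemma holomorphic_vec_transform:
  assumes "holomorphic_vec G S" "\<And>x. x \<in> S \<Longrightarrow> F x = G x" shows "holomorphic_vec F S"
  unfolding holomorphic_vec_def
proof
  fix x assume x: "x \<in> S"
  then obtain c where "(G has_derivative (\<lambda>h. \<Sum>i\<in>UNIV. c $ i * h $ i)) (at x within S)"
    using assms(1) by (auto simp: holomorphic_vec_def)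
  from has_derivative_transform[OF x assms(2) this]
  show "\<exists>c. (F has_derivative (\<lambda>h. \<Sum>i\<in>UNIV. c $ i * h $ i)) (at x within S)" by blast
qed

lemma fj_from_triv_data:
  assumes "transpose Q = Q" "has_signature Q 2 n" "period_domain Q D" "subgroup \<Gamma> (Oplus Q D)"
    "finite (rcosets\<^bsub>Oplus Q D\<^esub> \<Gamma>)" "primitive_isotropic Q 2 J" "f \<in> modular_forms Q D \<Gamma> lam k" "(e, e', l) \<in> triv_data Q D \<Gamma> J"
  shows "fj Q n e e' D \<Gamma> lam k f J l"
proof -
  interpret arithmetic Q n D \<Gamma>
    by (intro arithmetic.intro arithmetic_axioms.intro lat.intro assms)
  show ?thesis
    by unfold_locales (use assms in \<open>auto simp: triv_data_def\<close>)
qed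

theorem proposition7p12:
  fixes Q :: "int^'N^'N" and n m :: nat and k :: int and lam :: "nat list"
    and D :: "(complex^'N) set set" and \<Gamma> :: "(complex^'N^'N) set" and J :: "(complex^'N) set"
    and f :: "complex^'N \<Rightarrow> 'N tensor set" and \<tau> :: "'N triv"
  assumes "transpose Q = Q" and "has_signature Q 2 n" and "n \<ge> 3"
    and "period_domain Q D"
    and "subgroup \<Gamma> (Oplus Q D)" and "finite (rcosets\<^bsub>Oplus Q D\<^esub> \<Gamma>)"
    and "primitive_isotropic Q 2 J"
    and "length lam = n" and "sorted_wrt (\<ge>) lam" and "conj_part lam 1 + conj_part lam 2 \<le> n"
    and "m > 0"
    and "f \<in> modular_forms Q D \<Gamma> lam k"
    and "\<tau> \<in> triv_data Q D \<Gamma> J"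
  shows "jacobi_form Q D \<Gamma> J lam k m (fj_coeff Q D \<Gamma> J lam k f m \<tau>) \<and>
         (cusp_form Q D \<Gamma> lam k f \<longrightarrow>
            jacobi_cusp_form Q D \<Gamma> J lam k m (fj_coeff Q D \<Gamma> J lam k f m \<tau>))"
proof -
  let ?\<phi> = "fj_coeff Q D \<Gamma> J lam k f m \<tau>" and ?T = "triv_data Q D \<Gamma> J"
  note fj = fj_from_triv_data[OF assms(1,2,4,5,6,7,12)]
  obtain e0 e0' l0 where \<tau>: "\<tau> = (e0, e0', l0)" by (cases \<tau>)
  have c0: "fj Q n e0 e0' D \<Gamma> lam k f J l0" by (rule fj) (use assms(13) \<tau> in simp)
  have \<phi>: "?\<phi> (VJ_pt J \<omega>) (e, e', l) = fj_series Q D \<Gamma> J lam k f m (e, e', l) (VJ_pt J \<omega>)"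
    if "\<omega> \<in> cone D" "(e, e', l) \<in> ?T" for \<omega> e e' l
    unfolding \<tau> by (rule fj.fj_coeff_eq[OF c0 fj[OF that(2)] that(1)])
  then have \<phi>': "?\<phi> p (e, e', l) = fj_series Q D \<Gamma> J lam k f m (e, e', l) p"
    if "p \<in> Delta D J" "(e, e', l) \<in> ?T" for p e e' l using that by (auto simp: Delta_def)
  have "?\<phi> \<in> invariant_sections Q D \<Gamma> J lam k m"
    unfolding invariant_sections_def
  proof (intro CollectI conjI)
    show "\<forall>p\<in>Delta D J. ?\<phi> p \<in> J_fibre Q D \<Gamma> J lam k m p"
    proof
      fix p assume "p \<in> Delta D J"
      then obtain \<omega> where w: "\<omega> \<in> cone D" "p = VJ_pt J \<omega>" by (auto simp: Delta_def)
      have "?\<phi> p (e, e', l) \<in> V_lam Q lam e e'" if "(e, e', l) \<in> ?T" for e e' l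
        unfolding w(2) \<phi>[OF w(1) that] by (rule fj.fjs_V[OF fj[OF that] w(1)])
      moreover have "((\<lambda>\<omega>. transition Q k m (e, e', l) (e2, e2', l2) \<omega> (?\<phi> p (e, e', l)) xs) \<longlongrightarrow> ?\<phi> p (e2, e2', l2) xs)
          (to_boundary Q D \<Gamma> J (e, e', l) p)"
        if t: "(e, e', l) \<in> ?T" "(e2, e2', l2) \<in> ?T" for e e' l e2 e2' l2 xs
        using fj.transition_tendsto[OF fj[OF t(1)] fj[OF t(2)] w(1) fj.fjs_V[OF fj[OF t(1)] w(1)], of m m xs]
        unfolding w(2) \<phi>[OF w(1) t(1)] \<phi>[OF w(1) t(2)] fj.transition_fjs[OF fj[OF t(1)] fj[OF t(2)] w(1)] .
      ultimately show "?\<phi> p \<in> J_fibre Q D \<Gamma> J lam k m p" unfolding J_fibre_def by auto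
    qed
    show "\<forall>(e, e', l)\<in>?T. \<forall>xs. holomorphic_vec (\<lambda>Z. ?\<phi> (VJ_pt J (tube_pt Q e e' Z)) (e, e', l) xs)
          {Z \<in> UI Q UNIV e e'. VJ_pt J (tube_pt Q e e' Z) \<in> Delta D J}"
    proof (intro ballI allI, clarify)
      fix e e' l xs assume t: "(e, e', l) \<in> ?T"
      show "holomorphic_vec (\<lambda>Z. ?\<phi> (VJ_pt J (tube_pt Q e e' Z)) (e, e', l) xs)
          {Z \<in> UI Q UNIV e e'. VJ_pt J (tube_pt Q e e' Z) \<in> Delta D J}"
        by (rule holomorphic_vec_transform[OF fj.fjs_holomorphic[OF fj[OF t]]]) (simp add: \<phi>'[OF _ t])
    qed
    show "\<forall>g\<in>GammaJ Q \<rat> J \<inter> \<Gamma>. \<forall>p\<in>Delta D J. \<forall>(e, e', l)\<in>?T. ?\<phi> ((*v) g ` p) (g *v e, g *v e', g *v l) = tmap g (?\<phi> p (e, e', l))"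
    proof (intro ballI, clarify)
      fix g p e e' l assume g: "g \<in> GammaJ Q \<rat> J" "g \<in> \<Gamma>" and p: "p \<in> Delta D J" and t: "(e, e', l) \<in> ?T"
      interpret c: fj Q n e e' D \<Gamma> lam k f J l m by (rule fj[OF t])
      have gJ: "g \<in> GammaJ Q \<rat> J \<inter> \<Gamma>" using g by blast
      obtain \<omega> where w: "\<omega> \<in> cone D" "p = VJ_pt J \<omega>" using p by (auto simp: Delta_def)
      have g': "fj Q n (g *v e) (g *v e') D \<Gamma> lam k f J (g *v l)" by (rule c.fj_image[OF gJ])
      have "?\<phi> ((*v) g ` p) (g *v e, g *v e', g *v l) = fj_series Q D \<Gamma> J lam k f m (g *v e, g *v e', g *v l) ((*v) g ` p)"
        unfolding w(2) c.GammaJ_image(2)[OF gJ] \<tau> by (rule fj.fj_coeff_eq[OF c0 g' c.\<Gamma>_cone[OF g(2) w(1)]])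
      then show "?\<phi> ((*v) g ` p) (g *v e, g *v e', g *v l) = tmap g (?\<phi> p (e, e', l))"
        unfolding w(2) \<phi>[OF w(1) t] c.fjs_image[OF gJ w(1)] .
    qed
  qed
  moreover have "fourier_condition Q D \<Gamma> J m (\<lambda>r. 0 \<le> r) (e, e', l) ?\<phi>" if t: "(e, e', l) \<in> ?T" for e e' l
  proof -
    interpret c: fj Q n e e' D \<Gamma> lam k f J l m by (rule fj[OF t])
    show ?thesis
    proof (rule c.fourier_condition_fjs)
      show "?\<phi> p (e, e', l) = c.fjs p" if "p \<in> Delta D J" for p by (rule \<phi>'[OF that t])
      show "0 \<le> Re (bil Q x x)" if "c.coeff x \<noteq> (\<lambda>xs. 0)" "bil Q x c.vv = of_nat m" for x
        by (rule c.koecher[OF assms(3) that assms(11)])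
    qed
  qed
  moreover have "fourier_condition Q D \<Gamma> J m (\<lambda>r. 0 < r) (e, e', l) ?\<phi>"
    if cf: "cusp_form Q D \<Gamma> lam k f" and t: "(e, e', l) \<in> ?T" for e e' l
  proof -
    interpret c: fj Q n e e' D \<Gamma> lam k f J l m by (rule fj[OF t])
    have "0 < Re (bil Q x x)" if "c.coeff x \<noteq> (\<lambda>xs. 0)" for x
    proof -
      have "x \<in> pos_cone Q D e e'" using cf c.cusp that unfolding cusp_form_def by blast
      then show ?thesis by (simp add: c.u0(2) c.half_cone_def c.timelike_def)
    qed
    note pos = this
    show ?thesis
    proof (rule c.fourier_condition_fjs)
      show "?\<phi> p (e, e', l) = c.fjs p" if "p \<in> Delta D J" for p by (rule \<phi>'[OF that t])
    qed (rule pos)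
  qed
  ultimately show ?thesis unfolding jacobi_form_def jacobi_cusp_form_def by auto
qed

end
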